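(* Let $q$ be a prime power. For $n\ge 1$ let $\rho_n=\rho\big(ch(\chi^{(n)}_{(q_1,\ldots,q_{n-1})}\uparrow_{U_n}^{G_n})\big)\in\Lambda_{\mathbb C}(Y)$ be the image under the plethysm map $\rho$ of the characteristic of the linear character $\chi^{(n)}_{(q_1,\ldots,q_{n-1})}$ ($q_i\in\mathbb F_q^\times$) of $U_n$ induced to $G_n=GL_n(\mathbb F_q)$. Then for every $n\ge 1$, with $h_i=h_i(Y)$, $$\rho_n = (q^n-1)\, h_{n} - \rho_{n-1} h_{1} - \rho_{n-2} h_{2}- \cdots - \rho_1 h_{n-1} .$$
   Context: Groups and symmetric functions. $\mathbb F_q$ is the field with $q$ elements, $\bar{\mathbb F}_q$ its algebraic closure, $G_n=GL_n(\mathbb F_q)$, $U_n\le G_n$ the group of unipotent upper-triangular matrices. For a set $Z$ of infinitely many variables, $\Lambda_{\mathbb C}(Z)$ is the ring of symmetric functions in $Z$ over $\mathbb C$, with complete functions $h_\lambda$, power sums $p_\lambda$, Schur functions $s_\lambda$; $Y=\{y_1,y_2,\ldots\}$. $P_\lambda(Z;t)$ is the Hall-Littlewood symmetric function (Macdonald's normalization), and with $n(\lambda)=\sum_{i\ge1}(i-1)\lambda_i$ put $\tilde P_\lambda(Z;q)=q^{-n(\lambda)}P_\lambda(Z;q^{-1})$. Index sets. $F:z\mapsto z^q$ is the Frobenius. $\Phi$ is the set of $F$-orbits in $\bar{\mathbb F}_q^\times$, identified with the monic irreducible polynomials $f\neq x$ in $\mathbb F_q[x]$; $d(f)=\deg f$;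 $f_z\in\Phi$ is the orbit of $z$. Let $M_n=\mathbb F_{q^n}^\times$ and $\hat M_n=\mathrm{Hom}(M_n,\mathbb C^\times)$; for $m\mid n$ embed $\hat M_m\subset\hat M_n$ by composing with the norm $M_n\to M_m$. $\Theta$ is the set of orbits of $\xi\mapsto\xi^q$ on $\bigcup_n\hat M_n$; $d(\varphi)=\deg(\varphi)=|\varphi|$. If $\xi\in\varphi$ and $d(\varphi)\mid n$ then $\xi\in\hat M_n$ and $\xi(z)$, $z\in M_n$, is its value there. For a partition-valued function $\bm\mu$ on $\Phi$, $\|\bm\mu\|=\sum_f d(f)|\bm\mu(f)|$, and $\mathcal P^\Phi_n=\{\bm\mu:\|\bm\mu\|=n\}$; similarly $\mathcal P^\Theta_n$. Characteristic map. For $f\in\Phi$ and $\varphi\in\Theta$ let $X_f$ and $Y^\varphi$ be infinite sets of variables (of degree $d(f)$, resp. $d(\varphi)$). $\Lambda_{\mathbb C}=\otimes_{f\in\Phi}\Lambda_{\mathbb C}(X_f)$ is identified with $\otimes_{\varphi\in\Theta}\Lambda_{\mathbb C}(Y^\varphi)$ by $p_k(Y^\varphi)=(-1)^{n-1}\sum_{z\in M_n}\xi(z)\,p_{n/d(f_z)}(X_{f_z})$, where $\xi\in\varphi$, $n=k\,d(\varphi)$. Put $\tilde P_{\bm\mu}=\prod_f\tilde P_{\bm\mu(f)}(X_f;q^{d(f)})$ and $S_{\bm\lambda}=\prod_\varphi s_{\bm\lambda(\varphi)}(Y^\varphi)$. For $\bm\mu\in\mathcal P^\Phi_n$, $\pi_{\bm\mu}$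 is the indicator function of the conjugacy class $K^{\bm\mu}$ of those $g\in G_n$ making $\mathbb F_q^n$ an $\mathbb F_q[x]$-module isomorphic to $\bigoplus_f\bigoplus_i\mathbb F_q[x]/(f^{\bm\mu(f)_i})$. $ch$ is the linear map from the direct sum over $n\ge0$ of the spaces of class functions on $G_n$ to $\Lambda_{\mathbb C}$ with $\pi_{\bm\mu}\mapsto\tilde P_{\bm\mu}$; it is a (Hopf algebra) isomorphism, and it maps the irreducible characters $\chi^{\bm\lambda}$ of $G_n$ bijectively to the $S_{\bm\lambda}$, $\bm\lambda\in\mathcal P_n^\Theta$. Plethysm map. $\rho:\Lambda_{\mathbb C}\to\Lambda_{\mathbb C}(Y)$ is the $\mathbb C$-algebra homomorphism with $\rho(h_a(Y^\varphi))=h_a[p_b]:=h_a(y_1^b,y_2^b,\ldots)$, $b=d(\varphi)$. Linear characters. Fix a nontrivial additive character $\psi:\mathbb F_q\to\mathbb C^\times$. For $q_1,\ldots,q_{n-1}\in\mathbb F_q^\times$, $\chi^{(n)}_{(q_1,\ldots,q_{n-1})}(u)=\prod_{i=1}^{n-1}\psi(q_iu_{i,i+1})$ for $u\in U_n$; $\uparrow_{U_n}^{G_n}$ denotes induction. The induced character (hence $\rho_n$) does not depend on $q_1,\ldots,q_{n-1}$. *)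

theory Defs
  imports
    "HOL-Library.Cardinality"
    "HOL-Library.Poly_Mapping"
    "HOL-Combinatorics.Permutations"
    "HOL-Computational_Algebra.Fraction_Field"
    "HOL-Computational_Algebra.Polynomial_Factorial"
    "HOL-Algebra.Algebraic_Closure_Type"
    "Jordan_Normal_Form.Matrix"
begin

section \<open>Formal power series in arbitrarily many variables\<close>

text \<open>
  Variables are the elements of the type \<open>'v\<close>, monomials the elements of \<^typ>\<open>'v \<Rightarrow>\<^sub>0 nat\<close>
  (written additively), and a series is an arbitrary family of complex coefficients.
\<close>

typedef 'v mpseries = "UNIV :: (('v \<Rightarrow>\<^sub>0 nat) \<Rightarrow> complex) set"
  morphisms mcoeff MPSeries ..

setup_lifting type_definition_mpseries

lemma mpseries_eqI: "(\<And>m. mcoeff f m = mcoeff g m) \<Longrightarrow> f = g"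
  by (metis ext mcoeff_inject)

definition splits :: "('v \<Rightarrow>\<^sub>0 nat) \<Rightarrow> (('v \<Rightarrow>\<^sub>0 nat) \<times> ('v \<Rightarrow>\<^sub>0 nat)) set" where
  "splits m = {(a, b). a + b = m}"

lemma finite_splits [simp]:
  fixes m :: "'v \<Rightarrow>\<^sub>0 nat"
  shows "finite (splits m)"
proof -
  let ?K = "Poly_Mapping.keys m" and ?l = "Poly_Mapping.lookup :: ('v \<Rightarrow>\<^sub>0 nat) \<Rightarrow> 'v \<Rightarrow> nat"
  let ?r = "\<lambda>(a, b :: 'v \<Rightarrow>\<^sub>0 nat). restrict (?l a) ?K"
  have fin: "finite (PiE ?K (\<lambda>v. {0..?l m v}))"
    by (intro finite_PiE) auto
  have inj: "inj_on ?r (splits m)"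
  proof (rule inj_onI)
    fix s s' assume s: "s \<in> splits m" "s' \<in> splits m" and eq: "?r s = ?r s'"
    obtain a b a' b' where ab: "s = (a, b)" "s' = (a', b')" by (cases s, cases s')
    have m: "a + b = m" "a' + b' = m" using s ab by (auto simp: splits_def)
    have "?l a v = ?l a' v" for v
    proof (cases "v \<in> ?K")
      case True
      then show ?thesis using fun_cong[OF eq, of v] ab by simp
    next
      case False
      then have "?l (a + b) v = 0" "?l (a' + b') v = 0"
        unfolding m by (auto simp: in_keys_iff)
      then show ?thesis by (simp add: lookup_add)
    qed
    then have "a = a'" by (intro poly_mapping_eqI)
    with m ab show "s = s'" by auto
  qed
  have "?r ` splits m \<subseteq> PiE ?K (\<lambda>v. {0..?l m v})"
    by (auto simp: splits_def lookup_add)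
  from finite_imageD[OF finite_subset[OF this fin] inj] show ?thesis .
qed

instantiation mpseries :: (type) comm_ring_1
begin

lift_definition zero_mpseries :: "'a mpseries" is "\<lambda>_. 0" .
lift_definition one_mpseries :: "'a mpseries" is "\<lambda>m. if m = 0 then 1 else 0" .
lift_definition plus_mpseries :: "'a mpseries \<Rightarrow> 'a mpseries \<Rightarrow> 'a mpseries"
  is "\<lambda>f g m. f m + g m" .
lift_definition minus_mpseries :: "'a mpseries \<Rightarrow> 'a mpseries \<Rightarrow> 'a mpseries"
  is "\<lambda>f g m. f m - g m" .
lift_definition uminus_mpseries :: "'a mpseries \<Rightarrow> 'a mpseries"
  is "\<lambda>f m. - f m" .
lift_definition times_mpseries :: "'a mpseries \<Rightarrow> 'a mpseries \<Rightarrow> 'a mpseries"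
  is "\<lambda>f g m. \<Sum>(a, b)\<in>splits m. f a * g b" .

instance
proof
  fix f g h :: "'a mpseries"
  show "f + g + h = f + (g + h)" by transfer (simp add: add.assoc)
  show "f + g = g + f" by transfer (simp add: add.commute)
  show "0 + f = f" by transfer simp
  show "- f + f = 0" by transfer simp
  show "f - g = f + - g" by transfer simp
  show "(0 :: 'a mpseries) \<noteq> 1" by transfer (auto dest: fun_cong[of _ _ 0])
  show "(f + g) * h = f * h + g * h"
    by transfer (simp add: case_prod_unfold distrib_right sum.distrib)
  show "f * g = g * f"
  proof (transfer, rule ext)
    fix f g :: "('a \<Rightarrow>\<^sub>0 nat) \<Rightarrow> complex" and m
    show "(\<Sum>(a, b)\<in>splits m. f a * g b) = (\<Sum>(a, b)\<in>splits m. g a * f b)"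
      by (rule sum.reindex_bij_witness[of _ prod.swap prod.swap])
         (auto simp: splits_def add.commute)
  qed
  show "1 * f = f"
  proof (transfer, rule ext)
    fix f :: "('a \<Rightarrow>\<^sub>0 nat) \<Rightarrow> complex" and m
    have "(\<Sum>(a, b)\<in>splits m. (if a = 0 then 1 else 0) * f b)
        = (\<Sum>(a, b)\<in>{(0 :: 'a \<Rightarrow>\<^sub>0 nat, m)}. (if a = 0 then 1 else 0) * f b)"
      by (rule sum.mono_neutral_right[OF finite_splits]) (auto simp: splits_def split: if_splits)
    then show "(\<Sum>(a, b)\<in>splits m. (if a = 0 then 1 else 0) * f b) = f m" by simp
  qed
  show "f * g * h = f * (g * h)"
  proof (transfer, rule ext)
    fix f g h :: "('a \<Rightarrow>\<^sub>0 nat) \<Rightarrow> complex" and m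
    have "(\<Sum>(a, b)\<in>splits m. (\<Sum>(c, d)\<in>splits a. f c * g d) * h b)
        = (\<Sum>(p, r)\<in>(SIGMA p:splits m. splits (fst p)). f (fst r) * g (snd r) * h (snd p))"
      by (subst sum.Sigma[symmetric]) (auto simp: case_prod_unfold sum_distrib_right)
    also have "\<dots> = (\<Sum>(p, r)\<in>(SIGMA p:splits m. splits (snd p)).
                       f (fst p) * (g (fst r) * h (snd r)))"
      by (rule sum.reindex_bij_witness
            [of _ "\<lambda>((c, e), (d, b)). ((c + d, b), (c, d))"
                  "\<lambda>((a, b), (c, d)). ((c, d + b), (d, b))"])
         (auto simp: splits_def add.assoc mult.assoc)
    also have "\<dots> = (\<Sum>(a, b)\<in>splits m. f a * (\<Sum>(c, d)\<in>splits b. g c * h d))"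
      by (subst sum.Sigma[symmetric]) (auto simp: case_prod_unfold sum_distrib_left)
    finally show "(\<Sum>(a, b)\<in>splits m. (\<Sum>(c, d)\<in>splits a. f c * g d) * h b)
        = (\<Sum>(a, b)\<in>splits m. f a * (\<Sum>(c, d)\<in>splits b. g c * h d))" .
  qed
qed

end

definition const_mps :: "complex \<Rightarrow> 'v mpseries" where
  "const_mps c = MPSeries (\<lambda>m. if m = 0 then c else 0)"

inductive_set subalgebra_gen :: "'v mpseries set \<Rightarrow> 'v mpseries set"
  for B :: "'v mpseries set" where
  gen: "f \<in> B \<Longrightarrow> f \<in> subalgebra_gen B"
| const: "const_mps c \<in> subalgebra_gen B"
| add: "f \<in> subalgebra_gen B \<Longrightarrow> g \<in> subalgebra_gen B \<Longrightarrow> f + g \<in> subalgebra_gen B"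
| mult: "f \<in> subalgebra_gen B \<Longrightarrow> g \<in> subalgebra_gen B \<Longrightarrow> f * g \<in> subalgebra_gen B"

text \<open>Homomorphisms of unital \<open>\<complex>\<close>-algebras between subalgebras.\<close>

definition alg_hom ::
    "'v mpseries set \<Rightarrow> 'w mpseries set \<Rightarrow> ('v mpseries \<Rightarrow> 'w mpseries) \<Rightarrow> bool" where
  "alg_hom A B h \<longleftrightarrow>
     h ` A \<subseteq> B \<and>
     (\<forall>x\<in>A. \<forall>y\<in>A. h (x + y) = h x + h y) \<and>
     (\<forall>x\<in>A. \<forall>y\<in>A. h (x * y) = h x * h y) \<and>
     (\<forall>c. h (const_mps c) = const_mps c)"


section \<open>Symmetric functions\<close>

definition mdeg :: "('v \<Rightarrow>\<^sub>0 nat) \<Rightarrow> nat" where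
  "mdeg m = (\<Sum>v\<in>Poly_Mapping.keys m. Poly_Mapping.lookup m v)"

text \<open>\<open>\<Lambda>\<^sub>\<complex>(Y)\<close>: symmetric series of bounded degree in the variables indexed by \<^typ>\<open>nat\<close>.\<close>

definition Sym :: "nat mpseries set" where
  "Sym = {f. (\<exists>N. \<forall>m. N < mdeg m \<longrightarrow> mcoeff f m = 0) \<and>
             (\<forall>p m. bij p \<longrightarrow> mcoeff f (Poly_Mapping.map_key p m) = mcoeff f m)}"

text \<open>\<open>psum k\<close> is the usual power sum for \<open>k \<ge> 1\<close>.\<close>

definition psum :: "nat \<Rightarrow> nat mpseries" where
  "psum k = MPSeries (\<lambda>m. if \<exists>j. m = Poly_Mapping.single j k then 1 else 0)"

definition hsym :: "nat \<Rightarrow> nat mpseries" where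
  "hsym a = MPSeries (\<lambda>m. if mdeg m = a then 1 else 0)"

text \<open>\<open>power_subst b f\<close> is \<open>f(y\<^sub>1\<^sup>b, y\<^sub>2\<^sup>b, \<dots>)\<close>, that is \<open>f[p\<^sub>b]\<close>, for \<open>b \<ge> 1\<close>.\<close>

definition power_subst :: "nat \<Rightarrow> nat mpseries \<Rightarrow> nat mpseries" where
  "power_subst b f = MPSeries (\<lambda>m.
     if \<forall>j. b dvd Poly_Mapping.lookup m j then mcoeff f (Poly_Mapping.map (\<lambda>e. e div b) m) else 0)"

text \<open>
  The set of variables \<open>Z\<^sub>i\<close> consists of the pairs \<open>(i, j)\<close> with \<open>j :: nat\<close>; \<open>in_vars i f\<close> is
  \<open>f(Z\<^sub>i)\<close>. The tensor product of the \<open>\<Lambda>\<^sub>\<complex>(Z\<^sub>i)\<close>, \<open>i \<in> I\<close>, is realised as the subalgebra which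
  they generate in the series in all the variables; elements of it involve only finitely many
  of the \<open>Z\<^sub>i\<close>.
\<close>

definition in_vars :: "'i \<Rightarrow> nat mpseries \<Rightarrow> ('i \<times> nat) mpseries" where
  "in_vars i f = MPSeries (\<lambda>m.
     if Poly_Mapping.keys m \<subseteq> {i} \<times> UNIV then mcoeff f (Poly_Mapping.map_key (Pair i) m) else 0)"

definition tensor_Sym :: "'i set \<Rightarrow> ('i \<times> nat) mpseries set" where
  "tensor_Sym I = subalgebra_gen (\<Union>i\<in>I. in_vars i ` Sym)"


section \<open>Partitions and Hall-Littlewood functions\<close>

definition is_partition :: "nat list \<Rightarrow> bool" where
  "is_partition la \<longleftrightarrow> sorted_wrt (\<ge>) la \<and> 0 \<notin> set la"

text \<open>Indices start at 0, so \<open>part la i\<close> is \<open>\<lambda>\<^bsub>i+1\<^esub>\<close>.\<close>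

definition part :: "nat list \<Rightarrow> nat \<Rightarrow> nat" where
  "part la i = (if i < length la then la ! i else 0)"

definition n_stat :: "nat list \<Rightarrow> nat" where
  "n_stat la = (\<Sum>i<length la. i * part la i)"

text \<open>\<open>v_fac t m = \<Prod>\<^sub>i (1 - t\<^sup>i) / (1 - t)\<close>, with each quotient written as a geometric sum.\<close>

definition v_fac :: "complex \<Rightarrow> nat \<Rightarrow> complex" where
  "v_fac t m = (\<Prod>i=1..m. \<Sum>j<i. t ^ j)"

text \<open>For \<open>n \<ge> \<ell>(\<lambda>)\<close> this is \<open>v\<^sub>\<lambda>(t)\<close> for \<open>\<lambda>\<close> padded by \<open>n - \<ell>(\<lambda>)\<close> zeros.\<close>

definition v_part :: "nat \<Rightarrow> nat list \<Rightarrow> complex \<Rightarrow> complex" where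
  "v_part n la t = v_fac t (n - length la) * (\<Prod>r\<in>set la. v_fac t (count_list la r))"

type_synonym cpoly = "(nat \<Rightarrow>\<^sub>0 nat) \<Rightarrow>\<^sub>0 complex"

definition rf_of :: "cpoly \<Rightarrow> cpoly fract" where
  "rf_of p = Fraction_Field.Fract p 1"

definition rf_var :: "nat \<Rightarrow> cpoly fract" where
  "rf_var i = rf_of (Poly_Mapping.single (Poly_Mapping.single i 1) 1)"

definition rf_const :: "complex \<Rightarrow> cpoly fract" where
  "rf_const c = rf_of (Poly_Mapping.single 0 c)"

text \<open>
  \<open>P\<^sub>\<lambda>(x\<^sub>0, \<dots>, x\<^bsub>n-1\<^esub>; t) =
     v\<^sub>\<lambda>(t)\<^sup>-\<^sup>1 \<Sum>\<^sub>w w (x\<^sup>\<lambda> \<Prod>\<^bsub>i<j\<^esub> (x\<^sub>i - t x\<^sub>j) / (x\<^sub>i - x\<^sub>j))\<close>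
  (Macdonald, Symmetric Functions and Hall Polynomials, III.2), as a rational function.
\<close>

definition hall_littlewood_fin :: "nat \<Rightarrow> nat list \<Rightarrow> complex \<Rightarrow> cpoly fract" where
  "hall_littlewood_fin n la t =
     (\<Sum>w | w permutes {..<n}.
        (\<Prod>i<n. rf_var (w i) ^ part la i) *
        (\<Prod>(i, j)\<in>{(i, j). i < j \<and> j < n}.
            (rf_var (w i) - rf_const t * rf_var (w j)) / (rf_var (w i) - rf_var (w j))))
     / rf_const (v_part n la t)"

text \<open>
  \<open>P\<^sub>\<lambda>(Z; t)\<close> is the symmetric function specialising to the polynomial
  \<open>P\<^sub>\<lambda>(x\<^sub>0, \<dots>, x\<^bsub>n-1\<^esub>; t)\<close> for all \<open>n \<ge> \<ell>(\<lambda>)\<close>.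
\<close>

definition hall_littlewood :: "nat list \<Rightarrow> complex \<Rightarrow> nat mpseries" where
  "hall_littlewood la t = (THE P. P \<in> Sym \<and>
     (\<forall>n\<ge>length la. \<exists>p :: cpoly. rf_of p = hall_littlewood_fin n la t \<and>
        (\<forall>m. Poly_Mapping.lookup p m
               = (if Poly_Mapping.keys m \<subseteq> {..<n} then mcoeff P m else 0))))"

definition hl_tilde :: "nat list \<Rightarrow> complex \<Rightarrow> nat mpseries" where
  "hl_tilde la q = const_mps (1 / q ^ n_stat la) * hall_littlewood la (1 / q)"


section \<open>The index sets\<close>

text \<open>
  \<open>\<bbbF>\<^sub>q\<close> is a type \<open>'a\<close> of sort \<open>{field, finite}\<close>, so \<open>q\<close> is \<open>CARD('a)\<close>.
  Elements of \<open>\<Phi>\<close> are represented by the monic irreducible polynomials, \<open>f\<^sub>z\<close> being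
  the one with root \<open>z\<close>.
\<close>

definition Phi :: "'a::{field,finite} poly set" where
  "Phi = {f. lead_coeff f = 1 \<and> irreducible f \<and> f \<noteq> [:0, 1:]}"

definition f_at :: "'a::{field,finite} alg_closure \<Rightarrow> 'a poly" where
  "f_at z = (THE f. f \<in> Phi \<and> poly (map_poly to_ac f) z = 0)"

definition M_grp :: "nat \<Rightarrow> 'a::{field,finite} alg_closure set" where
  "M_grp n = {z. z \<noteq> 0 \<and> z ^ (CARD('a) ^ n) = z}"

text \<open>The norm from \<open>M\<^sub>n\<close> to \<open>M\<^sub>m\<close>, for \<open>m dvd n\<close>.\<close>

definition M_norm :: "nat \<Rightarrow> nat \<Rightarrow> 'a::{field,finite} alg_closure \<Rightarrow> 'a alg_closure" where
  "M_norm n m z = (\<Prod>i<n div m. z ^ (CARD('a) ^ (m * i)))"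

text \<open>Characters of \<open>M\<^sub>n\<close> are extended by 0 to functions on the whole type.\<close>

definition M_dual :: "nat \<Rightarrow> ('a::{field,finite} alg_closure \<Rightarrow> complex) set" where
  "M_dual n = {x. (\<forall>z\<in>M_grp n. \<forall>w\<in>M_grp n. x (z * w) = x z * x w) \<and>
                  (\<forall>z\<in>M_grp n. x z \<noteq> 0) \<and> (\<forall>z. z \<notin> M_grp n \<longrightarrow> x z = 0)}"

text \<open>
  The union \<open>\<Union>\<^sub>n Hom(M\<^sub>n, \<complex>\<^sup>\<times>)\<close> is a direct limit: its elements are classes of pairs
  \<open>(n, x)\<close> with \<open>x\<close> a character of \<open>M\<^sub>n\<close>, where two pairs are identified if the characters
  agree after composition with the norms from a common \<open>M\<^bsub>mn\<^esub>\<close>. Such a class \<open>\<xi>\<close> lies in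
  \<open>Hom(M\<^sub>n, \<complex>\<^sup>\<times>)\<close> iff it contains a (necessarily unique) pair with first component \<open>n\<close>.
\<close>

type_synonym 'a lchar = "(nat \<times> ('a alg_closure \<Rightarrow> complex)) set"

definition char_rel ::
    "((nat \<times> ('a::{field,finite} alg_closure \<Rightarrow> complex)) \<times>
      (nat \<times> ('a alg_closure \<Rightarrow> complex))) set" where
  "char_rel = {((m, x), (n, y)). 1 \<le> m \<and> 1 \<le> n \<and> x \<in> M_dual m \<and> y \<in> M_dual n \<and>
     (\<forall>z\<in>M_grp (m * n). x (M_norm (m * n) m z) = y (M_norm (m * n) n z))}"

definition char_limit :: "'a::{field,finite} lchar set" where
  "char_limit = (SIGMA n:{1..}. M_dual n) // char_rel"

definition char_val :: "'a::{field,finite} lchar \<Rightarrow> nat \<Rightarrow> 'a alg_closure \<Rightarrow> complex" where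
  "char_val \<xi> n z = (THE x. (n, x) \<in> \<xi>) z"

definition char_frob :: "'a::{field,finite} lchar \<Rightarrow> 'a lchar" where
  "char_frob \<xi> = (\<lambda>(n, x). (n, \<lambda>z. x z ^ CARD('a))) ` \<xi>"

definition Theta :: "'a::{field,finite} lchar set set" where
  "Theta = (\<lambda>\<xi>. range (\<lambda>i. (char_frob ^^ i) \<xi>)) ` char_limit"

definition P_Phi :: "nat \<Rightarrow> ('a::{field,finite} poly \<Rightarrow> nat list) set" where
  "P_Phi n = {\<mu>. (\<forall>f. is_partition (\<mu> f)) \<and> (\<forall>f. f \<notin> Phi \<longrightarrow> \<mu> f = []) \<and>
     finite {f. \<mu> f \<noteq> []} \<and> (\<Sum>f | \<mu> f \<noteq> []. degree f * sum_list (\<mu> f)) = n}"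


section \<open>Characteristic map and plethysm map\<close>

abbreviation Lambda_Phi :: "('a::{field,finite} poly \<times> nat) mpseries set" where
  "Lambda_Phi \<equiv> tensor_Sym Phi"

abbreviation Lambda_Theta :: "('a::{field,finite} lchar set \<times> nat) mpseries set" where
  "Lambda_Theta \<equiv> tensor_Sym Theta"

text \<open>
  The identification of \<open>\<Otimes>\<^sub>f \<Lambda>\<^sub>\<complex>(X\<^sub>f)\<close> with \<open>\<Otimes>\<^sub>\<phi> \<Lambda>\<^sub>\<complex>(Y\<^sup>\<phi>)\<close>; the argument of \<open>T\<close> below is
  the expression for \<open>p\<^sub>k(Y\<^sup>\<phi>)\<close> in terms of the \<open>p\<^sub>j(X\<^sub>f)\<close>.
\<close>

definition is_identification ::
    "(('a::{field,finite} poly \<times> nat) mpseries \<Rightarrow> ('a lchar set \<times> nat) mpseries) \<Rightarrow> bool" where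
  "is_identification T \<longleftrightarrow>
     alg_hom Lambda_Phi Lambda_Theta T \<and> bij_betw T Lambda_Phi Lambda_Theta \<and>
     (\<forall>\<phi>\<in>Theta. \<forall>\<xi>\<in>\<phi>. \<forall>k\<ge>1. let n = k * card \<phi> in
        T ((- 1) ^ (n - 1) *
             (\<Sum>z\<in>M_grp n. const_mps (char_val \<xi> n z) *
                 in_vars (f_at z) (psum (n div degree (f_at z)))))
          = in_vars \<phi> (psum k))"

definition is_plethysm_map ::
    "(('a::{field,finite} lchar set \<times> nat) mpseries \<Rightarrow> nat mpseries) \<Rightarrow> bool" where
  "is_plethysm_map \<rho> \<longleftrightarrow>
     alg_hom Lambda_Theta Sym \<rho> \<and>
     (\<forall>\<phi>\<in>Theta. \<forall>a. \<rho> (in_vars \<phi> (hsym a)) = power_subst (card \<phi>) (hsym a))"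

definition P_tilde :: "('a::{field,finite} poly \<Rightarrow> nat list) \<Rightarrow> ('a poly \<times> nat) mpseries" where
  "P_tilde \<mu> = (\<Prod>f | \<mu> f \<noteq> []. in_vars f (hl_tilde (\<mu> f) (of_nat CARD('a) ^ degree f)))"

definition GL :: "nat \<Rightarrow> 'a::{field,finite} mat monoid" where
  "GL n = units_of (ring_mat TYPE('a) n ())"

text \<open>
  The module \<open>\<Oplus>\<^sub>f \<Oplus>\<^sub>i \<bbbF>\<^sub>q[x]/(f\<^bsup>\<mu>(f)\<^sub>i\<^esup>)\<close>, with residue classes represented by
  their remainders, and multiplication by \<open>x\<close> on it.
\<close>

definition prim_module ::
    "('a::{field,finite} poly \<Rightarrow> nat list) \<Rightarrow> ('a poly \<times> nat \<Rightarrow> 'a poly) set" where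
  "prim_module \<mu> = {c. \<forall>f i. if i < length (\<mu> f)
     then c (f, i) mod f ^ (\<mu> f ! i) = c (f, i) else c (f, i) = 0}"

definition x_mult ::
    "('a::{field,finite} poly \<Rightarrow> nat list) \<Rightarrow> ('a poly \<times> nat \<Rightarrow> 'a poly) \<Rightarrow> ('a poly \<times> nat \<Rightarrow> 'a poly)"
  where "x_mult \<mu> c = (\<lambda>(f, i). if i < length (\<mu> f)
           then ([:0, 1:] * c (f, i)) mod f ^ (\<mu> f ! i) else 0)"

text \<open>
  \<open>K\<^sup>\<mu>\<close>: an isomorphism of \<open>\<bbbF>\<^sub>q[x]\<close>-modules is an \<open>\<bbbF>\<^sub>q\<close>-linear bijection commuting with the
  action of \<open>x\<close>, which on \<open>\<bbbF>\<^sub>q\<^sup>n\<close> is \<open>g\<close>.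
\<close>

definition K_class :: "nat \<Rightarrow> ('a::{field,finite} poly \<Rightarrow> nat list) \<Rightarrow> 'a mat set" where
  "K_class n \<mu> = {g \<in> carrier (GL n). \<exists>L. bij_betw L (carrier_vec n) (prim_module \<mu>) \<and>
     (\<forall>v\<in>carrier_vec n. \<forall>w\<in>carrier_vec n. L (v + w) = (\<lambda>s. L v s + L w s)) \<and>
     (\<forall>a. \<forall>v\<in>carrier_vec n. L (a \<cdot>\<^sub>v v) = (\<lambda>s. Polynomial.smult a (L v s))) \<and>
     (\<forall>v\<in>carrier_vec n. L (g *\<^sub>v v) = x_mult \<mu> (L v))}"

text \<open>
  The degree \<open>n\<close> part of \<open>ch\<close>. The indicator functions of the \<open>K\<^sup>\<mu>\<close> form a basis of the class
  functions, on which the coordinates of \<open>\<chi>\<close> are its values on the \<open>K\<^sup>\<mu>\<close>.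
\<close>

definition ch :: "nat \<Rightarrow> ('a::{field,finite} mat \<Rightarrow> complex) \<Rightarrow> ('a poly \<times> nat) mpseries" where
  "ch n \<chi> = (\<Sum>\<mu>\<in>P_Phi n. const_mps (\<chi> (SOME g. g \<in> K_class n \<mu>)) * P_tilde \<mu>)"


section \<open>The induced linear characters\<close>

definition induced_char :: "('g, 'b) monoid_scheme \<Rightarrow> 'g set \<Rightarrow> ('g \<Rightarrow> complex) \<Rightarrow> 'g \<Rightarrow> complex" where
  "induced_char G H \<chi> g =
     (\<Sum>y | y \<in> carrier G \<and> inv\<^bsub>G\<^esub> y \<otimes>\<^bsub>G\<^esub> g \<otimes>\<^bsub>G\<^esub> y \<in> H.
        \<chi> (inv\<^bsub>G\<^esub> y \<otimes>\<^bsub>G\<^esub> g \<otimes>\<^bsub>G\<^esub> y)) / of_nat (card H)"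

definition U_grp :: "nat \<Rightarrow> 'a::{field,finite} mat set" where
  "U_grp n = {u \<in> carrier_mat n n. upper_triangular u \<and> (\<forall>i<n. u $$ (i, i) = 1)}"

definition nontrivial_additive_char :: "('a::{field,finite} \<Rightarrow> complex) \<Rightarrow> bool" where
  "nontrivial_additive_char \<psi> \<longleftrightarrow>
     (\<forall>x. \<psi> x \<noteq> 0) \<and> (\<forall>x y. \<psi> (x + y) = \<psi> x * \<psi> y) \<and> (\<exists>x. \<psi> x \<noteq> 1)"

text \<open>Matrix indices start at 0, so the entry \<open>u\<^bsub>i,i+1\<^esub>\<close> is \<open>u $$ (i - 1, i)\<close>.\<close>

definition lin_char ::
    "('a::{field,finite} \<Rightarrow> complex) \<Rightarrow> nat \<Rightarrow> (nat \<Rightarrow> 'a) \<Rightarrow> 'a mat \<Rightarrow> complex" where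
  "lin_char \<psi> n qs u = (\<Prod>i=1..n-1. \<psi> (qs i * u $$ (i - 1, i)))"

definition rho_n ::
    "(('a::{field,finite} poly \<times> nat) mpseries \<Rightarrow> ('a lchar set \<times> nat) mpseries) \<Rightarrow>
     (('a lchar set \<times> nat) mpseries \<Rightarrow> nat mpseries) \<Rightarrow>
     ('a \<Rightarrow> complex) \<Rightarrow> (nat \<Rightarrow> 'a) \<Rightarrow> nat \<Rightarrow> nat mpseries" where
  "rho_n T \<rho> \<psi> qs n = \<rho> (T (ch n (induced_char (GL n) (U_grp n) (lin_char \<psi> n qs))))"

end

theory Submission
  imports
    Defs
    "HOL-Combinatorics.Multiset_Permutations"
    "HOL-Computational_Algebra.Polynomial_FPS"
    "Jordan_Normal_Form.Determinant"
begin

text \<open>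
  Let \<open>\<Gamma>\<^sub>n\<close> be the induced character and \<open>N = g - 1\<close>. Counting, with the weight \<open>\<psi>\<close>, the flags
  in which \<open>N\<close> lowers every step shows that \<open>\<Gamma>\<^sub>n\<close> vanishes off the unipotent classes and that
  its value on the class of type \<open>\<lambda>\<close> is \<open>(-1)\<^sup>n \<Prod>\<^sub>j (1 - q\<^sup>j)\<close>, where \<open>1 \<le> j \<le> \<ell>(\<lambda>)\<close>. So \<open>ch \<Gamma>\<^sub>n\<close>
  is \<open>(-1)\<^sup>n G\<^sub>n\<close> in the variables of \<open>x - 1\<close>, where the Hall-Littlewood identity
  \<open>\<Sum>\<^sub>\<lambda> \<Prod>\<^sub>j (1 - t\<^bsup>-j\<^esup>) t\<^bsup>n(\<lambda>)\<^esup> P\<^sub>\<lambda>(x; t) u\<^bsup>|\<lambda>|\<^esup> = \<Prod>\<^sub>i (1 - x\<^sub>i u / t) / (1 - x\<^sub>i u)\<close> at \<open>t = 1/q\<close>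
  gives \<open>\<Sum>\<^sub>n G\<^sub>n u\<^sup>n = H(u) / H(q u)\<close>.

  Summing the defining relation of the identification over all characters of \<open>M\<^sub>n\<close> isolates
  the summand \<open>z = 1\<close>, and \<open>p\<^sub>k(Y\<^sup>\<phi>)\<close> is mapped to \<open>p\<^sub>n\<close> whenever \<open>n = k d(\<phi>)\<close>; hence \<open>p\<^sub>n\<close> in the
  variables of \<open>x - 1\<close> is mapped to \<open>(-1)\<^bsup>n-1\<^esup> p\<^sub>n(Y)\<close>. Comparing logarithms,
  \<open>1 + \<Sum>\<^sub>n \<rho>\<^sub>n u\<^sup>n = H(q u) / H(u)\<close>, which is the recursion.
\<close>


section \<open>Symmetrised sums of Hall-Littlewood type\<close>

text \<open>In the flag count let W be the span of the columns chosen before the last one v, and E =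
  W + <v>. If N maps N^-1(E) into W, every possible next column has weight 1 and there are |N^-1(E)|
  - |E| of them. Otherwise the coefficient at v is a nonzero linear form on N^-1(E), the sum of
  \<open>\<psi>\<close> over that space vanishes, and the |E| excluded vectors leave -|E|. Both
  cases fit one closed formula in dim W and dim N^-1(W), so the Jordan type of N enters only through
  its kernel.

  The Hall-Littlewood identity is proved by cutting first columns off partitions: a weight depending
  only on the number of parts is then constant, and the case of weight 1 supplies everything to the
  right of that column. As \<open>hall_littlewood\<close> is a definite description, existence must
  be shown too; therefore the recursive sum over the variables is turned into a single symmetric
  function that serves all finite sets of variables.

  \<open>T\<close> is controlled only through the power sums in the variables of x - 1. This
  suffices because Newton's identities, as statements about u d/du of generating series, express
  each G_n by power sums.\<close>

definition psi :: "'b::field \<Rightarrow> ('i \<Rightarrow> 'b) \<Rightarrow> 'i set \<Rightarrow> 'i set \<Rightarrow> 'b" where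
  "psi t x B C = (\<Prod>b\<in>B. \<Prod>c\<in>C. (x b - t * x c) / (x b - x c))"

section \<open>Products of the weights psi and partial fractions\<close>

lemma psi_empty [simp]: "psi t x {} C = 1" "psi t x B {} = 1"
  by (simp_all add: psi_def)

lemma psi_insert_left:
  "finite B \<Longrightarrow> b \<notin> B \<Longrightarrow> psi t x (insert b B) C = psi t x {b} C * psi t x B C"
  by (simp add: psi_def)

lemma psi_Un_right:
  "finite C \<Longrightarrow> finite D \<Longrightarrow> C \<inter> D = {} \<Longrightarrow> psi t x B (C \<union> D) = psi t x B C * psi t x B D"
  by (simp add: psi_def prod.union_disjoint prod.distrib)

lemma psi_insert_right:
  "finite C \<Longrightarrow> c \<notin> C \<Longrightarrow> psi t x B (insert c C) = psi t x B {c} * psi t x B C"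
  using psi_Un_right[of C "{c}" t x B] by (simp add: mult.commute)

lemma psi_Un_left:
  "finite B \<Longrightarrow> finite D \<Longrightarrow> B \<inter> D = {} \<Longrightarrow> psi t x (B \<union> D) C = psi t x B C * psi t x D C"
  by (simp add: psi_def prod.union_disjoint)

text \<open>Partial fractions of prod (1 - t x_a u) / (1 - x_a u) with denominators cleared. Both
  sides have degree at most |A| in u and agree at the |A| + 1 points 0 and 1/x_a.\<close>

lemma lagrange_poly:
  fixes x :: "'i \<Rightarrow> 'b::field"
  assumes fin: "finite A" and inj: "inj_on x A" and nz: "\<And>a. a \<in> A \<Longrightarrow> x a \<noteq> 0"
  shows "(\<Prod>a\<in>A. [:1, - (t * x a):]) = (\<Prod>a\<in>A. [:1, - x a:]) +
     (\<Sum>a\<in>A. [:0, (1 - t) * x a * psi t x {a} (A - {a}):] * (\<Prod>c\<in>A - {a}. [:1, - x c:]))"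
    (is "?L = ?R")
proof -
  let ?n = "card A"
  have degp: "degree (\<Prod>a\<in>B. [:1, f a:]) \<le> card B" if "finite B" for B and f :: "'i \<Rightarrow> 'b"
    by (rule order_trans[OF degree_prod_sum_le[OF that]])
       (rule order_trans[OF sum_mono[of _ _ "\<lambda>_. 1"]], auto)
  have "degree ([:0, (1 - t) * x a * psi t x {a} (A - {a}):] * (\<Prod>c\<in>A - {a}. [:1, - x c:])) \<le> ?n"
    if a: "a \<in> A" for a
  proof -
    have "degree ([:0, (1 - t) * x a * psi t x {a} (A - {a}):] * (\<Prod>c\<in>A - {a}. [:1, - x c:]))
       \<le> 1 + card (A - {a})"
      by (rule order_trans[OF degree_mult_le]) (use degp[of "A - {a}" "\<lambda>c. - x c"] fin in \<open>auto intro!: add_mono\<close>)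
    then show ?thesis
      using card_Suc_Diff1[OF fin a] by simp
  qed
  then have degR: "degree ?R \<le> ?n"
    by (intro degree_add_le degree_sum_le degp fin)
  have degD: "degree (?L - ?R) \<le> ?n"
    by (intro degree_diff_le degR degp fin)
  have root0: "poly (?L - ?R) 0 = 0"
    by (simp add: poly_prod poly_sum)
  have root: "poly (?L - ?R) (1 / x a) = 0" if a: "a \<in> A" for a
  proof -
    have xa: "x a \<noteq> 0" using nz a by auto
    have "(\<Prod>c\<in>A - {a}. 1 - t * x c / x a) = (\<Prod>c\<in>A - {a}. (x a - t * x c) / x a)"
      using xa by (simp add: diff_divide_distrib)
    then have L: "poly ?L (1 / x a) = (1 - t) * (\<Prod>c\<in>A - {a}. (x a - t * x c) / x a)"
      using xa by (simp add: poly_prod prod.remove[OF fin a] left_diff_distrib)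
    \<comment> \<open>At u = 1/x_a every product that contains the factor of a vanishes, so only the
      summand of a itself survives.\<close>
    have z: "(\<Prod>c\<in>B. 1 - x c / x a) = 0" if "a \<in> B" "B \<subseteq> A" for B
      using that xa fin by (intro prod_zero) (auto intro: finite_subset)
    have "poly ?R (1 / x a) =
       (\<Sum>b\<in>A. (1 - t) * x b * psi t x {b} (A - {b}) / x a * (\<Prod>c\<in>A - {b}. 1 - x c / x a))"
      using z[OF a] by (simp add: poly_prod poly_sum mult_ac)
    also have "\<dots> = (\<Sum>b\<in>{a}. (1 - t) * x b * psi t x {b} (A - {b}) / x a * (\<Prod>c\<in>A - {b}. 1 - x c / x a))"
      by (rule sum.mono_neutral_right) (use a fin z in auto)
    also have "\<dots> = (1 - t) * (psi t x {a} (A - {a}) * (\<Prod>c\<in>A - {a}. 1 - x c / x a))"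
      using xa by simp
    also have "psi t x {a} (A - {a}) * (\<Prod>c\<in>A - {a}. 1 - x c / x a) = (\<Prod>c\<in>A - {a}. (x a - t * x c) / x a)"
    proof -
      have "(x a - t * x c) / (x a - x c) * (1 - x c / x a) = (x a - t * x c) / x a" if "c \<in> A - {a}" for c
      proof -
        have "1 - x c / x a = (x a - x c) / x a" "x a - x c \<noteq> 0"
          using xa inj a that by (auto simp: field_simps inj_on_def)
        then show ?thesis by simp
      qed
      then show ?thesis
        by (simp add: psi_def flip: prod.distrib)
    qed
    finally show ?thesis using L by simp
  qed
  show ?thesis
  proof (rule ccontr)
    assume "?L \<noteq> ?R"
    then have nz: "?L - ?R \<noteq> 0" by simp
    have "insert 0 ((\<lambda>a. 1 / x a) ` A) \<subseteq> {z. poly (?L - ?R) z = 0}"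
      using root root0 by blast
    then have "card (insert 0 ((\<lambda>a. 1 / x a) ` A)) \<le> card {z. poly (?L - ?R) z = 0}"
      by (intro card_mono poly_roots_finite nz)
    also have "\<dots> \<le> ?n" using card_poly_roots_bound[OF nz] degD by linarith
    also have "card (insert 0 ((\<lambda>a. 1 / x a) ` A)) = Suc (card ((\<lambda>a. 1 / x a) ` A))"
      using assms(3) fin by (subst card_insert_disjoint) auto
    also have "card ((\<lambda>a. 1 / x a) ` A) = ?n"
      by (rule card_image) (use inj in \<open>auto simp: inj_on_def\<close>)
    finally show False by simp
  qed
qed

lemma coeff_prod_linear:
  fixes f :: "'i \<Rightarrow> 'b::idom"
  assumes "finite A"
  shows "coeff (\<Prod>a\<in>A. [:1, f a:]) 0 = 1"
    and "coeff (\<Prod>a\<in>A. [:1, f a:]) (Suc 0) = (\<Sum>a\<in>A. f a)"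
    and "coeff (\<Prod>a\<in>A. [:1, f a:]) (card A) = (\<Prod>a\<in>A. f a)"
proof -
  \<comment> \<open>The vanishing above degree |A| is carried along because the inductive step for
    the top coefficient uses it.\<close>
  have "coeff (\<Prod>a\<in>A. [:1, f a:]) 0 = 1 \<and> coeff (\<Prod>a\<in>A. [:1, f a:]) (Suc 0) = (\<Sum>a\<in>A. f a) \<and>
    coeff (\<Prod>a\<in>A. [:1, f a:]) (card A) = (\<Prod>a\<in>A. f a) \<and>
    (\<forall>n>card A. coeff (\<Prod>a\<in>A. [:1, f a:]) n = 0)"
    using assms
  proof (induction A rule: finite_induct)
    case (insert a A)
    then show ?case
      by (auto simp: coeff_pCons split: nat.splits)
  qed (auto simp: coeff_pCons split: nat.splits)
  then show "coeff (\<Prod>a\<in>A. [:1, f a:]) 0 = 1"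
    "coeff (\<Prod>a\<in>A. [:1, f a:]) (Suc 0) = (\<Sum>a\<in>A. f a)"
    "coeff (\<Prod>a\<in>A. [:1, f a:]) (card A) = (\<Prod>a\<in>A. f a)"
    by auto
qed

text \<open>Pairs of a subset and a marked element, counted by the element first. This is how the
  inductions on A below remove one variable.\<close>

lemma sum_Pow_swap:
  assumes "finite A"
  shows "(\<Sum>B\<in>Pow A. \<Sum>a\<in>B. F a B) = (\<Sum>a\<in>A. \<Sum>B\<in>Pow (A - {a}). F a (insert a B))"
proof -
  have "(\<Sum>B\<in>Pow A. \<Sum>a\<in>B. F a B) = (\<Sum>(B, a)\<in>Sigma (Pow A) (\<lambda>B. B). F a B)"
    using assms by (subst sum.Sigma) (auto intro: finite_subset)
  also have "\<dots> = (\<Sum>(a, B)\<in>Sigma A (\<lambda>a. Pow (A - {a})). F a (insert a B))"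
    by (rule sum.reindex_bij_witness[of _ "\<lambda>(a, B). (insert a B, a)" "\<lambda>(B, a). (a, B - {a})"])
       (auto simp: insert_absorb)
  also have "\<dots> = (\<Sum>a\<in>A. \<Sum>B\<in>Pow (A - {a}). F a (insert a B))"
    using assms by (subst sum.Sigma) auto
  finally show ?thesis .
qed

lemma sum_Pow_swap_compl:
  assumes "finite A"
  shows "(\<Sum>B\<in>Pow A. \<Sum>c\<in>A - B. F c B) = (\<Sum>c\<in>A. \<Sum>B\<in>Pow (A - {c}). F c B)"
proof -
  have "(\<Sum>B\<in>Pow A. \<Sum>c\<in>A - B. F c B) = (\<Sum>(B, c)\<in>Sigma (Pow A) (\<lambda>B. A - B). F c B)"
    using assms by (subst sum.Sigma) auto
  also have "\<dots> = (\<Sum>(c, B)\<in>Sigma A (\<lambda>c. Pow (A - {c})). F c B)"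
    by (rule sum.reindex_bij_witness[of _ "\<lambda>(c, B). (B, c)" "\<lambda>(B, c). (c, B)"]) auto
  also have "\<dots> = (\<Sum>c\<in>A. \<Sum>B\<in>Pow (A - {c}). F c B)"
    using assms by (subst sum.Sigma) auto
  finally show ?thesis .
qed

text \<open>The t-integer [n]_t.\<close>

definition qint :: "'b::comm_ring_1 \<Rightarrow> nat \<Rightarrow> 'b" where
  "qint t n = (\<Sum>j<n. t ^ j)"

lemma qint_0 [simp]: "qint t 0 = 0"
  by (simp add: qint_def)

lemma qint_Suc: "qint t (Suc n) = qint t n + t ^ n"
  by (simp add: qint_def)

lemma one_minus_times_qint: "(1 - t) * qint t n = 1 - t ^ n"
proof (induction n)
  case (Suc n)
  then show ?case
    by (simp add: qint_Suc distrib_left left_diff_distrib)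
qed simp

lemma qint_add: "qint t (m + n) = t ^ n * qint t m + qint t n"
  by (induction m) (simp_all add: qint_Suc algebra_simps power_add)

text \<open>Together with t different from 1, \<open>qint_nz\<close> says that t is not a root of
  unity, so all factors of v_lambda(t) are invertible. Nonzero distinct x_a make 0 and the 1/x_a
  distinct nodes for \<open>lagrange_poly\<close>.\<close>

locale distinct_vars =
  fixes x :: "'i \<Rightarrow> 'b::field" and t :: 'b
  assumes inj_x: "inj x" and x_nz: "x a \<noteq> 0" and t_nz: "t \<noteq> 0" and t_ne_1: "t \<noteq> 1"
    and qint_nz: "qint t (Suc n) \<noteq> 0"
begin

lemma inj_on_x: "inj_on x A"
  using inj_x by (rule inj_on_subset) simp

text \<open>These are the coefficients of u^|A| and of u in \<open>lagrange_poly\<close>. The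
  parameter s is kept free because \<open>sum_psi_right\<close> uses s = 1/t.\<close>

lemma sum_psi:
  assumes "finite A" "s \<noteq> 1"
  shows "(\<Sum>a\<in>A. psi s x {a} (A - {a})) = qint s (card A)"
    and "(\<Sum>a\<in>A. x a * psi s x {a} (A - {a})) = (\<Sum>a\<in>A. x a)"
proof -
  have L: "(\<Prod>a\<in>A. [:1, - (s * x a):]) = (\<Prod>a\<in>A. [:1, - x a:]) +
     (\<Sum>a\<in>A. [:0, (1 - s) * x a * psi s x {a} (A - {a}):] * (\<Prod>c\<in>A - {a}. [:1, - x c:]))"
    by (rule lagrange_poly) (use assms inj_on_x x_nz in auto)
  have "coeff ([:0, (1 - s) * x a * psi s x {a} (A - {a}):] * (\<Prod>c\<in>A - {a}. [:1, - x c:])) (Suc 0)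
      = (1 - s) * (x a * psi s x {a} (A - {a}))" for a
    using coeff_prod_linear(1)[of "A - {a}" "\<lambda>c. - x c"] assms(1) by (simp add: coeff_pCons)
  then have "(\<Sum>a\<in>A. - (s * x a)) = (\<Sum>a\<in>A. - x a) + (1 - s) * (\<Sum>a\<in>A. x a * psi s x {a} (A - {a}))"
    using arg_cong[OF L, of "\<lambda>p. coeff p (Suc 0)"]
    by (simp only: coeff_add coeff_sum coeff_prod_linear(2)[OF assms(1)] sum_distrib_left)
  then have "(1 - s) * (\<Sum>a\<in>A. x a * psi s x {a} (A - {a})) = (1 - s) * (\<Sum>a\<in>A. x a)"
    by (simp add: sum_negf sum_distrib_left algebra_simps sum_subtractf)
  with assms(2) show "(\<Sum>a\<in>A. x a * psi s x {a} (A - {a})) = (\<Sum>a\<in>A. x a)"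
    by simp
  have top: "coeff ([:0, (1 - s) * x a * psi s x {a} (A - {a}):] * (\<Prod>c\<in>A - {a}. [:1, - x c:])) (card A)
      = - ((1 - s) * psi s x {a} (A - {a}) * (\<Prod>a\<in>A. - x a))" if a: "a \<in> A" for a
  proof -
    have c: "card A = Suc (card (A - {a}))" using card_Suc_Diff1[OF assms(1) a] by simp
    show ?thesis
      using coeff_prod_linear(3)[of "A - {a}" "\<lambda>c. - x c"] assms(1)
      unfolding c by (simp add: coeff_pCons prod.remove[OF assms(1) a])
  qed
  have "(\<Prod>a\<in>A. - (s * x a)) = (\<Prod>a\<in>A. - x a) +
     (\<Sum>a\<in>A. - ((1 - s) * psi s x {a} (A - {a}) * (\<Prod>a\<in>A. - x a)))"
    using arg_cong[OF L, of "\<lambda>p. coeff p (card A)"]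
    by (simp only: coeff_add coeff_sum coeff_prod_linear(3)[OF assms(1)] top cong: sum.cong)
  also have "(\<Prod>a\<in>A. - (s * x a)) = s ^ card A * (\<Prod>a\<in>A. - x a)"
    by (simp add: prod.distrib flip: mult_minus_right)
  finally have "s ^ card A * (\<Prod>a\<in>A. - x a) = (1 - (1 - s) * (\<Sum>a\<in>A. psi s x {a} (A - {a}))) * (\<Prod>a\<in>A. - x a)"
    by (simp add: sum_negf left_diff_distrib[of 1] sum_distrib_left sum_distrib_right mult.assoc)
  moreover have "(\<Prod>a\<in>A. - x a) \<noteq> 0"
    using x_nz assms(1) by simp
  ultimately have "(1 - s) * (\<Sum>a\<in>A. psi s x {a} (A - {a})) = 1 - s ^ card A"
    by simp
  then show "(\<Sum>a\<in>A. psi s x {a} (A - {a})) = qint s (card A)"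
    using assms(2) by (simp flip: one_minus_times_qint)
qed

text \<open>Exchanging the two variables in (x_b - t x_a) / (x_b - x_a) gives the same expression
  with 1/t for t, up to the factor t.\<close>

lemma psi_right_single:
  assumes "finite A" "a \<notin> A"
  shows "psi t x A {a} = t ^ card A * psi (1 / t) x {a} A"
proof -
  have "(x b - t * x a) / (x b - x a) = t * ((x a - 1 / t * x b) / (x a - x b))" if "b \<in> A" for b
  proof -
    have "t * (x a - 1 / t * x b) = - (x b - t * x a)"
      using t_nz by (simp add: field_simps)
    moreover have "(x b - t * x a) / (x b - x a) = (- (x b - t * x a)) / (x a - x b)"
      by (metis minus_diff_eq minus_divide_divide)
    ultimately show ?thesis by simp
  qed
  then show ?thesis
    using assms by (simp add: psi_def flip: prod_constant prod.distrib)
qed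

lemma sum_psi_right:
  assumes "finite A"
  shows "(\<Sum>a\<in>A. psi t x (A - {a}) {a}) = qint t (card A)"
    and "(\<Sum>a\<in>A. x a * psi t x (A - {a}) {a}) = t ^ (card A - 1) * (\<Sum>a\<in>A. x a)"
proof -
  have *: "psi t x (A - {a}) {a} = t ^ (card A - 1) * psi (1 / t) x {a} (A - {a})" if "a \<in> A" for a
    using that assms by (subst psi_right_single) auto
  have ne: "1 / t \<noteq> 1" using t_ne_1 by simp
  \<comment> \<open>The powers of t in t^(n-1) [n]_(1/t) are those of [n]_t in reverse
    order.\<close>
  have q: "t ^ (n - 1) * qint (1 / t) n = qint t n" for n
  proof (cases n)
    case (Suc m)
    have "t ^ m * (1 / t) ^ j = t ^ (m - j)" if "j \<le> m" for j
      using that t_nz by (simp add: power_diff power_one_over)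
    then have "t ^ m * qint (1 / t) n = (\<Sum>j<n. t ^ (m - j))"
      using Suc unfolding qint_def sum_distrib_left by (intro sum.cong) auto
    also have "\<dots> = qint t n"
      unfolding qint_def using Suc
      by (intro sum.reindex_bij_witness[of _ "\<lambda>j. m - j" "\<lambda>j. m - j"]) auto
    finally show ?thesis using Suc by simp
  qed simp
  show "(\<Sum>a\<in>A. psi t x (A - {a}) {a}) = qint t (card A)"
    using sum_psi(1)[OF assms ne] by (simp add: * q[simplified] flip: sum_distrib_left)
  show "(\<Sum>a\<in>A. x a * psi t x (A - {a}) {a}) = t ^ (card A - 1) * (\<Sum>a\<in>A. x a)"
    using sum_psi(2)[OF assms ne]
    by (simp add: * mult.left_commute[of "x _"] flip: sum_distrib_left)
qed

text \<open>Choosing a from A first and the rest of B afterwards has the same weight as choosing B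
  from A and then a from B.\<close>

lemma psi_split:
  assumes "finite A" "B \<subseteq> A" and a: "a \<in> B"
  shows "psi t x {a} (A - {a}) * psi t x (B - {a}) (A - B) = psi t x B (A - B) * psi t x {a} (B - {a})"
proof -
  have B: "finite B" using assms finite_subset by auto
  have "A - {a} = (B - {a}) \<union> (A - B)" using a assms by auto
  then have "psi t x {a} (A - {a}) = psi t x {a} (B - {a}) * psi t x {a} (A - B)"
    using assms B psi_Un_right[of "B - {a}" "A - B" t x "{a}"] by auto
  moreover have "psi t x B (A - B) = psi t x {a} (A - B) * psi t x (B - {a}) (A - B)"
    using psi_insert_left[of "B - {a}" a t x "A - B"] B a by (simp add: insert_absorb)
  ultimately show ?thesis by simp
qed

text \<open>By \<open>sum_psi\<close> inside B the factor [|B|]_t becomes a sum over a marked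
  element of B. \<open>psi_split\<close> then moves this element in front, which prepares the
  induction on A.\<close>

lemma psi_times_qint:
  assumes "finite A" "B \<subseteq> A"
  shows "psi t x B (A - B) * qint t (card B) =
    (\<Sum>a\<in>B. psi t x {a} (A - {a}) * psi t x (B - {a}) (A - B))"
proof -
  have B: "finite B" using assms finite_subset by auto
  show ?thesis
    using sum_psi(1)[OF B t_ne_1] by (simp add: psi_split[OF assms] flip: sum_distrib_left)
qed

text \<open>The mirror image: the marked element is taken from the complement of B and split off
  from A on the right.\<close>

lemma psi_times_qint_compl:
  assumes "finite A" "B \<subseteq> A"
  shows "psi t x B (A - B) * qint t (card (A - B)) =
    (\<Sum>c\<in>A - B. psi t x (A - {c}) {c} * psi t x B (A - {c} - B))"
proof -
  have B: "finite B" using assms finite_subset by auto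
  have "psi t x (A - {c}) {c} * psi t x B (A - {c} - B) = psi t x B (A - B) * psi t x (A - B - {c}) {c}"
    if c: "c \<in> A - B" for c
  proof -
    have "A - {c} = B \<union> (A - B - {c})" using c assms by auto
    then have "psi t x (A - {c}) {c} = psi t x B {c} * psi t x (A - B - {c}) {c}"
      using assms B psi_Un_left[of B "A - B - {c}" t x "{c}"] by auto
    moreover have "A - B = insert c (A - {c} - B)" using c by auto
    then have "psi t x B (A - B) = psi t x B {c} * psi t x B (A - {c} - B)"
      using psi_insert_right[of "A - {c} - B" c t x B] assms by auto
    ultimately show ?thesis by simp
  qed
  then show ?thesis
    using sum_psi_right(1)[of "A - B"] assms by (simp flip: sum_distrib_left)
qed

end

definition lin :: "'b::field \<Rightarrow> 'b fps" where
  "lin y = 1 - fps_const y * fps_X"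

lemma lin_inverse: "inverse (lin y) * lin y = 1"
  by (rule inverse_mult_eq_1) (simp add: lin_def)

lemma fps_of_poly_lin: "fps_of_poly [:1, - y:] = lin y"
  by (simp add: fps_of_poly_pCons lin_def flip: fps_const_neg)

text \<open>The t-factorial [m]_t!.\<close>

definition vq :: "'b::comm_ring_1 \<Rightarrow> nat \<Rightarrow> 'b" where
  "vq t m = (\<Prod>i=1..m. qint t i)"

lemma vq_0 [simp]: "vq t 0 = 1"
  by (simp add: vq_def)

lemma vq_Suc: "vq t (Suc m) = vq t m * qint t (Suc m)"
  by (simp add: vq_def)

text \<open>v_lambda(t) without the factor that belongs to zero parts.\<close>

definition vlist :: "'b::comm_ring_1 \<Rightarrow> nat list \<Rightarrow> 'b" where
  "vlist t la = (\<Prod>r\<in>set la. vq t (count_list la r))"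

definition Parts :: "nat \<Rightarrow> nat list set" where
  "Parts n = {la. is_partition la \<and> sum_list la = n}"

lemma length_le_sum_list: "0 \<notin> set la \<Longrightarrow> length la \<le> sum_list (la :: nat list)"
  by (induction la) auto

lemma finite_Parts [simp]: "finite (Parts n)"
proof (rule finite_subset)
  show "Parts n \<subseteq> {la. set la \<subseteq> {..n} \<and> length la \<le> n}"
    by (auto simp: Parts_def is_partition_def length_le_sum_list member_le_sum_list)
  show "finite {la. set la \<subseteq> {..n} \<and> length la \<le> n}"
    by (rule finite_lists_length_le) simp
qed

lemma Parts_0 [simp]: "Parts 0 = {[]}"
proof -
  have "la = []" if "la \<in> Parts 0" for la
    using that length_le_sum_list[of la] by (cases la) (auto simp: Parts_def is_partition_def)
  then show ?thesis by (auto simp: Parts_def is_partition_def)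
qed

text \<open>Puts a new first column of length k in front of the diagram of nu.\<close>

definition add_col :: "nat \<Rightarrow> nat list \<Rightarrow> nat list" where
  "add_col k nu = map Suc (nu @ replicate (k - length nu) 0)"

lemma length_add_col: "length nu \<le> k \<Longrightarrow> length (add_col k nu) = k"
  by (simp add: add_col_def)

lemma sum_list_add_col:
  assumes "length nu \<le> k"
  shows "sum_list (add_col k nu) = sum_list nu + k"
proof -
  have "sum_list (map Suc la) = sum_list la + length la" for la :: "nat list"
    by (induction la) auto
  from this[of "nu @ replicate (k - length nu) 0"] assms show ?thesis
    by (simp add: add_col_def sum_list_replicate)
qed

text \<open>The inverse removes the first column: all parts are lowered by one and those that become
  0 are dropped.\<close>

lemma bij_add_col:
  assumes "k \<le> n"
  shows "bij_betw (add_col k) {nu \<in> Parts (n - k). length nu \<le> k} {la \<in> Parts n. length la = k}"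
proof (rule bij_betw_byWitness[where f' = "\<lambda>la. filter (\<lambda>i. i \<noteq> 0) (map (\<lambda>i. i - 1) la)"])
  have inv: "filter (\<lambda>i. i \<noteq> 0) (map (\<lambda>i. i - 1) (add_col k nu)) = nu" if "0 \<notin> set nu" for nu
    using that by (auto simp: add_col_def comp_def filter_id_conv intro!: gr0I)
  then show "\<forall>nu\<in>{nu \<in> Parts (n - k). length nu \<le> k}.
      filter (\<lambda>i. i \<noteq> 0) (map (\<lambda>i. i - 1) (add_col k nu)) = nu"
    by (auto simp: Parts_def is_partition_def)
  \<comment> \<open>In a weakly decreasing list the zeros form the tail, so dropping them loses
    nothing but their number.\<close>
  have sw: "sorted_wrt (\<ge>) (filter (\<lambda>i. i \<noteq> 0) la @ replicate (length la - length (filter (\<lambda>i. i \<noteq> 0) la)) 0) \<and>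
      la = filter (\<lambda>i. i \<noteq> 0) la @ replicate (length la - length (filter (\<lambda>i. i \<noteq> 0) la)) 0"
    if "sorted_wrt (\<ge>) la" for la :: "nat list"
    using that
  proof (induction la)
    case (Cons a la)
    show ?case
    proof (cases "a = 0")
      case True
      then have z: "\<forall>b\<in>set la. b = 0" using Cons.prems by auto
      then have "replicate (length la) 0 = la"
        by (simp add: replicate_length_same)
      moreover have "filter (\<lambda>i. i \<noteq> 0) la = []"
        using z by (simp add: filter_empty_conv)
      ultimately show ?thesis using Cons.prems True by simp
    next
      case False
      let ?m = "length la - length (filter (\<lambda>i. i \<noteq> 0) la)"
      have "Suc (length la) - Suc (length (filter (\<lambda>i. i \<noteq> 0) la)) = ?m" by simp
      have s: "sorted_wrt (\<ge>) la" using Cons.prems by simp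
      note IH = Cons.IH[OF s]
      moreover have "\<forall>b\<in>set (filter (\<lambda>i. i \<noteq> 0) la @ replicate ?m 0). b \<le> a"
        using Cons.prems IH by auto
      ultimately show ?thesis using False s by simp
    qed
  qed simp
  have inv': "add_col (length la) (filter (\<lambda>i. i \<noteq> 0) (map (\<lambda>i. i - 1) la)) = la"
    if "is_partition la" for la
  proof -
    have "sorted_wrt (\<ge>) (map (\<lambda>i. i - 1) la)"
      using that by (auto simp: is_partition_def sorted_wrt_map intro: sorted_wrt_mono_rel[of la "(\<ge>)"])
    from sw[OF this] have "map (\<lambda>i. i - 1) la = filter (\<lambda>i. i \<noteq> 0) (map (\<lambda>i. i - 1) la) @
        replicate (length la - length (filter (\<lambda>i. i \<noteq> 0) (map (\<lambda>i. i - 1) la))) 0"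
      by simp
    then have "add_col (length la) (filter (\<lambda>i. i \<noteq> 0) (map (\<lambda>i. i - 1) la)) = map Suc (map (\<lambda>i. i - 1) la)"
      unfolding add_col_def by simp
    also have "i \<noteq> 0" if "i \<in> set la" for i
      using that \<open>is_partition la\<close> by (metis is_partition_def)
    then have "map Suc (map (\<lambda>i. i - 1) la) = la"
      unfolding map_map by (intro map_idI) simp
    finally show ?thesis .
  qed
  then show "\<forall>la\<in>{la \<in> Parts n. length la = k}. add_col k (filter (\<lambda>i. i \<noteq> 0) (map (\<lambda>i. i - 1) la)) = la"
    by (auto simp: Parts_def)
  show "add_col k ` {nu \<in> Parts (n - k). length nu \<le> k} \<subseteq> {la \<in> Parts n. length la = k}"
    using assms
    by (auto simp: Parts_def length_add_col sum_list_add_col is_partition_def)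
       (auto simp: add_col_def sorted_wrt_map sorted_wrt_append sorted_wrt_iff_nth_less nth_append)
  show "(\<lambda>la. filter (\<lambda>i. i \<noteq> 0) (map (\<lambda>i. i - 1) la)) ` {la \<in> Parts n. length la = k}
      \<subseteq> {nu \<in> Parts (n - k). length nu \<le> k}"
  proof (rule image_subsetI)
    fix la assume la: "la \<in> {la \<in> Parts n. length la = k}"
    let ?nu = "filter (\<lambda>i. i \<noteq> 0) (map (\<lambda>i. i - 1) la)"
    have len: "length ?nu \<le> k" using la length_filter_le[of "\<lambda>i. i \<noteq> 0" "map (\<lambda>i. i - 1) la"] by simp
    have "sorted_wrt (\<ge>) (map (\<lambda>i. i - 1) la)"
      using la by (auto simp: Parts_def is_partition_def sorted_wrt_map intro: sorted_wrt_mono_rel[of la "(\<ge>)"])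
    then have "is_partition ?nu"
      unfolding is_partition_def by (auto intro: sorted_wrt_filter)
    moreover have "sum_list (add_col k ?nu) = n"
      using inv'[of la] la by (auto simp: Parts_def)
    ultimately show "?nu \<in> {nu \<in> Parts (n - k). length nu \<le> k}"
      using len sum_list_add_col[OF len] by (simp add: Parts_def)
  qed
qed

text \<open>The new column contributes 0 + 1 + ... + (k - 1).\<close>

lemma n_stat_add_col:
  assumes "length nu \<le> k"
  shows "n_stat (add_col k nu) = n_stat nu + (k choose 2)"
proof -
  have "n_stat (add_col k nu) = (\<Sum>i<k. i * (part nu i + 1))"
    using assms unfolding n_stat_def length_add_col[OF assms]
    by (intro sum.cong) (auto simp: part_def add_col_def nth_append)
  also have "\<dots> = (\<Sum>i<k. i * part nu i) + (\<Sum>i<k. i)"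
    by (simp add: sum.distrib)
  also have "(\<Sum>i<k. i) = k choose 2"
    by (simp add: gauss_sum_nat choose_two lessThan_atLeast0 Sum_Ico_nat)
  also have "(\<Sum>i<k. i * part nu i) = n_stat nu"
    unfolding n_stat_def using assms by (intro sum.mono_neutral_right) (auto simp: part_def)
  finally show ?thesis .
qed

lemma count_list_map_Suc: "count_list (map Suc la) (Suc r) = count_list la r"
  by (induction la) auto

text \<open>The multiplicities of nu are shifted to the next part size, and the part 1 is new, with
  multiplicity k - l(nu).\<close>

lemma vlist_add_col:
  assumes "length nu \<le> k" "0 \<notin> set nu"
  shows "vlist t (add_col k nu) = vlist t nu * vq t (k - length nu)"
proof -
  let ?la = "nu @ replicate (k - length nu) 0"
  have rep: "count_list (replicate m (0::nat)) r = (if r = 0 then m else 0)" for m r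
    by (induction m) auto
  have "vlist t (add_col k nu) = (\<Prod>r\<in>set ?la. vq t (count_list ?la r))"
    unfolding vlist_def add_col_def set_map
    by (subst prod.reindex) (auto simp: count_list_map_Suc simp del: map_append set_append)
  \<comment> \<open>If there is no padding, 0 does not occur in the list and its factor is
    \<open>vq t 0 = 1\<close>.\<close>
  also have "\<dots> = (\<Prod>r\<in>insert 0 (set nu). vq t (count_list ?la r))"
    by (rule prod.mono_neutral_left) (auto simp: rep count_list_0_iff split: if_splits)
  also have "\<dots> = vq t (k - length nu) * (\<Prod>r\<in>set nu. vq t (count_list nu r))"
  proof -
    have "count_list ?la r = count_list nu r" if "r \<in> set nu" for r
      using that assms(2) by (cases "r = 0") (auto simp: rep)
    moreover have "count_list ?la 0 = k - length nu"
      using assms(2) by (simp add: rep count_list_0_iff)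
    ultimately show ?thesis
      using assms(2) by (subst prod.insert) (auto cong: prod.cong)
  qed
  finally show ?thesis by (simp add: vlist_def mult.commute)
qed

lemma fps_const_sum: "fps_const (sum f A) = (\<Sum>a\<in>A. fps_const (f a))"
  by (induction A rule: infinite_finite_induct) (simp_all flip: fps_const_add)

text \<open>
  Groups the permutations in \<open>P\<^sub>\<lambda>\<close> by the images of the first \<open>\<ell>(\<lambda>)\<close> indices. The sum over the images
  of the other indices is \<open>v\<^bsub>n-\<ell>(\<lambda>)\<^esub>(t)\<close> and cancels against the denominator.
\<close>

fun HLsum :: "'b::field \<Rightarrow> ('i \<Rightarrow> 'b) \<Rightarrow> nat list \<Rightarrow> 'i set \<Rightarrow> 'b" where
  "HLsum t x [] A = 1"
| "HLsum t x (l # la) A = (\<Sum>a\<in>A. x a ^ l * psi t x {a} (A - {a}) * HLsum t x la (A - {a}))"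

lemma HLsum_card_less:
  "finite A \<Longrightarrow> card A < length la \<Longrightarrow> HLsum t x la A = 0"
proof (induction la arbitrary: A)
  case (Cons l la)
  then have "HLsum t x la (A - {a}) = 0" if "a \<in> A" for a
    using that card_Suc_Diff1[of A a] by simp
  then show ?case by simp
qed simp

text \<open>With as many variables as parts, each summand uses every variable exactly once.\<close>

lemma HLsum_map_Suc:
  "finite A \<Longrightarrow> card A = length la \<Longrightarrow> HLsum t x (map Suc la) A = (\<Prod>a\<in>A. x a) * HLsum t x la A"
proof (induction la arbitrary: A)
  case (Cons l la)
  have "HLsum t x (map Suc la) (A - {a}) = (\<Prod>a\<in>A - {a}. x a) * HLsum t x la (A - {a})" if "a \<in> A" for a
    using that Cons card_Suc_Diff1[of A a] by simp
  then show ?case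
    using Cons.prems by (auto simp: sum_distrib_left prod.remove[of A] mult_ac intro!: sum.cong)
qed simp

context distinct_vars
begin

text \<open>B is the set of variables that receive the parts of la. By \<open>psi_split\<close> the
  weight of an ordered choice factors into that of B against the other variables and that of the
  order inside B.\<close>

lemma HLsum_subsets:
  "finite A \<Longrightarrow> HLsum t x la A =
    (\<Sum>B\<in>Pow A. if card B = length la then psi t x B (A - B) * HLsum t x la B else 0)"
proof (induction la arbitrary: A)
  case Nil
  have "(\<Sum>B\<in>Pow A. if card B = 0 then psi t x B (A - B) * HLsum t x [] B else 0) =
     (\<Sum>B\<in>{{}}. if card B = 0 then psi t x B (A - B) * HLsum t x [] B else 0)"
    by (rule sum.mono_neutral_right) (use Nil in \<open>auto dest: finite_subset\<close>)
  then show ?case by simp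
next
  case (Cons l la)
  let ?F = "\<lambda>a B. if card B = Suc (length la)
     then x a ^ l * psi t x {a} (A - {a}) * (psi t x (B - {a}) (A - B) * HLsum t x la (B - {a})) else 0"
  have "HLsum t x (l # la) A = (\<Sum>a\<in>A. \<Sum>B\<in>Pow (A - {a}). ?F a (insert a B))"
    unfolding HLsum.simps
  proof (intro sum.cong refl)
    fix a assume a: "a \<in> A"
    show "x a ^ l * psi t x {a} (A - {a}) * HLsum t x la (A - {a}) = (\<Sum>B\<in>Pow (A - {a}). ?F a (insert a B))"
    proof -
      have "?F a (insert a B) = x a ^ l * psi t x {a} (A - {a}) *
         (if card B = length la then psi t x B (A - {a} - B) * HLsum t x la B else 0)"
        if "B \<in> Pow (A - {a})" for B
      proof -
        have "finite B" "a \<notin> B" using that Cons.prems finite_subset by auto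
        moreover have "A - insert a B = A - {a} - B" by auto
        ultimately show ?thesis by simp
      qed
      then show ?thesis
        using Cons.IH[of "A - {a}"] Cons.prems by (simp add: sum_distrib_left)
    qed
  qed
  also have "\<dots> = (\<Sum>B\<in>Pow A. \<Sum>a\<in>B. ?F a B)"
    by (rule sum_Pow_swap[symmetric]) fact
  also have "\<dots> = (\<Sum>B\<in>Pow A. if card B = length (l # la) then psi t x B (A - B) * HLsum t x (l # la) B else 0)"
  proof (intro sum.cong refl)
    fix B assume B: "B \<in> Pow A"
    have "x a ^ l * psi t x {a} (A - {a}) * (psi t x (B - {a}) (A - B) * HLsum t x la (B - {a})) =
       psi t x B (A - B) * (x a ^ l * psi t x {a} (B - {a}) * HLsum t x la (B - {a}))" if "a \<in> B" for a
      using psi_split[OF Cons.prems _ that] B by (simp add: mult_ac)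
    then have "(\<Sum>a\<in>B. x a ^ l * psi t x {a} (A - {a}) * (psi t x (B - {a}) (A - B) * HLsum t x la (B - {a}))) =
       psi t x B (A - B) * HLsum t x (l # la) B"
      unfolding HLsum.simps sum_distrib_left by (rule sum.cong[OF refl])
    then show "(\<Sum>a\<in>B. ?F a B) = (if card B = length (l # la) then psi t x B (A - B) * HLsum t x (l # la) B else 0)"
      by simp
  qed
  finally show ?case .
qed

lemma HLsum_replicate_0: "finite A \<Longrightarrow> card A = m \<Longrightarrow> HLsum t x (replicate m 0) A = vq t m"
proof (induction m arbitrary: A)
  case (Suc m)
  have "HLsum t x (replicate m 0) (A - {a}) = vq t m" if "a \<in> A" for a
    using that Suc by simp
  then have "HLsum t x (replicate (Suc m) 0) A = (\<Sum>a\<in>A. psi t x {a} (A - {a})) * vq t m"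
    by (simp add: sum_distrib_right)
  then show ?case
    using sum_psi(1)[OF Suc.prems(1) t_ne_1] Suc.prems by (simp add: vq_Suc mult.commute)
qed simp

text \<open>Once the parts of la are placed, the zeros run over all orders of the remaining m
  variables, whose total weight is [m]_t!.\<close>

lemma HLsum_append_zeros:
  "finite A \<Longrightarrow> card A = length la + m \<Longrightarrow> HLsum t x (la @ replicate m 0) A = vq t m * HLsum t x la A"
proof (induction la arbitrary: A)
  case (Cons l la)
  have "HLsum t x (la @ replicate m 0) (A - {a}) = vq t m * HLsum t x la (A - {a})" if "a \<in> A" for a
    using that Cons by simp
  then show ?case by (simp add: sum_distrib_left mult_ac)
qed (simp add: HLsum_replicate_0)

lemma vq_nz: "vq t m \<noteq> 0"
  using qint_nz by (induction m) (simp_all add: vq_Suc)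

text \<open>P_lambda in the variables of A. By \<open>HLsum_card_less\<close> it is 0 if A has fewer
  elements than lambda has parts.\<close>

definition HLP :: "nat list \<Rightarrow> 'i set \<Rightarrow> 'b" where
  "HLP la A = HLsum t x la A / vlist t la"

lemma HLP_Nil [simp]: "HLP [] A = 1"
  by (simp add: HLP_def vlist_def)

lemma HLP_subsets:
  "finite A \<Longrightarrow> HLP la A = (\<Sum>B\<in>Pow A. if card B = length la then psi t x B (A - B) * HLP la B else 0)"
  unfolding HLP_def by (subst HLsum_subsets) (auto simp: sum_divide_distrib intro!: sum.cong)

text \<open>In k variables a first column of full length k is the factor x_1 ... x_k. The orders of
  the padding zeros produce exactly the extra factor of \<open>vlist_add_col\<close>.\<close>

lemma HLP_add_col:
  assumes "finite B" "length nu \<le> card B" "0 \<notin> set nu"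
  shows "HLP (add_col (card B) nu) B = (\<Prod>b\<in>B. x b) * HLP nu B"
proof -
  have "HLsum t x (add_col (card B) nu) B = (\<Prod>b\<in>B. x b) * (vq t (card B - length nu) * HLsum t x nu B)"
    unfolding add_col_def using assms by (subst HLsum_map_Suc) (auto simp: HLsum_append_zeros)
  then show ?thesis
    using assms vq_nz by (simp add: HLP_def vlist_add_col)
qed

text \<open>The weight c sees only the number of parts, so it becomes constant once the first column
  is fixed.\<close>

definition wsum :: "(nat \<Rightarrow> 'b) \<Rightarrow> nat \<Rightarrow> 'i set \<Rightarrow> 'b" where
  "wsum c n A = (\<Sum>la\<in>Parts n. c (length la) * t ^ n_stat la * HLP la A)"

lemma wsum_0: "wsum c 0 A = c 0"
  by (simp add: wsum_def n_stat_def)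

lemma wsum_empty: "n > 0 \<Longrightarrow> wsum c n {} = 0"
proof -
  assume "n > 0"
  then have "HLP la {} = 0" if "la \<in> Parts n" for la
    using that HLsum_card_less[of "{}" la] by (cases la) (auto simp: HLP_def Parts_def)
  then show ?thesis by (simp add: wsum_def)
qed

text \<open>Partitions are sorted by their first column and by the set B of variables that carry it.
  The rest of the partition is summed with weight 1 in the variables of B, so weight 1 gives a
  recursion and any other weight reduces to it.\<close>

lemma wsum_columns:
  assumes "finite A"
  shows "wsum c n A = (\<Sum>B\<in>Pow A. if card B \<le> n
     then c (card B) * t ^ (card B choose 2) * psi t x B (A - B) * (\<Prod>b\<in>B. x b) * wsum (\<lambda>_. 1) (n - card B) B
     else 0)"
proof -
  have "wsum c n A = (\<Sum>la\<in>Parts n. \<Sum>B\<in>Pow A.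
     if card B = length la then c (length la) * t ^ n_stat la * (psi t x B (A - B) * HLP la B) else 0)"
    unfolding wsum_def
    by (intro sum.cong refl, subst HLP_subsets[OF assms])
       (auto simp: sum_distrib_left intro!: sum.cong)
  also have "\<dots> = (\<Sum>B\<in>Pow A. \<Sum>la\<in>Parts n.
     if card B = length la then c (length la) * t ^ n_stat la * (psi t x B (A - B) * HLP la B) else 0)"
    by (rule sum.swap)
  also have "\<dots> = (\<Sum>B\<in>Pow A. if card B \<le> n
     then c (card B) * t ^ (card B choose 2) * psi t x B (A - B) * (\<Prod>b\<in>B. x b) * wsum (\<lambda>_. 1) (n - card B) B
     else 0)"
  proof (intro sum.cong refl)
    fix B assume "B \<in> Pow A"
    then have fB: "finite B" using assms finite_subset by auto
    let ?k = "card B"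
    have "(\<Sum>la\<in>Parts n. if ?k = length la then c (length la) * t ^ n_stat la * (psi t x B (A - B) * HLP la B) else 0)
      = (\<Sum>la\<in>{la \<in> Parts n. length la = ?k}. c ?k * t ^ n_stat la * (psi t x B (A - B) * HLP la B))"
      by (simp add: sum.If_cases Int_def eq_commute conj_commute cong: conj_cong)
    also have "\<dots> = (if ?k \<le> n
     then c ?k * t ^ (?k choose 2) * psi t x B (A - B) * (\<Prod>b\<in>B. x b) * wsum (\<lambda>_. 1) (n - ?k) B else 0)"
    proof (cases "?k \<le> n")
      case True
      have "(\<Sum>la\<in>{la \<in> Parts n. length la = ?k}. c ?k * t ^ n_stat la * (psi t x B (A - B) * HLP la B)) =
        (\<Sum>nu\<in>{nu \<in> Parts (n - ?k). length nu \<le> ?k}.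
          c ?k * t ^ n_stat (add_col ?k nu) * (psi t x B (A - B) * HLP (add_col ?k nu) B))"
        by (rule sum.reindex_bij_betw[OF bij_add_col[OF True], symmetric])
      also have "\<dots> = (\<Sum>nu\<in>{nu \<in> Parts (n - ?k). length nu \<le> ?k}.
          c ?k * t ^ (?k choose 2) * psi t x B (A - B) * (\<Prod>b\<in>B. x b) * (t ^ n_stat nu * HLP nu B))"
        using fB
        by (intro sum.cong) (auto simp: n_stat_add_col HLP_add_col Parts_def is_partition_def power_add mult_ac)
      \<comment> \<open>Partitions with more than \<open>card B\<close> parts may be added because
        they vanish in \<open>card B\<close> variables.\<close>
      also have "\<dots> = (\<Sum>nu\<in>Parts (n - ?k).
          c ?k * t ^ (?k choose 2) * psi t x B (A - B) * (\<Prod>b\<in>B. x b) * (t ^ n_stat nu * HLP nu B))"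
        using fB by (intro sum.mono_neutral_left) (auto simp: HLP_def HLsum_card_less)
      finally show ?thesis
        using True by (simp add: wsum_def sum_distrib_left)
    next
      case False
      have "{la \<in> Parts n. length la = ?k} = {}"
        using False length_le_sum_list by (fastforce simp: Parts_def is_partition_def)
      then show ?thesis using False by (simp only: sum.empty if_False)
    qed
    finally show "(\<Sum>la\<in>Parts n. if ?k = length la then c (length la) * t ^ n_stat la * (psi t x B (A - B) * HLP la B) else 0)
      = (if ?k \<le> n
     then c ?k * t ^ (?k choose 2) * psi t x B (A - B) * (\<Prod>b\<in>B. x b) * wsum (\<lambda>_. 1) (n - ?k) B else 0)" .
  qed
  finally show ?thesis .
qed

section \<open>Generating series as sums over sets of variables\<close>

definition vX :: "'i \<Rightarrow> 'b fps" where
  "vX a = fps_const (x a) * fps_X"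

definition HA :: "'i set \<Rightarrow> 'b fps" where
  "HA A = (\<Prod>a\<in>A. inverse (lin (x a)))"

lemma HA_mult: "HA A * (\<Prod>a\<in>A. lin (x a)) = 1"
  by (simp add: HA_def lin_inverse flip: prod.distrib)

lemma HA_split: "finite A \<Longrightarrow> B \<subseteq> A \<Longrightarrow> HA A * (\<Prod>a\<in>A - B. lin (x a)) = HA B"
proof -
  assume "finite A" "B \<subseteq> A"
  then have "HA A = HA B * HA (A - B)"
    unfolding HA_def by (subst prod.subset_diff[of B A]) (auto simp: mult.commute)
  then show ?thesis by (simp add: mult.assoc HA_mult)
qed

text \<open>Induction on |A| after multiplication by [|A|]_t, which splits as t^(|A|-|B|) [|B|]_t +
  [|A-B|]_t. The two terms mark an element inside and outside B; removing it leads to the sum for A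
  without that element, which is 1.\<close>

lemma sum_subsets_lin:
  "finite A \<Longrightarrow> (\<Sum>B\<in>Pow A. fps_const (t ^ (card B choose 2) * psi t x B (A - B)) *
      ((\<Prod>b\<in>B. vX b) * (\<Prod>c\<in>A - B. lin (x c)))) = 1"
proof (induction "card A" arbitrary: A)
  case 0
  then show ?case by (simp add: numeral_2_eq_2)
next
  case (Suc m)
  let ?n = "card A"
  let ?w = "\<lambda>A B. (\<Prod>b\<in>B. vX b) * (\<Prod>c\<in>A - B. lin (x c))"
  let ?K = "\<lambda>A. \<Sum>B\<in>Pow A. fps_const (t ^ (card B choose 2) * psi t x B (A - B)) * ?w A B"
  let ?F = "\<lambda>a B. fps_const (t ^ (?n - card B) * t ^ (card B choose 2) * (psi t x {a} (A - {a}) * psi t x (B - {a}) (A - B))) * ?w A B"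
  let ?G = "\<lambda>c B. fps_const (t ^ (card B choose 2) * (psi t x (A - {c}) {c} * psi t x B (A - {c} - B))) * ?w A B"
  have IH: "?K (A - {a}) = 1" if "a \<in> A" for a
    using that Suc.hyps(1)[of "A - {a}"] Suc.hyps(2) Suc.prems by simp
  have split: "fps_const (qint t ?n) * (fps_const (t ^ (card B choose 2) * psi t x B (A - B)) * ?w A B) =
     (\<Sum>a\<in>B. ?F a B) + (\<Sum>c\<in>A - B. ?G c B)" if B: "B \<in> Pow A" for B
  proof -
    have fB: "finite B" "B \<subseteq> A" using B Suc.prems finite_subset by auto
    have "?n = card B + (?n - card B)" using card_mono[OF Suc.prems fB(2)] by simp
    then have "qint t ?n = t ^ (?n - card B) * qint t (card B) + qint t (card (A - B))"
      by (metis qint_add card_Diff_subset fB)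
    then have "qint t ?n * psi t x B (A - B) =
        t ^ (?n - card B) * (psi t x B (A - B) * qint t (card B)) + psi t x B (A - B) * qint t (card (A - B))"
      by (simp add: algebra_simps)
    also have "\<dots> = (\<Sum>a\<in>B. t ^ (?n - card B) * (psi t x {a} (A - {a}) * psi t x (B - {a}) (A - B))) +
       (\<Sum>c\<in>A - B. psi t x (A - {c}) {c} * psi t x B (A - {c} - B))"
      by (simp add: psi_times_qint[OF Suc.prems fB(2)] psi_times_qint_compl[OF Suc.prems fB(2)] sum_distrib_left)
    finally have e: "qint t ?n * psi t x B (A - B) = \<dots>" .
    have "fps_const (qint t ?n) * (fps_const (t ^ (card B choose 2) * psi t x B (A - B)) * ?w A B) =
       fps_const (t ^ (card B choose 2) * (qint t ?n * psi t x B (A - B))) * ?w A B"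
      by (simp add: mult_ac flip: fps_const_mult)
    also have "\<dots> = (\<Sum>a\<in>B. ?F a B) + (\<Sum>c\<in>A - B. ?G c B)"
      unfolding e by (simp add: distrib_left distrib_right sum_distrib_left sum_distrib_right mult_ac
        fps_const_sum flip: fps_const_add fps_const_mult)
    finally show ?thesis .
  qed
  have "fps_const (qint t ?n) * ?K A = (\<Sum>B\<in>Pow A. \<Sum>a\<in>B. ?F a B) + (\<Sum>B\<in>Pow A. \<Sum>c\<in>A - B. ?G c B)"
    unfolding sum_distrib_left sum.distrib[symmetric] by (rule sum.cong[OF refl split])
  also have "(\<Sum>B\<in>Pow A. \<Sum>a\<in>B. ?F a B) = (\<Sum>a\<in>A. \<Sum>B\<in>Pow (A - {a}). ?F a (insert a B))"
    by (rule sum_Pow_swap) fact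
  also have "\<dots> = (\<Sum>a\<in>A. fps_const (t ^ (?n - 1) * psi t x {a} (A - {a})) * vX a * ?K (A - {a}))"
    unfolding sum_distrib_left
  proof (intro sum.cong refl)
    fix a B assume a: "a \<in> A" and B: "B \<in> Pow (A - {a})"
    have fB: "finite B" "B \<subseteq> A - {a}" using B Suc.prems finite_subset by auto
    have "card B \<le> card (A - {a})" using fB Suc.prems by (intro card_mono) auto
    \<comment> \<open>Since binom(k+1, 2) = binom(k, 2) + k, the power of t that is left over after
      removing a does not depend on B.\<close>
    then have "?n - Suc (card B) + (Suc (card B) choose 2) = ?n - 1 + (card B choose 2)"
      using a Suc.prems by (simp add: choose_two numeral_2_eq_2 card_gt_0_iff)
    then have p: "t ^ (?n - Suc (card B)) * t ^ (Suc (card B) choose 2) = t ^ (?n - 1) * t ^ (card B choose 2)"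
      by (simp flip: power_add)
    have "insert a B - {a} = B" "A - insert a B = A - {a} - B" "a \<notin> B" using fB by auto
    then show "?F a (insert a B) = fps_const (t ^ (?n - 1) * psi t x {a} (A - {a})) * vX a *
       (fps_const (t ^ (card B choose 2) * psi t x B (A - {a} - B)) * ?w (A - {a}) B)"
      using fB p by (simp add: mult_ac flip: fps_const_mult)
  qed
  also have "(\<Sum>B\<in>Pow A. \<Sum>c\<in>A - B. ?G c B) = (\<Sum>c\<in>A. \<Sum>B\<in>Pow (A - {c}). ?G c B)"
    by (rule sum_Pow_swap_compl) fact
  also have "\<dots> = (\<Sum>c\<in>A. fps_const (psi t x (A - {c}) {c}) * lin (x c) * ?K (A - {c}))"
    unfolding sum_distrib_left
  proof (intro sum.cong refl)
    fix c B assume c: "c \<in> A" and B: "B \<in> Pow (A - {c})"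
    have "A - B - {c} = A - {c} - B" by auto
    then have "(\<Prod>c\<in>A - B. lin (x c)) = lin (x c) * (\<Prod>c\<in>A - {c} - B. lin (x c))"
      using c B Suc.prems prod.remove[of "A - B" c "\<lambda>c. lin (x c)"] by auto
    then show "?G c B = fps_const (psi t x (A - {c}) {c}) * lin (x c) *
       (fps_const (t ^ (card B choose 2) * psi t x B (A - {c} - B)) * ?w (A - {c}) B)"
      by (simp add: mult_ac flip: fps_const_mult)
  qed
  also have "(\<Sum>a\<in>A. fps_const (t ^ (?n - 1) * psi t x {a} (A - {a})) * vX a * ?K (A - {a})) +
      (\<Sum>c\<in>A. fps_const (psi t x (A - {c}) {c}) * lin (x c) * ?K (A - {c})) =
     (\<Sum>a\<in>A. fps_const (t ^ (?n - 1) * psi t x {a} (A - {a})) * vX a) +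
      (\<Sum>c\<in>A. fps_const (psi t x (A - {c}) {c}) * lin (x c))"
    by (simp add: IH cong: sum.cong)
  \<comment> \<open>What remains is linear in u. Its coefficient of u cancels, because both weighted
    sums of the x_a equal t^(n-1) times the plain sum, with n = |A|.\<close>
  also have "\<dots> = fps_const (t ^ (?n - 1) * (\<Sum>a\<in>A. x a * psi t x {a} (A - {a})) - (\<Sum>c\<in>A. x c * psi t x (A - {c}) {c})) * fps_X
      + fps_const (\<Sum>c\<in>A. psi t x (A - {c}) {c})"
    by (simp add: vX_def lin_def algebra_simps sum_distrib_left sum_subtractf sum_distrib_right
       fps_const_sum flip: fps_const_mult fps_const_sub)
  also have "\<dots> = fps_const (qint t ?n)"
    by (simp add: sum_psi(2)[OF Suc.prems t_ne_1] sum_psi_right[OF Suc.prems])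
  finally have "fps_const (qint t ?n) * ?K A = fps_const (qint t ?n) * 1" by simp
  moreover have "fps_const (qint t ?n) \<noteq> 0"
    using qint_nz[of m] Suc.hyps(2) by simp
  ultimately show ?case
    using mult_left_cancel by blast
qed

end

context distinct_vars
begin

lemma prod_vX: "(\<Prod>b\<in>B. vX b) = fps_const (\<Prod>b\<in>B. x b) * fps_X ^ card B"
  by (induction B rule: infinite_finite_induct) (simp_all add: vX_def mult_ac flip: fps_const_mult)

lemma HA_subsets:
  assumes "finite A"
  shows "HA A = (\<Sum>B\<in>Pow A. fps_const (t ^ (card B choose 2) * psi t x B (A - B)) * ((\<Prod>b\<in>B. vX b) * HA B))"
proof -
  have "HA A = HA A * (\<Sum>B\<in>Pow A. fps_const (t ^ (card B choose 2) * psi t x B (A - B)) *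
      ((\<Prod>b\<in>B. vX b) * (\<Prod>c\<in>A - B. lin (x c))))"
    by (simp add: sum_subsets_lin[OF assms])
  also have "\<dots> = (\<Sum>B\<in>Pow A. fps_const (t ^ (card B choose 2) * psi t x B (A - B)) *
      ((\<Prod>b\<in>B. vX b) * (HA A * (\<Prod>c\<in>A - B. lin (x c)))))"
    by (simp add: sum_distrib_left mult_ac)
  also have "\<dots> = (\<Sum>B\<in>Pow A. fps_const (t ^ (card B choose 2) * psi t x B (A - B)) * ((\<Prod>b\<in>B. vX b) * HA B))"
    by (intro sum.cong refl) (simp add: HA_split[OF assms])
  finally show ?thesis .
qed

text \<open>The identity sum t^n(lambda) P_lambda = h_n. By \<open>HA_subsets\<close> the series
  H(u) obeys the recursion of \<open>wsum_columns\<close>; a nonempty B lowers the degree, and the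
  empty B contributes 0 to both sides in positive degree.\<close>

lemma wsum_1:
  "finite A \<Longrightarrow> wsum (\<lambda>_. 1) n A = HA A $ n"
proof (induction n arbitrary: A rule: less_induct)
  case (less n)
  show ?case
  proof (cases "n = 0")
    case True
    have "fps_nth (HA A) 0 = 1" for A
      by (induction A rule: infinite_finite_induct) (simp_all add: HA_def lin_def)
    then show ?thesis using True by (simp add: wsum_0)
  next
    case False
    have "HA A $ n = (\<Sum>B\<in>Pow A. if card B \<le> n
      then 1 * t ^ (card B choose 2) * psi t x B (A - B) * (\<Prod>b\<in>B. x b) * HA B $ (n - card B) else 0)"
      by (subst HA_subsets[OF less.prems])
         (auto simp: fps_sum_nth prod_vX mult.assoc fps_X_power_mult_nth intro!: sum.cong)
    also have "\<dots> = wsum (\<lambda>_. 1) n A"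
      unfolding wsum_columns[OF less.prems, of _ n]
    proof (intro sum.cong refl)
      fix B assume "B \<in> Pow A"
      then have B: "finite B" using less.prems finite_subset by auto
      have "HA B $ (n - card B) = wsum (\<lambda>_. 1) (n - card B) B"
      proof (cases "B = {}")
        case True
        then show ?thesis using False by (simp add: HA_def wsum_empty)
      next
        case False
        then show ?thesis using less.IH[of "n - card B" B] B \<open>n \<noteq> 0\<close>
          by (simp add: card_gt_0_iff)
      qed
      then show "(if card B \<le> n then 1 * t ^ (card B choose 2) * psi t x B (A - B) * (\<Prod>b\<in>B. x b) * HA B $ (n - card B) else 0) =
        (if card B \<le> n then 1 * t ^ (card B choose 2) * psi t x B (A - B) * (\<Prod>b\<in>B. x b) * wsum (\<lambda>_. 1) (n - card B) B else 0)"
        by simp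
    qed
    finally show ?thesis by simp
  qed
qed

text \<open>At t = 1/q this is the product of the 1 - q^j, up to sign the value of the induced
  character at a unipotent class with k Jordan blocks.\<close>

definition gfac :: "nat \<Rightarrow> 'b" where
  "gfac k = (\<Prod>j=1..k. 1 - (1 / t) ^ j)"

text \<open>Passing from k to k + 1 produces the factor [k+1]_t, which \<open>psi_times_qint\<close>
  can turn into a marked element.\<close>

lemma gfac_choose: "gfac (Suc k) * t ^ (Suc k choose 2) = (t - 1) / t * qint t (Suc k) * (gfac k * t ^ (k choose 2))"
proof -
  have "t ^ k * (1 - (1 / t) ^ Suc k) = (t ^ Suc k - 1) / t"
    using t_nz by (simp add: field_simps power_one_over)
  also have "\<dots> = (t - 1) / t * qint t (Suc k)"
  proof -
    have "t ^ Suc k - 1 = (t - 1) * qint t (Suc k)"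
      using one_minus_times_qint[of t "Suc k"] by (simp add: algebra_simps)
    then show ?thesis by simp
  qed
  finally have "t ^ k * (1 - (1 / t) ^ Suc k) = \<dots>" .
  have "Suc k choose 2 = k + (k choose 2)"
    by (simp add: numeral_2_eq_2)
  moreover have "gfac (Suc k) = gfac k * (1 - (1 / t) ^ Suc k)"
    by (simp add: gfac_def)
  ultimately have "gfac (Suc k) * t ^ (Suc k choose 2) =
      (t ^ k * (1 - (1 / t) ^ Suc k)) * (gfac k * t ^ (k choose 2))"
    by (simp only: power_add mult_ac)
  then show ?thesis
    by (simp only: \<open>t ^ k * (1 - (1 / t) ^ Suc k) = (t - 1) / t * qint t (Suc k)\<close>)
qed

text \<open>This is \<open>lagrange_poly\<close> for the variables x_a / t, solved for the other
  product. The weights psi are homogeneous of degree 0 and do not change under the scaling.\<close>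

lemma lagrange_fps:
  assumes "finite A"
  shows "(\<Prod>a\<in>A. lin (x a / t)) = (\<Prod>a\<in>A. lin (x a)) +
    (\<Sum>a\<in>A. fps_const ((t - 1) / t * psi t x {a} (A - {a})) * vX a * (\<Prod>c\<in>A - {a}. lin (x c / t)))"
proof -
  have psi: "psi t (\<lambda>a. x a / t) B C = psi t x B C" for B C
  proof -
    have "(x b / t - t * (x c / t)) / (x b / t - x c / t) = (x b - t * x c) / (x b - x c)" for b c
    proof -
      have "x b / t - t * (x c / t) = (x b - t * x c) / t" "x b / t - x c / t = (x b - x c) / t"
        by (simp_all add: diff_divide_distrib)
      then show ?thesis using t_nz by simp
    qed
    then show ?thesis by (simp add: psi_def)
  qed
  have "(\<Prod>a\<in>A. [:1, - (t * (x a / t)):]) = (\<Prod>a\<in>A. [:1, - (x a / t):]) +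
     (\<Sum>a\<in>A. [:0, (1 - t) * (x a / t) * psi t (\<lambda>a. x a / t) {a} (A - {a}):] * (\<Prod>c\<in>A - {a}. [:1, - (x c / t):]))"
    by (rule lagrange_poly) (use assms inj_on_x x_nz t_nz in \<open>auto simp: inj_on_def dest!: injD[OF inj_x]\<close>)
  then have "(\<Prod>a\<in>A. [:1, - x a:]) = (\<Prod>a\<in>A. [:1, - (x a / t):]) +
     (\<Sum>a\<in>A. [:0, (1 - t) * (x a / t) * psi t x {a} (A - {a}):] * (\<Prod>c\<in>A - {a}. [:1, - (x c / t):]))"
    using t_nz by (simp add: psi)
  then have "fps_of_poly (\<Prod>a\<in>A. [:1, - x a:]) = fps_of_poly ((\<Prod>a\<in>A. [:1, - (x a / t):]) +
     (\<Sum>a\<in>A. [:0, (1 - t) * (x a / t) * psi t x {a} (A - {a}):] * (\<Prod>c\<in>A - {a}. [:1, - (x c / t):])))"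
    by (rule arg_cong)
  then have "(\<Prod>a\<in>A. lin (x a)) = (\<Prod>a\<in>A. lin (x a / t)) +
     (\<Sum>a\<in>A. fps_const ((1 - t) * (x a / t) * psi t x {a} (A - {a})) * fps_X * (\<Prod>c\<in>A - {a}. lin (x c / t)))"
    by (simp only: fps_of_poly_add fps_of_poly_sum fps_of_poly_prod fps_of_poly_mult fps_of_poly_lin)
       (simp add: fps_of_poly_pCons)
  moreover have "fps_const ((1 - t) * (x a / t) * psi t x {a} (A - {a})) * fps_X =
      - (fps_const ((t - 1) / t * psi t x {a} (A - {a})) * vX a)" for a
  proof -
    have "(1 - t) * (x a / t) * psi t x {a} (A - {a}) = - ((t - 1) / t * psi t x {a} (A - {a}) * x a)"
      using t_nz by (simp add: field_simps)
    then show ?thesis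
      by (simp only: vX_def fps_const_neg[symmetric] fps_const_mult[symmetric] mult.assoc minus_mult_left)
  qed
  ultimately show ?thesis
    by (simp add: sum_negf)
qed

text \<open>For nonempty B the factor [|B|]_t from \<open>gfac_choose\<close> marks an element a of
  B. The sum over the other elements is known by induction for A - {a}, and the sum over a is then
  evaluated by \<open>lagrange_fps\<close>; the empty B gives the summand 1.\<close>

lemma sum_subsets_gfac:
  "finite A \<Longrightarrow> (\<Sum>B\<in>Pow A. fps_const (gfac (card B) * t ^ (card B choose 2) * psi t x B (A - B)) * ((\<Prod>b\<in>B. vX b) * HA B))
    = (\<Prod>a\<in>A. lin (x a / t)) * HA A" (is "_ \<Longrightarrow> ?Z A = _")
proof (induction "card A" arbitrary: A)
  case 0
  then show ?case by (simp add: gfac_def numeral_2_eq_2 HA_def)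
next
  case (Suc m)
  let ?F = "\<lambda>a B. fps_const ((t - 1) / t * (gfac (card B - 1) * t ^ (card B - 1 choose 2)) *
     (psi t x {a} (A - {a}) * psi t x (B - {a}) (A - B))) * ((\<Prod>b\<in>B. vX b) * HA B)"
  have "fps_const (gfac (card B) * t ^ (card B choose 2) * psi t x B (A - B)) * ((\<Prod>b\<in>B. vX b) * HA B) =
     (if B = {} then 1 else 0) + (\<Sum>a\<in>B. ?F a B)" if B: "B \<in> Pow A" for B
  proof (cases "B = {}")
    case True
    then show ?thesis by (simp add: gfac_def numeral_2_eq_2 HA_def)
  next
    case False
    have fB: "finite B" "B \<subseteq> A" using B Suc.prems finite_subset by auto
    then obtain k where k: "card B = Suc k" using False by (metis card_eq_0_iff not0_implies_Suc)
    have "gfac (card B) * t ^ (card B choose 2) * psi t x B (A - B) =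
       (t - 1) / t * (gfac k * t ^ (k choose 2)) * (psi t x B (A - B) * qint t (card B))"
      unfolding k gfac_choose by (simp add: mult_ac)
    also have "\<dots> = (\<Sum>a\<in>B. (t - 1) / t * (gfac k * t ^ (k choose 2)) * (psi t x {a} (A - {a}) * psi t x (B - {a}) (A - B)))"
      by (simp only: psi_times_qint[OF Suc.prems fB(2)] sum_distrib_left)
    finally have e: "gfac (card B) * t ^ (card B choose 2) * psi t x B (A - B) = \<dots>" .
    show ?thesis
      unfolding e using False k by (simp only: fps_const_sum sum_distrib_right diff_Suc_1 if_False add_0_left)
  qed
  then have "?Z A = (\<Sum>B\<in>Pow A. if B = {} then 1 else 0) + (\<Sum>B\<in>Pow A. \<Sum>a\<in>B. ?F a B)"
    by (simp only: sum.distrib[symmetric] cong: sum.cong)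
  also have "(\<Sum>B\<in>Pow A. if B = {} then 1 else 0) = (1 :: 'b fps)"
    using Suc.prems by (simp add: sum.delta)
  also have "(\<Sum>B\<in>Pow A. \<Sum>a\<in>B. ?F a B) = (\<Sum>a\<in>A. \<Sum>B\<in>Pow (A - {a}). ?F a (insert a B))"
    by (rule sum_Pow_swap) fact
  also have "\<dots> = (\<Sum>a\<in>A. fps_const ((t - 1) / t * psi t x {a} (A - {a})) * vX a * inverse (lin (x a)) * ?Z (A - {a}))"
    unfolding sum_distrib_left
  proof (intro sum.cong refl)
    fix a B assume a: "a \<in> A" and B: "B \<in> Pow (A - {a})"
    have fB: "finite B" "B \<subseteq> A - {a}" using B Suc.prems finite_subset by auto
    have "insert a B - {a} = B" "A - insert a B = A - {a} - B" "a \<notin> B" using fB by auto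
    then show "?F a (insert a B) = fps_const ((t - 1) / t * psi t x {a} (A - {a})) * vX a * inverse (lin (x a)) *
       (fps_const (gfac (card B) * t ^ (card B choose 2) * psi t x B (A - {a} - B)) * ((\<Prod>b\<in>B. vX b) * HA B))"
      using fB by (simp add: HA_def mult_ac flip: fps_const_mult)
  qed
  also have "\<dots> = (\<Sum>a\<in>A. fps_const ((t - 1) / t * psi t x {a} (A - {a})) * vX a * (\<Prod>c\<in>A - {a}. lin (x c / t))) * HA A"
    unfolding sum_distrib_right
  proof (intro sum.cong refl)
    fix a assume a: "a \<in> A"
    have "?Z (A - {a}) = (\<Prod>a\<in>A - {a}. lin (x a / t)) * HA (A - {a})"
      by (rule Suc.hyps(1)) (use a Suc in auto)
    moreover have "HA A = inverse (lin (x a)) * HA (A - {a})"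
      using prod.remove[OF Suc.prems a, of "\<lambda>a. inverse (lin (x a))"] by (simp add: HA_def)
    ultimately show "fps_const ((t - 1) / t * psi t x {a} (A - {a})) * vX a * inverse (lin (x a)) * ?Z (A - {a}) =
      fps_const ((t - 1) / t * psi t x {a} (A - {a})) * vX a * (\<Prod>c\<in>A - {a}. lin (x c / t)) * HA A"
      by (simp only: mult_ac)
  qed
  also have "(\<Sum>a\<in>A. fps_const ((t - 1) / t * psi t x {a} (A - {a})) * vX a * (\<Prod>c\<in>A - {a}. lin (x c / t))) =
     (\<Prod>a\<in>A. lin (x a / t)) - (\<Prod>a\<in>A. lin (x a))"
    unfolding lagrange_fps[OF Suc.prems] by simp
  finally show ?case
    using HA_mult[of A] by (simp add: algebra_simps)
qed

lemma wsum_gfac: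
  assumes "finite A"
  shows "wsum gfac n A = ((\<Prod>a\<in>A. lin (x a / t)) * HA A) $ n"
  unfolding wsum_columns[OF assms] sum_subsets_gfac[OF assms, symmetric] fps_sum_nth
  using assms
  by (intro sum.cong refl)
     (auto simp: prod_vX mult.assoc fps_X_power_mult_nth wsum_1 dest: finite_subset)

text \<open>Division of \<open>lagrange_poly\<close> by prod (1 - x_a u). The right side is H(u) /
  H(t u), so the weighted power sums on the left are, up to the factor 1 - t, the Hall-Littlewood
  functions of one-row partitions.\<close>

lemma sum_power_psi:
  assumes "finite A"
  shows "1 + fps_const (1 - t) * Abs_fps (\<lambda>r. if r = 0 then 0 else \<Sum>a\<in>A. x a ^ r * psi t x {a} (A - {a}))
     = (\<Prod>a\<in>A. lin (t * x a)) * HA A"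
proof -
  have g: "vX a * inverse (lin (x a)) = Abs_fps (\<lambda>r. if r = 0 then 0 else x a ^ r)" for a
  proof -
    have v: "lin (x a) * Abs_fps (\<lambda>r. if r = 0 then 0 else x a ^ r) = vX a"
    proof (rule fps_ext)
      fix n show "(lin (x a) * Abs_fps (\<lambda>r. if r = 0 then 0 else x a ^ r)) $ n = vX a $ n"
        by (cases n) (auto simp: lin_def vX_def left_diff_distrib mult.assoc power_eq_if)
    qed
    have "vX a * inverse (lin (x a)) = (inverse (lin (x a)) * lin (x a)) * Abs_fps (\<lambda>r. if r = 0 then 0 else x a ^ r)"
      unfolding v[symmetric] by (simp only: mult_ac)
    then show ?thesis by (simp only: lin_inverse mult_1_left)
  qed
  have "(\<Prod>a\<in>A. [:1, - (t * x a):]) = (\<Prod>a\<in>A. [:1, - (x a):]) +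
     (\<Sum>a\<in>A. [:0, (1 - t) * x a * psi t x {a} (A - {a}):] * (\<Prod>c\<in>A - {a}. [:1, - x c:]))"
    by (rule lagrange_poly) (use assms inj_on_x x_nz in auto)
  from arg_cong[OF this, of fps_of_poly]
  have "(\<Prod>a\<in>A. lin (t * x a)) = (\<Prod>a\<in>A. lin (x a)) +
     (\<Sum>a\<in>A. fps_const ((1 - t) * x a * psi t x {a} (A - {a})) * fps_X * (\<Prod>c\<in>A - {a}. lin (x c)))"
    by (simp only: fps_of_poly_add fps_of_poly_sum fps_of_poly_prod fps_of_poly_mult fps_of_poly_lin)
       (simp add: fps_of_poly_pCons)
  then have "(\<Prod>a\<in>A. lin (t * x a)) * HA A = HA A * (\<Prod>a\<in>A. lin (x a)) +
     (\<Sum>a\<in>A. fps_const ((1 - t) * x a * psi t x {a} (A - {a})) * fps_X * (HA A * (\<Prod>c\<in>A - {a}. lin (x c))))"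
    by (simp add: distrib_left sum_distrib_left mult_ac)
  also have "\<dots> = 1 + (\<Sum>a\<in>A. fps_const ((1 - t) * psi t x {a} (A - {a})) * (vX a * inverse (lin (x a))))"
  proof -
    have "HA A * (\<Prod>c\<in>A - {a}. lin (x c)) = inverse (lin (x a))" if "a \<in> A" for a
      using HA_split[OF assms, of "{a}"] that by (simp add: HA_def)
    then show ?thesis
      by (simp add: HA_mult vX_def mult_ac flip: fps_const_mult cong: sum.cong)
  qed
  also have "\<dots> = 1 + fps_const (1 - t) * Abs_fps (\<lambda>r. if r = 0 then 0 else \<Sum>a\<in>A. x a ^ r * psi t x {a} (A - {a}))"
    unfolding g by (auto simp: fps_eq_iff fps_sum_nth sum_distrib_left mult_ac)
  finally show ?thesis by simp
qed

end


section \<open>Symmetric functions\<close>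

abbreviation (input) lk :: "('v \<Rightarrow>\<^sub>0 'b::zero) \<Rightarrow> 'v \<Rightarrow> 'b" where "lk \<equiv> Poly_Mapping.lookup"
abbreviation (input) sg :: "'v \<Rightarrow> 'b::zero \<Rightarrow> 'v \<Rightarrow>\<^sub>0 'b" where "sg \<equiv> Poly_Mapping.single"

lemma mcoeff_simps [simp]:
  "mcoeff 0 m = 0" "mcoeff (f + g) m = mcoeff f m + mcoeff g m"
  "mcoeff (f - g) m = mcoeff f m - mcoeff g m" "mcoeff (- f) m = - mcoeff f m"
  by (simp_all add: zero_mpseries.rep_eq plus_mpseries.rep_eq minus_mpseries.rep_eq uminus_mpseries.rep_eq)

lemma mcoeff_one: "mcoeff 1 m = (if m = 0 then 1 else 0)"
  by (simp add: one_mpseries.rep_eq)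

lemma mcoeff_mult: "mcoeff (f * g) m = (\<Sum>(a, b)\<in>splits m. mcoeff f a * mcoeff g b)"
  by (simp add: times_mpseries.rep_eq)

lemma mcoeff_MPSeries [simp]: "mcoeff (MPSeries f) = f"
  by (simp add: MPSeries_inverse)

lemma mcoeff_sum: "mcoeff (sum f A) m = (\<Sum>a\<in>A. mcoeff (f a) m)"
  by (induction A rule: infinite_finite_induct) simp_all

lemma mcoeff_const: "mcoeff (const_mps c) m = (if m = 0 then c else 0)"
  by (simp add: const_mps_def)

lemma mcoeff_const_mult [simp]:
  fixes f :: "'v mpseries"
  shows "mcoeff (const_mps c * f) m = c * mcoeff f m"
proof -
  have "(\<Sum>(a, b)\<in>splits m. mcoeff (const_mps c) a * mcoeff f b)
      = (\<Sum>(a, b)\<in>{(0 :: 'v \<Rightarrow>\<^sub>0 nat, m)}. mcoeff (const_mps c) a * mcoeff f b)"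
    by (rule sum.mono_neutral_right[OF finite_splits]) (auto simp: splits_def mcoeff_const split: if_splits)
  then show ?thesis by (simp add: mcoeff_mult mcoeff_const)
qed

lemma const_mps_simps:
  "const_mps 0 = 0" "const_mps 1 = 1" "const_mps (a + b) = const_mps a + const_mps b"
  "const_mps (a * b) = const_mps a * const_mps b" "const_mps (a - b) = const_mps a - const_mps b"
  "const_mps (- a) = - const_mps a"
  by (rule mpseries_eqI; simp add: mcoeff_const mcoeff_one)+

lemma const_mps_of_nat: "const_mps (of_nat n) = of_nat n"
  by (induction n) (simp_all add: const_mps_simps)

lemma const_mps_power: "const_mps (a ^ n) = const_mps a ^ n"
  by (induction n) (simp_all add: const_mps_simps)

lemma const_mps_sum: "const_mps (sum f A) = (\<Sum>a\<in>A. const_mps (f a))"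
  by (induction A rule: infinite_finite_induct) (simp_all add: const_mps_simps)

lemma const_mps_cancel:
  assumes "c \<noteq> 0" "const_mps c * f = const_mps c * g"
  shows "f = g"
proof -
  have "const_mps (1 / c) * (const_mps c * f) = const_mps (1 / c) * (const_mps c * g)"
    using assms by simp
  then have "const_mps (1 / c * c) * f = const_mps (1 / c * c) * g"
    by (simp only: const_mps_simps mult.assoc)
  then show ?thesis
    using assms(1) by (simp add: const_mps_simps)
qed

lemma mdeg_superset: "finite S \<Longrightarrow> Poly_Mapping.keys m \<subseteq> S \<Longrightarrow> mdeg m = (\<Sum>v\<in>S. lk m v)"
  unfolding mdeg_def by (rule sum.mono_neutral_left) (auto simp: in_keys_iff)

lemma mdeg_add [simp]: "mdeg (a + b) = mdeg a + mdeg b"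
proof -
  have "mdeg (a + b) = (\<Sum>v\<in>Poly_Mapping.keys a \<union> Poly_Mapping.keys b. lk (a + b) v)"
    by (rule mdeg_superset) (auto simp: in_keys_iff lookup_add)
  also have "\<dots> = mdeg a + mdeg b"
    unfolding lookup_add sum.distrib
    by (intro arg_cong2[of _ _ _ _ "(+)"] mdeg_superset[symmetric]) auto
  finally show ?thesis .
qed

lemma mdeg_single [simp]: "mdeg (sg v k) = k"
  by (simp add: mdeg_def)

lemma mdeg_0 [simp]: "mdeg 0 = 0"
  by (simp add: mdeg_def)

lemma mdeg_eq_0_iff [simp]: "mdeg m = 0 \<longleftrightarrow> m = 0"
proof
  assume "mdeg m = 0"
  then have "lk m v = 0" for v
    by (cases "v \<in> Poly_Mapping.keys m") (auto simp: mdeg_def in_keys_iff)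
  then show "m = 0" by (intro poly_mapping_eqI) simp
qed simp

lemma lookup_le_mdeg: "lk m v \<le> mdeg m"
  by (cases "v \<in> Poly_Mapping.keys m") (auto simp: mdeg_def in_keys_iff intro: member_le_sum)

lemma lookup_map_key: "inj p \<Longrightarrow> lk (Poly_Mapping.map_key p m) v = lk m (p v)"
  by (simp add: map_key.rep_eq)

lemma mdeg_map_key:
  assumes "bij p"
  shows "mdeg (Poly_Mapping.map_key p m) = mdeg m"
proof -
  have p: "inj p" "surj p" using assms by (auto simp: bij_def)
  have "mdeg (Poly_Mapping.map_key p m) = (\<Sum>v\<in>p -` Poly_Mapping.keys m. lk m (p v))"
    unfolding mdeg_def keys_map_key[OF p(1)] lookup_map_key[OF p(1)] ..
  also have "\<dots> = mdeg m"
    unfolding mdeg_def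
    by (rule sum.reindex_bij_betw[of p])
       (use p in \<open>auto simp: bij_betw_def inj_on_def\<close>)
  finally show ?thesis .
qed

section \<open>Symmetric functions of bounded degree and Newton's identities\<close>

definition SymN :: "nat \<Rightarrow> nat mpseries set" where
  "SymN N = {f. (\<forall>m. N < mdeg m \<longrightarrow> mcoeff f m = 0) \<and>
     (\<forall>p m. bij p \<longrightarrow> mcoeff f (Poly_Mapping.map_key p m) = mcoeff f m)}"

lemma Sym_iff_SymN: "f \<in> Sym \<longleftrightarrow> (\<exists>N. f \<in> SymN N)"
  by (auto simp: Sym_def SymN_def)

lemma SymN_mono: "f \<in> SymN M \<Longrightarrow> M \<le> N \<Longrightarrow> f \<in> SymN N"
  by (auto simp: SymN_def)

lemma SymN_zero: "0 \<in> SymN N"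
  by (simp add: SymN_def)

lemma SymN_const: "const_mps c \<in> SymN N"
proof -
  have "Poly_Mapping.map_key p m = 0 \<longleftrightarrow> m = 0" if "bij p" for p :: "nat \<Rightarrow> nat" and m :: "nat \<Rightarrow>\<^sub>0 nat"
    using mdeg_map_key[OF that, of m] by (metis mdeg_eq_0_iff)
  then show ?thesis by (auto simp: SymN_def mcoeff_const)
qed

lemma SymN_add: "f \<in> SymN N \<Longrightarrow> g \<in> SymN N \<Longrightarrow> f + g \<in> SymN N"
  by (auto simp: SymN_def)

lemma SymN_diff: "f \<in> SymN N \<Longrightarrow> g \<in> SymN N \<Longrightarrow> f - g \<in> SymN N"
  by (auto simp: SymN_def)

lemma SymN_uminus: "f \<in> SymN N \<Longrightarrow> - f \<in> SymN N"
  by (auto simp: SymN_def)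

lemma SymN_sum: "(\<And>a. a \<in> A \<Longrightarrow> f a \<in> SymN N) \<Longrightarrow> sum f A \<in> SymN N"
  by (induction A rule: infinite_finite_induct) (auto intro: SymN_zero SymN_add)

lemma SymN_mult:
  assumes "f \<in> SymN M" "g \<in> SymN N"
  shows "f * g \<in> SymN (M + N)"
proof -
  have "mcoeff (f * g) m = 0" if "M + N < mdeg m" for m
  proof -
    have "mcoeff f a * mcoeff g b = 0" if "(a, b) \<in> splits m" for a b
    proof -
      have "mdeg a + mdeg b > M + N" using that \<open>M + N < mdeg m\<close> by (auto simp: splits_def)
      then have "mdeg a > M \<or> mdeg b > N" by linarith
      then show ?thesis using assms by (auto simp: SymN_def)
    qed
    then show ?thesis by (auto simp: mcoeff_mult intro!: sum.neutral)
  qed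
  moreover have "mcoeff (f * g) (Poly_Mapping.map_key p m) = mcoeff (f * g) m" if p: "bij p" for p m
  proof -
    let ?m = "Poly_Mapping.map_key p" and ?i = "Poly_Mapping.map_key (inv_into UNIV p)"
    have ip: "inj p" "inj (inv_into UNIV p)" "bij (inv_into UNIV p)" using p by (auto simp: bij_imp_bij_inv bij_is_inj)
    have 1: "?i (?m a) = a" "?m (?i a) = a" for a :: "nat \<Rightarrow>\<^sub>0 nat"
      using ip p by (auto intro!: poly_mapping_eqI simp: lookup_map_key bij_inv_eq_iff surj_f_inv_f bij_is_surj)
    \<comment> \<open>Renaming variables by p is a bijection between the splittings of m and those
      of the renamed monomial.\<close>
    have "mcoeff (f * g) (?m m) = (\<Sum>(a, b)\<in>splits m. mcoeff f (?m a) * mcoeff g (?m b))"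
      unfolding mcoeff_mult
    proof (rule sum.reindex_bij_witness[of _ "\<lambda>(a, b). (?m a, ?m b)" "\<lambda>(a, b). (?i a, ?i b)"], goal_cases)
      case (2 s) then show ?case using 1 ip by (auto simp: splits_def map_key_plus[symmetric])
    next
      case (4 s) then show ?case using 1 ip by (auto simp: splits_def map_key_plus[symmetric])
    qed (auto simp: 1)
    also have "\<dots> = mcoeff (f * g) m"
      unfolding mcoeff_mult using assms p by (auto simp: SymN_def intro!: sum.cong)
    finally show ?thesis .
  qed
  ultimately show ?thesis by (auto simp: SymN_def)
qed

lemma SymN_const_mult: "f \<in> SymN N \<Longrightarrow> const_mps c * f \<in> SymN N"
  using SymN_mult[OF SymN_const, of f N c 0] by simp

lemma Sym_closed:
  "const_mps c \<in> Sym" "f \<in> Sym \<Longrightarrow> g \<in> Sym \<Longrightarrow> f + g \<in> Sym"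
  "f \<in> Sym \<Longrightarrow> g \<in> Sym \<Longrightarrow> f - g \<in> Sym" "f \<in> Sym \<Longrightarrow> g \<in> Sym \<Longrightarrow> f * g \<in> Sym"
proof -
  show "const_mps c \<in> Sym" using SymN_const Sym_iff_SymN by blast
  assume "f \<in> Sym" "g \<in> Sym"
  then obtain M N where *: "f \<in> SymN M" "g \<in> SymN N" by (auto simp: Sym_iff_SymN)
  then have "f \<in> SymN (M + N)" "g \<in> SymN (M + N)" by (auto intro: SymN_mono)
  then show "f + g \<in> Sym" "f - g \<in> Sym" using SymN_add SymN_diff Sym_iff_SymN by blast+
  show "f * g \<in> Sym" using * SymN_mult Sym_iff_SymN by blast
qed

lemma Sym_sum: "(\<And>a. a \<in> A \<Longrightarrow> f a \<in> Sym) \<Longrightarrow> sum f A \<in> Sym"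
  by (induction A rule: infinite_finite_induct)
     (auto intro: Sym_closed Sym_closed(1)[of 0, unfolded const_mps_simps])

lemma hsym_SymN: "hsym n \<in> SymN n"
  by (auto simp: SymN_def hsym_def mdeg_map_key)

lemma psum_SymN: "psum k \<in> SymN k"
proof -
  have "(\<exists>j. Poly_Mapping.map_key p m = sg j k) \<longleftrightarrow> (\<exists>j. m = sg j k)" if p: "bij p" for p :: "nat \<Rightarrow> nat" and m
  proof -
    have ip: "inj p" "inj (inv_into UNIV p)" using p by (auto simp: bij_imp_bij_inv bij_is_inj)
    have k: "Poly_Mapping.map_key p (sg j k) = sg (inv_into UNIV p j) k" for j
      using map_key_single[OF ip(1), of "inv_into UNIV p j" k] p by (simp add: bij_is_surj surj_f_inv_f)
    have inv: "Poly_Mapping.map_key p a = Poly_Mapping.map_key p b \<longleftrightarrow> a = b" for a b :: "nat \<Rightarrow>\<^sub>0 nat"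
    proof
      assume "Poly_Mapping.map_key p a = Poly_Mapping.map_key p b"
      then have *: "lk a (p v) = lk b (p v)" for v
        by (simp flip: lookup_map_key[OF ip(1)])
      show "a = b"
      proof (rule poly_mapping_eqI)
        fix w obtain v where "w = p v" using p by (auto simp: bij_def surj_def)
        then show "lk a w = lk b w" using * by simp
      qed
    qed simp
    show ?thesis
    proof
      assume "\<exists>j. Poly_Mapping.map_key p m = sg j k"
      then obtain j where "Poly_Mapping.map_key p m = sg j k" by auto
      also have "\<dots> = Poly_Mapping.map_key p (sg (p j) k)" by (simp add: map_key_single[OF ip(1)])
      finally show "\<exists>j. m = sg j k" by (auto simp: inv)
    qed (auto simp: k)
  qed
  then show ?thesis by (auto simp: SymN_def psum_def)
qed

lemma psum_Sym: "psum k \<in> Sym" and hsym_Sym: "hsym n \<in> Sym"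
  using psum_SymN hsym_SymN by (auto simp: Sym_iff_SymN)

lemma hsym_0: "hsym 0 = 1"
  by (rule mpseries_eqI) (auto simp: hsym_def mcoeff_one)

text \<open>Since k is positive, the monomial y_v^k determines v, so each contributing splitting is
  counted once.\<close>

lemma mcoeff_psum_mult:
  assumes "k \<ge> 1"
  shows "mcoeff (psum k * f) m = (\<Sum>v | v \<in> Poly_Mapping.keys m \<and> k \<le> lk m v. mcoeff f (m - sg v k))"
proof -
  let ?S = "{v. v \<in> Poly_Mapping.keys m \<and> k \<le> lk m v}"
  have add: "sg v k + (m - sg v k) = m" if "k \<le> lk m v" for v
    by (rule poly_mapping_eqI) (use that in \<open>auto simp: lookup_add lookup_minus lookup_single when_def\<close>)
  have inj: "inj_on (\<lambda>v. (sg v k, m - sg v k)) ?S"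
  proof (rule inj_onI)
    fix v w assume "(sg v k, m - sg v k) = (sg w k, m - sg w k)"
    then have "Poly_Mapping.keys (sg v k) = Poly_Mapping.keys (sg w k)" by simp
    then show "v = w" using assms by simp
  qed
  have "mcoeff (psum k * f) m = (\<Sum>(a, b)\<in>(\<lambda>v. (sg v k, m - sg v k)) ` ?S. mcoeff (psum k) a * mcoeff f b)"
    unfolding mcoeff_mult
  proof (rule sum.mono_neutral_right)
    show "(\<lambda>v. (sg v k, m - sg v k)) ` ?S \<subseteq> splits m"
      using add by (auto simp: splits_def)
    show "\<forall>s\<in>splits m - (\<lambda>v. (sg v k, m - sg v k)) ` ?S. (case s of (a, b) \<Rightarrow> mcoeff (psum k) a * mcoeff f b) = 0"
    proof safe
      fix a b assume ab: "(a, b) \<in> splits m" "(a, b) \<notin> (\<lambda>v. (sg v k, m - sg v k)) ` ?S"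
      have "\<not> (\<exists>j. a = sg j k)"
      proof
        assume "\<exists>j. a = sg j k"
        then obtain j where a: "a = sg j k" by auto
        have m: "m = sg j k + b" using ab a by (auto simp: splits_def)
        then have "k \<le> lk m j" "j \<in> Poly_Mapping.keys m" "b = m - sg j k"
          using assms by (auto simp: lookup_add in_keys_iff)
        then show False using ab(2) a by auto
      qed
      then show "mcoeff (psum k) a * mcoeff f b = 0" by (simp add: psum_def)
    qed
  qed simp
  also have "\<dots> = (\<Sum>v\<in>?S. mcoeff f (m - sg v k))"
    by (subst sum.reindex[OF inj]) (auto simp: psum_def intro!: sum.cong)
  finally show ?thesis .
qed

lemma mcoeff_power_subst_hsym:
  assumes "b \<ge> 1"
  shows "mcoeff (power_subst b (hsym a)) m = (if (\<forall>j. b dvd lk m j) \<and> mdeg m = b * a then 1 else 0)"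
proof -
  have "mdeg m = b * mdeg (Poly_Mapping.map (\<lambda>e. e div b) m)" if "\<forall>j. b dvd lk m j"
  proof -
    have lm: "lk (Poly_Mapping.map (\<lambda>e. e div b) m) v = lk m v div b" for v
      by (simp add: Poly_Mapping.map.rep_eq when_def)
    have "mdeg (Poly_Mapping.map (\<lambda>e. e div b) m) = (\<Sum>v\<in>Poly_Mapping.keys m. lk m v div b)"
      unfolding lm[symmetric]
    proof (rule mdeg_superset)
      show "Poly_Mapping.keys (Poly_Mapping.map (\<lambda>e. e div b) m) \<subseteq> Poly_Mapping.keys m"
        by (rule subsetI) (simp only: in_keys_iff lm, auto intro: gr0I)
    qed simp
    then show ?thesis
      using that by (simp add: mdeg_def sum_distrib_left)
  qed
  then show ?thesis
    using assms by (auto simp: power_subst_def hsym_def)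
qed

text \<open>Newton's identities in the variables y_j^b. On an admissible monomial m the summand k
  counts the v with k b <= m_v, and summing over k gives the sum of the m_v / b, which is n.\<close>

lemma newton_power_subst:
  assumes b: "b \<ge> 1"
  shows "of_nat n * power_subst b (hsym n) = (\<Sum>k=1..n. psum (k * b) * power_subst b (hsym (n - k)))"
proof (rule mpseries_eqI)
  fix m :: "nat \<Rightarrow>\<^sub>0 nat"
  let ?S = "\<lambda>k. {v. v \<in> Poly_Mapping.keys m \<and> k * b \<le> lk m v}"
  let ?h = "\<lambda>n. power_subst b (hsym n)"
  have lkm: "lk (m - sg v (k * b)) j = (if j = v then lk m j - k * b else lk m j)" for v k j
    by (simp add: lookup_minus lookup_single when_def)
  have *: "mcoeff (psum (k * b) * ?h (n - k)) m =
     (if (\<forall>j. b dvd lk m j) \<and> mdeg m = b * n then of_nat (card (?S k)) else 0)" if k: "k \<in> {1..n}" for k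
  proof -
    have "mcoeff (psum (k * b) * ?h (n - k)) m = (\<Sum>v\<in>?S k. mcoeff (?h (n - k)) (m - sg v (k * b)))"
      using b k by (subst mcoeff_psum_mult) (auto simp: Suc_le_eq)
    also have "\<dots> = (\<Sum>v\<in>?S k. if (\<forall>j. b dvd lk m j) \<and> mdeg m = b * n then 1 else 0)"
    proof (rule sum.cong[OF refl])
      fix v assume v: "v \<in> ?S k"
      have "k * b \<le> lk m v" using v by simp
      then have "b dvd lk m v - k * b \<longleftrightarrow> b dvd lk m v"
        using dvd_diffD[of b "lk m v" "k * b"] dvd_diff_nat[of b "lk m v" "k * b"] by auto
      then have 1: "(\<forall>j. b dvd lk (m - sg v (k * b)) j) \<longleftrightarrow> (\<forall>j. b dvd lk m j)"
        unfolding lkm by auto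
      have "m = (m - sg v (k * b)) + sg v (k * b)"
        by (rule poly_mapping_eqI) (use v in \<open>auto simp: lookup_add lookup_minus lookup_single when_def\<close>)
      then have "mdeg m = mdeg (m - sg v (k * b)) + k * b"
        by (metis mdeg_add mdeg_single)
      then have 2: "mdeg (m - sg v (k * b)) = b * (n - k) \<longleftrightarrow> mdeg m = b * n"
        using k by (auto simp: diff_mult_distrib2 mult.commute)
      show "mcoeff (?h (n - k)) (m - sg v (k * b)) = (if (\<forall>j. b dvd lk m j) \<and> mdeg m = b * n then 1 else 0)"
        unfolding mcoeff_power_subst_hsym[OF b] 1 2 ..
    qed
    finally show ?thesis by simp
  qed
  have "(\<Sum>k=1..n. card (?S k)) = n" if dv: "\<forall>j. b dvd lk m j" and deg: "mdeg m = b * n"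
  proof -
    have "(\<Sum>k=1..n. card (?S k)) = card (Sigma {1..n} ?S)" by simp
    \<comment> \<open>The pairs are sorted by v instead. No k is lost, since m_v <= b n bounds every
      k that occurs by n.\<close>
    also have "Sigma {1..n} ?S = (\<lambda>(v, k). (k, v)) ` (Sigma (Poly_Mapping.keys m) (\<lambda>v. {1..lk m v div b}))"
    proof -
      have "k * b \<le> lk m v \<longleftrightarrow> k \<le> lk m v div b" for k v
        using b by (simp add: less_eq_div_iff_mult_less_eq)
      moreover have "lk m v div b \<le> n" for v
        using div_le_mono[OF lookup_le_mdeg[of m v], of b] deg b by simp
      then have "k \<le> lk m v div b \<Longrightarrow> k \<le> n" for k v
        using order_trans by blast
      ultimately show ?thesis
        by (auto simp: image_iff)
    qed
    also have "card \<dots> = card (Sigma (Poly_Mapping.keys m) (\<lambda>v. {1..lk m v div b}))"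
      by (rule card_image) (auto simp: inj_on_def)
    also have "\<dots> = (\<Sum>v\<in>Poly_Mapping.keys m. lk m v div b)" by simp
    also have "b * \<dots> = b * n"
      using dv deg by (simp add: sum_distrib_left mdeg_def)
    then have "(\<Sum>v\<in>Poly_Mapping.keys m. lk m v div b) = n" using b by simp
    finally show ?thesis .
  qed
  then have "(\<Sum>k=1..n. mcoeff (psum (k * b) * ?h (n - k)) m) =
     (if (\<forall>j. b dvd lk m j) \<and> mdeg m = b * n then of_nat n else 0)"
  proof (cases "(\<forall>j. b dvd lk m j) \<and> mdeg m = b * n")
    case True
    then have "(\<Sum>k=1..n. mcoeff (psum (k * b) * ?h (n - k)) m) = of_nat (\<Sum>k=1..n. card (?S k))"
      using * by simp
    with True show ?thesis
      using \<open>\<lbrakk>\<forall>j. b dvd lk m j; mdeg m = b * n\<rbrakk> \<Longrightarrow> (\<Sum>k=1..n. card (?S k)) = n\<close> by (simp flip: of_nat_sum)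
  next
    case False
    then show ?thesis using * by (intro trans[OF sum.neutral]) auto
  qed
  then show "mcoeff (of_nat n * ?h n) m = mcoeff (\<Sum>k=1..n. psum (k * b) * ?h (n - k)) m"
    by (simp add: mcoeff_sum mcoeff_power_subst_hsym[OF b] flip: const_mps_of_nat)
qed

lemma power_subst_1_hsym: "power_subst 1 (hsym n) = hsym n"
  by (rule mpseries_eqI) (subst mcoeff_power_subst_hsym, auto simp: hsym_def)

lemma newton_hsym: "of_nat n * hsym n = (\<Sum>k=1..n. psum k * hsym (n - k))"
  using newton_power_subst[of 1 n] by (simp add: power_subst_1_hsym[simplified])

lemma keys_add_nat: "Poly_Mapping.keys (a + b) = Poly_Mapping.keys a \<union> Poly_Mapping.keys (b :: 'v \<Rightarrow>\<^sub>0 nat)"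
  by (auto simp: in_keys_iff lookup_add)

lemma in_vars_add: "in_vars i (f + g) = in_vars i f + in_vars i g"
  by (rule mpseries_eqI) (simp add: in_vars_def)

lemma in_vars_mult: "in_vars i (f * g) = in_vars i f * in_vars i g"
proof (rule mpseries_eqI)
  fix m :: "('a \<times> nat) \<Rightarrow>\<^sub>0 nat"
  let ?k = "Poly_Mapping.map_key (Pair i)"
  have inj: "inj (Pair i)" by (simp add: inj_def)
  show "mcoeff (in_vars i (f * g)) m = mcoeff (in_vars i f * in_vars i g) m"
  proof (cases "Poly_Mapping.keys m \<subseteq> {i} \<times> UNIV")
    case True
    \<comment> \<open>\<open>e\<close> moves a monomial in the y_j to the variables of Z_i; it
      inverts \<open>?k\<close> on the monomials supported there.\<close>
    define e :: "(nat \<Rightarrow>\<^sub>0 nat) \<Rightarrow> ('a \<times> nat) \<Rightarrow>\<^sub>0 nat" where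
      "e a = Abs_poly_mapping (\<lambda>(j, v). if j = i then lk a v else 0)" for a
    have fin: "finite {s. (case s of (j, v) \<Rightarrow> if j = i then lk a v else 0) \<noteq> 0}" for a :: "nat \<Rightarrow>\<^sub>0 nat"
      by (rule finite_subset[of _ "{i} \<times> Poly_Mapping.keys a"]) (auto simp: in_keys_iff split: if_splits)
    have lke: "lk (e a) (j, v) = (if j = i then lk a v else 0)" for a j v
      unfolding e_def using fin[of a] by simp
    have ke: "?k (e a) = a" for a
      by (rule poly_mapping_eqI) (simp add: lookup_map_key[OF inj] lke)
    have ek: "e (?k a) = a" if "Poly_Mapping.keys a \<subseteq> {i} \<times> UNIV" for a
    proof (rule poly_mapping_eqI)
      fix s :: "'a \<times> nat" obtain j v where s: "s = (j, v)" by (cases s)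
      show "lk (e (?k a)) s = lk a s"
        using that by (auto simp: s lke lookup_map_key[OF inj] subset_iff in_keys_iff)
    qed
    have eadd: "e (a + b) = e a + e b" for a b
      by (rule poly_mapping_eqI) (auto simp: lke lookup_add split: prod.split)
    have keys_e: "Poly_Mapping.keys (e a) \<subseteq> {i} \<times> UNIV" for a
      by (auto simp: in_keys_iff lke split: if_splits)
    have sub: "Poly_Mapping.keys a \<subseteq> {i} \<times> UNIV" "Poly_Mapping.keys b \<subseteq> {i} \<times> UNIV"
      if "(a, b) \<in> splits m" for a b
      using that True by (auto simp: splits_def keys_add_nat)
    have "mcoeff (in_vars i (f * g)) m = (\<Sum>(a, b)\<in>splits (?k m). mcoeff f a * mcoeff g b)"
      using True by (simp add: in_vars_def mcoeff_mult)
    also have "\<dots> = (\<Sum>s\<in>splits m. mcoeff f (?k (fst s)) * mcoeff g (?k (snd s)))"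
    proof -
      have bij: "bij_betw (map_prod ?k ?k) (splits m) (splits (?k m))"
      proof (rule bij_betw_byWitness[where f' = "map_prod e e"])
        show "\<forall>s\<in>splits m. map_prod e e (map_prod ?k ?k s) = s"
        proof
          fix s assume s: "s \<in> splits m"
          obtain a b where ab: "s = (a, b)" by (cases s)
          show "map_prod e e (map_prod ?k ?k s) = s"
            using sub[of a b] s by (simp add: ab ek)
        qed
        show "\<forall>s\<in>splits (?k m). map_prod ?k ?k (map_prod e e s) = s"
          by (auto simp: ke)
        show "map_prod ?k ?k ` splits m \<subseteq> splits (?k m)"
          by (auto simp: splits_def map_key_plus[OF inj])
        show "map_prod e e ` splits (?k m) \<subseteq> splits m"
        proof (rule image_subsetI)
          fix s assume s: "s \<in> splits (?k m)"
          obtain a b where ab: "s = (a, b)" by (cases s)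
          have "e (a + b) = m" using s ek[OF True] by (simp add: ab splits_def)
          then show "map_prod e e s \<in> splits m" by (simp add: ab splits_def eadd)
        qed
      qed
      show ?thesis
        using sum.reindex_bij_betw[OF bij, of "\<lambda>(a, b). mcoeff f a * mcoeff g b"]
        by (simp add: case_prod_unfold)
    qed
    also have "\<dots> = (\<Sum>(a, b)\<in>splits m. mcoeff (in_vars i f) a * mcoeff (in_vars i g) b)"
    proof (rule sum.cong[OF refl])
      fix s assume s: "s \<in> splits m"
      obtain a b where ab: "s = (a, b)" by (cases s)
      show "mcoeff f (?k (fst s)) * mcoeff g (?k (snd s)) = (case s of (a, b) \<Rightarrow> mcoeff (in_vars i f) a * mcoeff (in_vars i g) b)"
        using sub[of a b] s by (simp add: ab in_vars_def)
    qed
    finally show ?thesis by (simp add: mcoeff_mult)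
  next
    case False
    have "mcoeff (in_vars i f) a * mcoeff (in_vars i g) b = 0" if "(a, b) \<in> splits m" for a b
      using that False by (auto simp: splits_def keys_add_nat in_vars_def)
    then have "mcoeff (in_vars i f * in_vars i g) m = 0"
      by (auto simp: mcoeff_mult intro!: sum.neutral)
    then show ?thesis using False by (simp add: in_vars_def)
  qed
qed

lemma in_vars_const: "in_vars i (const_mps c) = const_mps c"
proof (rule mpseries_eqI)
  fix m :: "('a \<times> nat) \<Rightarrow>\<^sub>0 nat"
  have inj: "inj (Pair i)" by (simp add: inj_def)
  have "m = 0" if "Poly_Mapping.keys m \<subseteq> {i} \<times> UNIV" "Poly_Mapping.map_key (Pair i) m = 0"
  proof (rule poly_mapping_eqI)
    fix s :: "'a \<times> nat" obtain j v where s: "s = (j, v)" by (cases s)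
    have "lk m (i, v) = 0" using that(2) lookup_map_key[OF inj, of m v] by simp
    then show "lk m s = lk 0 s" using that(1) by (cases "j = i") (auto simp: s in_keys_iff subset_iff)
  qed
  then show "mcoeff (in_vars i (const_mps c)) m = mcoeff (const_mps c) m"
    by (auto simp: in_vars_def mcoeff_const map_key_zero[OF inj])
qed

lemma in_vars_sum: "in_vars i (sum f A) = (\<Sum>a\<in>A. in_vars i (f a))"
  using in_vars_const[of i 0]
  by (induction A rule: infinite_finite_induct) (simp_all add: in_vars_add const_mps_simps)

lemma in_vars_tensor: "i \<in> I \<Longrightarrow> f \<in> Sym \<Longrightarrow> in_vars i f \<in> tensor_Sym I"
  by (auto simp: tensor_Sym_def intro!: subalgebra_gen.gen)

lemma finite_bounded_monomials:
  assumes "finite A"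
  shows "finite {m :: 'v \<Rightarrow>\<^sub>0 nat. Poly_Mapping.keys m \<subseteq> A \<and> mdeg m \<le> N}"
proof (rule finite_imageD)
  show "finite ((\<lambda>m. restrict (lk m) A) ` {m :: 'v \<Rightarrow>\<^sub>0 nat. Poly_Mapping.keys m \<subseteq> A \<and> mdeg m \<le> N})"
  proof (rule finite_subset)
    show "(\<lambda>m. restrict (lk m) A) ` {m :: 'v \<Rightarrow>\<^sub>0 nat. Poly_Mapping.keys m \<subseteq> A \<and> mdeg m \<le> N} \<subseteq> PiE A (\<lambda>_. {..N})"
      by (auto intro: order_trans[OF lookup_le_mdeg])
    show "finite (PiE A (\<lambda>_. {..N}))" using assms by (intro finite_PiE) auto
  qed
  show "inj_on (\<lambda>m. restrict (lk m) A) {m :: 'v \<Rightarrow>\<^sub>0 nat. Poly_Mapping.keys m \<subseteq> A \<and> mdeg m \<le> N}"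
  proof (rule inj_onI)
    fix m m' :: "'v \<Rightarrow>\<^sub>0 nat"
    assume m: "m \<in> {m. Poly_Mapping.keys m \<subseteq> A \<and> mdeg m \<le> N}" "m' \<in> {m. Poly_Mapping.keys m \<subseteq> A \<and> mdeg m \<le> N}"
      and eq: "restrict (lk m) A = restrict (lk m') A"
    show "m = m'"
    proof (rule poly_mapping_eqI)
      fix v show "lk m v = lk m' v"
        using fun_cong[OF eq, of v] m
        by (cases "v \<in> A") (simp_all add: subset_iff in_keys_iff, metis gr0I)
    qed
  qed
qed

section \<open>Truncation to finitely many variables\<close>

lemma lookup_mult_splits:
  fixes p q :: "('v \<Rightarrow>\<^sub>0 nat) \<Rightarrow>\<^sub>0 complex"
  shows "lk (p * q) m = (\<Sum>(a, b)\<in>splits m. lk p a * lk q b)"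
proof -
  have "lk (p * q) m = prod_fun (lk p) (lk q) m"
    by (simp add: times_poly_mapping.rep_eq)
  also have "\<dots> = Sum_any (\<lambda>(a, b). lk p a * lk q b when m = a + b)"
    by (rule prod_fun_unfold_prod) simp_all
  also have "\<dots> = (\<Sum>(a, b)\<in>splits m. lk p a * lk q b when m = a + b)"
    by (rule Sum_any.expand_superset) (auto simp: splits_def simp del: finite_splits intro: finite_splits[unfolded splits_def])
  also have "\<dots> = (\<Sum>(a, b)\<in>splits m. lk p a * lk q b)"
    by (intro sum.cong) (auto simp: splits_def)
  finally show ?thesis .
qed

text \<open>All variables outside A are set to 0. The result is a polynomial if A is finite and f
  has bounded degree, which is the setting of \<open>lookup_tr\<close>.\<close>

definition tr :: "nat set \<Rightarrow> nat mpseries \<Rightarrow> cpoly" where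
  "tr A f = Abs_poly_mapping (\<lambda>m. if Poly_Mapping.keys m \<subseteq> A then mcoeff f m else 0)"

lemma lookup_tr:
  assumes "finite A" "f \<in> SymN N"
  shows "lk (tr A f) m = (if Poly_Mapping.keys m \<subseteq> A then mcoeff f m else 0)"
proof -
  have "finite {m. (if Poly_Mapping.keys m \<subseteq> A then mcoeff f m else 0) \<noteq> 0}"
    by (rule finite_subset[OF _ finite_bounded_monomials[OF assms(1), of N]])
       (use assms(2) in \<open>auto simp: SymN_def split: if_splits intro: leI\<close>)
  then show ?thesis by (simp add: tr_def)
qed

lemma tr_add: "finite A \<Longrightarrow> f \<in> SymN N \<Longrightarrow> g \<in> SymN N \<Longrightarrow> tr A (f + g) = tr A f + tr A g"
  by (rule poly_mapping_eqI) (simp add: lookup_tr[of _ _ N] SymN_add lookup_add)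

lemma tr_zero: "tr A 0 = 0"
  by (simp add: tr_def cong: if_cong)

lemma tr_sum:
  "finite A \<Longrightarrow> (\<And>i. i \<in> I \<Longrightarrow> f i \<in> SymN N) \<Longrightarrow> tr A (sum f I) = (\<Sum>i\<in>I. tr A (f i))"
  by (induction I rule: infinite_finite_induct) (simp_all add: tr_zero tr_add[of _ _ N] SymN_sum)

lemma tr_mult:
  assumes "finite A" "f \<in> SymN M" "g \<in> SymN N"
  shows "tr A (f * g) = tr A f * tr A g"
proof (rule poly_mapping_eqI)
  fix m :: "nat \<Rightarrow>\<^sub>0 nat"
  have "lk (tr A f * tr A g) m = (\<Sum>(a, b)\<in>splits m. if Poly_Mapping.keys m \<subseteq> A then mcoeff f a * mcoeff g b else 0)"
    unfolding lookup_mult_splits lookup_tr[OF assms(1,2)] lookup_tr[OF assms(1,3)]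
    by (intro sum.cong) (auto simp: splits_def keys_add_nat)
  then show "lk (tr A (f * g)) m = lk (tr A f * tr A g) m"
    unfolding lookup_tr[OF assms(1) SymN_mult[OF assms(2,3)]] mcoeff_mult by simp
qed

lemma tr_const: "finite A \<Longrightarrow> tr A (const_mps c) = sg 0 c"
  by (rule poly_mapping_eqI) (auto simp: lookup_tr[OF _ SymN_const] mcoeff_const lookup_single)

text \<open>Every monomial involves only finitely many variables, so it is seen by the truncation to
  these.\<close>

lemma tr_inject:
  assumes "f \<in> SymN N" "g \<in> SymN N" "\<And>A. finite A \<Longrightarrow> tr A f = tr A g"
  shows "f = g"
proof (rule mpseries_eqI)
  fix m
  have "lk (tr (Poly_Mapping.keys m) f) m = lk (tr (Poly_Mapping.keys m) g) m"
    using assms(3) by simp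
  then show "mcoeff f m = mcoeff g m"
    by (simp add: lookup_tr[OF finite_keys assms(1)] lookup_tr[OF finite_keys assms(2)])
qed

section \<open>Adding and removing one variable\<close>

text \<open>\<open>f(y, X) = \<Sum>\<^sub>k y\<^sup>k (dplus k f)(X)\<close>, and \<open>dminus\<close> inverts this expansion:
  \<open>f(X - y) = \<Sum>\<^sub>k y\<^sup>k (dminus f k)(X)\<close>.\<close>

definition dplus :: "nat \<Rightarrow> nat mpseries \<Rightarrow> nat mpseries" where
  "dplus k f = MPSeries (\<lambda>m. mcoeff f (m + sg (SOME v. v \<notin> Poly_Mapping.keys m) k))"

fun dminus :: "nat mpseries \<Rightarrow> nat \<Rightarrow> nat mpseries" where
  "dminus f 0 = f"
| "dminus f (Suc k) = - (\<Sum>j\<le>k. dplus (Suc j) (dminus f (k - j)))"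

lemma SymN_map_key: "f \<in> SymN N \<Longrightarrow> bij p \<Longrightarrow> mcoeff f (Poly_Mapping.map_key p m) = mcoeff f m"
  by (simp add: SymN_def)

text \<open>The choice of the fresh variable is immaterial: a transposition that fixes m moves one
  fresh variable to another.\<close>

lemma mcoeff_dplus:
  assumes f: "f \<in> SymN N" and v: "v \<notin> Poly_Mapping.keys m"
  shows "mcoeff (dplus k f) m = mcoeff f (m + sg v k)"
proof -
  define w where "w = (SOME v. v \<notin> Poly_Mapping.keys m)"
  have w: "w \<notin> Poly_Mapping.keys m" unfolding w_def using v by (rule someI)
  let ?p = "Transposition.transpose v w"
  have "Poly_Mapping.map_key ?p (m + sg v k) = m + sg w k"
  proof (rule poly_mapping_eqI)
    fix u
    show "lk (Poly_Mapping.map_key ?p (m + sg v k)) u = lk (m + sg w k) u"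
      using v w by (auto simp: lookup_map_key lookup_add lookup_single when_def in_keys_iff
          transpose_def inj_swap split: if_splits)
  qed
  moreover have "bij ?p" by simp
  ultimately have "mcoeff f (m + sg w k) = mcoeff f (m + sg v k)"
    using SymN_map_key[OF f, of ?p "m + sg v k"] by simp
  then show ?thesis by (simp add: dplus_def w_def)
qed

lemma ex_fresh: "\<exists>v. v \<notin> Poly_Mapping.keys (m :: nat \<Rightarrow>\<^sub>0 'b::zero)"
  using ex_new_if_finite[OF infinite_UNIV_nat finite_keys] .

lemma dplus_SymN:
  assumes f: "f \<in> SymN N"
  shows "dplus k f \<in> SymN (N - k)" "N < k \<Longrightarrow> dplus k f = 0"
proof -
  have deg: "mcoeff (dplus k f) m = 0" if "N < mdeg m + k" for m
    using f that ex_fresh[of m] mcoeff_dplus[OF f, of _ m] by (auto simp: SymN_def)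
  have "mcoeff (dplus k f) (Poly_Mapping.map_key p m) = mcoeff (dplus k f) m" if p: "bij p" for p m
  proof -
    have ip: "inj p" using p by (simp add: bij_is_inj)
    obtain v where v: "v \<notin> Poly_Mapping.keys (Poly_Mapping.map_key p m)" using ex_fresh by blast
    then have v': "p v \<notin> Poly_Mapping.keys m" by (simp add: keys_map_key[OF ip])
    have "mcoeff (dplus k f) (Poly_Mapping.map_key p m) = mcoeff f (Poly_Mapping.map_key p m + sg v k)"
      by (rule mcoeff_dplus[OF f v])
    also have "Poly_Mapping.map_key p m + sg v k = Poly_Mapping.map_key p (m + sg (p v) k)"
      by (simp add: map_key_plus[OF ip] map_key_single[OF ip])
    also have "mcoeff f \<dots> = mcoeff f (m + sg (p v) k)"
      using f p by (simp add: SymN_def)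
    also have "\<dots> = mcoeff (dplus k f) m"
      by (rule mcoeff_dplus[OF f v', symmetric])
    finally show ?thesis .
  qed
  then show "dplus k f \<in> SymN (N - k)" using deg by (auto simp: SymN_def)
  show "dplus k f = 0" if "N < k" using deg that by (intro mpseries_eqI) simp
qed

lemma dplus_0: "dplus 0 f = f"
  by (rule mpseries_eqI) (simp add: dplus_def)

text \<open>Truncated subtraction gives N - k = 0 for k > N, so the vanishing beyond degree N has to
  be carried through the induction separately.\<close>

lemma dminus_SymN:
  assumes f: "f \<in> SymN N"
  shows "dminus f k \<in> SymN (N - k) \<and> (N < k \<longrightarrow> dminus f k = 0)"
proof (induction k rule: less_induct)
  case (less k)
  show ?case
  proof (cases k)
    case 0
    then show ?thesis using f by simp
  next
    case (Suc k')
    have *: "dplus (Suc j) (dminus f (k' - j)) \<in> SymN (N - k) \<and> (N < k \<longrightarrow> dplus (Suc j) (dminus f (k' - j)) = 0)"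
      if j: "j \<le> k'" for j
    proof (cases "N < k' - j")
      case True
      then have "dminus f (k' - j) = 0" using less.IH[of "k' - j"] Suc by simp
      moreover have "dplus (Suc j) 0 = 0" by (rule mpseries_eqI) (simp add: dplus_def)
      ultimately show ?thesis by (simp add: SymN_zero)
    next
      case False
      have s: "dminus f (k' - j) \<in> SymN (N - (k' - j))" using less.IH[of "k' - j"] Suc by simp
      have "N - (k' - j) - Suc j = N - k" using j False Suc by simp
      moreover have "N - (k' - j) < Suc j" if "N < k" using j False Suc that by simp
      ultimately show ?thesis using dplus_SymN[OF s, of "Suc j"] by auto
    qed
    then have "dminus f (Suc k') \<in> SymN (N - k)"
      by (auto intro!: SymN_uminus SymN_sum)
    moreover have "N < k \<longrightarrow> dminus f (Suc k') = 0" using * by simp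
    ultimately show ?thesis using Suc by simp
  qed
qed

lemma dplus_dminus: "s > 0 \<Longrightarrow> (\<Sum>j\<le>s. dplus j (dminus f (s - j))) = 0"
  by (cases s) (simp_all add: sum.atMost_Suc_shift dplus_0 del: sum.atMost_Suc)

lemma single_power: "sg (sg a k) (1 :: complex) = sg (sg (a :: 'v) (1 :: nat)) 1 ^ k"
proof (induction k)
  case (Suc k)
  have eq: "sg a (Suc k) = sg a 1 + sg a k" by (simp flip: single_add)
  show ?case unfolding eq power_Suc Suc.IH[symmetric] mult_single by simp
qed simp

lemma lookup_single_mult:
  "lk (sg n (1 :: complex) * p) m =
     (if \<forall>v. lk n v \<le> lk m v then lk p (m - n) else 0)" for n m :: "'v \<Rightarrow>\<^sub>0 nat"
proof -
  have eq: "m = n + b \<longleftrightarrow> b = m - n \<and> (\<forall>v. lk n v \<le> lk m v)" for b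
  proof
    assume "b = m - n \<and> (\<forall>v. lk n v \<le> lk m v)"
    then show "m = n + b" by (intro poly_mapping_eqI) (simp add: lookup_add lookup_minus)
  qed (simp add: lookup_add)
  have "lk (sg n 1 * p) m = (\<Sum>(a, b)\<in>splits m. lk (sg n 1) a * lk p b)"
    by (rule lookup_mult_splits)
  also have "\<dots> = (\<Sum>(a, b)\<in>(if \<forall>v. lk n v \<le> lk m v then {(n, m - n)} else {}). lk (sg n 1) a * lk p b)"
  proof (rule sum.mono_neutral_right[OF finite_splits])
    show "(if \<forall>v. lk n v \<le> lk m v then {(n, m - n)} else {}) \<subseteq> splits m"
      using eq[of "m - n"] by (auto simp: splits_def)
    show "\<forall>s\<in>splits m - (if \<forall>v. lk n v \<le> lk m v then {(n, m - n)} else {}).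
        (case s of (a, b) \<Rightarrow> lk (sg n 1) a * lk p b) = 0"
    proof
      fix s assume s: "s \<in> splits m - (if \<forall>v. lk n v \<le> lk m v then {(n, m - n)} else {})"
      obtain a b where ab: "s = (a, b)" by (cases s)
      have "a \<noteq> n"
        using s eq[of b] by (auto simp: ab splits_def split: if_splits)
      then show "(case s of (a, b) \<Rightarrow> lk (sg n 1) a * lk p b) = 0"
        by (simp add: ab lookup_single when_def)
    qed
  qed
  also have "\<dots> = (if \<forall>v. lk n v \<le> lk m v then lk p (m - n) else 0)"
    by simp
  finally show ?thesis .
qed

text \<open>A monomial gets its coefficient from the single j that equals its exponent at a;
  exponents above N cannot occur in degree at most N.\<close>

lemma tr_dplus:
  assumes "finite A" "a \<in> A" and f: "f \<in> SymN N"
  shows "tr A f = (\<Sum>j\<le>N. sg (sg a 1) 1 ^ j * tr (A - {a}) (dplus j f))"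
proof (rule poly_mapping_eqI)
  fix m :: "nat \<Rightarrow>\<^sub>0 nat"
  let ?mu = "m - sg a (lk m a)"
  have lka: "(\<forall>v. lk (sg a j) v \<le> lk m v) \<longleftrightarrow> j \<le> lk m a" for j
    by (auto simp: lookup_single when_def)
  have k0: "Poly_Mapping.keys (m - sg a j) \<subseteq> A - {a} \<longleftrightarrow> Poly_Mapping.keys m \<subseteq> A \<and> j = lk m a" if "j \<le> lk m a" for j
  proof -
    have "(\<forall>v. lk (m - sg a j) v \<noteq> 0 \<longrightarrow> v \<in> A - {a}) \<longleftrightarrow> lk m a \<le> j \<and> (\<forall>v. v \<noteq> a \<longrightarrow> lk m v \<noteq> 0 \<longrightarrow> v \<in> A)"
      by (auto simp: lookup_minus lookup_single when_def)
    also have "\<dots> \<longleftrightarrow> (\<forall>v. lk m v \<noteq> 0 \<longrightarrow> v \<in> A) \<and> j = lk m a"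
      using that assms(2) by auto
    finally show ?thesis by (simp add: subset_iff in_keys_iff)
  qed
  have "lk (sg (sg a 1) 1 ^ j * tr (A - {a}) (dplus j f)) m =
     (if j = lk m a then if Poly_Mapping.keys m \<subseteq> A then mcoeff (dplus j f) ?mu else 0 else 0)" for j
    unfolding single_power[symmetric] lookup_single_mult lka
    using assms(1) k0 by (auto simp: lookup_tr[OF _ dplus_SymN(1)[OF f]])
  moreover have "mcoeff (dplus (lk m a) f) ?mu = mcoeff f m"
  proof -
    have "a \<notin> Poly_Mapping.keys ?mu" by (simp add: in_keys_iff lookup_minus)
    moreover have "?mu + sg a (lk m a) = m"
      by (rule poly_mapping_eqI) (simp add: lookup_add lookup_minus lookup_single when_def)
    ultimately show ?thesis using mcoeff_dplus[OF f] by simp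
  qed
  moreover have "mcoeff f m = 0" if "lk m a > N"
    using f that lookup_le_mdeg[of m a] by (auto simp: SymN_def)
  ultimately show "lk (tr A f) m = lk (\<Sum>j\<le>N. sg (sg a 1) 1 ^ j * tr (A - {a}) (dplus j f)) m"
    by (auto simp: lookup_sum lookup_tr[OF assms(1) f] sum.delta)
qed

text \<open>Each \<open>dminus f k\<close> is expanded by \<open>tr_dplus\<close>. The coefficient
  of x_a^s is then the sum in \<open>dplus_dminus\<close>, which vanishes for s > 0.\<close>

lemma tr_dminus:
  assumes "finite A" "a \<in> A" and f: "f \<in> SymN N"
  shows "tr (A - {a}) f = (\<Sum>k\<le>N. sg (sg a 1) 1 ^ k * tr A (dminus f k))"
proof -
  let ?X = "sg (sg a 1) 1 :: cpoly" and ?t = "tr (A - {a})"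
  have S: "dminus f k \<in> SymN (N - k)" for k using dminus_SymN[OF f] by blast
  have "(\<Sum>k\<le>N. ?X ^ k * tr A (dminus f k)) =
     (\<Sum>k\<le>N. \<Sum>j\<le>N - k. ?X ^ (k + j) * ?t (dplus j (dminus f k)))"
    by (intro sum.cong refl, subst tr_dplus[OF assms(1,2) S])
       (simp add: sum_distrib_left power_add mult.assoc)
  also have "\<dots> = (\<Sum>(k, j)\<in>{(k, j). k + j \<le> N}. ?X ^ (k + j) * ?t (dplus j (dminus f k)))"
    by (subst sum.Sigma) (auto intro!: sum.cong)
  also have "\<dots> = (\<Sum>s\<le>N. \<Sum>k\<le>s. ?X ^ (k + (s - k)) * ?t (dplus (s - k) (dminus f k)))"
    by (rule sum.triangle_reindex_eq)
  also have "\<dots> = (\<Sum>s\<le>N. ?X ^ s * ?t (\<Sum>k\<le>s. dplus (s - k) (dminus f k)))"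
  proof (intro sum.cong refl)
    fix s assume "s \<in> {..N}"
    have "dplus (s - k) (dminus f k) \<in> SymN N" for k
      by (rule SymN_mono[OF dplus_SymN(1)[OF S]]) simp
    then have "?t (\<Sum>k\<le>s. dplus (s - k) (dminus f k)) = (\<Sum>k\<le>s. ?t (dplus (s - k) (dminus f k)))"
      using assms(1) by (intro tr_sum) auto
    then show "(\<Sum>k\<le>s. ?X ^ (k + (s - k)) * ?t (dplus (s - k) (dminus f k))) =
       ?X ^ s * ?t (\<Sum>k\<le>s. dplus (s - k) (dminus f k))"
      by (simp add: sum_distrib_left)
  qed
  also have "\<dots> = (\<Sum>s\<le>N. if s = 0 then ?t f else 0)"
  proof (intro sum.cong refl)
    fix s
    have "(\<Sum>k\<le>s. dplus (s - k) (dminus f k)) = (\<Sum>j\<le>s. dplus j (dminus f (s - j)))"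
      by (rule sum.reindex_bij_witness[of _ "\<lambda>j. s - j" "\<lambda>j. s - j"]) auto
    also have "\<dots> = (if s = 0 then f else 0)"
      using dplus_dminus[of s f] by (auto simp: dplus_0)
    finally show "?X ^ s * ?t (\<Sum>k\<le>s. dplus (s - k) (dminus f k)) = (if s = 0 then ?t f else 0)"
      by (simp add: tr_zero)
  qed
  also have "\<dots> = ?t f" by (simp add: sum.delta)
  finally show ?thesis by simp
qed

lemma dplus_hsym: "dplus j (hsym n) = (if j \<le> n then hsym (n - j) else 0)"
proof (rule mpseries_eqI)
  fix m :: "nat \<Rightarrow>\<^sub>0 nat"
  show "mcoeff (dplus j (hsym n)) m = mcoeff (if j \<le> n then hsym (n - j) else 0) m"
    by (auto simp: dplus_def hsym_def)
qed


section \<open>Hall-Littlewood functions\<close>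

lemma rf_of_simps:
  "rf_of 0 = 0" "rf_of 1 = 1" "rf_of (p + q) = rf_of p + rf_of q" "rf_of (p * q) = rf_of p * rf_of q"
  "rf_of (p - q) = rf_of p - rf_of q" "rf_of (- p) = - rf_of p" "rf_of p = rf_of q \<longleftrightarrow> p = q"
  by (simp_all add: rf_of_def Zero_fract_def One_fract_def eq_fract)

lemma rf_of_power: "rf_of (p ^ n) = rf_of p ^ n"
  by (induction n) (simp_all add: rf_of_simps)

lemma rf_of_sum: "rf_of (sum f A) = (\<Sum>a\<in>A. rf_of (f a))"
  by (induction A rule: infinite_finite_induct) (simp_all add: rf_of_simps)

lemma rf_const_simps:
  "rf_const 0 = 0" "rf_const 1 = 1" "rf_const (a + b) = rf_const a + rf_const b"
  "rf_const (a * b) = rf_const a * rf_const b" "rf_const (- a) = - rf_const a"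
  "rf_const (a - b) = rf_const a - rf_const b" "rf_const a = rf_const b \<longleftrightarrow> a = b"
proof -
  show mult: "rf_const (a * b) = rf_const a * rf_const b" for a b
    by (simp add: rf_const_def mult_single flip: rf_of_simps)
  show "rf_const (a + b) = rf_const a + rf_const b" "rf_const (- a) = - rf_const a"
    "rf_const (a - b) = rf_const a - rf_const b"
    by (simp_all add: rf_const_def single_add single_uminus single_diff flip: rf_of_simps)
  show "rf_const 0 = 0" "rf_const 1 = 1"
    by (simp_all add: rf_const_def rf_of_simps)
  show "rf_const a = rf_const b \<longleftrightarrow> a = b"
    unfolding rf_const_def rf_of_simps(7) by (metis lookup_single_eq)
qed

lemma rf_const_eq_0: "rf_const a = 0 \<longleftrightarrow> a = 0" and rf_const_eq_1: "rf_const a = 1 \<longleftrightarrow> a = 1"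
  using rf_const_simps(7)[of a 0] rf_const_simps(7)[of a 1] by (simp_all add: rf_const_simps(1,2))

lemma rf_const_power: "rf_const (a ^ n) = rf_const a ^ n"
  by (induction n) (simp_all add: rf_const_simps)

lemma rf_const_sum: "rf_const (sum f A) = (\<Sum>a\<in>A. rf_const (f a))"
  by (induction A rule: infinite_finite_induct) (simp_all add: rf_const_simps)

lemma rf_const_prod: "rf_const (prod f A) = (\<Prod>a\<in>A. rf_const (f a))"
  by (induction A rule: infinite_finite_induct) (simp_all add: rf_const_simps)

lemma rf_const_divide: "rf_const (a / b) = rf_const a / rf_const b"
proof (cases "b = 0")
  case False
  then have "rf_const (a / b) * rf_const b = rf_const a"
    by (simp flip: rf_const_simps(4))
  moreover have "rf_const b \<noteq> 0" using False by (simp add: rf_const_eq_0)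
  ultimately show ?thesis by (simp add: field_simps)
qed (simp add: rf_const_simps)

lemma rf_const_qint: "rf_const (qint t n) = qint (rf_const t) n"
  by (simp add: qint_def rf_const_sum rf_const_power)

lemma rf_const_vq: "rf_const (vq t n) = vq (rf_const t) n"
  by (simp add: vq_def rf_const_prod rf_const_qint)

lemma rf_const_vlist: "rf_const (vlist t la) = vlist (rf_const t) la"
  by (simp add: vlist_def rf_const_prod rf_const_vq)

lemma v_fac_eq: "v_fac t m = vq t m"
  by (simp add: v_fac_def vq_def qint_def)

lemma v_part_eq: "v_part n la t = vq t (n - length la) * vlist t la"
  by (simp add: v_part_def vlist_def v_fac_eq)

definition ev :: "nat set \<Rightarrow> nat mpseries \<Rightarrow> cpoly fract" where
  "ev A f = rf_of (tr A f)"

lemma ev_add: "finite A \<Longrightarrow> f \<in> SymN N \<Longrightarrow> g \<in> SymN N \<Longrightarrow> ev A (f + g) = ev A f + ev A g"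
  by (simp add: ev_def tr_add rf_of_simps)

lemma ev_diff: "finite A \<Longrightarrow> f \<in> SymN N \<Longrightarrow> g \<in> SymN N \<Longrightarrow> ev A (f - g) = ev A f - ev A g"
  using ev_add[of A "f - g" N g] by (simp add: SymN_diff)

lemma ev_mult: "finite A \<Longrightarrow> f \<in> SymN M \<Longrightarrow> g \<in> SymN N \<Longrightarrow> ev A (f * g) = ev A f * ev A g"
  by (simp add: ev_def tr_mult rf_of_simps)

lemma ev_const: "finite A \<Longrightarrow> ev A (const_mps c) = rf_const c"
  by (simp add: ev_def tr_const rf_const_def)

lemma ev_const_mult: "finite A \<Longrightarrow> f \<in> SymN N \<Longrightarrow> ev A (const_mps c * f) = rf_const c * ev A f"
  by (subst ev_mult[OF _ SymN_const]) (auto simp: ev_const)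

lemma ev_sum: "finite A \<Longrightarrow> (\<And>i. i \<in> I \<Longrightarrow> f i \<in> SymN N) \<Longrightarrow> ev A (sum f I) = (\<Sum>i\<in>I. ev A (f i))"
  by (simp add: ev_def tr_sum[of A I f N] rf_of_sum)

lemma ev_inject:
  assumes "f \<in> SymN N" "g \<in> SymN N" "\<And>A. finite A \<Longrightarrow> ev A f = ev A g"
  shows "f = g"
  using assms(3) by (intro tr_inject[OF assms(1,2)]) (simp add: ev_def rf_of_simps)

lemma ev_dplus:
  "finite A \<Longrightarrow> a \<in> A \<Longrightarrow> f \<in> SymN N \<Longrightarrow> ev A f = (\<Sum>j\<le>N. rf_var a ^ j * ev (A - {a}) (dplus j f))"
  using tr_dplus[of A a f N] by (simp add: ev_def rf_var_def rf_of_simps rf_of_sum rf_of_power)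

lemma ev_dminus:
  "finite A \<Longrightarrow> a \<in> A \<Longrightarrow> f \<in> SymN N \<Longrightarrow> ev (A - {a}) f = (\<Sum>k\<le>N. rf_var a ^ k * ev A (dminus f k))"
  using tr_dminus[of A a f N] by (simp add: ev_def rf_var_def rf_of_simps rf_of_sum rf_of_power)

lemma single_injD: "c \<noteq> 0 \<Longrightarrow> sg a c = sg b c \<Longrightarrow> a = b"
  by (drule arg_cong[of _ _ Poly_Mapping.keys]) (simp split: if_splits)

lemma distinct_vars_rf:
  assumes "t \<noteq> 0" "t \<noteq> 1" "\<And>n. qint t (Suc n) \<noteq> 0"
  shows "distinct_vars rf_var (rf_const t)"
proof
  show "inj rf_var"
  proof (rule injI)
    fix a b :: nat assume "rf_var a = rf_var b"
    then have "sg (sg a (1 :: nat)) (1 :: complex) = sg (sg b 1) 1"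
      unfolding rf_var_def rf_of_simps(7) .
    from single_injD[OF _ this] have "sg a (1 :: nat) = sg b 1" by simp
    from single_injD[OF _ this] show "a = b" by simp
  qed
  show "rf_var a \<noteq> 0" for a
  proof
    assume "rf_var a = 0"
    then have "rf_of (sg (sg a (1 :: nat)) (1 :: complex)) = rf_of 0" by (simp add: rf_var_def rf_of_simps(1))
    then have "sg (sg a (1 :: nat)) (1 :: complex) = 0" by (simp only: rf_of_simps(7))
    from arg_cong[OF this, of Poly_Mapping.keys] show False by simp
  qed
  show "rf_const t \<noteq> 0" "rf_const t \<noteq> 1" "qint (rf_const t) (Suc n) \<noteq> 0" for n
    using assms by (simp_all add: rf_const_eq_0 rf_const_eq_1 flip: rf_const_qint)
qed

text \<open>The conditions are imposed on the complex number t and transferred to its image among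
  the rational functions, where the role of the x_a is played by the variables themselves.\<close>

locale hl_param =
  fixes t :: complex
  assumes t_nz: "t \<noteq> 0" and t_ne_1: "t \<noteq> 1" and qint_nz: "qint t (Suc n) \<noteq> 0"
begin

sublocale dv: distinct_vars rf_var "rf_const t"
  by (rule distinct_vars_rf) (fact t_nz t_ne_1 qint_nz)+

end

definition scale_fps :: "'b::comm_ring_1 \<Rightarrow> 'b fps \<Rightarrow> 'b fps" where
  "scale_fps c F = Abs_fps (\<lambda>n. c ^ n * F $ n)"

lemma scale_fps_mult: "scale_fps c (F * G) = scale_fps c F * scale_fps c G"
proof (rule fps_ext)
  fix n
  have "c ^ n * (F $ i * G $ (n - i)) = c ^ i * F $ i * (c ^ (n - i) * G $ (n - i))" if "i \<in> {0..n}" for i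
  proof -
    have "c ^ n = c ^ i * c ^ (n - i)" using that by (simp flip: power_add)
    then show ?thesis by (simp add: mult_ac)
  qed
  then show "scale_fps c (F * G) $ n = (scale_fps c F * scale_fps c G) $ n"
    unfolding scale_fps_def fps_mult_nth fps_nth_Abs_fps sum_distrib_left by (rule sum.cong[OF refl])
qed

lemma scale_fps_1: "scale_fps c 1 = 1"
  by (rule fps_ext) (simp add: scale_fps_def)

lemma scale_fps_prod: "scale_fps c (prod f A) = (\<Prod>a\<in>A. scale_fps c (f a))"
  by (induction A rule: infinite_finite_induct) (simp_all add: scale_fps_1 scale_fps_mult)

lemma scale_fps_lin: "scale_fps c (lin y) = lin (c * y)"
proof (rule fps_ext)
  fix n show "scale_fps c (lin y) $ n = lin (c * y) $ n"
    by (cases "n = 1") (auto simp: scale_fps_def lin_def fps_X_def)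
qed

text \<open>By \<open>dplus_hsym\<close> a new variable a multiplies H(u) by the geometric series in
  x_a u.\<close>

lemma ev_hsym:
  "finite A \<Longrightarrow> Abs_fps (\<lambda>n. ev A (hsym n)) * (\<Prod>a\<in>A. lin (rf_var a)) = 1"
proof (induction A rule: finite_induct)
  case empty
  have "tr {} (hsym n) = (if n = 0 then 1 else 0)" for n
    by (rule poly_mapping_eqI, subst lookup_tr[OF finite.emptyI hsym_SymN])
       (auto simp: hsym_def lookup_one when_def)
  then show ?case by (intro fps_ext) (auto simp: ev_def rf_of_simps)
next
  case (insert a A)
  let ?H = "\<lambda>A. Abs_fps (\<lambda>n. ev A (hsym n))"
  have "ev (insert a A) (hsym n) = (\<Sum>j\<le>n. rf_var a ^ j * ev A (hsym (n - j)))" for n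
    using ev_dplus[of "insert a A" a "hsym n" n] insert hsym_SymN by (simp add: dplus_hsym)
  then have "?H (insert a A) = Abs_fps (\<lambda>j. rf_var a ^ j) * ?H A"
    by (intro fps_ext) (simp add: fps_mult_nth atLeast0AtMost)
  moreover have "Abs_fps (\<lambda>j. rf_var a ^ j) * lin (rf_var a) = 1"
  proof (rule fps_ext)
    fix n show "(Abs_fps (\<lambda>j. rf_var a ^ j) * lin (rf_var a)) $ n = 1 $ n"
      by (cases n) (auto simp: lin_def right_diff_distrib mult.assoc[symmetric])
  qed
  ultimately have "?H (insert a A) * (\<Prod>a\<in>insert a A. lin (rf_var a)) =
     (Abs_fps (\<lambda>j. rf_var a ^ j) * lin (rf_var a)) * (?H A * (\<Prod>a\<in>A. lin (rf_var a)))"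
    using insert by (simp add: mult_ac)
  then show ?case using \<open>Abs_fps (\<lambda>j. rf_var a ^ j) * lin (rf_var a) = 1\<close> insert.IH by simp
qed

text \<open>\<open>\<Sum>\<^sub>n qser t n u\<^sup>n = H(u) / H(t u)\<close>.\<close>

fun qser :: "complex \<Rightarrow> nat \<Rightarrow> nat mpseries" where
  "qser t n = hsym n - (\<Sum>i<n. const_mps (t ^ (n - i)) * hsym (n - i) * qser t i)"

declare qser.simps [simp del]

lemma qser_SymN: "qser t n \<in> SymN n"
proof (induction n rule: less_induct)
  case (less n)
  have "const_mps (t ^ (n - i)) * hsym (n - i) * qser t i \<in> SymN n" if "i < n" for i
    using SymN_mult[OF SymN_const_mult[OF hsym_SymN[of "n - i"]] less[OF that]] that by simp
  then show ?case
    by (subst qser.simps) (auto intro!: SymN_diff hsym_SymN SymN_sum)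
qed

context hl_param
begin

lemma ev_hsym_HA: "finite A \<Longrightarrow> Abs_fps (\<lambda>n. ev A (hsym n)) = dv.HA A"
proof -
  assume A: "finite A"
  have "Abs_fps (\<lambda>n. ev A (hsym n)) = Abs_fps (\<lambda>n. ev A (hsym n)) * (dv.HA A * (\<Prod>a\<in>A. lin (rf_var a)))"
    by (simp add: dv.HA_mult)
  also have "\<dots> = (Abs_fps (\<lambda>n. ev A (hsym n)) * (\<Prod>a\<in>A. lin (rf_var a))) * dv.HA A"
    by (simp only: mult_ac)
  finally show ?thesis by (simp add: ev_hsym[OF A])
qed

lemma ev_hsym_scaled:
  assumes "finite A"
  shows "Abs_fps (\<lambda>n. c ^ n * ev A (hsym n)) * (\<Prod>a\<in>A. lin (c * rf_var a)) = 1"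
proof -
  have "Abs_fps (\<lambda>n. c ^ n * ev A (hsym n)) = scale_fps c (Abs_fps (\<lambda>n. ev A (hsym n)))"
    by (simp add: scale_fps_def)
  moreover have "(\<Prod>a\<in>A. lin (c * rf_var a)) = scale_fps c (\<Prod>a\<in>A. lin (rf_var a))"
    by (simp add: scale_fps_prod scale_fps_lin)
  ultimately show ?thesis
    by (simp only: scale_fps_mult[symmetric] ev_hsym[OF assms] scale_fps_1)
qed

text \<open>Read as generating series, the recursion of \<open>qser\<close> says Q(u) H(t u) =
  H(u).\<close>

lemma ev_qser:
  assumes A: "finite A"
  shows "Abs_fps (\<lambda>n. ev A (qser t n)) = (\<Prod>a\<in>A. lin (rf_const t * rf_var a)) * dv.HA A"
proof -
  let ?T = "Abs_fps (\<lambda>n. rf_const t ^ n * ev A (hsym n))"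
  have rec: "ev A (hsym n) = (\<Sum>i\<le>n. ev A (qser t i) * (rf_const t ^ (n - i) * ev A (hsym (n - i))))" for n
  proof -
    have S: "const_mps (t ^ (n - i)) * hsym (n - i) * qser t i \<in> SymN n" if "i < n" for i
      using SymN_mult[OF SymN_const_mult[OF hsym_SymN[of "n - i"]] qser_SymN[of t i]] that by simp
    have "ev A (qser t n) = ev A (hsym n) - (\<Sum>i<n. ev A (const_mps (t ^ (n - i)) * hsym (n - i) * qser t i))"
    proof (subst qser.simps, subst ev_diff[OF A hsym_SymN])
      show "(\<Sum>i<n. const_mps (t ^ (n - i)) * hsym (n - i) * qser t i) \<in> SymN n"
        using S by (intro SymN_sum) auto
      show "ev A (hsym n) - ev A (\<Sum>i<n. const_mps (t ^ (n - i)) * hsym (n - i) * qser t i) =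
        ev A (hsym n) - (\<Sum>i<n. ev A (const_mps (t ^ (n - i)) * hsym (n - i) * qser t i))"
        using S by (subst ev_sum[OF A]) auto
    qed
    moreover have "ev A (const_mps (t ^ (n - i)) * hsym (n - i) * qser t i) =
       ev A (qser t i) * (rf_const t ^ (n - i) * ev A (hsym (n - i)))" for i
      by (simp add: ev_mult[OF A SymN_const_mult[OF hsym_SymN] qser_SymN] ev_const_mult[OF A hsym_SymN] rf_const_power)
    moreover have "ev A (hsym 0) = 1" by (simp add: hsym_0 ev_const[OF A, of 1, unfolded const_mps_simps rf_const_simps])
    ultimately show ?thesis
      unfolding lessThan_Suc_atMost[symmetric] sum.lessThan_Suc
      by (simp only: diff_self_eq_0 power_0 mult_1_right add_diff_cancel_left' diff_add_cancel add_diff_eq)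
  qed
  have "Abs_fps (\<lambda>n. ev A (hsym n)) = Abs_fps (\<lambda>n. ev A (qser t n)) * ?T"
    unfolding fps_eq_iff fps_mult_nth fps_nth_Abs_fps atLeast0AtMost by (intro allI rec)
  then have "dv.HA A * (\<Prod>a\<in>A. lin (rf_const t * rf_var a)) =
      Abs_fps (\<lambda>n. ev A (qser t n)) * (?T * (\<Prod>a\<in>A. lin (rf_const t * rf_var a)))"
    by (simp add: ev_hsym_HA[OF A] mult.assoc)
  then show ?thesis
    unfolding ev_hsym_scaled[OF A] by (simp only: mult_1_right mult.commute[of _ "dv.HA A"])
qed

text \<open>Thus the weighted power sums over all finite A come from one symmetric function. This
  removes the denominators x_a - x_b and is the key to the existence of P_lambda.\<close>

lemma ev_qser_eq:
  assumes A: "finite A" and r: "r > 0"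
  shows "ev A (qser t r) = (1 - rf_const t) * (\<Sum>a\<in>A. rf_var a ^ r * psi (rf_const t) rf_var {a} (A - {a}))"
proof -
  have "Abs_fps (\<lambda>n. ev A (qser t n)) $ r = (1 + fps_const (1 - rf_const t) *
     Abs_fps (\<lambda>r. if r = 0 then 0 else \<Sum>a\<in>A. rf_var a ^ r * psi (rf_const t) rf_var {a} (A - {a}))) $ r"
    unfolding dv.sum_power_psi[OF A] ev_qser[OF A] ..
  then show ?thesis
    unfolding fps_add_nth fps_mult_left_const_nth fps_nth_Abs_fps fps_one_nth using r by simp
qed

text \<open>
  With \<open>f(A - a) = \<Sum>\<^sub>m x\<^sub>a\<^sup>m (dminus f m)(A)\<close> the outer sum of \<open>HLsum\<close> becomes a sum of the powers
  \<open>x\<^sub>a\<^bsup>l+m\<^esup>\<close> with the weights \<open>psi\<close>, which is \<open>qser t (l + m) / (1 - t)\<close>.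
\<close>

fun FHL :: "nat list \<Rightarrow> nat mpseries" where
  "FHL [] = 1"
| "FHL (l # la) = (\<Sum>m\<le>sum_list la. dminus (FHL la) m * (const_mps (1 / (1 - t)) * qser t (l + m)))"

lemma FHL_SymN: "FHL la \<in> SymN (sum_list la)"
proof (induction la)
  case Nil
  then show ?case using SymN_const[of 1] by (simp add: const_mps_simps)
next
  case (Cons l la)
  have "dminus (FHL la) m * (const_mps (1 / (1 - t)) * qser t (l + m)) \<in> SymN (sum_list (l # la))"
    if "m \<le> sum_list la" for m
    using SymN_mult[OF conjunct1[OF dminus_SymN[OF Cons, of m]] SymN_const_mult[OF qser_SymN[of t "l + m"]]] that
    by (simp add: add.commute)
  then show ?case by (auto intro!: SymN_sum)
qed

lemma ev_FHL:
  "0 \<notin> set la \<Longrightarrow> finite A \<Longrightarrow> ev A (FHL la) = HLsum (rf_const t) rf_var la A"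
proof (induction la arbitrary: A)
  case Nil
  then show ?case using ev_const[of A 1] by (simp add: const_mps_simps rf_const_simps)
next
  case (Cons l la)
  have A: "finite A" by fact
  let ?N = "sum_list la" and ?p = "\<lambda>a. psi (rf_const t) rf_var {a} (A - {a})"
  have D: "dminus (FHL la) m \<in> SymN (?N - m)" for m using dminus_SymN[OF FHL_SymN] by blast
  have Q: "const_mps (1 / (1 - t)) * qser t (l + m) \<in> SymN (l + m)" for m
    by (rule SymN_const_mult[OF qser_SymN])
  have q: "ev A (const_mps (1 / (1 - t)) * qser t (l + m)) = (\<Sum>a\<in>A. rf_var a ^ (l + m) * ?p a)" for m
  proof -
    \<comment> \<open>Positivity matters: for exponent 0 the weighted sum is [|A|]_t, which depends
      on the number of variables.\<close>
    have "l + m > 0" using Cons.prems by simp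
    moreover have "rf_const (1 / (1 - t)) * (1 - rf_const t) = 1"
      using dv.t_ne_1 by (simp add: rf_const_divide rf_const_simps)
    ultimately show ?thesis
      by (simp add: ev_const_mult[OF A qser_SymN] ev_qser_eq[OF A] mult.assoc[symmetric])
  qed
  have "ev A (FHL (l # la)) = (\<Sum>m\<le>?N. ev A (dminus (FHL la) m * (const_mps (1 / (1 - t)) * qser t (l + m))))"
    unfolding FHL.simps
  proof (rule ev_sum[OF A])
    fix m assume "m \<in> {..?N}"
    then have "?N - m + (l + m) = ?N + l" by simp
    then show "dminus (FHL la) m * (const_mps (1 / (1 - t)) * qser t (l + m)) \<in> SymN (?N + l)"
      using SymN_mult[OF D Q, of m m] by simp
  qed
  also have "\<dots> = (\<Sum>m\<le>?N. \<Sum>a\<in>A. ev A (dminus (FHL la) m) * (rf_var a ^ (l + m) * ?p a))"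
    by (simp add: ev_mult[OF A D Q] q sum_distrib_left)
  also have "\<dots> = (\<Sum>a\<in>A. \<Sum>m\<le>?N. ev A (dminus (FHL la) m) * (rf_var a ^ (l + m) * ?p a))"
    by (rule sum.swap)
  also have "\<dots> = (\<Sum>a\<in>A. rf_var a ^ l * ?p a * ev (A - {a}) (FHL la))"
  proof (intro sum.cong refl)
    fix a assume a: "a \<in> A"
    show "(\<Sum>m\<le>?N. ev A (dminus (FHL la) m) * (rf_var a ^ (l + m) * ?p a)) =
      rf_var a ^ l * ?p a * ev (A - {a}) (FHL la)"
      by (simp add: ev_dminus[OF A a FHL_SymN] sum_distrib_left power_add mult_ac)
  qed
  also have "\<dots> = HLsum (rf_const t) rf_var (l # la) A"
    using Cons by simp
  finally show ?case .
qed

end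

section \<open>The sum over permutations as a recursive sum\<close>

lemma sum_permutations_of_set_insert:
  assumes "finite A" "A \<noteq> {}"
  shows "(\<Sum>xs\<in>permutations_of_set A. G xs) = (\<Sum>a\<in>A. \<Sum>xs\<in>permutations_of_set (A - {a}). G (a # xs))"
proof -
  have "(\<Sum>xs\<in>permutations_of_set A. G xs) =
      (\<Sum>a\<in>A. \<Sum>xs\<in>(\<lambda>xs. a # xs) ` permutations_of_set (A - {a}). G xs)"
    unfolding permutations_of_set_nonempty[OF assms(2)]
    by (rule sum.UNION_disjoint) (use assms in auto)
  then show ?thesis by (simp add: sum.reindex)
qed

lemma sum_permutes_eq_lists:
  "(\<Sum>w | w permutes {..<n}. G (map w [0..<n])) = (\<Sum>xs\<in>permutations_of_set {..<n}. G xs)"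
proof (rule sum.reindex_bij_witness[of _ "\<lambda>xs i. if i < n then xs ! i else i" "\<lambda>w. map w [0..<n]"])
  fix w assume "w \<in> {w. w permutes {..<n}}"
  then have w: "w permutes {..<n}" by simp
  show "(\<lambda>i. if i < n then map w [0..<n] ! i else i) = w"
  proof
    fix i show "(if i < n then map w [0..<n] ! i else i) = w i"
      using permutes_not_in[OF w, of i] by simp
  qed
  have "w ` {..<n} = {..<n}" using w by (rule permutes_image)
  then show "map w [0..<n] \<in> permutations_of_set {..<n}"
    using permutes_inj_on[OF w, of "{0..<n}"]
    by (simp add: permutations_of_set_def distinct_map atLeast0LessThan)
next
  fix xs assume "xs \<in> permutations_of_set {..<n}"
  then have xs: "set xs = {..<n}" "distinct xs" by (auto simp: permutations_of_set_def)
  then have len: "length xs = n" using distinct_card[of xs] by simp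
  show "map (\<lambda>i. if i < n then xs ! i else i) [0..<n] = xs"
    using len by (intro nth_equalityI) auto
  have "bij_betw (\<lambda>i. if i < n then xs ! i else i) {..<n} {..<n}"
  proof -
    have "bij_betw ((!) xs) {..<n} {..<n}"
      by (rule bij_betw_nth) (simp_all add: xs len)
    also have "?this \<longleftrightarrow> ?thesis" by (rule bij_betw_cong) simp
    finally show ?thesis .
  qed
  from bij_imp_permutes[OF this]
  show "(\<lambda>i. if i < n then xs ! i else i) \<in> {w. w permutes {..<n}}"
    by simp
qed (rule refl)

text \<open>The summand of a permutation in terms of the list of its images. Lists can be peeled
  from the front, with the exponents shifted, and live on any finite set of variables.\<close>

definition hl_term :: "'b::field \<Rightarrow> ('i \<Rightarrow> 'b) \<Rightarrow> (nat \<Rightarrow> nat) \<Rightarrow> 'i list \<Rightarrow> 'b" where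
  "hl_term t x e xs = (\<Prod>i<length xs. x (xs ! i) ^ e i) *
     (\<Prod>(i, j)\<in>{(i, j). i < j \<and> j < length xs}. (x (xs ! i) - t * x (xs ! j)) / (x (xs ! i) - x (xs ! j)))"

text \<open>Pairs of positions that contain position 0 give the weight of a against the rest; the
  other pairs are those of xs shifted by one.\<close>

lemma hl_term_Cons:
  assumes "distinct (a # xs)"
  shows "hl_term t x e (a # xs) = x a ^ e 0 * psi t x {a} (set xs) * hl_term t x (\<lambda>i. e (Suc i)) xs"
proof -
  let ?f = "\<lambda>ys (i, j). (x (ys ! i) - t * x (ys ! j)) / (x (ys ! i) - x (ys ! j))"
  let ?n = "length xs"
  have "{(i, j). i < j \<and> j < Suc ?n} = (\<lambda>j. (0, Suc j)) ` {..<?n} \<union> map_prod Suc Suc ` {(i, j). i < j \<and> j < ?n}"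
    (is "?L = ?R")
  proof
    show "?L \<subseteq> ?R"
    proof
      fix s assume "s \<in> ?L"
      then obtain i j where s: "s = (i, j)" "i < j" "j < Suc ?n" by auto
      then obtain j' where j: "j = Suc j'" by (cases j) auto
      show "s \<in> ?R"
      proof (cases i)
        case 0
        then show ?thesis using s j by auto
      next
        case (Suc i')
        then have "s = map_prod Suc Suc (i', j')" "i' < j'" "j' < ?n" using s j by auto
        then show ?thesis by blast
      qed
    qed
  qed auto
  moreover have fin: "finite {(i, j). i < j \<and> j < ?n}"
    by (rule finite_subset[of _ "{..<?n} \<times> {..<?n}"]) auto
  ultimately have "(\<Prod>s\<in>{(i, j). i < j \<and> j < length (a # xs)}. ?f (a # xs) s) =
    (\<Prod>s\<in>(\<lambda>j. (0, Suc j)) ` {..<?n}. ?f (a # xs) s) * (\<Prod>s\<in>map_prod Suc Suc ` {(i, j). i < j \<and> j < ?n}. ?f (a # xs) s)"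
    by (simp only: list.size(4) add_Suc_right add_0_right, intro prod.union_disjoint) auto
  also have "(\<Prod>s\<in>(\<lambda>j. (0, Suc j)) ` {..<?n}. ?f (a # xs) s) = (\<Prod>j<?n. (x a - t * x (xs ! j)) / (x a - x (xs ! j)))"
    by (subst prod.reindex) (auto simp: inj_on_def)
  also have "\<dots> = psi t x {a} (set xs)"
  proof -
    have "bij_betw ((!) xs) {..<?n} (set xs)"
      using assms by (intro bij_betw_nth) auto
    from prod.reindex_bij_betw[OF this, of "\<lambda>b. (x a - t * x b) / (x a - x b)"] show ?thesis
      by (simp add: psi_def)
  qed
  also have "(\<Prod>s\<in>map_prod Suc Suc ` {(i, j). i < j \<and> j < ?n}. ?f (a # xs) s) = (\<Prod>s\<in>{(i, j). i < j \<and> j < ?n}. ?f xs s)"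
    by (subst prod.reindex) (auto simp: inj_on_def intro!: prod.cong)
  finally show ?thesis
    unfolding hl_term_def by (simp add: prod.lessThan_Suc_shift mult_ac del: prod.lessThan_Suc)
qed

lemma sum_hl_term:
  "finite A \<Longrightarrow> (\<Sum>xs\<in>permutations_of_set A. hl_term t x e xs) = HLsum t x (map e [0..<card A]) A"
proof (induction "card A" arbitrary: A e)
  case 0
  then show ?case by (simp add: hl_term_def)
next
  case (Suc n)
  have ne: "A \<noteq> {}" using Suc by auto
  have "(\<Sum>xs\<in>permutations_of_set A. hl_term t x e xs) =
      (\<Sum>a\<in>A. \<Sum>xs\<in>permutations_of_set (A - {a}). x a ^ e 0 * psi t x {a} (A - {a}) * hl_term t x (\<lambda>i. e (Suc i)) xs)"
    unfolding sum_permutations_of_set_insert[OF Suc.prems ne]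
    by (intro sum.cong refl, subst hl_term_Cons) (auto simp: permutations_of_set_def)
  also have "\<dots> = (\<Sum>a\<in>A. x a ^ e 0 * psi t x {a} (A - {a}) * HLsum t x (map (\<lambda>i. e (Suc i)) [0..<n]) (A - {a}))"
  proof (intro sum.cong refl)
    fix a assume a: "a \<in> A"
    have "card (A - {a}) = n" using a Suc by simp
    then show "(\<Sum>xs\<in>permutations_of_set (A - {a}). x a ^ e 0 * psi t x {a} (A - {a}) * hl_term t x (\<lambda>i. e (Suc i)) xs)
       = x a ^ e 0 * psi t x {a} (A - {a}) * HLsum t x (map (\<lambda>i. e (Suc i)) [0..<n]) (A - {a})"
      using Suc.hyps(1)[of "A - {a}" "\<lambda>i. e (Suc i)"] Suc.prems by (simp flip: sum_distrib_left)
  qed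
  also have "\<dots> = HLsum t x (map e [0..<card A]) A"
    unfolding Suc.hyps(2)[symmetric] by (simp add: map_upt_Suc del: upt_Suc)
  finally show ?case .
qed

text \<open>Polynomials embed into the fraction field, and each monomial is seen as soon as n
  exceeds all indices of its variables.\<close>

lemma SymN_polynomials_unique:
  assumes P: "P \<in> Sym" and Q: "Q \<in> Sym"
    and Pp: "\<forall>n\<ge>N. \<exists>p :: cpoly. rf_of p = R n \<and>
        (\<forall>m. lk p m = (if Poly_Mapping.keys m \<subseteq> {..<n} then mcoeff P m else 0))"
    and Qp: "\<forall>n\<ge>N. \<exists>p :: cpoly. rf_of p = R n \<and>
        (\<forall>m. lk p m = (if Poly_Mapping.keys m \<subseteq> {..<n} then mcoeff Q m else 0))"
  shows "P = Q"
proof (rule mpseries_eqI)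
  fix m :: "nat \<Rightarrow>\<^sub>0 nat"
  obtain k where k: "Poly_Mapping.keys m \<subseteq> {..<k}"
    using finite_nat_iff_bounded[of "Poly_Mapping.keys m"] by auto
  let ?n = "max N k"
  have m: "Poly_Mapping.keys m \<subseteq> {..<?n}" using k by force
  obtain p where p: "rf_of p = R ?n" "\<forall>m. lk p m = (if Poly_Mapping.keys m \<subseteq> {..<?n} then mcoeff P m else 0)"
    using Pp[rule_format, of ?n] by auto
  obtain p' where p': "rf_of p' = R ?n" "\<forall>m. lk p' m = (if Poly_Mapping.keys m \<subseteq> {..<?n} then mcoeff Q m else 0)"
    using Qp[rule_format, of ?n] by auto
  have "p = p'" using p(1) p'(1) by (simp flip: rf_of_simps(7))
  then have "(if Poly_Mapping.keys m \<subseteq> {..<?n} then mcoeff P m else 0) =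
      (if Poly_Mapping.keys m \<subseteq> {..<?n} then mcoeff Q m else 0)"
    using p(2)[rule_format, of m] p'(2)[rule_format, of m] by simp
  then show "mcoeff P m = mcoeff Q m" by (simp only: m if_True)
qed

context hl_param
begin

text \<open>Padding la by zeros up to length n multiplies the recursive sum by [n - l(la)]_t!, which
  cancels against the same factor of \<open>v_part\<close>.\<close>

lemma hall_littlewood_fin_eq:
  assumes "length la \<le> n"
  shows "hall_littlewood_fin n la t = dv.HLP la {..<n}"
proof -
  have "(\<Sum>w | w permutes {..<n}.
        (\<Prod>i<n. rf_var (w i) ^ part la i) *
        (\<Prod>(i, j)\<in>{(i, j). i < j \<and> j < n}.
            (rf_var (w i) - rf_const t * rf_var (w j)) / (rf_var (w i) - rf_var (w j)))) =
     (\<Sum>w | w permutes {..<n}. hl_term (rf_const t) rf_var (part la) (map w [0..<n]))"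
  proof (rule sum.cong[OF refl])
    fix w
    have "(\<Prod>(i, j)\<in>{(i, j). i < j \<and> j < n}. (rf_var (w i) - rf_const t * rf_var (w j)) / (rf_var (w i) - rf_var (w j)))
      = (\<Prod>(i, j)\<in>{(i, j). i < j \<and> j < n}. (rf_var (map w [0..<n] ! i) - rf_const t * rf_var (map w [0..<n] ! j)) /
           (rf_var (map w [0..<n] ! i) - rf_var (map w [0..<n] ! j)))"
      by (rule prod.cong) auto
    then show "(\<Prod>i<n. rf_var (w i) ^ part la i) *
        (\<Prod>(i, j)\<in>{(i, j). i < j \<and> j < n}.
            (rf_var (w i) - rf_const t * rf_var (w j)) / (rf_var (w i) - rf_var (w j))) =
        hl_term (rf_const t) rf_var (part la) (map w [0..<n])"
      by (simp add: hl_term_def)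
  qed
  also have "\<dots> = HLsum (rf_const t) rf_var (map (part la) [0..<n]) {..<n}"
    unfolding sum_permutes_eq_lists using sum_hl_term[of "{..<n}" "rf_const t" rf_var "part la"] by simp
  also have "map (part la) [0..<n] = la @ replicate (n - length la) 0"
    using assms by (intro nth_equalityI) (auto simp: part_def nth_append)
  also have "HLsum (rf_const t) rf_var \<dots> {..<n} = vq (rf_const t) (n - length la) * HLsum (rf_const t) rf_var la {..<n}"
    using assms by (intro dv.HLsum_append_zeros) auto
  finally show ?thesis
    unfolding hall_littlewood_fin_def
    using dv.vq_nz by (simp add: v_part_eq rf_const_simps rf_const_vq rf_const_vlist dv.HLP_def)
qed

definition PHL :: "nat list \<Rightarrow> nat mpseries" where
  "PHL la = const_mps (1 / vlist t la) * FHL la"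

lemma PHL_SymN: "PHL la \<in> SymN (sum_list la)"
  unfolding PHL_def by (rule SymN_const_mult[OF FHL_SymN])

lemma ev_PHL: "0 \<notin> set la \<Longrightarrow> finite A \<Longrightarrow> ev A (PHL la) = dv.HLP la A"
  by (simp add: PHL_def ev_const_mult[OF _ FHL_SymN] ev_FHL rf_const_divide rf_const_simps rf_const_vlist dv.HLP_def)

text \<open>\<open>PHL la\<close> witnesses that the description of P_lambda is satisfiable: its
  truncations are the required polynomials by \<open>ev_PHL\<close>. Uniqueness is
  \<open>SymN_polynomials_unique\<close>.\<close>

lemma hall_littlewood_eq:
  assumes "0 \<notin> set la"
  shows "hall_littlewood la t = PHL la"
proof -
  let ?C = "\<lambda>P. P \<in> Sym \<and>
     (\<forall>n\<ge>length la. \<exists>p :: cpoly. rf_of p = hall_littlewood_fin n la t \<and>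
        (\<forall>m. Poly_Mapping.lookup p m
               = (if Poly_Mapping.keys m \<subseteq> {..<n} then mcoeff P m else 0)))"
  have "rf_of (tr {..<n} (PHL la)) = hall_littlewood_fin n la t \<and>
     (\<forall>m. lk (tr {..<n} (PHL la)) m = (if Poly_Mapping.keys m \<subseteq> {..<n} then mcoeff (PHL la) m else 0))"
    if "length la \<le> n" for n
    using that assms by (simp add: hall_littlewood_fin_eq ev_PHL[symmetric] ev_def lookup_tr[OF _ PHL_SymN])
  note fin = this
  have S: "PHL la \<in> Sym" unfolding Sym_iff_SymN by (rule exI) (rule PHL_SymN)
  have ex: "?C (PHL la)"
    by (intro conjI allI impI S) (rule exI, erule fin)
  have un: "P = PHL la" if "?C P" for P
    by (rule SymN_polynomials_unique[OF conjunct1[OF that] S conjunct2[OF that] conjunct2[OF ex]])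
  show ?thesis
    unfolding hall_littlewood_def by (rule the_equality, rule ex, rule un)
qed

text \<open>The degree \<open>n\<close> part of \<open>\<Prod>\<^sub>i (1 - x\<^sub>i / t) / (1 - x\<^sub>i)\<close>.\<close>

definition Gser :: "nat \<Rightarrow> nat mpseries" where
  "Gser n = (\<Sum>la\<in>Parts n. const_mps ((\<Prod>j=1..length la. 1 - (1 / t) ^ j) * t ^ n_stat la) * hall_littlewood la t)"

lemma Gser_SymN: "Gser n \<in> SymN n"
  unfolding Gser_def
proof (rule SymN_sum)
  fix la assume "la \<in> Parts n"
  then have "0 \<notin> set la" "sum_list la = n" by (auto simp: Parts_def is_partition_def)
  then show "const_mps ((\<Prod>j=1..length la. 1 - (1 / t) ^ j) * t ^ n_stat la) * hall_littlewood la t \<in> SymN n"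
    using SymN_const_mult[OF PHL_SymN[of la]] by (simp add: hall_littlewood_eq)
qed

lemma ev_Gser:
  assumes A: "finite A"
  shows "Abs_fps (\<lambda>n. ev A (Gser n)) = (\<Prod>a\<in>A. lin (rf_var a / rf_const t)) * dv.HA A"
proof (rule fps_ext)
  fix n
  have P: "0 \<notin> set la" "hall_littlewood la t \<in> SymN n" if "la \<in> Parts n" for la
    using that PHL_SymN[of la] by (auto simp: Parts_def is_partition_def hall_littlewood_eq)
  have "ev A (Gser n) = (\<Sum>la\<in>Parts n. ev A (const_mps ((\<Prod>j=1..length la. 1 - (1 / t) ^ j) * t ^ n_stat la) * hall_littlewood la t))"
    unfolding Gser_def by (rule ev_sum[OF A]) (rule SymN_const_mult[OF P(2)])
  also have "\<dots> = dv.wsum dv.gfac n A"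
    unfolding dv.wsum_def
  proof (intro sum.cong refl)
    fix la assume la: "la \<in> Parts n"
    have "rf_const ((\<Prod>j=1..length la. 1 - (1 / t) ^ j) * t ^ n_stat la) = dv.gfac (length la) * rf_const t ^ n_stat la"
      by (simp add: dv.gfac_def rf_const_simps rf_const_prod rf_const_power rf_const_divide)
    then show "ev A (const_mps ((\<Prod>j=1..length la. 1 - (1 / t) ^ j) * t ^ n_stat la) * hall_littlewood la t) =
       dv.gfac (length la) * rf_const t ^ n_stat la * dv.HLP la A"
      using P[OF la] A by (simp add: ev_const_mult[OF A PHL_SymN] hall_littlewood_eq ev_PHL)
  qed
  also have "\<dots> = ((\<Prod>a\<in>A. lin (rf_var a / rf_const t)) * dv.HA A) $ n"
    by (rule dv.wsum_gfac[OF A])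
  finally show "Abs_fps (\<lambda>n. ev A (Gser n)) $ n = ((\<Prod>a\<in>A. lin (rf_var a / rf_const t)) * dv.HA A) $ n"
    by simp
qed

text \<open>The identity G(u) H(u/t) = H(u), which holds because it holds in every finite set of
  variables.\<close>

lemma Gser_hsym: "(\<Sum>i\<le>n. const_mps ((1 / t) ^ (n - i)) * hsym (n - i) * Gser i) = hsym n"
proof (rule ev_inject)
  have S: "const_mps ((1 / t) ^ (n - i)) * hsym (n - i) * Gser i \<in> SymN n" if "i \<in> {..n}" for i
    using SymN_mult[OF SymN_const_mult[OF hsym_SymN[of "n - i"]] Gser_SymN[of i]] that by simp
  then show "(\<Sum>i\<le>n. const_mps ((1 / t) ^ (n - i)) * hsym (n - i) * Gser i) \<in> SymN n"
    by (rule SymN_sum)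
  show "hsym n \<in> SymN n" by (rule hsym_SymN)
  fix A :: "nat set" assume A: "finite A"
  let ?c = "1 / rf_const t"
  have "ev A (\<Sum>i\<le>n. const_mps ((1 / t) ^ (n - i)) * hsym (n - i) * Gser i) =
     (\<Sum>i\<le>n. ev A (const_mps ((1 / t) ^ (n - i)) * hsym (n - i) * Gser i))"
    by (rule ev_sum[OF A S])
  also have "\<dots> = (\<Sum>i\<le>n. ev A (Gser i) * (?c ^ (n - i) * ev A (hsym (n - i))))"
  proof (intro sum.cong refl)
    fix i
    have "ev A (const_mps ((1 / t) ^ (n - i)) * hsym (n - i) * Gser i) =
        rf_const ((1 / t) ^ (n - i)) * ev A (hsym (n - i)) * ev A (Gser i)"
      by (simp only: ev_mult[OF A SymN_const_mult[OF hsym_SymN] Gser_SymN] ev_const_mult[OF A hsym_SymN])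
    also have "rf_const ((1 / t) ^ (n - i)) = ?c ^ (n - i)"
      by (simp add: rf_const_power rf_const_divide rf_const_simps)
    finally show "ev A (const_mps ((1 / t) ^ (n - i)) * hsym (n - i) * Gser i) =
        ev A (Gser i) * (?c ^ (n - i) * ev A (hsym (n - i)))"
      by (simp only: mult_ac)
  qed
  also have "\<dots> = (Abs_fps (\<lambda>n. ev A (Gser n)) * Abs_fps (\<lambda>n. ?c ^ n * ev A (hsym n))) $ n"
    by (simp add: fps_mult_nth atLeast0AtMost)
  also have "\<dots> = (dv.HA A * (Abs_fps (\<lambda>n. ?c ^ n * ev A (hsym n)) * (\<Prod>a\<in>A. lin (?c * rf_var a)))) $ n"
    by (simp add: ev_Gser[OF A] mult_ac)
  also have "\<dots> = ev A (hsym n)"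
    unfolding ev_hsym_scaled[OF A] ev_hsym_HA[OF A, symmetric] by simp
  finally show "ev A (\<Sum>i\<le>n. const_mps ((1 / t) ^ (n - i)) * hsym (n - i) * Gser i) = ev A (hsym n)" .
qed

end


section \<open>The recursion for homomorphic images\<close>

text \<open>The operator u d/du. An equation \<open>theta F = A * F\<close> says that A is u d/du of
  log F without forming a logarithm.\<close>

definition theta :: "'r::comm_ring_1 fps \<Rightarrow> 'r fps" where
  "theta F = fps_X * fps_deriv F"

lemma theta_nth: "theta F $ n = of_nat n * F $ n"
  by (cases n) (simp_all add: theta_def)

lemma theta_mult: "theta (F * G) = theta F * G + F * theta G"
  by (simp add: theta_def algebra_simps)

lemma theta_eq_iff: "theta F = Abs_fps c * F \<longleftrightarrow> (\<forall>n. of_nat n * F $ n = (\<Sum>k\<le>n. c k * F $ (n - k)))"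
  by (simp add: fps_eq_iff theta_nth fps_mult_nth atLeast0AtMost)

text \<open>Constant coefficient 1 allows cancellation over any commutative ring, with or without
  zero divisors.\<close>

lemma fps_mult_cancel_unit:
  fixes F :: "'r::comm_ring_1 fps"
  assumes "F * K = 0" "fps_nth K 0 = 1"
  shows "F = 0"
proof (rule fps_ext)
  fix n show "F $ n = 0 $ n"
  proof (induction n rule: less_induct)
    case (less n)
    have "(F * K) $ n = (\<Sum>i\<in>{0..n}. if i = n then F $ n else 0)"
      unfolding fps_mult_nth by (rule sum.cong) (use less assms(2) in auto)
    then show ?case using assms(1) by simp
  qed
qed

lemma theta_quotient:
  fixes F :: "'r::comm_ring_1 fps"
  assumes "F * K = H" "fps_nth K 0 = 1" "theta H = A * H" "theta K = B * K"
  shows "theta F = (A - B) * F"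
proof -
  have "theta F * K + F * (B * K) = A * (F * K)"
    using theta_mult[of F K] assms by simp
  then have "(theta F - (A - B) * F) * K = 0"
    by (simp add: algebra_simps)
  from fps_mult_cancel_unit[OF this assms(2)] show ?thesis by simp
qed

text \<open>As \<open>c 0 = 0\<close>, the equation expresses n F_n by earlier coefficients, and
  division by n is possible over the complex numbers.\<close>

lemma theta_unique:
  fixes F G :: "'v mpseries fps"
  assumes "theta F = Abs_fps c * F" "theta G = Abs_fps c * G" "F $ 0 = G $ 0" "c 0 = 0"
  shows "F = G"
proof (rule fps_ext)
  fix n show "F $ n = G $ n"
  proof (induction n rule: less_induct)
    case (less n)
    show ?case
    proof (cases "n = 0")
      case False
      have "(\<Sum>k\<le>n. c k * F $ (n - k)) = (\<Sum>k\<le>n. c k * G $ (n - k))"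
      proof (rule sum.cong[OF refl])
        fix k show "c k * F $ (n - k) = c k * G $ (n - k)"
          using less[of "n - k"] False assms(4) by (cases "k = 0") auto
      qed
      then have "of_nat n * F $ n = of_nat n * G $ n"
        using assms(1,2) unfolding theta_eq_iff by simp
      then show ?thesis
        using const_mps_cancel[of "of_nat n" "F $ n" "G $ n"] False by (simp add: const_mps_of_nat)
    qed (use assms(3) in simp)
  qed
qed

lemma theta_hsym_scaled:
  "theta (Abs_fps (\<lambda>n. const_mps (c ^ n) * hsym n)) =
     Abs_fps (\<lambda>k. if k = 0 then 0 else const_mps (c ^ k) * psum k) * Abs_fps (\<lambda>n. const_mps (c ^ n) * hsym n)"
  unfolding theta_eq_iff
proof
  fix n
  have "(\<Sum>k\<le>n. (if k = 0 then 0 else const_mps (c ^ k) * psum k) * (const_mps (c ^ (n - k)) * hsym (n - k)))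
     = (\<Sum>k=1..n. const_mps (c ^ n) * (psum k * hsym (n - k)))"
  proof (rule sum.mono_neutral_cong_right)
    fix k assume k: "k \<in> {1..n}"
    then have "c ^ n = c ^ k * c ^ (n - k)" by (simp flip: power_add)
    then show "(if k = 0 then 0 else const_mps (c ^ k) * psum k) * (const_mps (c ^ (n - k)) * hsym (n - k)) =
       const_mps (c ^ n) * (psum k * hsym (n - k))"
      using k by (simp add: const_mps_simps mult_ac)
  qed auto
  also have "\<dots> = of_nat n * (const_mps (c ^ n) * hsym n)"
  proof -
    have "\<dots> = const_mps (c ^ n) * (of_nat n * hsym n)"
      by (simp only: sum_distrib_left[symmetric] newton_hsym[symmetric])
    then show ?thesis by (simp only: mult.left_commute)
  qed
  finally show "of_nat n * Abs_fps (\<lambda>n. const_mps (c ^ n) * hsym n) $ n =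
     (\<Sum>k\<le>n. (if k = 0 then 0 else const_mps (c ^ k) * psum k) * Abs_fps (\<lambda>n. const_mps (c ^ n) * hsym n) $ (n - k))"
    by simp
qed

context hl_param
begin

text \<open>G(u) is the quotient H(u) / H(u/t), so the logarithmic derivatives of numerator and
  denominator are subtracted.\<close>

lemma theta_Gser:
  "theta (Abs_fps Gser) = Abs_fps (\<lambda>k. if k = 0 then 0 else const_mps (1 - (1 / t) ^ k) * psum k) * Abs_fps Gser"
proof -
  have "Abs_fps Gser * Abs_fps (\<lambda>n. const_mps ((1 / t) ^ n) * hsym n) = Abs_fps (\<lambda>n. const_mps (1 ^ n) * hsym n)"
  proof (rule fps_ext)
    fix n
    have "(\<Sum>i\<le>n. Gser i * (const_mps ((1 / t) ^ (n - i)) * hsym (n - i))) = hsym n"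
      using Gser_hsym[of n] by (simp only: mult.commute)
    then show "(Abs_fps Gser * Abs_fps (\<lambda>n. const_mps ((1 / t) ^ n) * hsym n)) $ n = Abs_fps (\<lambda>n. const_mps (1 ^ n) * hsym n) $ n"
      by (simp add: fps_mult_nth atLeast0AtMost const_mps_simps)
  qed
  from theta_quotient[OF this _ theta_hsym_scaled theta_hsym_scaled]
  have "theta (Abs_fps Gser) = (Abs_fps (\<lambda>k. if k = 0 then 0 else const_mps (1 ^ k) * psum k) -
      Abs_fps (\<lambda>k. if k = 0 then 0 else const_mps ((1 / t) ^ k) * psum k)) * Abs_fps Gser"
    by (simp add: hsym_0 const_mps_simps)
  also have "Abs_fps (\<lambda>k. if k = 0 then 0 else const_mps (1 ^ k) * psum k) -
      Abs_fps (\<lambda>k. if k = 0 then 0 else const_mps ((1 / t) ^ k) * psum k) =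
      Abs_fps (\<lambda>k. if k = 0 then 0 else const_mps (1 - (1 / t) ^ k) * psum k)"
    by (rule fps_ext) (simp add: const_mps_simps left_diff_distrib)
  finally show ?thesis .
qed

lemma Gser_0: "Gser 0 = 1"
  using Gser_hsym[of 0] by (simp add: hsym_0 const_mps_simps)

text \<open>The hypothesis on power sums is \<open>\<phi> (psum k) = (-1)^(k-1) psum k\<close>
  multiplied by t^(-k) - 1, which is both what the sum over characters yields and what enters here.
  Hence the image of G(-u) has the logarithmic derivative of H(u/t) / H(u).\<close>

lemma hom_Gser_recursion:
  fixes \<phi> :: "nat mpseries \<Rightarrow> nat mpseries" and g :: "nat \<Rightarrow> nat mpseries"
  assumes add: "\<And>f g. f \<in> Sym \<Longrightarrow> g \<in> Sym \<Longrightarrow> \<phi> (f + g) = \<phi> f + \<phi> g"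
    and mult: "\<And>f g. f \<in> Sym \<Longrightarrow> g \<in> Sym \<Longrightarrow> \<phi> (f * g) = \<phi> f * \<phi> g"
    and const: "\<And>c. \<phi> (const_mps c) = const_mps c"
    and psum: "\<And>k. k \<ge> 1 \<Longrightarrow> const_mps ((-1) ^ k * (1 - (1 / t) ^ k)) * \<phi> (psum k) = const_mps ((1 / t) ^ k - 1) * psum k"
  defines "g \<equiv> \<lambda>n. const_mps ((-1) ^ n) * \<phi> (Gser n)"
  assumes n: "n \<ge> 1"
  shows "g n = (const_mps (1 / t) ^ n - 1) * hsym n - (\<Sum>i=1..n-1. g (n - i) * hsym i)"
proof -
  have sum: "\<phi> (sum f I) = (\<Sum>i\<in>I. \<phi> (f i))" if "\<And>i. i \<in> I \<Longrightarrow> f i \<in> Sym" for f :: "nat \<Rightarrow> _" and I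
    using that
  proof (induction I rule: infinite_finite_induct)
    case (insert i I)
    then show ?case by (simp add: add Sym_sum)
  qed (use const[of 0] in \<open>simp_all add: const_mps_simps\<close>)
  have G: "Gser n \<in> Sym" for n using Gser_SymN Sym_iff_SymN by blast
  have newton: "of_nat n * g n = (\<Sum>k\<le>n. (if k = 0 then 0 else const_mps ((1 / t) ^ k - 1) * psum k) * g (n - k))" for n
  proof -
    have cG: "const_mps (1 - (1 / t) ^ k) * psum k \<in> Sym" for k
      by (intro Sym_closed psum_Sym)
    have "of_nat n * Gser n = (\<Sum>k\<le>n. (if k = 0 then 0 else const_mps (1 - (1 / t) ^ k) * psum k) * Gser (n - k))"
      using theta_Gser unfolding theta_eq_iff by simp
    also have "\<dots> = (\<Sum>k=1..n. const_mps (1 - (1 / t) ^ k) * psum k * Gser (n - k))"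
      by (rule sum.mono_neutral_cong_right) auto
    finally have "\<phi> (const_mps (of_nat n) * Gser n) = \<phi> (\<Sum>k=1..n. const_mps (1 - (1 / t) ^ k) * psum k * Gser (n - k))"
      by (simp add: const_mps_of_nat)
    also have "\<dots> = (\<Sum>k=1..n. \<phi> (const_mps (1 - (1 / t) ^ k) * psum k * Gser (n - k)))"
      by (rule sum) (intro Sym_closed(4) cG G)
    also have "\<phi> (const_mps (of_nat n) * Gser n) = const_mps (of_nat n) * \<phi> (Gser n)"
      by (simp only: mult[OF Sym_closed(1) G] const)
    finally have "const_mps ((-1) ^ n) * (of_nat n * \<phi> (Gser n)) =
       (\<Sum>k=1..n. const_mps ((-1) ^ n) * \<phi> (const_mps (1 - (1 / t) ^ k) * psum k * Gser (n - k)))"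
      by (simp add: sum_distrib_left const_mps_of_nat)
    also have "\<dots> = (\<Sum>k=1..n. const_mps ((1 / t) ^ k - 1) * psum k * g (n - k))"
    proof (intro sum.cong refl)
      fix k assume k: "k \<in> {1..n}"
      then have s: "(-1 :: complex) ^ n = (-1) ^ k * (-1) ^ (n - k)" by (simp flip: power_add)
      have "\<phi> (const_mps (1 - (1 / t) ^ k) * psum k * Gser (n - k)) =
          const_mps (1 - (1 / t) ^ k) * \<phi> (psum k) * \<phi> (Gser (n - k))"
        by (simp only: mult[OF cG G] mult[OF Sym_closed(1) psum_Sym] const)
      then have "const_mps ((-1) ^ n) * \<phi> (const_mps (1 - (1 / t) ^ k) * psum k * Gser (n - k)) =
         (const_mps ((-1) ^ k * (1 - (1 / t) ^ k)) * \<phi> (psum k)) * g (n - k)"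
        unfolding s g_def by (simp add: const_mps_simps(4) mult_ac)
      then show "const_mps ((-1) ^ n) * \<phi> (const_mps (1 - (1 / t) ^ k) * psum k * Gser (n - k)) =
         const_mps ((1 / t) ^ k - 1) * psum k * g (n - k)"
        using psum[of k] k by simp
    qed
    also have "\<dots> = (\<Sum>k\<le>n. (if k = 0 then 0 else const_mps ((1 / t) ^ k - 1) * psum k) * g (n - k))"
      by (rule sum.mono_neutral_cong_left) auto
    finally show ?thesis by (simp add: g_def mult_ac)
  qed
  let ?H = "\<lambda>c. Abs_fps (\<lambda>n. const_mps (c ^ n) * hsym n)"
  let ?P = "\<lambda>c. Abs_fps (\<lambda>k. if k = 0 then 0 else const_mps (c ^ k) * psum k)"
  let ?C = "Abs_fps (\<lambda>k. if k = 0 then 0 else const_mps ((1 / t) ^ k - 1) * psum k)"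
  have g0: "g 0 = 1"
    using const[of 1] by (simp add: g_def Gser_0 const_mps_simps)
  have "theta (Abs_fps g) = ?C * Abs_fps g"
    unfolding theta_eq_iff using newton by simp
  \<comment> \<open>Multiplication by H(u) adds its power sums, which turns the coefficients t^(-k)
    - 1 into t^(-k).\<close>
  then have "theta (Abs_fps g * ?H 1) = (?C + ?P 1) * (Abs_fps g * ?H 1)"
    unfolding theta_mult theta_hsym_scaled by (simp add: algebra_simps)
  also have "?C + ?P 1 = ?P (1 / t)"
    by (rule fps_ext) (simp add: const_mps_simps left_diff_distrib)
  finally have "theta (Abs_fps g * ?H 1) = ?P (1 / t) * (Abs_fps g * ?H 1)" .
  from theta_unique[OF this theta_hsym_scaled]
  have "Abs_fps g * ?H 1 = ?H (1 / t)"
    by (simp add: g0 hsym_0)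
  then have "(Abs_fps g * ?H 1) $ n = ?H (1 / t) $ n" by (rule arg_cong)
  then have "(\<Sum>i\<le>n. g (n - i) * hsym i) = const_mps ((1 / t) ^ n) * hsym n"
    unfolding mult.commute[of "Abs_fps g"]
    by (simp add: fps_mult_nth atLeast0AtMost const_mps_simps mult.commute)
  \<comment> \<open>The summand i = n is \<open>g 0 * hsym n = hsym n\<close>; it is the source of
    the -1 in the coefficient of \<open>hsym n\<close>.\<close>
  also have "(\<Sum>i\<le>n. g (n - i) * hsym i) = g n + (\<Sum>i=1..n-1. g (n - i) * hsym i) + hsym n"
  proof -
    have "{..n} = insert 0 (insert n {1..n-1})" using n by auto
    then show ?thesis using n by (simp add: g0 hsym_0 algebra_simps)
  qed
  finally show ?thesis
    by (simp add: algebra_simps const_mps_power)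
qed

end


section \<open>Characters of the multiplicative groups\<close>

definition exact_order :: "'b::monoid_mult \<Rightarrow> nat \<Rightarrow> bool" where
  "exact_order g d \<longleftrightarrow> (\<forall>k. g ^ k = 1 \<longleftrightarrow> d dvd k)"

lemma power_gcd_eq_1:
  fixes w :: "'b::field"
  assumes "w ^ a = 1" "w ^ b = 1"
  shows "w ^ gcd a b = 1"
proof (cases "a = 0")
  case False
  obtain x y where xy: "a * x = b * y + gcd a b"
    using bezout_nat[OF False, of b] by blast
  have 1: "w ^ (a * x) = 1" "w ^ (b * y) = 1" by (simp_all add: power_mult assms)
  show ?thesis using 1(1) unfolding xy power_add 1(2) by simp
qed (use assms in simp)

text \<open>Raising a relation (g h)^k = 1 to the power b, or a, removes one factor; coprimality
  then yields a | k and b | k.\<close>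

lemma exact_order_mult:
  fixes g h :: "'b::field"
  assumes "exact_order g a" "exact_order h b" "coprime a b"
  shows "exact_order (g * h) (a * b)"
  unfolding exact_order_def
proof safe
  have ga: "g ^ a = 1" and hb: "h ^ b = 1" using assms by (simp_all add: exact_order_def)
  fix k
  show "(g * h) ^ k = 1" if "a * b dvd k"
  proof -
    have "a dvd k" "b dvd k" by (rule dvd_mult_left[OF that], rule dvd_mult_right[OF that])
    then have "g ^ k = 1" "h ^ k = 1" using assms by (simp_all add: exact_order_def)
    then show ?thesis by (simp add: power_mult_distrib)
  qed
  assume 1: "(g * h) ^ k = 1"
  have "g ^ (b * k) * h ^ (b * k) = 1"
    unfolding power_mult_distrib[symmetric] unfolding mult.commute[of b k] power_mult 1 by simp
  moreover have "h ^ (b * k) = 1" unfolding power_mult hb by simp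
  ultimately have "g ^ (b * k) = 1" by simp
  then have "a dvd b * k" using assms(1) by (simp add: exact_order_def)
  then have "a dvd k" by (rule coprime_dvd_mult_right_iff[OF assms(3), THEN iffD1])
  have "g ^ (a * k) * h ^ (a * k) = 1"
    unfolding power_mult_distrib[symmetric] unfolding mult.commute[of a k] power_mult 1 by simp
  moreover have "g ^ (a * k) = 1" unfolding power_mult ga by simp
  ultimately have "h ^ (a * k) = 1" by simp
  then have "b dvd a * k" using assms(2) by (simp add: exact_order_def)
  then have "b dvd k" by (rule coprime_dvd_mult_right_iff[OF coprime_commute[THEN iffD1, OF assms(3)], THEN iffD1])
  show "a * b dvd k" using \<open>a dvd k\<close> \<open>b dvd k\<close> assms(3) by (rule divides_mult)
qed

lemma card_roots_of_unity_le:
  fixes N :: nat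
  assumes "N > 0"
  shows "card {z :: 'b::field. z ^ N = 1} \<le> N" "finite {z :: 'b::field. z ^ N = 1}"
proof -
  let ?p = "monom (1 :: 'b) N - 1"
  have nz: "?p \<noteq> 0"
  proof
    assume "?p = 0"
    then have "coeff ?p N = 0" by simp
    then show False using assms by simp
  qed
  have eq: "{z. z ^ N = 1} = {z. poly ?p z = 0}" by (simp add: poly_monom)
  show "finite {z :: 'b. z ^ N = 1}" unfolding eq by (rule poly_roots_finite[OF nz])
  have "card {z. poly ?p z = 0} \<le> degree ?p" by (rule card_poly_roots_bound[OF nz])
  also have "degree ?p \<le> N" by (rule degree_diff_le) (simp_all add: degree_monom_le)
  finally show "card {z :: 'b. z ^ N = 1} \<le> N" unfolding eq .
qed

text \<open>At most N/r elements satisfy z^(N/r) = 1, so some z with z^N = 1 does not. Its power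
  with exponent N / r^(e+1) has order exactly r^(e+1).\<close>

lemma ex_exact_order_prime_power:
  fixes N :: nat
  assumes N: "N > 0" "card {z :: 'b::field. z ^ N = 1} = N" and r: "prime r" and e: "r ^ Suc e dvd N"
  shows "\<exists>w :: 'b. exact_order w (r ^ Suc e)"
proof -
  have r1: "r > 1" using r prime_gt_1_nat by blast
  have "r dvd N" by (rule dvd_trans[OF _ e]) simp
  then obtain c where c: "N = r * c" by (elim dvdE)
  have Nr: "0 < N div r" "N div r < N" using N(1) r1 by (auto simp: c)
  have "\<not> {z :: 'b. z ^ N = 1} \<subseteq> {z. z ^ (N div r) = 1}"
  proof
    assume "{z :: 'b. z ^ N = 1} \<subseteq> {z. z ^ (N div r) = 1}"
    then have "card {z :: 'b. z ^ N = 1} \<le> card {z :: 'b. z ^ (N div r) = 1}"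
      by (intro card_mono card_roots_of_unity_le Nr)
    then show False using N(2) card_roots_of_unity_le(1)[OF Nr(1), where 'b = 'b] Nr(2) by linarith
  qed
  then obtain z :: 'b where z: "z ^ N = 1" "z ^ (N div r) \<noteq> 1" by blast
  define M where "M = N div r ^ Suc e"
  have NM: "N = M * r ^ Suc e" using e by (simp add: M_def)
  have "N div r = M * r ^ e" using NM r1 by simp
  define w where "w = z ^ M"
  have w1: "w ^ (r ^ Suc e) = 1" using z(1) NM by (simp add: w_def power_mult)
  have w2: "w ^ (r ^ e) \<noteq> 1" using z(2) \<open>N div r = M * r ^ e\<close> by (simp add: w_def power_mult)
  have "exact_order w (r ^ Suc e)"
    unfolding exact_order_def
  proof safe
    fix k
    show "w ^ k = 1" if "r ^ Suc e dvd k"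
      using that w1 by (auto simp: power_mult elim!: dvdE)
    assume k: "w ^ k = 1"
    \<comment> \<open>The gcd is a power of r. If it were smaller than r^(e+1), then w^(r^e) would
      already be 1.\<close>
    obtain f where f: "f \<le> Suc e" "gcd k (r ^ Suc e) = r ^ f"
      using divides_primepow_nat[OF r, THEN iffD1, OF gcd_dvd2] by blast
    have wf: "w ^ (r ^ f) = 1" using power_gcd_eq_1[OF k w1] f by simp
    have "f = Suc e"
    proof (rule ccontr)
      assume "f \<noteq> Suc e"
      then have "r ^ e = r ^ f * r ^ (e - f)" using f(1) by (simp flip: power_add)
      then have "w ^ (r ^ e) = 1" using wf by (simp add: power_mult)
      then show False using w2 by simp
    qed
    then have "gcd k (r ^ Suc e) = r ^ Suc e" using f(2) by simp
    then show "r ^ Suc e dvd k" using gcd_dvd1[of k "r ^ Suc e"] by (simp only:)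
  qed
  then show ?thesis by blast
qed

text \<open>Elements whose orders are the full prime powers in N have coprime orders, so their
  product has order N and generates the N-th roots of unity.\<close>

lemma ex_exact_order:
  fixes N :: nat
  assumes N: "N > 0" "card {z :: 'b::field. z ^ N = 1} = N"
  shows "\<exists>g :: 'b. exact_order g N"
proof -
  have "\<exists>g :: 'b. exact_order g (\<Prod>p\<in>S. p ^ multiplicity p N)"
    if "finite S" "S \<subseteq> prime_factors N" for S
    using that
  proof (induction S rule: finite_induct)
    case empty
    then show ?case by (intro exI[of _ 1]) (simp add: exact_order_def)
  next
    case (insert r S)
    have r: "prime r" "r dvd N" using insert.prems N(1) by (auto simp: prime_factors_dvd)
    then have "multiplicity r N > 0" using N(1) by (simp add: prime_multiplicity_gt_zero_iff)
    then obtain e where e: "multiplicity r N = Suc e" using gr0_implies_Suc by blast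
    have "r ^ Suc e dvd N" using multiplicity_dvd[of r N] e by simp
    then obtain w :: 'b where w: "exact_order w (r ^ multiplicity r N)"
      unfolding e using ex_exact_order_prime_power[OF N r(1)] by blast
    obtain g :: 'b where g: "exact_order g (\<Prod>p\<in>S. p ^ multiplicity p N)" using insert by auto
    have "coprime (r ^ multiplicity r N) (\<Prod>p\<in>S. p ^ multiplicity p N)"
    proof (intro prod_coprime_right)
      fix p assume p: "p \<in> S"
      then have "prime p" "p \<noteq> r" using insert by (auto simp: prime_factors_dvd)
      then show "coprime (r ^ multiplicity r N) (p ^ multiplicity p N)"
        using r(1) by (simp add: primes_coprime)
    qed
    from exact_order_mult[OF w g this] show ?case using insert by auto
  qed
  from this[of "prime_factors N"] show ?thesis
    using prime_factorization_nat[OF N(1)] by simp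
qed

lemma power_swap: "(z ^ a) ^ b = (z ^ b) ^ (a :: nat)" for z :: "'b::monoid_mult"
  by (simp only: power_mult[symmetric] mult.commute)

lemma power_eq_imp:
  fixes g :: "'b::field"
  assumes "g ^ i = g ^ j" "i \<le> j" "g \<noteq> 0"
  shows "g ^ (j - i) = 1"
proof -
  have "g ^ j = g ^ i * g ^ (j - i)" using assms(2) by (simp flip: power_add)
  then show ?thesis using assms by simp
qed

lemma exact_order_powers:
  fixes g :: "'b::field"
  assumes g: "exact_order g N" and N: "N > 0"
  shows "{z. z ^ N = 1} = (\<lambda>i. g ^ i) ` {..<N}" "inj_on (\<lambda>i. g ^ i) {..<N}"
proof -
  have gN: "g ^ N = 1" using g by (simp add: exact_order_def)
  then have gnz: "g \<noteq> 0" using N by (auto simp: power_0_left)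
  have le: "i = j" if "i \<le> j" "j < N" "g ^ i = g ^ j" for i j
  proof -
    have "g ^ (j - i) = 1" by (rule power_eq_imp) (use that gnz in auto)
    then have "N dvd j - i" using g by (simp add: exact_order_def)
    then show "i = j" using that by (auto dest: dvd_imp_le)
  qed
  show inj: "inj_on (\<lambda>i. g ^ i) {..<N}"
  proof (rule inj_onI)
    fix i j assume "i \<in> {..<N}" "j \<in> {..<N}" "g ^ i = g ^ j"
    then show "i = j" using le[of i j] le[of j i] by (cases "i \<le> j") auto
  qed
  have "(\<lambda>i. g ^ i) ` {..<N} \<subseteq> {z. z ^ N = 1}"
    using gN by (auto simp: power_swap[of g _ N])
  moreover have "card {z :: 'b. z ^ N = 1} \<le> card ((\<lambda>i. g ^ i) ` {..<N})"
    using card_roots_of_unity_le(1)[OF N] by (simp add: card_image[OF inj])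
  ultimately show "{z. z ^ N = 1} = (\<lambda>i. g ^ i) ` {..<N}"
    using card_seteq[OF card_roots_of_unity_le(2)[OF N]] by blast
qed

text \<open>A double root x of X^N - 1 would be a root of the derivative N X^(N-1), which is
  impossible since N is nonzero in the field and so is x.\<close>

lemma card_roots_of_unity_alg_closed:
  fixes N :: nat
  assumes N: "N > 0" "of_nat N \<noteq> (0 :: 'b::alg_closed_field)"
  shows "card {z :: 'b. z ^ N = 1} = N"
proof -
  let ?p = "monom (1 :: 'b) N - 1"
  have deg: "degree ?p = N"
    using N degree_add_eq_left[of "- 1" "monom (1 :: 'b) N"] by (simp add: degree_monom_eq)
  have lc: "lead_coeff ?p = 1" using N(1) unfolding deg by simp
  have nz: "?p \<noteq> 0" using N(1) deg by auto
  obtain A where A: "size A = N" "?p = (\<Prod>x\<in>#A. [:-x, 1:])"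
    using alg_closed_imp_factorization[OF nz] unfolding deg lc[unfolded deg] by auto
  have roots: "set_mset A = {z. z ^ N = 1}"
  proof -
    have "z \<in># A \<longleftrightarrow> poly ?p z = 0" for z
      unfolding A(2) by (auto simp: poly_prod_mset prod_mset_zero_iff)
    then show ?thesis by (auto simp: poly_monom)
  qed
  have "count A x = 1" if x: "x \<in># A" for x
  proof (rule ccontr)
    assume "count A x \<noteq> 1"
    then have "count A x \<ge> 2" using x by (simp add: count_greater_zero_iff[symmetric] del: count_greater_zero_iff)
    then have "{#x, x#} \<subseteq># A" by (auto simp: subseteq_mset_def)
    then obtain B where "A = {#x, x#} + B" by (auto simp: mset_subset_eq_exists_conv)
    then have "?p = [:-x, 1:] * ([:-x, 1:] * (\<Prod>x\<in>#B. [:-x, 1:]))" using A(2) by (simp add: mult.assoc)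
    then have "poly (pderiv ?p) x = 0"
      by (simp only: pderiv_mult poly_mult poly_add) simp
    moreover have "pderiv ?p = monom (of_nat N) (N - 1)"
      by (simp add: pderiv_diff pderiv_monom)
    moreover have "x ^ N = 1" using roots x by auto
    then have "x \<noteq> 0" using N(1) by (auto simp: power_0_left)
    ultimately show False using N(2) by (simp add: poly_monom)
  qed
  then have "size A = card (set_mset A)" by (simp add: size_multiset_overloaded_eq)
  then show ?thesis using A(1) roots by simp
qed

text \<open>The translation by 1 permutes the ring, so adding 1 to every element does not change the
  sum of all elements.\<close>

lemma of_nat_card_UNIV: "of_nat CARD('a) = (0 :: 'a::{ring_1,finite})"
proof -
  have "(\<Sum>x\<in>UNIV. x + 1) = (\<Sum>x\<in>UNIV. x :: 'a)"
    by (rule sum.reindex_bij_witness[of _ "\<lambda>x. x - 1" "\<lambda>x. x + 1"]) auto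
  then show ?thesis by (simp add: sum.distrib)
qed

lemma card_ge_2: "CARD('a::{field,finite}) \<ge> 2"
proof -
  have "card {0, 1 :: 'a} \<le> CARD('a)" by (intro card_mono) auto
  then show ?thesis by simp
qed

section \<open>The groups M_n and their characters\<close>

context
  fixes n :: nat and N :: nat
  assumes n: "n \<ge> 1" and N_def: "N = CARD('a::{field,finite}) ^ n - 1"
begin

lemma N_pos: "N > 0"
proof -
  have "CARD('a) ^ n > 1" using card_ge_2[where 'a = 'a] n by (intro one_less_power) auto
  then show ?thesis by (simp add: N_def)
qed

lemma M_grp_eq: "(M_grp n :: 'a alg_closure set) = {z. z ^ N = 1}"
proof -
  have "CARD('a) ^ n = Suc N" using N_pos by (simp add: N_def)
  then show ?thesis unfolding M_grp_def using N_pos by (auto simp: power_0_left)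
qed

text \<open>q is 0 in the field, so N = q^n - 1 is -1 there, and X^N - 1 has N distinct
  roots.\<close>

lemma card_M_grp: "card (M_grp n :: 'a alg_closure set) = N"
  unfolding M_grp_eq
proof (rule card_roots_of_unity_alg_closed[OF N_pos])
  have "of_nat CARD('a) = (0 :: 'a alg_closure)"
    using arg_cong[OF of_nat_card_UNIV[where 'a = 'a], of to_ac] by simp
  then have "of_nat (CARD('a) ^ n) = (0 :: 'a alg_closure)" using n by simp
  moreover have "CARD('a) ^ n = N + 1" using N_pos by (simp add: N_def)
  ultimately have "of_nat N + (1 :: 'a alg_closure) = 0" by (metis of_nat_1 of_nat_add)
  then show "of_nat N \<noteq> (0 :: 'a alg_closure)" by auto
qed

lemma finite_M_grp: "finite (M_grp n :: 'a alg_closure set)"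
  using card_M_grp N_pos by (intro card_ge_0_finite) simp

lemma M_grp_mult: "z \<in> M_grp n \<Longrightarrow> w \<in> M_grp n \<Longrightarrow> z * w \<in> (M_grp n :: 'a alg_closure set)"
  unfolding M_grp_eq by (simp add: power_mult_distrib)

lemma M_grp_power: "z \<in> M_grp n \<Longrightarrow> z ^ k \<in> (M_grp n :: 'a alg_closure set)"
  unfolding M_grp_eq by (simp add: power_swap[of z k N])

lemma one_M_grp: "1 \<in> (M_grp n :: 'a alg_closure set)"
  unfolding M_grp_eq by simp

lemma M_dual_one: "x \<in> M_dual n \<Longrightarrow> x (1 :: 'a alg_closure) = 1"
proof -
  assume "x \<in> M_dual n"
  then have "x (1 * 1) = x 1 * x 1" "x 1 \<noteq> 0" using one_M_grp unfolding M_dual_def by blast+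
  then show ?thesis by simp
qed

lemma M_dual_power:
  assumes x: "x \<in> M_dual n" and z: "z \<in> (M_grp n :: 'a alg_closure set)"
  shows "x (z ^ k) = x z ^ k"
proof (induction k)
  case 0
  then show ?case using M_dual_one[OF x] by simp
next
  case (Suc k)
  have "x (z * z ^ k) = x z * x (z ^ k)"
    using x z M_grp_power[OF z, of k] unfolding M_dual_def by blast
  then show ?case using Suc by simp
qed

lemma M_dual_roots:
  assumes x: "x \<in> M_dual n" and z: "z \<in> (M_grp n :: 'a alg_closure set)"
  shows "x z ^ N = 1" "x z ^ (CARD('a) ^ n) = x z"
proof -
  have "z ^ N = 1" using z M_grp_eq by auto
  then show 1: "x z ^ N = 1" using M_dual_power[OF x z, of N] M_dual_one[OF x] by simp
  have "CARD('a) ^ n = Suc N" using N_pos by (simp add: N_def)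
  then show "x z ^ (CARD('a) ^ n) = x z" using 1 by simp
qed

text \<open>A character is determined by its value at a generator g, and every N-th root of unity a
  occurs as such a value. For z = g^i the sum is therefore that of a^i over all these a.\<close>

lemma sum_M_dual:
  assumes z: "z \<in> (M_grp n :: 'a alg_closure set)"
  shows "(\<Sum>x\<in>M_dual n. x z) = (if z = 1 then of_nat N else 0)"
proof -
  obtain g :: "'a alg_closure" where g: "exact_order g N"
    using ex_exact_order[OF N_pos] card_M_grp unfolding M_grp_eq by blast
  note gp = exact_order_powers[OF g N_pos]
  obtain om :: complex where om: "exact_order om N"
    using ex_exact_order[OF N_pos card_roots_unity_eq[OF N_pos]] by blast
  have gM: "g ^ i \<in> M_grp n" for i
  proof -
    have "g \<in> M_grp n" using g unfolding M_grp_eq exact_order_def by auto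
    then show ?thesis by (rule M_grp_power)
  qed
  \<comment> \<open>The discrete logarithm to the base g.\<close>
  define dl where "dl z = (THE i. i < N \<and> g ^ i = z)" for z
  have dl: "dl z < N \<and> g ^ dl z = z" if "z \<in> M_grp n" for z
  proof -
    obtain i where i: "i < N" "g ^ i = z" using \<open>z \<in> M_grp n\<close> gp(1) unfolding M_grp_eq by auto
    show ?thesis unfolding dl_def
    proof (rule theI[of _ i])
      show "i < N \<and> g ^ i = z" using i by simp
      show "j = i" if "j < N \<and> g ^ j = z" for j
        using that i inj_onD[OF gp(2), of j i] by simp
    qed
  qed
  \<comment> \<open>A power of an N-th root of unity depends only on the exponent modulo N, hence
    only on the corresponding power of g. This makes \<open>?ch a\<close> multiplicative.\<close>
  have gmod: "a ^ i = a ^ j" if "g ^ i = g ^ j" "a ^ N = 1" for i j and a :: complex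
  proof -
    have main: "a ^ i = a ^ j" if "i \<le> j" "g ^ i = g ^ j" for i j
    proof -
      have "g \<noteq> 0" using gM[of 1] unfolding M_grp_def by simp
      have "g ^ (j - i) = 1" by (rule power_eq_imp) (use that \<open>g \<noteq> 0\<close> in auto)
      then have "N dvd j - i" using g by (simp add: exact_order_def)
      then have "a ^ (j - i) = 1" using \<open>a ^ N = 1\<close> by (auto simp: power_mult elim!: dvdE)
      then have "a ^ i * a ^ (j - i) = a ^ i" by simp
      then have "a ^ (i + (j - i)) = a ^ i" by (simp only: power_add)
      then show ?thesis using that(1) by simp
    qed
    show ?thesis
    proof (cases "i \<le> j")
      case True
      then show ?thesis using that(1) by (rule main)
    next
      case False
      then show ?thesis by (intro main[symmetric] that(1)[symmetric]) simp
    qed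
  qed
  let ?ch = "\<lambda>a z. if z \<in> M_grp n then a ^ dl z else (0 :: complex)"
  have "(\<Sum>x\<in>M_dual n. x z) = (\<Sum>a\<in>{a. a ^ N = 1}. a ^ dl z)"
  proof (rule sum.reindex_bij_witness[of _ ?ch "\<lambda>x. x g"])
    fix x :: "'a alg_closure \<Rightarrow> complex" assume x: "x \<in> M_dual n"
    show "?ch (x g) = x"
    proof
      fix z show "?ch (x g) z = x z"
      proof (cases "z \<in> M_grp n")
        case True
        then show ?thesis using M_dual_power[OF x, of g "dl z"] gM[of 1] dl[OF True] by simp
      next
        case False
        then show ?thesis using x unfolding M_dual_def by auto
      qed
    qed
    show "x g \<in> {a. a ^ N = 1}" using M_dual_roots(1)[OF x, of g] gM[of 1] by simp
    show "x g ^ dl z = x z" using M_dual_power[OF x, of g "dl z"] gM[of 1] dl[OF z] by simp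
  next
    fix a :: complex assume "a \<in> {a. a ^ N = 1}"
    then have a: "a ^ N = 1" by simp
    then have anz: "a \<noteq> 0" using N_pos by (auto simp: power_0_left)
    have "a ^ dl g = a ^ 1" using dl[OF gM[of 1]] by (intro gmod a) simp
    then show "?ch a g = a" using gM[of 1] by simp
    have "a ^ dl (z * w) = a ^ dl z * a ^ dl w" if "z \<in> M_grp n" "w \<in> M_grp n" for z w
      unfolding power_add[symmetric]
      using dl[OF that(1)] dl[OF that(2)] dl[OF M_grp_mult[OF that]] by (intro gmod a) (simp add: power_add)
    then show "?ch a \<in> M_dual n" using anz M_grp_mult unfolding M_dual_def by simp
  qed
  also have "\<dots> = (if z = 1 then of_nat N else 0)"
  proof (cases "z = 1")
    case True
    have "dl z = 0" using dl[OF z] True inj_onD[OF gp(2), of "dl z" 0] N_pos by simp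
    then show ?thesis using True card_roots_unity_eq[OF N_pos] by simp
  next
    case False
    have om1: "om ^ dl z \<noteq> 1"
    proof
      assume "om ^ dl z = 1"
      then have "N dvd dl z" using om by (simp add: exact_order_def)
      then have "dl z = 0" using dl[OF z] by (auto dest: dvd_imp_le)
      then show False using dl[OF z] False by simp
    qed
    have omN: "om ^ N = 1" using om by (simp add: exact_order_def)
    then have omnz: "om \<noteq> 0" using N_pos by (auto simp: power_0_left)
    \<comment> \<open>Replacing a by \<open>om * a\<close> multiplies the sum by a factor different
      from 1, so it is 0.\<close>
    have "(\<Sum>a\<in>{a. a ^ N = 1}. a ^ dl z) = (\<Sum>a\<in>{a. a ^ N = 1}. (om * a) ^ dl z)"
      by (rule sum.reindex_bij_witness[of _ "\<lambda>a. om * a" "\<lambda>a. a / om"])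
         (use omN omnz in \<open>auto simp: power_mult_distrib power_divide\<close>)
    also have "\<dots> = om ^ dl z * (\<Sum>a\<in>{a. a ^ N = 1}. a ^ dl z)"
      by (simp add: power_mult_distrib sum_distrib_left)
    finally show ?thesis using om1 False by simp
  qed
  finally show ?thesis .
qed

end

text \<open>The orbit has as many elements as the least period, which divides every period.\<close>

lemma card_range_funpow_dvd:
  assumes "(f ^^ n) x = x" "n \<ge> 1"
  shows "card (range (\<lambda>i. (f ^^ i) x)) dvd n" "card (range (\<lambda>i. (f ^^ i) x)) \<ge> 1"
proof -
  define d where "d = (LEAST d. d \<ge> 1 \<and> (f ^^ d) x = x)"
  have d: "d \<ge> 1 \<and> (f ^^ d) x = x" unfolding d_def by (rule LeastI[of _ n]) (use assms in simp)
  have min: "(f ^^ k) x \<noteq> x" if "1 \<le> k" "k < d" for k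
    using not_less_Least[of k "\<lambda>d. d \<ge> 1 \<and> (f ^^ d) x = x"] that unfolding d_def by blast
  have md: "(f ^^ (k mod d)) x = (f ^^ k) x" for k
    using d by (intro funpow_mod_eq) simp
  have "range (\<lambda>i. (f ^^ i) x) = (\<lambda>i. (f ^^ i) x) ` {..<d}"
  proof (intro antisym subsetI)
    fix y assume "y \<in> range (\<lambda>i. (f ^^ i) x)"
    then obtain i where "y = (f ^^ i) x" by auto
    then have "y = (f ^^ (i mod d)) x" using md by simp
    moreover have "i mod d < d" using d by simp
    ultimately show "y \<in> (\<lambda>i. (f ^^ i) x) ` {..<d}" by auto
  qed auto
  moreover have "inj_on (\<lambda>i. (f ^^ i) x) {..<d}"
  proof -
    have "False" if ij: "i < j" "j < d" "(f ^^ i) x = (f ^^ j) x" for i j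
    proof -
      have "(f ^^ (d - j + i)) x = (f ^^ (d - j)) ((f ^^ j) x)" by (simp only: funpow_add comp_def ij(3))
      also have "\<dots> = (f ^^ (d - j + j)) x" by (simp only: funpow_add comp_def)
      also have "\<dots> = x" using d ij by simp
      finally have "(f ^^ (d - j + i)) x = x" .
      moreover have "1 \<le> d - j + i" "d - j + i < d" using ij by auto
      ultimately show False using min by blast
    qed
    then show ?thesis by (intro linorder_inj_onI) auto
  qed
  ultimately have c: "card (range (\<lambda>i. (f ^^ i) x)) = d" by (simp add: card_image)
  show "card (range (\<lambda>i. (f ^^ i) x)) \<ge> 1" using c d by simp
  have "n mod d < d" using d by simp
  then have "n mod d = 0" using min[of "n mod d"] md[of n] assms by (cases "n mod d = 0") auto
  then show "card (range (\<lambda>i. (f ^^ i) x)) dvd n" unfolding c by (rule mod_0_imp_dvd)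
qed

text \<open>The norm is the power map with exponent c = (q^(ab) - 1) / (q^a - 1). A c-th root of w
  exists in the algebraic closure and automatically lies in M_(ab).\<close>

lemma M_norm_surj:
  assumes ab: "a \<ge> 1" "b \<ge> 1" and w: "w \<in> M_grp a"
  shows "\<exists>z\<in>M_grp (a * b). M_norm (a * b) a z = (w :: 'a::{field,finite} alg_closure)"
proof -
  let ?q = "CARD('a)"
  define c where "c = (\<Sum>i<b. ?q ^ (a * i))"
  have norm: "M_norm (a * b) a z = z ^ c" for z :: "'a alg_closure"
    using ab unfolding M_norm_def c_def by (simp add: power_sum)
  have "?q ^ (a * 0) \<le> c" unfolding c_def using ab by (intro member_le_sum) auto
  then have c: "c > 0" by simp
  then obtain z where z: "z ^ c = w" using nth_root_exists[of c w] by blast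
  have "c * (?q ^ a - 1) = ?q ^ (a * b) - 1"
  proof -
    have "(?q ^ a) ^ b - 1 = (?q ^ a - 1) * (\<Sum>i<b. (?q ^ a) ^ i)"
    proof -
      have "?q ^ a > 0" using card_ge_2[where 'a = 'a] by simp
      then obtain P where P: "?q ^ a = Suc P" using gr0_implies_Suc by blast
      have "P * (\<Sum>i<b. Suc P ^ i) + 1 = Suc P ^ b"
        by (induction b) (simp_all add: algebra_simps)
      then show ?thesis unfolding P by simp
    qed
    then show ?thesis unfolding c_def power_mult[of ?q a] by (simp only: mult.commute)
  qed
  then have "z ^ (?q ^ (a * b) - 1) = w ^ (?q ^ a - 1)"
    unfolding z[symmetric] power_mult[symmetric] by simp
  also have "\<dots> = 1" using w M_grp_eq[OF ab(1) refl, where 'a = 'a] by auto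
  finally have "z \<in> M_grp (a * b)"
    using M_grp_eq[of "a * b", OF _ refl, where 'a = 'a] ab by auto
  then show ?thesis using norm z by blast
qed

section \<open>The direct limit of the dual groups and its Frobenius orbits\<close>

lemma char_rel_refl: "n \<ge> 1 \<Longrightarrow> x \<in> M_dual n \<Longrightarrow> ((n, x), (n, x)) \<in> char_rel"
  by (simp add: char_rel_def)

text \<open>Every element of M_n is a norm, so characters that agree after composition with the norm
  are equal.\<close>

lemma char_rel_unique:
  assumes "((n, x), (n, y)) \<in> char_rel"
  shows "x = y"
proof
  fix w
  have *: "n \<ge> 1" "x \<in> M_dual n" "y \<in> M_dual n"
    "\<forall>z\<in>M_grp (n * n). x (M_norm (n * n) n z) = y (M_norm (n * n) n z)"
    using assms by (auto simp: char_rel_def)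
  show "x w = y w"
  proof (cases "w \<in> M_grp n")
    case True
    then show ?thesis using M_norm_surj[OF *(1) *(1) True] *(4) by blast
  next
    case False
    then show ?thesis using *(2,3) by (simp add: M_dual_def)
  qed
qed

lemma char_frob_funpow:
  "(char_frob ^^ i) \<xi> = (\<lambda>(m, y). (m, \<lambda>z. y z ^ (CARD('a) ^ i))) ` (\<xi> :: 'a::{field,finite} lchar)"
proof (induction i)
  case (Suc i)
  show ?case
    unfolding funpow.simps comp_def Suc.IH unfolding char_frob_def
    by (simp add: image_image case_prod_unfold power_mult[symmetric] mult.commute)
qed simp

context
  fixes n :: nat and x :: "'a::{field,finite} alg_closure \<Rightarrow> complex"
  assumes n: "n \<ge> 1" and x: "x \<in> M_dual n"
begin

text \<open>Values of x are fixed by the power q^n. By surjectivity of the norm every other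
  representative of the class takes only values of x on its group, so it is fixed too; outside the
  groups the value 0 is kept.\<close>

lemma char_frob_period: "(char_frob ^^ n) (char_rel `` {(n, x)}) = char_rel `` {(n, x)}"
proof -
  have "(m, \<lambda>z. y z ^ (CARD('a) ^ n)) = (m, y)" if "((n, x), (m, y)) \<in> char_rel" for m y
  proof -
    have *: "m \<ge> 1" "y \<in> M_dual m" "\<forall>z\<in>M_grp (n * m). x (M_norm (n * m) n z) = y (M_norm (n * m) m z)"
      using that by (auto simp: char_rel_def)
    have xq: "x u ^ (CARD('a) ^ n) = x u" for u
    proof (cases "u \<in> M_grp n")
      case True
      then show ?thesis using M_dual_roots(2)[OF n refl x] by simp
    next
      case False
      then have "x u = 0" using x by (simp add: M_dual_def)
      then show ?thesis using card_ge_2[where 'a = 'a] by simp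
    qed
    have "y w ^ (CARD('a) ^ n) = y w" for w
    proof (cases "w \<in> M_grp m")
      case True
      then obtain z where "z \<in> M_grp (m * n)" "M_norm (m * n) m z = w" using M_norm_surj[OF *(1) n] by blast
      then have "y w = x (M_norm (n * m) n z)" using *(3) by (simp add: mult.commute)
      then show ?thesis using xq by simp
    next
      case False
      then have "y w = 0" using *(2) by (simp add: M_dual_def)
      then show ?thesis using card_ge_2[where 'a = 'a] by simp
    qed
    then show ?thesis by simp
  qed
  then have "(\<lambda>(m, y). (m, \<lambda>z. y z ^ (CARD('a) ^ n))) ` (char_rel `` {(n, x)}) = id ` (char_rel `` {(n, x)})"
    by (intro image_cong) auto
  then show ?thesis by (simp add: char_frob_funpow)
qed

text \<open>For each character of M_n this supplies an orbit whose size divides n, so that the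
  defining relation of \<open>T\<close> applies with k = n / d(\<phi>).\<close>

lemma Theta_of_char:
  defines "\<phi> \<equiv> range (\<lambda>i. (char_frob ^^ i) (char_rel `` {(n, x)}))"
  shows "\<phi> \<in> Theta" "char_rel `` {(n, x)} \<in> \<phi>" "card \<phi> dvd n" "card \<phi> \<ge> 1"
    "char_val (char_rel `` {(n, x)}) n z = x z"
proof -
  have "char_rel `` {(n, x)} \<in> char_limit"
    unfolding char_limit_def using n x by (intro quotientI) simp
  then show "\<phi> \<in> Theta" unfolding Theta_def \<phi>_def by (rule imageI)
  have "(char_frob ^^ 0) (char_rel `` {(n, x)}) \<in> \<phi>" unfolding \<phi>_def by (rule rangeI)
  then show "char_rel `` {(n, x)} \<in> \<phi>" by simp
  show "card \<phi> dvd n" "card \<phi> \<ge> 1"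
    unfolding \<phi>_def by (rule card_range_funpow_dvd[OF char_frob_period n])+
  have "(THE y. (n, y) \<in> char_rel `` {(n, x)}) = x"
  proof (rule the_equality)
    show "(n, x) \<in> char_rel `` {(n, x)}" using char_rel_refl[OF n x] by simp
    show "y = x" if "(n, y) \<in> char_rel `` {(n, x)}" for y
      using char_rel_unique[of n x y] that by simp
  qed
  then show "char_val (char_rel `` {(n, x)}) n z = x z" by (simp add: char_val_def)
qed

end

section \<open>Evaluation of polynomials at z and the polynomial f_z\<close>

context
  fixes z :: "'a::{field,finite} alg_closure"
begin

definition ev_ac :: "'a poly \<Rightarrow> 'a alg_closure" where
  "ev_ac p = poly (map_poly to_ac p) z"

lemma ev_ac_pCons: "ev_ac (pCons a p) = to_ac a + z * ev_ac p"
  by (simp add: ev_ac_def map_poly_pCons)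

lemma ev_ac_0: "ev_ac 0 = 0"
  by (simp add: ev_ac_def)

lemma ev_ac_add: "ev_ac (p + q) = ev_ac p + ev_ac q"
  by (induction p q rule: poly_induct2) (simp_all add: ev_ac_pCons ev_ac_0 algebra_simps)

lemma ev_ac_smult: "ev_ac (smult c p) = to_ac c * ev_ac p"
  by (induction p) (simp_all add: ev_ac_pCons ev_ac_0 algebra_simps)

lemma ev_ac_mult: "ev_ac (p * q) = ev_ac p * ev_ac q"
  by (induction p) (simp_all add: ev_ac_pCons ev_ac_0 ev_ac_add ev_ac_smult algebra_simps)

lemma ev_ac_unit: "p dvd 1 \<Longrightarrow> ev_ac p \<noteq> 0"
proof
  assume "p dvd 1" "ev_ac p = 0"
  then obtain r where "1 = p * r" by (elim dvdE)
  have "ev_ac (p * r) = 0" using \<open>ev_ac p = 0\<close> by (simp add: ev_ac_mult)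
  then have "ev_ac 1 = 0" by (simp only: \<open>1 = p * r\<close>)
  moreover have "ev_ac 1 = 1" using ev_ac_pCons[of 1 0] by (simp add: ev_ac_0 one_pCons)
  ultimately show False by simp
qed

lemma minimal_polynomial:
  obtains m where "m \<noteq> 0" "ev_ac m = 0" "\<And>p. ev_ac p = 0 \<Longrightarrow> m dvd p"
proof -
  obtain p0 :: "'a poly" where p0: "p0 \<noteq> 0" "ev_ac p0 = 0"
    using alg_closure_algebraic[of z] unfolding ev_ac_def by blast
  define m where "m = arg_min degree (\<lambda>p. p \<noteq> 0 \<and> ev_ac p = 0)"
  have m: "m \<noteq> 0" "ev_ac m = 0"
    using arg_min_natI[of "\<lambda>p. p \<noteq> 0 \<and> ev_ac p = 0" p0 degree] p0 unfolding m_def by blast+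
  have min: "degree m \<le> degree p" if "p \<noteq> 0" "ev_ac p = 0" for p
    using arg_min_nat_le[of "\<lambda>p. p \<noteq> 0 \<and> ev_ac p = 0" p degree] that unfolding m_def by blast
  show ?thesis
  proof (rule that[OF m])
    fix p assume p: "ev_ac p = 0"
    have "ev_ac (p div m * m + p mod m) = 0" using p by simp
    then have "ev_ac (p mod m) = 0" using m(2) by (simp only: ev_ac_add ev_ac_mult) simp
    then have "p mod m = 0" using min[of "p mod m"] degree_mod_less'[of m p] m(1) by fastforce
    then show "m dvd p" by (rule mod_0_imp_dvd)
  qed
qed

text \<open>Both polynomials are irreducible multiples of the minimal polynomial of z, hence
  constant multiples of it, and they are monic.\<close>

lemma Phi_unique:
  assumes f: "f \<in> Phi" "ev_ac f = 0" and g: "g \<in> Phi" "ev_ac g = 0"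
  shows "f = g"
proof -
  obtain m where m: "m \<noteq> 0" "ev_ac m = 0" "\<And>p. ev_ac p = 0 \<Longrightarrow> m dvd p"
    using minimal_polynomial by blast
  have "\<exists>c. f = smult c m" if f: "f \<in> Phi" "ev_ac f = 0" for f
  proof -
    obtain u where u: "f = m * u" using m(3)[OF f(2)] by (elim dvdE)
    have "irreducible f" using f(1) by (simp add: Phi_def)
    then have "m dvd 1 \<or> u dvd 1" by (rule irreducibleD) (fact u)
    then have "u dvd 1" using ev_ac_unit[of m] m(2) by blast
    then obtain c where "u = [:c:]" by (auto simp: is_unit_poly_iff)
    then show ?thesis using u by auto
  qed
  then obtain c d where cd: "f = smult c m" "g = smult d m" using f g by meson
  have "lead_coeff f = 1" "lead_coeff g = 1" using f(1) g(1) by (auto simp: Phi_def)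
  then have "c * lead_coeff m = 1" "d * lead_coeff m = 1" unfolding cd lead_coeff_smult .
  then have "c = d" by (metis m(1) leading_coeff_0_iff mult_right_cancel)
  then show ?thesis using cd by simp
qed

text \<open>The normalised minimal polynomial. It is not x because z is nonzero.\<close>

lemma ex_Phi_root:
  assumes "z \<noteq> 0"
  shows "\<exists>f\<in>Phi. ev_ac f = 0"
proof -
  obtain m where m: "m \<noteq> 0" "ev_ac m = 0" "\<And>p. ev_ac p = 0 \<Longrightarrow> m dvd p"
    using minimal_polynomial by blast
  define f where "f = smult (inverse (lead_coeff m)) m"
  have f0: "ev_ac f = 0" using m(2) by (simp add: f_def ev_ac_smult)
  have fm: "f \<noteq> 0" "degree f = degree m" using m(1) by (auto simp: f_def)
  have unit: "b dvd 1" if "f = a * b" "ev_ac a = 0" for a b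
  proof -
    have nz: "a \<noteq> 0" "b \<noteq> 0" using that(1) fm(1) by auto
    have "degree m \<le> degree a" using m(3)[OF that(2)] nz by (intro dvd_imp_degree_le)
    moreover have "degree m = degree a + degree b" using fm(2) that(1) nz by (simp add: degree_mult_eq)
    ultimately have "degree b = 0" by simp
    then show ?thesis using nz by (simp add: is_unit_iff_degree)
  qed
  have "irreducible f"
  proof (rule irreducibleI)
    show "f \<noteq> 0" by fact
    show "\<not> f dvd 1" using ev_ac_unit f0 by blast
    fix a b assume ab: "f = a * b"
    then have "ev_ac a = 0 \<or> ev_ac b = 0" using f0 by (simp add: ev_ac_mult)
    then show "a dvd 1 \<or> b dvd 1" using unit[of a b] unit[of b a] ab by (auto simp: mult.commute)
  qed
  moreover have "lead_coeff f = 1" using m(1) by (simp add: f_def)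
  moreover have "f \<noteq> [:0, 1:]"
  proof
    assume "f = [:0, 1:]"
    then have "ev_ac f = z" by (simp add: ev_ac_pCons ev_ac_0)
    then show False using f0 assms by simp
  qed
  ultimately show ?thesis using f0 by (auto simp: Phi_def)
qed

lemma f_at_Phi:
  assumes "z \<noteq> 0"
  shows "f_at z \<in> Phi"
proof -
  obtain f where f: "f \<in> Phi" "ev_ac f = 0" using ex_Phi_root[OF assms] by blast
  have "f_at z = f"
    unfolding f_at_def
  proof (rule the_equality)
    show "f \<in> Phi \<and> poly (map_poly to_ac f) z = 0" using f by (simp add: ev_ac_def)
    show "g = f" if "g \<in> Phi \<and> poly (map_poly to_ac g) z = 0" for g
      using Phi_unique[of g f] f that by (simp add: ev_ac_def)
  qed
  then show ?thesis using f by simp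
qed

end

lemma irreducible_degree_1:
  fixes f :: "'a::field poly"
  assumes "degree f = 1"
  shows "irreducible f"
proof (rule irreducibleI)
  show "f \<noteq> 0" "\<not> f dvd 1" using assms by (auto simp: is_unit_poly_iff)
  fix a b assume ab: "f = a * b"
  then have "a \<noteq> 0" "b \<noteq> 0" using \<open>f \<noteq> 0\<close> by auto
  then have "degree a + degree b = 1" using assms ab by (simp add: degree_mult_eq)
  then have "degree a = 0 \<or> degree b = 0" by linarith
  then show "a dvd 1 \<or> b dvd 1" using \<open>a \<noteq> 0\<close> \<open>b \<noteq> 0\<close> by (auto simp: is_unit_iff_degree)
qed

lemma x_minus_1_Phi: "[:-1, 1:] \<in> (Phi :: 'a::{field,finite} poly set)"
  by (auto simp: Phi_def intro: irreducible_degree_1)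

lemma f_at_1: "f_at (1 :: 'a::{field,finite} alg_closure) = [:-1, 1:]"
  unfolding f_at_def
proof (rule the_equality)
  have ev: "ev_ac (1 :: 'a alg_closure) [:-1, 1:] = 0" by (simp add: ev_ac_pCons ev_ac_0)
  then show "[:-1, 1:] \<in> (Phi :: 'a poly set) \<and> poly (map_poly to_ac [:-1, 1 :: 'a:]) 1 = 0"
    using x_minus_1_Phi unfolding ev_ac_def by blast
  show "g = [:-1, 1:]" if "g \<in> Phi \<and> poly (map_poly to_ac g) (1 :: 'a alg_closure) = 0" for g
    using Phi_unique[of g 1 "[:-1, 1:]"] that x_minus_1_Phi ev by (simp add: ev_ac_def)
qed

section \<open>The images of the power sums\<close>

lemma tensor_Sym_closed:
  "const_mps c \<in> tensor_Sym I" "f \<in> tensor_Sym I \<Longrightarrow> g \<in> tensor_Sym I \<Longrightarrow> f + g \<in> tensor_Sym I"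
  "f \<in> tensor_Sym I \<Longrightarrow> g \<in> tensor_Sym I \<Longrightarrow> f * g \<in> tensor_Sym I"
  unfolding tensor_Sym_def by (auto intro: subalgebra_gen.intros)

lemma tensor_Sym_sum: "(\<And>a. a \<in> A \<Longrightarrow> f a \<in> tensor_Sym I) \<Longrightarrow> sum f A \<in> tensor_Sym I"
  using tensor_Sym_closed(1)[of 0]
  by (induction A rule: infinite_finite_induct) (auto simp: const_mps_simps intro: tensor_Sym_closed)

lemma alg_homD:
  assumes "alg_hom A B h"
  shows "x \<in> A \<Longrightarrow> h x \<in> B" "x \<in> A \<Longrightarrow> y \<in> A \<Longrightarrow> h (x + y) = h x + h y"
    "x \<in> A \<Longrightarrow> y \<in> A \<Longrightarrow> h (x * y) = h x * h y" "h (const_mps c) = const_mps c"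
  using assms unfolding alg_hom_def by blast+

lemma alg_hom_sum:
  assumes "alg_hom (tensor_Sym I) B h" "\<And>a. a \<in> S \<Longrightarrow> f a \<in> tensor_Sym I"
  shows "h (sum f S) = (\<Sum>a\<in>S. h (f a))"
  using assms(2)
proof (induction S rule: infinite_finite_induct)
  case (insert a S)
  then show ?case using alg_homD(2)[OF assms(1)] by (simp add: tensor_Sym_sum)
qed (use alg_homD(4)[OF assms(1), of 0] in \<open>simp_all add: const_mps_simps\<close>)

text \<open>The plethysm map is prescribed on the h_a only. Comparing the image of Newton's identity
  with its form in the variables y_j^b, all terms agree by induction except the last, which contains
  the power sum p_k.\<close>

lemma plethysm_psum:
  assumes "is_plethysm_map \<rho>" "\<phi> \<in> Theta" and b: "card \<phi> \<ge> 1"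
  shows "k \<ge> 1 \<Longrightarrow> \<rho> (in_vars \<phi> (psum k)) = psum (k * card \<phi>)"
proof (induction k rule: less_induct)
  case (less k)
  let ?b = "card \<phi>" and ?s = "\<lambda>f. \<rho> (in_vars \<phi> f)"
  have hom: "alg_hom Lambda_Theta Sym \<rho>"
    and rh: "?s (hsym a) = power_subst ?b (hsym a)" for a
    using assms by (auto simp: is_plethysm_map_def)
  have mem: "in_vars \<phi> f \<in> Lambda_Theta" if "f \<in> Sym" for f
    using in_vars_tensor[OF assms(2) that] .
  have mult: "?s (f * g) = ?s f * ?s g" if "f \<in> Sym" "g \<in> Sym" for f g
    by (simp only: in_vars_mult alg_homD(3)[OF hom mem[OF that(1)] mem[OF that(2)]])
  have 1: "?s (of_nat k * hsym k) = of_nat k * power_subst ?b (hsym k)"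
    using mult[OF Sym_closed(1)[of "of_nat k"] hsym_Sym[of k]] alg_homD(4)[OF hom, of "of_nat k"]
    unfolding in_vars_const rh by (simp add: const_mps_of_nat)
  have 2: "?s (of_nat k * hsym k) = (\<Sum>j=1..k. ?s (psum j) * power_subst ?b (hsym (k - j)))"
  proof -
    have "?s (of_nat k * hsym k) = \<rho> (\<Sum>j=1..k. in_vars \<phi> (psum j * hsym (k - j)))"
      by (simp only: newton_hsym in_vars_sum)
    also have "\<dots> = (\<Sum>j=1..k. ?s (psum j * hsym (k - j)))"
      by (rule alg_hom_sum[OF hom]) (intro mem Sym_closed psum_Sym hsym_Sym)
    also have "\<dots> = (\<Sum>j=1..k. ?s (psum j) * power_subst ?b (hsym (k - j)))"
      by (simp only: mult[OF psum_Sym hsym_Sym] rh)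
    finally show ?thesis .
  qed
  have split: "(\<Sum>j=1..k. F j) = (\<Sum>j\<in>{1..<k}. F j) + F k" for F :: "nat \<Rightarrow> nat mpseries"
    using less.prems by (simp add: atLeastLessThanSuc_atLeastAtMost[symmetric])
  have "(\<Sum>j=1..k. ?s (psum j) * power_subst ?b (hsym (k - j))) = (\<Sum>j=1..k. psum (j * ?b) * power_subst ?b (hsym (k - j)))"
    using 1 2 newton_power_subst[OF b, of k] by simp
  moreover have "(\<Sum>j\<in>{1..<k}. ?s (psum j) * power_subst ?b (hsym (k - j))) = (\<Sum>j\<in>{1..<k}. psum (j * ?b) * power_subst ?b (hsym (k - j)))"
    by (intro sum.cong) (auto simp: less.IH)
  ultimately have "?s (psum k) * power_subst ?b (hsym 0) = psum (k * ?b) * power_subst ?b (hsym 0)"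
    unfolding split by simp
  moreover have "power_subst ?b (hsym 0) = 1"
    using rh[of 0] alg_homD(4)[OF hom, of 1] in_vars_const[of \<phi> 1] by (simp add: hsym_0 const_mps_simps)
  ultimately show ?case by simp
qed

text \<open>The factor q^n - 1 = |M_n| occurs twice: as the value of the character sum at z = 1 on
  the left, and as the number of characters, each contributing p_n, on the right. It is kept because
  \<open>hom_Gser_recursion\<close> takes the relation in this form.\<close>

lemma rho_T_psum:
  fixes T :: "('a::{field,finite} poly \<times> nat) mpseries \<Rightarrow> ('a lchar set \<times> nat) mpseries"
  assumes T: "is_identification T" and \<rho>: "is_plethysm_map \<rho>" and n: "n \<ge> 1"
  shows "const_mps ((-1) ^ n * (1 - of_nat CARD('a) ^ n)) * \<rho> (T (in_vars [:-1, 1:] (psum n))) =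
     const_mps (of_nat CARD('a) ^ n - 1) * psum n"
proof -
  define N where N: "N = CARD('a) ^ n - 1"
  let ?X = "[:-1, 1 :: 'a:]"
  have homT: "alg_hom Lambda_Phi Lambda_Theta T" using T by (simp add: is_identification_def)
  have homR: "alg_hom Lambda_Theta Sym \<rho>" using \<rho> by (simp add: is_plethysm_map_def)
  let ?u = "\<lambda>z :: 'a alg_closure. in_vars (f_at z) (psum (n div degree (f_at z)))"
  let ?a = "\<lambda>x. (- 1) ^ (n - 1) * (\<Sum>z\<in>M_grp n. const_mps (x z) * ?u z)"
  let ?phi = "\<lambda>x. range (\<lambda>i. (char_frob ^^ i) (char_rel `` {(n, x)})) :: 'a lchar set"
  have sign: "(- 1) ^ (n - 1) = const_mps ((-1) ^ (n - 1))"
    by (simp add: const_mps_power const_mps_simps)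
  have u: "?u z \<in> Lambda_Phi" if "z \<in> M_grp n" for z
    using that by (intro in_vars_tensor f_at_Phi psum_Sym) (simp add: M_grp_def)
  have a: "?a x \<in> Lambda_Phi" for x
    unfolding sign by (intro tensor_Sym_closed tensor_Sym_sum u)
  have Ta: "T (?a x) = in_vars (?phi x) (psum (n div card (?phi x)))" if x: "x \<in> M_dual n" for x
  proof -
    note th = Theta_of_char[OF n x]
    let ?k = "n div card (?phi x)"
    have k: "?k * card (?phi x) = n" using th(3) by simp
    then have "?k \<ge> 1" using n by (cases "?k = 0") auto
    have "T ((- 1) ^ (?k * card (?phi x) - 1) *
             (\<Sum>z\<in>M_grp (?k * card (?phi x)). const_mps (char_val (char_rel `` {(n, x)}) (?k * card (?phi x)) z) *
                 in_vars (f_at z) (psum (?k * card (?phi x) div degree (f_at z)))))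
          = in_vars (?phi x) (psum ?k)"
      using T th(1,2) \<open>?k \<ge> 1\<close> unfolding is_identification_def Let_def by blast
    then show ?thesis unfolding k th(5) .
  qed
  have rT: "\<rho> (T (?a x)) = psum n" if x: "x \<in> M_dual n" for x
  proof -
    note th = Theta_of_char[OF n x]
    let ?k = "n div card (?phi x)"
    have k: "?k * card (?phi x) = n" using th(3) by simp
    then have "?k \<ge> 1" using n by (cases "?k = 0") auto
    then show ?thesis unfolding Ta[OF x] using plethysm_psum[OF \<rho> th(1) th(4)] k by simp
  qed
  have mX: "in_vars ?X (psum n) \<in> Lambda_Phi"
    by (rule in_vars_tensor[OF x_minus_1_Phi psum_Sym])
  have "(\<Sum>x\<in>M_dual n. ?a x) = const_mps ((-1) ^ (n - 1)) * (\<Sum>z\<in>M_grp n. const_mps (\<Sum>x\<in>M_dual n. x z) * ?u z)"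
    unfolding sign const_mps_sum sum_distrib_right sum_distrib_left[symmetric]
    by (subst sum.swap) simp
  also have "(\<Sum>z\<in>M_grp n. const_mps (\<Sum>x\<in>M_dual n. x z) * ?u z) = (\<Sum>z\<in>M_grp n. if z = 1 then of_nat N * ?u z else 0)"
    by (intro sum.cong refl) (auto simp: sum_M_dual[OF n N] const_mps_simps const_mps_of_nat)
  also have "\<dots> = of_nat N * in_vars ?X (psum n)"
    using one_M_grp[OF n N] finite_M_grp[OF n N] by (simp add: f_at_1)
  finally have "(\<Sum>x\<in>M_dual n. ?a x) = const_mps ((-1) ^ (n - 1) * of_nat N) * in_vars ?X (psum n)"
    by (simp add: const_mps_simps const_mps_of_nat mult.assoc)
  then have "\<rho> (T (\<Sum>x\<in>M_dual n. ?a x)) = \<rho> (T (const_mps ((-1) ^ (n - 1) * of_nat N) * in_vars ?X (psum n)))"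
    by (rule arg_cong)
  also have "\<dots> = const_mps ((-1) ^ (n - 1) * of_nat N) * \<rho> (T (in_vars ?X (psum n)))"
    using mX by (simp only: alg_homD(3,4)[OF homT] alg_homD(3,4)[OF homR] alg_homD(1)[OF homT] tensor_Sym_closed(1))
  also have "\<rho> (T (\<Sum>x\<in>M_dual n. ?a x)) = (\<Sum>x\<in>M_dual n. \<rho> (T (?a x)))"
    using alg_homD(1)[OF homT a] by (simp only: alg_hom_sum[OF homT a] alg_hom_sum[OF homR])
  also have "\<dots> = of_nat (card (M_dual n :: ('a alg_closure \<Rightarrow> complex) set)) * psum n"
    using rT by simp
  \<comment> \<open>The number of characters is itself the case z = 1 of
    \<open>sum_M_dual\<close>.\<close>
  also have "card (M_dual n :: ('a alg_closure \<Rightarrow> complex) set) = N"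
  proof -
    have "(\<Sum>x\<in>M_dual n. x (1 :: 'a alg_closure)) = of_nat N"
      using sum_M_dual[OF n N one_M_grp[OF n N]] by simp
    moreover have "(\<Sum>x\<in>M_dual n. x (1 :: 'a alg_closure)) = (\<Sum>x\<in>(M_dual n :: ('a alg_closure \<Rightarrow> complex) set). 1)"
      by (rule sum.cong) (auto simp: M_dual_one[OF n N])
    ultimately have "of_nat (card (M_dual n :: ('a alg_closure \<Rightarrow> complex) set)) = (of_nat N :: complex)"
      by simp
    then show ?thesis by (simp only: of_nat_eq_iff)
  qed
  finally have eq: "const_mps ((-1) ^ (n - 1) * of_nat N) * \<rho> (T (in_vars ?X (psum n))) = const_mps (of_nat N) * psum n"
    by (simp add: const_mps_of_nat)
  have N': "(of_nat N :: complex) = of_nat CARD('a) ^ n - 1"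
    unfolding N using card_ge_2[where 'a = 'a] by (subst of_nat_diff) auto
  have "(-1 :: complex) ^ n * (1 - of_nat CARD('a) ^ n) = (-1) ^ (n - 1) * of_nat N"
    unfolding N' using n by (cases n) (auto simp: algebra_simps)
  then show ?thesis using eq unfolding N' by simp
qed


section \<open>Induction from the unipotent group\<close>

definition vsub :: "nat \<Rightarrow> 'a::field vec set \<Rightarrow> bool" where
  "vsub n W \<longleftrightarrow> W \<subseteq> carrier_vec n \<and> 0\<^sub>v n \<in> W \<and> (\<forall>x\<in>W. \<forall>y\<in>W. x + y \<in> W) \<and> (\<forall>c. \<forall>x\<in>W. c \<cdot>\<^sub>v x \<in> W)"

definition vext :: "'a::field vec set \<Rightarrow> 'a vec \<Rightarrow> 'a vec set" where
  "vext W v = {x + c \<cdot>\<^sub>v v | x c. x \<in> W}"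

text \<open>The coordinate along v modulo W; it is meaningful for a subspace W, v outside W and x in
  \<open>vext W v\<close>.\<close>

definition vcoef :: "'a::field vec set \<Rightarrow> 'a vec \<Rightarrow> 'a vec \<Rightarrow> 'a" where
  "vcoef W v x = (THE c. \<exists>y\<in>W. x = y + c \<cdot>\<^sub>v v)"

lemma vsubD:
  assumes "vsub n W"
  shows "x \<in> W \<Longrightarrow> x \<in> carrier_vec n" "0\<^sub>v n \<in> W" "x \<in> W \<Longrightarrow> y \<in> W \<Longrightarrow> x + y \<in> W" "x \<in> W \<Longrightarrow> c \<cdot>\<^sub>v x \<in> W"
  using assms by (auto simp: vsub_def)

lemma finite_carrier_vec: "finite (carrier_vec n :: 'a::finite vec set)"
  and card_carrier_vec: "card (carrier_vec n :: 'a::finite vec set) = CARD('a) ^ n"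
proof -
  have bij: "bij_betw (\<lambda>f. vec n f) (PiE {..<n} (\<lambda>_. UNIV :: 'a set)) (carrier_vec n)"
  proof (rule bij_betw_byWitness[where f' = "\<lambda>v. restrict (\<lambda>i. vec_index v i) {..<n}"])
    show "\<forall>f\<in>PiE {..<n} (\<lambda>_. UNIV :: 'a set). restrict (\<lambda>i. vec_index (vec n f) i) {..<n} = f"
      by (intro ballI ext) (simp add: restrict_def PiE_def extensional_def)
    show "\<forall>v\<in>carrier_vec n. vec n (restrict (\<lambda>i. vec_index (v :: 'a vec) i) {..<n}) = v"
      by (intro ballI eq_vecI) simp_all
    show "(\<lambda>f. vec n f) ` PiE {..<n} (\<lambda>_. UNIV :: 'a set) \<subseteq> carrier_vec n"
      by (rule image_subsetI) simp
    show "(\<lambda>v. restrict (\<lambda>i. vec_index v i) {..<n}) ` (carrier_vec n :: 'a vec set) \<subseteq> PiE {..<n} (\<lambda>_. UNIV)"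
      by (rule image_subsetI) simp
  qed
  have "finite (PiE {..<n} (\<lambda>_. UNIV :: 'a set))" by (intro finite_PiE) auto
  then show "finite (carrier_vec n :: 'a vec set)" using bij bij_betw_finite by blast
  show "card (carrier_vec n :: 'a vec set) = CARD('a) ^ n"
    using bij_betw_same_card[OF bij] by (simp add: card_PiE)
qed

context
  fixes n :: nat and W :: "'a::{field,finite} vec set" and v :: "'a vec"
  assumes W: "vsub n W" and v: "v \<in> carrier_vec n" "v \<notin> W"
begin

lemma vcoef_unique:
  assumes "y \<in> W" "y' \<in> W" "y + c \<cdot>\<^sub>v v = y' + c' \<cdot>\<^sub>v v"
  shows "c = c'" "y = y'"
proof -
  have car: "y \<in> carrier_vec n" "y' \<in> carrier_vec n" using vsubD(1)[OF W] assms by auto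
  have i: "y $ i + c * v $ i = y' $ i + c' * v $ i" if "i < n" for i
    using arg_cong[OF assms(3), of "\<lambda>x. vec_index x i"] that car v by simp
  show c: "c = c'"
  proof (rule ccontr)
    assume ne: "c \<noteq> c'"
    \<comment> \<open>Two different coefficients would put v into W.\<close>
    have "v = (1 / (c - c')) \<cdot>\<^sub>v (y' + (-1) \<cdot>\<^sub>v y)"
    proof (rule eq_vecI)
      fix i assume "i < dim_vec ((1 / (c - c')) \<cdot>\<^sub>v (y' + (-1) \<cdot>\<^sub>v y))"
      then have i': "i < n" using car by simp
      have "(c - c') * v $ i = y' $ i - y $ i" using i[OF i'] by (simp add: algebra_simps)
      then have "v $ i = (y' $ i - y $ i) / (c - c')" using ne by (simp add: field_simps)
      then show "v $ i = ((1 / (c - c')) \<cdot>\<^sub>v (y' + (-1) \<cdot>\<^sub>v y)) $ i" using i' car by simp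
    qed (use v car in auto)
    then have "v \<in> W" using vsubD(3,4)[OF W] assms by metis
    then show False using v by simp
  qed
  show "y = y'"
  proof (rule eq_vecI)
    fix i assume "i < dim_vec y'"
    then have "i < n" using car by simp
    from i[OF this] c show "y $ i = y' $ i" by simp
  qed (use car in auto)
qed

lemma vcoef_eq: "y \<in> W \<Longrightarrow> vcoef W v (y + c \<cdot>\<^sub>v v) = c"
  unfolding vcoef_def using vcoef_unique(1) by (intro the_equality) blast+

lemma vext_sub: "vsub n (vext W v)"
  unfolding vsub_def
proof (intro conjI ballI allI)
  show "vext W v \<subseteq> carrier_vec n" using vsubD(1)[OF W] v by (auto simp: vext_def)
  have "0\<^sub>v n = 0\<^sub>v n + 0 \<cdot>\<^sub>v v" using v by auto
  then show "0\<^sub>v n \<in> vext W v" using vsubD(2)[OF W] unfolding vext_def by blast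
  fix x assume "x \<in> vext W v"
  then obtain a c where x: "x = a + c \<cdot>\<^sub>v v" "a \<in> W" by (auto simp: vext_def)
  note aW = vsubD(1)[OF W x(2)]
  show "e \<cdot>\<^sub>v x \<in> vext W v" for e
  proof -
    have "e \<cdot>\<^sub>v x = e \<cdot>\<^sub>v a + (e * c) \<cdot>\<^sub>v v" using x aW v by (auto simp: algebra_simps)
    then show ?thesis using vsubD(4)[OF W x(2)] unfolding vext_def by blast
  qed
  fix y assume "y \<in> vext W v"
  then obtain b d where y: "y = b + d \<cdot>\<^sub>v v" "b \<in> W" by (auto simp: vext_def)
  have "x + y = (a + b) + (c + d) \<cdot>\<^sub>v v" using x y aW vsubD(1)[OF W y(2)] v by (auto simp: algebra_simps)
  then show "x + y \<in> vext W v" using vsubD(3)[OF W x(2) y(2)] unfolding vext_def by blast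
qed

lemma vcoef_hom:
  assumes "x \<in> vext W v" "y \<in> vext W v"
  shows "vcoef W v (x + y) = vcoef W v x + vcoef W v y" "vcoef W v (e \<cdot>\<^sub>v x) = e * vcoef W v x"
proof -
  obtain a c where x: "x = a + c \<cdot>\<^sub>v v" "a \<in> W" using assms by (auto simp: vext_def)
  obtain b d where y: "y = b + d \<cdot>\<^sub>v v" "b \<in> W" using assms by (auto simp: vext_def)
  note aW = vsubD(1)[OF W x(2)] and bW = vsubD(1)[OF W y(2)]
  have "x + y = (a + b) + (c + d) \<cdot>\<^sub>v v" using x y aW bW v by (auto simp: algebra_simps)
  then show "vcoef W v (x + y) = vcoef W v x + vcoef W v y"
    using vcoef_eq x y vsubD(3)[OF W x(2) y(2)] by simp
  have "e \<cdot>\<^sub>v x = e \<cdot>\<^sub>v a + (e * c) \<cdot>\<^sub>v v" using x aW v by (auto simp: algebra_simps)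
  then show "vcoef W v (e \<cdot>\<^sub>v x) = e * vcoef W v x"
    using vcoef_eq x vsubD(4)[OF W x(2)] by simp
qed

lemma vcoef_0_iff: "x \<in> vext W v \<Longrightarrow> vcoef W v x = 0 \<longleftrightarrow> x \<in> W"
proof -
  assume "x \<in> vext W v"
  then obtain a c where x: "x = a + c \<cdot>\<^sub>v v" "a \<in> W" by (auto simp: vext_def)
  note aW = vsubD(1)[OF W x(2)]
  have "c = 0" if "x \<in> W"
  proof -
    have "x + 0 \<cdot>\<^sub>v v = a + c \<cdot>\<^sub>v v" using x aW v by auto
    from vcoef_unique(1)[OF that x(2) this] show ?thesis by simp
  qed
  moreover have "x = a" if "c = 0" using x aW v that by auto
  ultimately show ?thesis using vcoef_eq[OF x(2)] x by auto
qed

lemma vext_mono: "W \<subseteq> vext W v"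
proof
  fix x assume x: "x \<in> W"
  have "x = x + 0 \<cdot>\<^sub>v v" using vsubD(1)[OF W x] v by auto
  then show "x \<in> vext W v" using x unfolding vext_def by blast
qed

lemma card_vext: "card (vext W v) = CARD('a) * card W"
proof -
  have "vext W v = (\<lambda>(x, c). x + c \<cdot>\<^sub>v v) ` (W \<times> UNIV)" by (auto simp: vext_def)
  moreover have "inj_on (\<lambda>(x, c). x + c \<cdot>\<^sub>v v) (W \<times> UNIV)"
    using vcoef_unique by (auto simp: inj_on_def)
  ultimately show ?thesis by (simp add: card_image card_cartesian_product mult.commute)
qed

end

section \<open>The weighted number of flags\<close>

locale nilpotent_map =
  fixes n :: nat and N :: "'a::{field,finite} vec \<Rightarrow> 'a vec"
    and \<psi> :: "'a \<Rightarrow> complex" and qs :: "nat \<Rightarrow> 'a"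
  assumes N_carrier: "x \<in> carrier_vec n \<Longrightarrow> N x \<in> carrier_vec n"
    and N_add: "x \<in> carrier_vec n \<Longrightarrow> y \<in> carrier_vec n \<Longrightarrow> N (x + y) = N x + N y"
    and N_smult: "x \<in> carrier_vec n \<Longrightarrow> N (c \<cdot>\<^sub>v x) = c \<cdot>\<^sub>v N x"
    and N_nilpotent: "x \<in> carrier_vec n \<Longrightarrow> \<exists>k. (N ^^ k) x = 0\<^sub>v n"
    and psi: "nontrivial_additive_char \<psi>"
    and qs: "1 \<le> i \<Longrightarrow> i < n \<Longrightarrow> qs i \<noteq> 0"
begin

definition pre :: "'a vec set \<Rightarrow> 'a vec set" where
  "pre W = {x \<in> carrier_vec n. N x \<in> W}"

text \<open>
  For \<open>N = g - 1\<close> the matrix \<open>y\<^sup>-\<^sup>1 g y\<close> is upper unitriangular iff \<open>N\<close> maps each column of \<open>y\<close> into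
  the span of the previous ones, and its entry above the diagonal is then the coefficient at
  the last of these. \<open>flagsum\<close> runs over the choices of the last \<open>m\<close> columns, if \<open>v\<close> was
  chosen last and \<open>W\<close> is the span of the columns before it.
\<close>

fun flagsum :: "nat \<Rightarrow> nat \<Rightarrow> 'a vec set \<Rightarrow> 'a vec \<Rightarrow> complex" where
  "flagsum 0 i W v = 1"
| "flagsum (Suc m) i W v =
     (\<Sum>w\<in>pre (vext W v) - vext W v. \<psi> (qs i * vcoef W v (N w)) * flagsum m (Suc i) (vext W v) w)"

lemma finite_pre: "finite (pre W)"
  by (rule finite_subset[OF _ finite_carrier_vec]) (auto simp: pre_def)

lemma psi_props: "\<psi> (x + y) = \<psi> x * \<psi> y" "\<psi> 0 = 1"
proof -
  show add: "\<psi> (x + y) = \<psi> x * \<psi> y" for x y using psi by (simp add: nontrivial_additive_char_def)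
  show "\<psi> 0 = 1" using add[of 0 0] psi by (simp add: nontrivial_additive_char_def)
qed

lemma pre_vsub:
  assumes "vsub n W"
  shows "vsub n (pre W)"
proof -
  have "0 \<cdot>\<^sub>v 0\<^sub>v n = (0\<^sub>v n :: 'a vec)" by auto
  then have "N (0\<^sub>v n) = 0 \<cdot>\<^sub>v N (0\<^sub>v n)" using N_smult[of "0\<^sub>v n" 0] by simp
  also have "\<dots> = 0\<^sub>v n" using N_carrier[of "0\<^sub>v n"] by auto
  finally show ?thesis
    using vsubD[OF assms] by (auto simp: vsub_def pre_def N_add N_smult)
qed

text \<open>Some power of N sends x to 0, which lies in W; applying the inclusion repeatedly leads
  back to x.\<close>

lemma pre_full:
  assumes W: "vsub n W" and sub: "pre W \<subseteq> W"
  shows "W = carrier_vec n"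
proof -
  have "x \<in> W" if "x \<in> carrier_vec n" "(N ^^ k) x \<in> W" for k x
    using that
  proof (induction k arbitrary: x)
    case (Suc k)
    have "(N ^^ k) (N x) \<in> W" using Suc.prems by (simp add: funpow_swap1)
    then have "N x \<in> W" using Suc N_carrier by blast
    then show ?case using Suc.prems sub by (auto simp: pre_def)
  qed simp
  then have "x \<in> W" if "x \<in> carrier_vec n" for x
    using N_nilpotent[OF that] vsubD(2)[OF W] that by metis
  then show ?thesis using vsubD(1)[OF W] by blast
qed

text \<open>With E = W + <v>, the number k is dim N^-1(W) - dim E. If N^-1(E) = N^-1(W), then k
  drops by one and q^(d+1) (q^k - 1) columns of weight 1 remain. Otherwise N^-1(E) grows by one
  dimension, k stays, and the new columns contribute -q^(d+1). The sign (-1)^(m+k) is consistent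
  with both.\<close>

lemma flagsum_value:
  assumes "vsub n W" "v \<in> carrier_vec n" "v \<notin> W" "N v \<in> W" "N ` W \<subseteq> W"
    and "card W = CARD('a) ^ d" "card (pre W) = CARD('a) ^ (d + Suc k)" "n = Suc d + m"
  shows "flagsum m (Suc d) W v =
    (-1) ^ (m + k) * (\<Prod>j=1..k. of_nat CARD('a) ^ j - 1) * (\<Prod>j=Suc d..<n. of_nat CARD('a) ^ j)"
  using assms
proof (induction m arbitrary: W v d k)
  case 0
  note P = 0
  have q2: "CARD('a) \<ge> 2" by (rule card_ge_2)
  have "card (pre W) \<le> card (carrier_vec n :: 'a vec set)"
    by (intro card_mono finite_carrier_vec) (auto simp: pre_def)
  then have "CARD('a) ^ (d + Suc k) \<le> CARD('a) ^ n" using P by (simp add: card_carrier_vec)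
  \<comment> \<open>With no column left to choose dim W is n - 1, which leaves only k = 0.\<close>
  then have "d + Suc k \<le> n" by (rule power_le_imp_le_exp[rotated]) (use q2 in simp)
  then have "k = 0" using P by simp
  then show ?case unfolding flagsum.simps using P(8) by simp
next
  case (Suc m)
  note W = Suc.prems(1) and v = Suc.prems(2,3) and Nv = Suc.prems(4) and NW = Suc.prems(5)
    and cW = Suc.prems(6) and cP = Suc.prems(7) and n = Suc.prems(8)
  let ?q = "CARD('a)" and ?E = "vext W v" and ?d = "Suc d"
  have q2: "?q \<ge> 2" by (rule card_ge_2)
  have E: "vsub n ?E" by (rule vext_sub[OF W v])
  have cE: "card ?E = ?q ^ Suc d" using card_vext[OF W v] cW by simp
  have NE: "N x \<in> W" if xE: "x \<in> ?E" for x
  proof -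
    obtain a c where x: "x = a + c \<cdot>\<^sub>v v" "a \<in> W" using xE by (auto simp: vext_def)
    have "N x = N a + c \<cdot>\<^sub>v N v" using x v vsubD(1)[OF W x(2)] by (simp add: N_add N_smult)
    then show ?thesis using x NW Nv vsubD(3,4)[OF W] by auto
  qed
  have Esub: "?E \<subseteq> pre W" using NE vsubD(1)[OF E] by (auto simp: pre_def)
  have PW: "pre W \<subseteq> pre ?E" using vext_mono[OF W v] by (auto simp: pre_def)
  have NEE: "N ` ?E \<subseteq> ?E" using NE vext_mono[OF W v] by auto
  let ?al = "\<lambda>x. vcoef W v (N x)"
  have al0: "?al x = 0" if "x \<in> pre W" for x
    using vcoef_0_iff[OF W v, of "N x"] that vext_mono[OF W v] by (auto simp: pre_def)
  \<comment> \<open>The claimed value for the remaining m columns, where k' is dim N^-1(E) - dim E -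
    1.\<close>
  define C where "C k' = (-1) ^ (m + k') * (\<Prod>j=1..k'. of_nat ?q ^ j - 1) * (\<Prod>j=Suc ?d..<n. of_nat ?q ^ j :: complex)" for k'
  have IH: "flagsum m (Suc ?d) ?E w = C k'"
    if "w \<in> pre ?E - ?E" "card (pre ?E) = ?q ^ (?d + Suc k')" for w k'
    unfolding C_def
  proof (rule Suc.IH[OF E _ _ _ NEE cE that(2)])
    show "w \<in> carrier_vec n" "w \<notin> ?E" "N w \<in> ?E" using that(1) by (auto simp: pre_def)
    show "n = Suc ?d + m" using n by simp
  qed
  have prodd: "(\<Prod>j=?d..<n. of_nat ?q ^ j :: complex) = of_nat ?q ^ ?d * (\<Prod>j=Suc ?d..<n. of_nat ?q ^ j)"
    using n by (subst prod.atLeast_Suc_lessThan) auto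
  show ?case
  proof (cases "\<exists>x\<in>pre ?E. ?al x \<noteq> 0")
    case False
    have "pre ?E \<subseteq> pre W"
    proof
      fix x assume x: "x \<in> pre ?E"
      then have "?al x = 0" "N x \<in> ?E" using False by (auto simp: pre_def)
      then show "x \<in> pre W" using vcoef_0_iff[OF W v, of "N x"] x by (auto simp: pre_def)
    qed
    then have PE: "pre ?E = pre W" using PW by auto
    have "flagsum (Suc m) ?d W v = (\<Sum>w\<in>pre ?E - ?E. flagsum m (Suc ?d) ?E w)"
      using False by (auto simp: psi_props intro!: sum.cong)
    \<comment> \<open>For k = 0 the spaces E, N^-1(W) and N^-1(E) coincide, and nilpotency makes E
      the whole space although columns are still missing.\<close>
    have "k \<noteq> 0"
    proof
      assume "k = 0"
      then have "card ?E = card (pre W)" using cE cP by simp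
      then have "?E = pre ?E" using card_subset_eq[OF finite_pre Esub] PE by simp
      then have "?E = carrier_vec n" by (intro pre_full[OF E]) simp
      then have "?q ^ Suc d = ?q ^ n" using cE card_carrier_vec[where 'a = 'a, of n] by simp
      then show False using n q2 by (simp add: power_inject_exp del: power_Suc)
    qed
    then obtain k' where k: "k = Suc k'" using not0_implies_Suc by blast
    have IH': "flagsum m (Suc ?d) ?E w = C k'" if "w \<in> pre ?E - ?E" for w
      using IH[OF that, of k'] PE cP k by simp
    have "flagsum (Suc m) ?d W v = (\<Sum>w\<in>pre ?E - ?E. C k')"
      unfolding flagsum.simps
    proof (rule sum.cong[OF refl])
      fix w assume w: "w \<in> pre ?E - ?E"
      then have "?al w = 0" using False by auto
      then show "\<psi> (qs ?d * ?al w) * flagsum m (Suc ?d) ?E w = C k'" using IH'[OF w] by (simp add: psi_props)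
    qed
    also have "\<dots> = of_nat (card (pre ?E - ?E)) * C k'" by simp
    also have "card (pre ?E - ?E) = ?q ^ (d + Suc k) - ?q ^ ?d"
      using PE Esub cP cE finite_subset[OF Esub finite_pre] by (simp add: card_Diff_subset)
    also have "(of_nat \<dots> :: complex) = of_nat ?q ^ ?d * (of_nat ?q ^ k - 1)"
    proof -
      have "?q ^ ?d \<le> ?q ^ (d + Suc k)" using q2 by (intro power_increasing) auto
      then have "(of_nat (?q ^ (d + Suc k) - ?q ^ ?d) :: complex) = of_nat ?q ^ (?d + k) - of_nat ?q ^ ?d"
        by (subst of_nat_diff) auto
      then show ?thesis by (simp only: power_add right_diff_distrib mult_1_right)
    qed
    finally show ?thesis
      unfolding prodd C_def k by (simp add: mult_ac)
  next
    case True
    then obtain x0 where x0: "x0 \<in> pre ?E" "?al x0 \<noteq> 0" by auto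
    note PV = pre_vsub[OF E]
    have x0c: "x0 \<in> carrier_vec n" "N x0 \<in> ?E" using x0 by (auto simp: pre_def)
    \<comment> \<open>Scaled so that N x1 has coefficient 1 at v; then N^-1(E) is spanned by N^-1(W)
      and x1.\<close>
    define x1 where "x1 = (1 / ?al x0) \<cdot>\<^sub>v x0"
    have x1: "x1 \<in> pre ?E" "x1 \<in> carrier_vec n" using vsubD(4)[OF PV x0(1)] x0c by (auto simp: x1_def)
    have Nx1: "N (c \<cdot>\<^sub>v x1) \<in> ?E" "N x1 \<in> ?E" for c
      using vsubD(4)[OF PV x1(1)] x1 by (auto simp: pre_def)
    have al1: "?al x1 = 1"
      using vcoef_hom(2)[OF W v x0c(2) x0c(2)] x0 x0c by (simp add: x1_def N_smult)
    have alc: "?al (c \<cdot>\<^sub>v x1) = c" for c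
      using vcoef_hom(2)[OF W v Nx1(2) Nx1(2)] al1 x1 by (simp add: N_smult)
    have al_add: "?al (x + y) = ?al x + ?al y" if "x \<in> pre ?E" "y \<in> pre ?E" for x y
      using vcoef_hom(1)[OF W v, of "N x" "N y"] that by (simp add: pre_def N_add)
    have x1W: "x1 \<notin> pre W" using al0 al1 by fastforce
    have "pre ?E = vext (pre W) x1"
    proof (intro antisym subsetI)
      fix x assume x: "x \<in> pre ?E"
      let ?y = "x + (- ?al x) \<cdot>\<^sub>v x1"
      have y: "?y \<in> pre ?E" using vsubD(3,4)[OF PV] x x1 by auto
      have "?al ?y = 0" using al_add[OF x vsubD(4)[OF PV x1(1)]] alc by simp
      then have "?y \<in> pre W" using vcoef_0_iff[OF W v, of "N ?y"] y by (auto simp: pre_def)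
      moreover have "x = ?y + ?al x \<cdot>\<^sub>v x1" using x x1 by (auto simp: pre_def)
      ultimately show "x \<in> vext (pre W) x1" unfolding vext_def by blast
    next
      fix x assume "x \<in> vext (pre W) x1"
      then show "x \<in> pre ?E" using PW x1 vsubD(3,4)[OF PV] by (auto simp: vext_def)
    qed
    then have cPE: "card (pre ?E) = ?q ^ (?d + Suc k)"
      using card_vext[OF pre_vsub[OF W] x1(2) x1W] cP by simp
    have "(\<Sum>w\<in>pre ?E. \<psi> (qs ?d * ?al w)) = 0"
    proof -
      have q0: "qs ?d \<noteq> 0" using n by (intro qs) auto
      obtain c where c: "\<psi> c \<noteq> 1" using psi by (auto simp: nontrivial_additive_char_def)
      let ?x = "(c / qs ?d) \<cdot>\<^sub>v x1"
      have xE: "?x \<in> pre ?E" "((-1) \<cdot>\<^sub>v ?x) \<in> pre ?E" by (intro vsubD(4)[OF PV] x1)+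
      have ca: "w \<in> carrier_vec n" if "w \<in> pre ?E" for w using that by (simp add: pre_def)
      have xc: "?x \<in> carrier_vec n" using x1 by simp
      have canc: "w + (-1) \<cdot>\<^sub>v z + z = w" "w + z + (-1) \<cdot>\<^sub>v z = w"
        if "w \<in> carrier_vec n" "z \<in> carrier_vec n" for w z :: "'a vec"
        using that by (auto intro!: eq_vecI)
      \<comment> \<open>The shift by \<open>?x\<close> adds c to the argument of
        \<open>\<psi>\<close> and so multiplies the sum by \<open>\<psi> c\<close>, which is not
        1.\<close>
      have "(\<Sum>w\<in>pre ?E. \<psi> (qs ?d * ?al w)) = (\<Sum>w\<in>pre ?E. \<psi> (qs ?d * ?al (w + ?x)))"
        by (rule sum.reindex_bij_witness[of _ "\<lambda>w. w + ?x" "\<lambda>w. w + (-1) \<cdot>\<^sub>v ?x"])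
           (use canc[OF ca xc] vsubD(3)[OF PV _ xE(1)] vsubD(3)[OF PV _ xE(2)] in simp_all)
      also have "\<dots> = (\<Sum>w\<in>pre ?E. \<psi> c * \<psi> (qs ?d * ?al w))"
        by (intro sum.cong refl)
           (simp add: al_add[OF _ xE(1)] alc q0 distrib_left psi_props mult.commute)
      also have "\<dots> = \<psi> c * (\<Sum>w\<in>pre ?E. \<psi> (qs ?d * ?al w))" by (simp add: sum_distrib_left)
      finally show ?thesis using c by simp
    qed
    moreover have "(\<Sum>w\<in>?E. \<psi> (qs ?d * ?al w)) = of_nat ?q ^ ?d"
    proof -
      have "(\<Sum>w\<in>?E. \<psi> (qs ?d * ?al w)) = (\<Sum>w\<in>?E. 1)"
        by (intro sum.cong refl) (use Esub al0 in \<open>auto simp: psi_props\<close>)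
      then show ?thesis using cE by simp
    qed
    moreover have "(\<Sum>w\<in>pre ?E. \<psi> (qs ?d * ?al w)) = (\<Sum>w\<in>pre ?E - ?E. \<psi> (qs ?d * ?al w)) + (\<Sum>w\<in>?E. \<psi> (qs ?d * ?al w))"
      using Esub PW finite_pre by (intro sum.subset_diff) auto
    ultimately have S: "(\<Sum>w\<in>pre ?E - ?E. \<psi> (qs ?d * ?al w)) = - (of_nat ?q ^ ?d)"
      by (simp add: eq_neg_iff_add_eq_0)
    have "flagsum (Suc m) ?d W v = (\<Sum>w\<in>pre ?E - ?E. \<psi> (qs ?d * ?al w) * C k)"
      unfolding flagsum.simps using IH[OF _ cPE] by (intro sum.cong) auto
    also have "\<dots> = - (of_nat ?q ^ ?d) * C k"
      using S by (simp only: sum_distrib_right[symmetric])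
    finally show ?thesis
      unfolding prodd C_def by (simp add: mult_ac)
  qed
qed

end

section \<open>Spans of columns and invertible matrices\<close>

lemma sum_lists_Suc:
  assumes "finite V"
  shows "(\<Sum>ws | set ws \<subseteq> V \<and> length ws = Suc m. f ws) = (\<Sum>w\<in>V. \<Sum>ws | set ws \<subseteq> V \<and> length ws = m. f (w # ws))"
proof -
  let ?L = "{ws. set ws \<subseteq> V \<and> length ws = m}"
  have "{ws. set ws \<subseteq> V \<and> length ws = Suc m} = (\<lambda>(w, ws). w # ws) ` (V \<times> ?L)"
    by (auto simp: length_Suc_conv)
  moreover have "inj_on (\<lambda>(w, ws). w # ws) (V \<times> ?L)" by (auto simp: inj_on_def)
  ultimately have "(\<Sum>ws | set ws \<subseteq> V \<and> length ws = Suc m. f ws) = (\<Sum>(w, ws)\<in>V \<times> ?L. f (w # ws))"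
    by (simp add: sum.reindex case_prod_unfold)
  also have "\<dots> = (\<Sum>w\<in>V. \<Sum>ws\<in>?L. f (w # ws))"
    using assms finite_lists_length_eq[OF assms, of m] by (simp add: sum.cartesian_product)
  finally show ?thesis .
qed

text \<open>The span of the first i columns, given by coefficient vectors so that for invertible y
  membership can be read off from the coefficients (\<open>colspan_mem\<close>).\<close>

definition colspan :: "nat \<Rightarrow> 'a::field mat \<Rightarrow> nat \<Rightarrow> 'a vec set" where
  "colspan n y i = {y *\<^sub>v c | c. c \<in> carrier_vec n \<and> (\<forall>j<n. i \<le> j \<longrightarrow> vec_index c j = 0)}"

lemma mult_unit_vec: "y \<in> carrier_mat n n \<Longrightarrow> j < n \<Longrightarrow> y *\<^sub>v unit_vec n j = col y j"
  for y :: "'a::field mat"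
  by (intro eq_vecI) auto

context
  fixes n :: nat and y :: "'a::field mat"
  assumes y: "y \<in> carrier_mat n n"
begin

lemma mult_vec_lin:
  assumes "c \<in> carrier_vec n" "d \<in> carrier_vec n"
  shows "y *\<^sub>v (c + d) = y *\<^sub>v c + y *\<^sub>v d" "y *\<^sub>v (a \<cdot>\<^sub>v c) = a \<cdot>\<^sub>v (y *\<^sub>v c)"
    "y *\<^sub>v (c - d) = y *\<^sub>v c - y *\<^sub>v d"
  using y assms by (auto simp: mult_add_distrib_mat_vec mult_mat_vec mult_minus_distrib_mat_vec)

lemma colspan_0: "colspan n y 0 = {0\<^sub>v n}"
proof -
  have "c = 0\<^sub>v n" if "c \<in> carrier_vec n" "\<forall>j<n. vec_index c j = 0" for c :: "'a vec"
    using that by (intro eq_vecI) auto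
  moreover have y0: "y *\<^sub>v 0\<^sub>v n = 0\<^sub>v n" using y by (intro eq_vecI) auto
  ultimately have "x = 0\<^sub>v n" if "x \<in> colspan n y 0" for x using that unfolding colspan_def by fastforce
  moreover have "0\<^sub>v n \<in> colspan n y 0"
    unfolding colspan_def using y0 by (intro CollectI exI[of _ "0\<^sub>v n"]) auto
  ultimately show ?thesis by blast
qed

lemma vext_colspan:
  assumes i: "i < n"
  shows "vext (colspan n y i) (col y i) = colspan n y (Suc i)"
proof (intro antisym subsetI)
  fix x assume "x \<in> vext (colspan n y i) (col y i)"
  then obtain c a where x: "x = y *\<^sub>v c + a \<cdot>\<^sub>v col y i" "c \<in> carrier_vec n" "\<forall>j<n. i \<le> j \<longrightarrow> vec_index c j = 0"
    unfolding vext_def colspan_def by auto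
  have "x = y *\<^sub>v (c + a \<cdot>\<^sub>v unit_vec n i)"
    using x i by (simp add: mult_vec_lin mult_unit_vec[OF y i])
  then show "x \<in> colspan n y (Suc i)"
    unfolding colspan_def using x(2,3) i by (intro CollectI exI[of _ "c + a \<cdot>\<^sub>v unit_vec n i"]) auto
next
  fix x assume "x \<in> colspan n y (Suc i)"
  then obtain c where x: "x = y *\<^sub>v c" "c \<in> carrier_vec n" "\<forall>j<n. Suc i \<le> j \<longrightarrow> vec_index c j = 0"
    unfolding colspan_def by auto
  let ?a = "vec_index c i"
  let ?c = "c - ?a \<cdot>\<^sub>v unit_vec n i"
  have c: "c = ?c + ?a \<cdot>\<^sub>v unit_vec n i" using x(2) by (intro eq_vecI) auto
  have "y *\<^sub>v (?c + ?a \<cdot>\<^sub>v unit_vec n i) = y *\<^sub>v ?c + ?a \<cdot>\<^sub>v col y i"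
    using x(2) by (subst mult_vec_lin(1)) (auto simp: mult_vec_lin(2)[of _ "0\<^sub>v n"] mult_unit_vec[OF y i])
  then have "x = y *\<^sub>v ?c + ?a \<cdot>\<^sub>v col y i" by (simp only: x(1) c[symmetric])
  moreover have "y *\<^sub>v ?c \<in> colspan n y i"
    unfolding colspan_def using x(2,3) i by (intro CollectI exI[of _ ?c]) auto
  ultimately show "x \<in> vext (colspan n y i) (col y i)" unfolding vext_def by blast
qed

lemma vsub_colspan: "vsub n (colspan n y i)"
  unfolding vsub_def
proof (intro conjI ballI allI)
  show "colspan n y i \<subseteq> carrier_vec n" using y by (auto simp: colspan_def)
  have "y *\<^sub>v 0\<^sub>v n = 0\<^sub>v n" using y by (intro eq_vecI) auto
  then show "0\<^sub>v n \<in> colspan n y i" unfolding colspan_def by (intro CollectI exI[of _ "0\<^sub>v n"]) auto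
  fix x assume "x \<in> colspan n y i"
  then obtain c where x: "x = y *\<^sub>v c" "c \<in> carrier_vec n" "\<forall>j<n. i \<le> j \<longrightarrow> vec_index c j = 0"
    unfolding colspan_def by auto
  show "a \<cdot>\<^sub>v x \<in> colspan n y i" for a
    unfolding colspan_def using x by (intro CollectI exI[of _ "a \<cdot>\<^sub>v c"]) (auto simp: mult_vec_lin(2)[of _ c])
  fix x' assume "x' \<in> colspan n y i"
  then obtain c' where x': "x' = y *\<^sub>v c'" "c' \<in> carrier_vec n" "\<forall>j<n. i \<le> j \<longrightarrow> vec_index c' j = 0"
    unfolding colspan_def by auto
  show "x + x' \<in> colspan n y i"
    unfolding colspan_def using x x' by (intro CollectI exI[of _ "c + c'"]) (auto simp: mult_vec_lin)
qed

text \<open>A nonzero kernel vector would express the column at its last nonzero coordinate through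
  the earlier columns.\<close>

lemma invertible_of_columns:
  assumes admissible: "\<And>j. j < n \<Longrightarrow> col y j \<notin> colspan n y j"
  shows "inj_on (\<lambda>c. y *\<^sub>v c) (carrier_vec n)"
proof (rule inj_onI)
  fix c c' assume c: "c \<in> carrier_vec n" "c' \<in> carrier_vec n" and eq: "y *\<^sub>v c = y *\<^sub>v c'"
  show "c = c'"
  proof (rule ccontr)
    assume "c \<noteq> c'"
    obtain d where d_def: "d = c - c'" by blast
    let ?d = d
    have d: "?d \<in> carrier_vec n" using c by (simp add: d_def)
    have yd: "y *\<^sub>v ?d = 0\<^sub>v n" unfolding d_def using mult_vec_lin(3)[OF c] eq y c by simp
    have "\<exists>j<n. vec_index ?d j \<noteq> 0"
    proof (rule ccontr)
      assume "\<not> (\<exists>j<n. vec_index ?d j \<noteq> 0)"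
      then have "c = c'" using c unfolding d_def by (intro eq_vecI) auto
      then show False using \<open>c \<noteq> c'\<close> by simp
    qed
    then have ne: "{j. j < n \<and> vec_index ?d j \<noteq> 0} \<noteq> {}" by auto
    define j where "j = Max {j. j < n \<and> vec_index ?d j \<noteq> 0}"
    have j: "j < n" "vec_index ?d j \<noteq> 0" using Max_in[OF _ ne] unfolding j_def by auto
    have above: "vec_index ?d k = 0" if "j < k" "k < n" for k
      using Max_ge[of "{j. j < n \<and> vec_index ?d j \<noteq> 0}" k] that unfolding j_def by fastforce
    let ?a = "1 / vec_index ?d j"
    \<comment> \<open>\<open>?e\<close> is supported below j, and since y d = 0 it is mapped to
      column j.\<close>
    let ?e = "unit_vec n j - ?a \<cdot>\<^sub>v ?d"
    have e: "?e \<in> carrier_vec n" using d by simp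
    have "y *\<^sub>v ?e = col y j - ?a \<cdot>\<^sub>v (y *\<^sub>v ?d)"
      using d by (subst mult_vec_lin(3)) (auto simp: mult_vec_lin(2)[OF d d] mult_unit_vec[OF y j(1)])
    also have "\<dots> = col y j" unfolding yd using y j by (intro eq_vecI) auto
    finally have ye: "y *\<^sub>v ?e = col y j" .
    have "vec_index ?e k = 0" if "k < n" "j \<le> k" for k
    proof (cases "k = j")
      case True
      then show ?thesis using j d by simp
    next
      case False
      then have "vec_index ?d k = 0" using above[of k] that by simp
      then show ?thesis using that False d j(1) by simp
    qed
    then have "col y j \<in> colspan n y j"
      unfolding colspan_def using e ye[symmetric] by blast
    then show False using admissible[OF j(1)] by simp
  qed
qed

end

lemma GL_carrier:
  "y \<in> carrier (GL n) \<longleftrightarrow> y \<in> carrier_mat n n \<and> (\<exists>z\<in>carrier_mat n n. z * y = 1\<^sub>m n \<and> y * z = 1\<^sub>m n)"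
  by (simp add: GL_def units_of_def Units_def ring_mat_simps)

lemma GL_inv:
  fixes y :: "'a::{field,finite} mat"
  assumes "y \<in> carrier (GL n)"
  shows "inv\<^bsub>GL n\<^esub> y \<in> carrier_mat n n" "inv\<^bsub>GL n\<^esub> y * y = 1\<^sub>m n" "y * inv\<^bsub>GL n\<^esub> y = 1\<^sub>m n"
proof -
  let ?R = "ring_mat TYPE('a) n ()"
  interpret R: ring ?R by (rule ring_mat)
  have u: "y \<in> Units ?R" using assms by (simp add: GL_def units_of_carrier)
  have i: "inv\<^bsub>GL n\<^esub> y = inv\<^bsub>?R\<^esub> y" using u by (simp add: GL_def R.units_of_inv)
  show "inv\<^bsub>GL n\<^esub> y \<in> carrier_mat n n" "inv\<^bsub>GL n\<^esub> y * y = 1\<^sub>m n" "y * inv\<^bsub>GL n\<^esub> y = 1\<^sub>m n"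
    unfolding i using R.Units_inv_closed[OF u] R.Units_l_inv[OF u] R.Units_r_inv[OF u]
    by (simp_all add: ring_mat_simps)
qed

lemma GL_mult: "x \<otimes>\<^bsub>GL n\<^esub> y = x * y"
  by (simp add: GL_def units_of_mult ring_mat_simps)

text \<open>On a finite set of vectors injectivity gives surjectivity, and preimages of the unit
  vectors are the columns of a right inverse.\<close>

lemma GL_of_inj:
  fixes y :: "'a::{field,finite} mat"
  assumes y: "y \<in> carrier_mat n n" and inj: "inj_on (\<lambda>c. y *\<^sub>v c) (carrier_vec n)"
  shows "y \<in> carrier (GL n)"
proof -
  have "(\<lambda>c. y *\<^sub>v c) ` carrier_vec n = carrier_vec n"
    using y by (intro endo_inj_surj[OF finite_carrier_vec _ inj]) auto
  then have "\<forall>j. \<exists>c. c \<in> carrier_vec n \<and> (j < n \<longrightarrow> y *\<^sub>v c = unit_vec n j)"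
    by (metis (no_types, lifting) imageE unit_vec_carrier)
  then obtain C where C: "\<And>j. C j \<in> carrier_vec n" "\<And>j. j < n \<Longrightarrow> y *\<^sub>v C j = unit_vec n j" by metis
  define z where "z = mat_of_cols n (map C [0..<n])"
  have z: "z \<in> carrier_mat n n" by (simp add: z_def mat_of_cols_def)
  have colz: "col z j = C j" if "j < n" for j
    using that C(1)[of j] unfolding z_def by (subst col_mat_of_cols) auto
  have yz: "y * z = 1\<^sub>m n"
  proof (rule eq_matI)
    fix i j assume ij: "i < dim_row (1\<^sub>m n :: 'a mat)" "j < dim_col (1\<^sub>m n :: 'a mat)"
    then have "(y * z) $$ (i, j) = vec_index (col (y * z) j) i" using y z by simp
    also have "col (y * z) j = unit_vec n j" using col_mult2[OF y z, of j] ij colz C(2) by simp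
    finally show "(y * z) $$ (i, j) = 1\<^sub>m n $$ (i, j)" using ij by auto
  qed (use y z in auto)
  moreover have "z * y = 1\<^sub>m n" by (rule mat_mult_left_right_inverse[OF y z yz])
  ultimately show ?thesis using y z by (auto simp: GL_carrier)
qed

text \<open>Column j, counted from 0, has j free entries.\<close>

lemma card_U_grp: "card (U_grp n :: 'a::{field,finite} mat set) = (\<Prod>j<n. CARD('a) ^ j)"
proof -
  let ?P = "PiE {..<n} (\<lambda>j. PiE {..<j} (\<lambda>_. UNIV :: 'a set))"
  let ?f = "\<lambda>h. mat n n (\<lambda>(i, j). if i < j then h j i else if i = j then 1 else 0 :: 'a)"
  let ?g = "\<lambda>u. restrict (\<lambda>j. restrict (\<lambda>i. u $$ (i, j)) {..<j}) {..<n}"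
  have "bij_betw ?f ?P (U_grp n)"
  proof (rule bij_betw_byWitness[where f' = ?g])
    show "\<forall>h\<in>?P. ?g (?f h) = h"
    proof (intro ballI ext)
      fix h j i assume h: "h \<in> ?P"
      show "?g (?f h) j i = h j i"
      proof (cases "j < n")
        case True
        then have "h j \<in> PiE {..<j} (\<lambda>_. UNIV)" using h by (auto simp: PiE_iff)
        then show ?thesis using True by (cases "i < j") (auto simp: PiE_def extensional_def)
      next
        case False
        then have "h j = undefined" using h by (simp add: PiE_def extensional_def)
        then show ?thesis using False by simp
      qed
    qed
    show "\<forall>u\<in>U_grp n. ?f (?g u) = u"
    proof
      fix u :: "'a mat" assume u: "u \<in> U_grp n"
      show "?f (?g u) = u"
      proof (rule eq_matI)
        fix i j assume ij: "i < dim_row u" "j < dim_col u"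
        then have ij': "i < n" "j < n" using u by (auto simp: U_grp_def)
        have "u $$ (i, j) = 0" if "j < i" using u that ij by (auto simp: U_grp_def upper_triangular_def)
        moreover have "u $$ (i, i) = 1" using u ij' by (auto simp: U_grp_def)
        ultimately show "?f (?g u) $$ (i, j) = u $$ (i, j)" using ij' by (cases i j rule: linorder_cases) auto
      qed (use u in \<open>auto simp: U_grp_def\<close>)
    qed
    show "?f ` ?P \<subseteq> U_grp n" by (rule image_subsetI) (auto simp: U_grp_def)
    show "?g ` U_grp n \<subseteq> ?P" by (rule image_subsetI) auto
  qed
  then have "card (U_grp n :: 'a mat set) = card ?P" by (rule bij_betw_same_card[symmetric])
  also have "\<dots> = (\<Prod>j<n. CARD('a) ^ j)" by (simp add: card_PiE)
  finally show ?thesis .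
qed

section \<open>Flags as columns of matrices\<close>

context nilpotent_map
begin

text \<open>The summand of \<open>flagsum\<close> for a prescribed list of columns, extended by 0 to
  lists that do not form a flag, so that one can sum over all lists.\<close>

fun flag_weight :: "'a vec set \<Rightarrow> 'a vec \<Rightarrow> nat \<Rightarrow> 'a vec list \<Rightarrow> complex" where
  "flag_weight W v i [] = 1"
| "flag_weight W v i (w # ws) = (if w \<in> pre (vext W v) - vext W v
     then \<psi> (qs i * vcoef W v (N w)) * flag_weight (vext W v) w (Suc i) ws else 0)"

lemma flagsum_lists:
  "flagsum m i W v = (\<Sum>ws | set ws \<subseteq> carrier_vec n \<and> length ws = m. flag_weight W v i ws)"
proof (induction m arbitrary: i W v)
  case 0
  have "{ws :: 'a vec list. set ws \<subseteq> carrier_vec n \<and> length ws = 0} = {[]}" by auto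
  then show ?case by simp
next
  case (Suc m)
  let ?E = "vext W v"
  have "(\<Sum>ws | set ws \<subseteq> carrier_vec n \<and> length ws = Suc m. flag_weight W v i ws)
    = (\<Sum>w\<in>carrier_vec n. \<Sum>ws | set ws \<subseteq> carrier_vec n \<and> length ws = m. flag_weight W v i (w # ws))"
    by (rule sum_lists_Suc[OF finite_carrier_vec])
  also have "\<dots> = (\<Sum>w\<in>carrier_vec n. if w \<in> pre ?E - ?E
      then \<psi> (qs i * vcoef W v (N w)) * flagsum m (Suc i) ?E w else 0)"
  proof (rule sum.cong[OF refl])
    fix w
    show "(\<Sum>ws | set ws \<subseteq> carrier_vec n \<and> length ws = m. flag_weight W v i (w # ws)) =
      (if w \<in> pre ?E - ?E then \<psi> (qs i * vcoef W v (N w)) * flagsum m (Suc i) ?E w else 0)"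
      by (cases "w \<in> pre ?E - ?E") (simp_all add: Suc.IH sum_distrib_left del: Diff_iff)
  qed
  also have "\<dots> = (\<Sum>w\<in>pre ?E - ?E. \<psi> (qs i * vcoef W v (N w)) * flagsum m (Suc i) ?E w)"
    using finite_carrier_vec by (intro sum.mono_neutral_cong_right) (auto simp: pre_def)
  finally show ?case by simp
qed

text \<open>For N = g - 1 and all columns this amounts to y being invertible with y^-1 g y upper
  unitriangular.\<close>

definition admissible :: "'a mat \<Rightarrow> nat set \<Rightarrow> bool" where
  "admissible y J \<longleftrightarrow> (\<forall>j\<in>J. col y j \<in> pre (colspan n y j) - colspan n y j)"

lemma flag_weight_cols:
  assumes y: "y \<in> carrier_mat n n" and i: "i < n"
  shows "flag_weight (colspan n y i) (col y i) (Suc i) (map (col y) [Suc i..<n]) =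
    (if admissible y {Suc i..<n} then \<Prod>j=Suc i..<n. \<psi> (qs j * vcoef (colspan n y (j - 1)) (col y (j - 1)) (N (col y j))) else 0)"
  using i
proof (induction "n - i" arbitrary: i)
  case (Suc k)
  show ?case
  proof (cases "Suc i = n")
    case True
    then show ?thesis by (simp add: admissible_def)
  next
    case False
    then have i: "Suc i < n" using Suc.prems by simp
    have IH: "flag_weight (colspan n y (Suc i)) (col y (Suc i)) (Suc (Suc i)) (map (col y) [Suc (Suc i)..<n]) =
      (if admissible y {Suc (Suc i)..<n} then \<Prod>j=Suc (Suc i)..<n. \<psi> (qs j * vcoef (colspan n y (j - 1)) (col y (j - 1)) (N (col y j))) else 0)"
      using Suc.hyps(1)[of "Suc i"] Suc.hyps(2) i by simp
    have "[Suc i..<n] = Suc i # [Suc (Suc i)..<n]" using i by (rule upt_conv_Cons)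
    moreover have "{Suc i..<n} = insert (Suc i) {Suc (Suc i)..<n}" using i by auto
    ultimately show ?thesis
      using IH vext_colspan[OF y Suc.prems] by (simp add: admissible_def)
  qed
qed simp

definition flag_total :: complex where
  "flag_total = (\<Sum>v\<in>pre {0\<^sub>v n} - {0\<^sub>v n}. flagsum (n - 1) 1 {0\<^sub>v n} v)"

lemma flag_total_matrices:
  assumes n: "n \<ge> 1"
  shows "flag_total = (\<Sum>y\<in>(carrier_mat n n :: 'a mat set). if admissible y {..<n}
     then \<Prod>j=1..<n. \<psi> (qs j * vcoef (colspan n y (j - 1)) (col y (j - 1)) (N (col y j))) else 0)"
proof -
  define m where "m = n - 1"
  have Sm: "Suc m = n" using n by (simp add: m_def)
  let ?F = "\<lambda>vs. if hd vs \<in> pre {0\<^sub>v n} - {0\<^sub>v n} then flag_weight {0\<^sub>v n} (hd vs) 1 (tl vs) else 0"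
  let ?L = "{vs :: 'a vec list. set vs \<subseteq> carrier_vec n \<and> length vs = n}"
  have "flag_total = (\<Sum>v\<in>carrier_vec n. if v \<in> pre {0\<^sub>v n} - {0\<^sub>v n} then flagsum (n - 1) 1 {0\<^sub>v n} v else 0)"
    unfolding flag_total_def using finite_carrier_vec
    by (intro sum.mono_neutral_cong_left) (auto simp: pre_def)
  also have "\<dots> = (\<Sum>v\<in>carrier_vec n. \<Sum>ws | set ws \<subseteq> carrier_vec n \<and> length ws = m. ?F (v # ws))"
  proof (rule sum.cong[OF refl])
    fix v
    show "(if v \<in> pre {0\<^sub>v n} - {0\<^sub>v n} then flagsum (n - 1) 1 {0\<^sub>v n} v else 0)
      = (\<Sum>ws | set ws \<subseteq> carrier_vec n \<and> length ws = m. ?F (v # ws))"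
      unfolding flagsum_lists m_def[symmetric] list.sel
      by (cases "v \<in> pre {0\<^sub>v n} - {0\<^sub>v n}") (simp_all del: Diff_iff)
  qed
  also have "\<dots> = (\<Sum>vs\<in>?L. ?F vs)"
    using sum_lists_Suc[OF finite_carrier_vec, where f = ?F and m = m] unfolding Sm by (rule sym)
  also have "\<dots> = (\<Sum>y\<in>(carrier_mat n n :: 'a mat set). ?F (map (col y) [0..<n]))"
  proof (rule sum.reindex_bij_witness[of _ "\<lambda>y. map (col y) [0..<n]" "mat_of_cols n"])
    fix vs assume vs: "vs \<in> ?L"
    show "mat_of_cols n vs \<in> carrier_mat n n" using vs by auto
    show "map (col (mat_of_cols n vs)) [0..<n] = vs"
      using vs by (intro nth_equalityI) (auto simp: col_mat_of_cols subset_iff)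
    then show "?F (map (col (mat_of_cols n vs)) [0..<n]) = ?F vs" by simp
  next
    fix y :: "'a mat" assume y: "y \<in> carrier_mat n n"
    show "map (col y) [0..<n] \<in> ?L" using y by auto
    show "mat_of_cols n (map (col y) [0..<n]) = y"
      using y by (intro eq_matI) (auto simp: mat_of_cols_def)
  qed
  also have "\<dots> = (\<Sum>y\<in>(carrier_mat n n :: 'a mat set). if admissible y {..<n}
     then \<Prod>j=1..<n. \<psi> (qs j * vcoef (colspan n y (j - 1)) (col y (j - 1)) (N (col y j))) else 0)"
  proof (intro sum.cong refl)
    fix y :: "'a mat" assume y: "y \<in> carrier_mat n n"
    have "[0..<n] = 0 # [Suc 0..<n]" using n by (intro upt_conv_Cons) simp
    then have "?F (map (col y) [0..<n]) = (if col y 0 \<in> pre (colspan n y 0) - colspan n y 0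
        then flag_weight (colspan n y 0) (col y 0) (Suc 0) (map (col y) [Suc 0..<n]) else 0)"
      by (simp add: colspan_0[OF y])
    also have "\<dots> = (if admissible y {..<n}
     then \<Prod>j=1..<n. \<psi> (qs j * vcoef (colspan n y (j - 1)) (col y (j - 1)) (N (col y j))) else 0)"
    proof -
      have "{..<n} = insert 0 {Suc 0..<n}" using n by auto
      then show ?thesis using n by (subst flag_weight_cols[OF y]) (auto simp: admissible_def)
    qed
    finally show "?F (map (col y) [0..<n]) = \<dots>" .
  qed
  finally show ?thesis .
qed

text \<open>The first column is any nonzero vector of the kernel of N, whose dimension is k + 1.
  This supplies the factor q^(k+1) - 1, and \<open>flagsum_value\<close> with W = 0 gives the
  rest.\<close>

lemma flag_total_value:
  assumes n: "n \<ge> 1" and cP: "card (pre {0\<^sub>v n}) = CARD('a) ^ Suc k"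
  shows "flag_total = (-1) ^ (n - 1 + k) * (\<Prod>j=1..Suc k. of_nat CARD('a) ^ j - 1) * (\<Prod>j<n. of_nat CARD('a) ^ j)"
proof -
  have sub0: "vsub n {0\<^sub>v n :: 'a vec}" by (auto simp: vsub_def)
  have N0: "N (0\<^sub>v n) = 0\<^sub>v n"
    using vsubD(2)[OF pre_vsub[OF sub0]] by (simp add: pre_def)
  have "flagsum (n - 1) 1 {0\<^sub>v n} v =
      (-1) ^ (n - 1 + k) * (\<Prod>j=1..k. of_nat CARD('a) ^ j - 1) * (\<Prod>j=Suc 0..<n. of_nat CARD('a) ^ j)"
    if "v \<in> pre {0\<^sub>v n} - {0\<^sub>v n}" for v
  proof -
    have v: "v \<in> carrier_vec n" "v \<notin> {0\<^sub>v n}" "N v \<in> {0\<^sub>v n}" using that by (simp_all add: pre_def)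
    have 1: "N ` {0\<^sub>v n} \<subseteq> {0\<^sub>v n}" using N0 by simp
    have 2: "card {0\<^sub>v n :: 'a vec} = CARD('a) ^ 0" by simp
    have 3: "card (pre {0\<^sub>v n}) = CARD('a) ^ (0 + Suc k)" by (simp only: cP add_0)
    have 4: "n = Suc 0 + (n - 1)" using n by simp
    show ?thesis using flagsum_value[OF sub0 v 1 2 3 4] by (simp only: One_nat_def)
  qed
  then have "flag_total = of_nat (card (pre {0\<^sub>v n} - {0\<^sub>v n})) *
      ((-1) ^ (n - 1 + k) * (\<Prod>j=1..k. of_nat CARD('a) ^ j - 1) * (\<Prod>j=Suc 0..<n. of_nat CARD('a) ^ j))"
    unfolding flag_total_def sum_constant[symmetric] sum_distrib_right by (intro sum.cong refl) simp
  also have "card (pre {0\<^sub>v n} - {0\<^sub>v n}) = CARD('a) ^ Suc k - 1"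
    using cP vsubD(2)[OF pre_vsub[OF sub0]] finite_pre by (simp add: card_Diff_singleton)
  also have "(of_nat \<dots> :: complex) = of_nat CARD('a) ^ Suc k - 1"
    by (subst of_nat_diff) (auto simp: Suc_le_eq)
  also have "(\<Prod>j=Suc 0..<n. of_nat CARD('a) ^ j) = (\<Prod>j<n. of_nat CARD('a) ^ j :: complex)"
  proof -
    have "{..<n} = insert 0 {Suc 0..<n}" using n by auto
    then show ?thesis by simp
  qed
  finally have tot: "flag_total = (of_nat CARD('a) ^ Suc k - 1) * ((-1) ^ (n - 1 + k) *
      (\<Prod>j=1..k. of_nat CARD('a) ^ j - 1) * (\<Prod>j<n. of_nat CARD('a) ^ j))" .
  have "{1..Suc k} = insert (Suc k) {1..k}" by auto
  then have "(\<Prod>j=1..Suc k. of_nat CARD('a) ^ j - 1 :: complex)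
      = (of_nat CARD('a) ^ Suc k - 1) * (\<Prod>j=1..k. of_nat CARD('a) ^ j - 1)"
    by (simp del: power_Suc)
  then show ?thesis unfolding tot by (simp only: mult_ac)
qed

end

section \<open>Conjugates inside the unitriangular group\<close>

context
  fixes n :: nat and y :: "'a::{field,finite} mat"
  assumes yG: "y \<in> carrier (GL n)"
begin

lemma GL_mat: "y \<in> carrier_mat n n"
  using yG by (simp add: GL_carrier)

lemma GL_inj:
  assumes "c \<in> carrier_vec n" "d \<in> carrier_vec n" "y *\<^sub>v c = y *\<^sub>v d"
  shows "c = d"
proof -
  have "inv\<^bsub>GL n\<^esub> y *\<^sub>v (y *\<^sub>v c) = inv\<^bsub>GL n\<^esub> y *\<^sub>v (y *\<^sub>v d)" using assms(3) by simp
  then show ?thesis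
    using assms(1,2) GL_inv(1,2)[OF yG] GL_mat by (simp add: assoc_mult_mat_vec[symmetric])
qed

lemma colspan_mem:
  assumes "c \<in> carrier_vec n"
  shows "y *\<^sub>v c \<in> colspan n y i \<longleftrightarrow> (\<forall>j<n. i \<le> j \<longrightarrow> vec_index c j = 0)"
  unfolding colspan_def using GL_inj assms by blast

lemma col_notin_colspan:
  assumes "j < n"
  shows "col y j \<notin> colspan n y j"
  using colspan_mem[of "unit_vec n j" j] assms by (auto simp: mult_unit_vec[OF GL_mat])

context
  fixes g u :: "'a mat"
  assumes g: "g \<in> carrier_mat n n" and u_def: "u = inv\<^bsub>GL n\<^esub> y * g * y"
begin

lemma conj_mat: "u \<in> carrier_mat n n"
  using GL_inv(1)[OF yG] GL_mat g by (simp add: u_def)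

lemma conj_mult: "y * u = g * y"
proof -
  have "y * u = (y * inv\<^bsub>GL n\<^esub> y) * (g * y)"
    unfolding u_def using GL_inv(1)[OF yG] GL_mat g by (simp add: assoc_mult_mat[of _ n n _ n _ n])
  then show ?thesis using GL_inv(3)[OF yG] GL_mat g by simp
qed

lemma conj_act:
  assumes "c \<in> carrier_vec n"
  shows "g *\<^sub>v (y *\<^sub>v c) - y *\<^sub>v c = y *\<^sub>v (u *\<^sub>v c - c)"
proof -
  have "g *\<^sub>v (y *\<^sub>v c) = y *\<^sub>v (u *\<^sub>v c)"
    using assoc_mult_mat_vec[OF g GL_mat assms] assoc_mult_mat_vec[OF GL_mat conj_mat assms] conj_mult by simp
  then show ?thesis using GL_mat conj_mat assms by (simp add: mult_minus_distrib_mat_vec)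
qed

lemma conj_act_col:
  assumes "j < n"
  shows "g *\<^sub>v col y j - col y j = y *\<^sub>v (col u j - unit_vec n j)"
  using conj_act[of "unit_vec n j"] assms
  by (simp add: mult_unit_vec[OF GL_mat] mult_unit_vec[OF conj_mat])

lemma conj_act_colspan:
  assumes "j < n"
  shows "g *\<^sub>v col y j - col y j \<in> colspan n y j \<longleftrightarrow> (\<forall>i<n. j \<le> i \<longrightarrow> u $$ (i, j) = (if i = j then 1 else 0))"
proof -
  obtain d where d_def: "d = col u j - unit_vec n j" by blast
  have "d \<in> carrier_vec n" unfolding d_def using conj_mat by (intro carrier_vecI) simp
  moreover have "vec_index d i = u $$ (i, j) - (if i = j then 1 else 0)" if "i < n" for i
    unfolding d_def using that assms conj_mat by simp
  ultimately show ?thesis unfolding conj_act_col[OF assms] d_def[symmetric] by (auto simp: colspan_mem)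
qed

text \<open>Column j of y (u - 1) is (g - 1) y_j. As y is invertible, it lies in the span of the
  earlier columns iff column j of u - 1 vanishes from row j on.\<close>

lemma conj_U_iff:
  "u \<in> U_grp n \<longleftrightarrow> (\<forall>j<n. g *\<^sub>v col y j - col y j \<in> colspan n y j)"
proof -
  have "(\<forall>j<n. g *\<^sub>v col y j - col y j \<in> colspan n y j) \<longleftrightarrow>
      (\<forall>j<n. \<forall>i<n. j \<le> i \<longrightarrow> u $$ (i, j) = (if i = j then 1 else 0))"
    by (simp add: conj_act_colspan)
  also have "\<dots> \<longleftrightarrow> u \<in> U_grp n"
    using conj_mat by (auto simp: U_grp_def upper_triangular_def le_less dest: less_trans)
  finally show ?thesis by simp
qed

text \<open>Without its entry in row j - 1, column j of u - 1 is supported in the rows before j -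
  1.\<close>

lemma conj_coef:
  assumes uU: "u \<in> U_grp n" and j: "1 \<le> j" "j < n"
  shows "vcoef (colspan n y (j - 1)) (col y (j - 1)) (g *\<^sub>v col y j - col y j) = u $$ (j - 1, j)"
proof -
  let ?d = "col u j - unit_vec n j" and ?a = "u $$ (j - 1, j)"
  let ?c = "?d - ?a \<cdot>\<^sub>v unit_vec n (j - 1)"
  have j': "j - 1 < n" using j by simp
  have c: "?c \<in> carrier_vec n" using conj_mat by (intro carrier_vecI) simp
  have "vec_index ?c i = 0" if i: "i < n" "j - 1 \<le> i" for i
  proof -
    have di: "vec_index ?d i = u $$ (i, j) - (if i = j then 1 else 0)" using i j conj_mat by simp
    consider "i = j - 1" | "i = j" | "i > j" using i by linarith
    then show ?thesis
    proof cases
      case 1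
      then show ?thesis using di j' j conj_mat by simp
    next
      case 2
      then show ?thesis using di j' j uU conj_mat by (simp add: U_grp_def)
    next
      case 3
      then have "u $$ (i, j) = 0" using uU i by (auto simp: U_grp_def upper_triangular_def)
      then show ?thesis using 3 di j' j i conj_mat by simp
    qed
  qed
  then have cW: "y *\<^sub>v ?c \<in> colspan n y (j - 1)" using colspan_mem[OF c] by blast
  have dc: "?d = ?c + ?a \<cdot>\<^sub>v unit_vec n (j - 1)" using conj_mat by (intro eq_vecI) auto
  have "y *\<^sub>v (?c + ?a \<cdot>\<^sub>v unit_vec n (j - 1)) = y *\<^sub>v ?c + ?a \<cdot>\<^sub>v col y (j - 1)"
    using c mult_vec_lin(1)[OF GL_mat c, of "?a \<cdot>\<^sub>v unit_vec n (j - 1)"]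
      mult_vec_lin(2)[OF GL_mat unit_vec_carrier unit_vec_carrier, of ?a "j - 1"] mult_unit_vec[OF GL_mat j'] by simp
  then have "g *\<^sub>v col y j - col y j = y *\<^sub>v ?c + ?a \<cdot>\<^sub>v col y (j - 1)"
    unfolding conj_act_col[OF j(2)] by (simp only: dc[symmetric])
  moreover have "col y (j - 1) \<in> carrier_vec n" using GL_mat by (intro carrier_vecI) simp
  ultimately show ?thesis
    using vcoef_eq[OF vsub_colspan[OF GL_mat] _ col_notin_colspan[OF j'] cW, of ?a] by simp
qed

text \<open>u - 1 is strictly upper triangular, so each step shortens the support of the coordinates
  with respect to y by one.\<close>

lemma conj_U_nilpotent:
  assumes uU: "u \<in> U_grp n" and "x \<in> carrier_vec n"
  shows "((\<lambda>x. g *\<^sub>v x - x) ^^ n) x = 0\<^sub>v n"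
proof -
  let ?N = "\<lambda>x. g *\<^sub>v x - x"
  have step: "vec_index (u *\<^sub>v c - c) k = 0"
    if c: "c \<in> carrier_vec n" "\<forall>k<n. Suc i \<le> k \<longrightarrow> vec_index c k = 0" and k: "k < n" "i \<le> k" for c i k
  proof -
    have "vec_index (u *\<^sub>v c) k = (\<Sum>l<n. u $$ (k, l) * vec_index c l)"
      using c k conj_mat by (simp add: scalar_prod_def lessThan_atLeast0)
    also have "\<dots> = (\<Sum>l<n. if l = k then vec_index c k else 0)"
    proof (rule sum.cong[OF refl])
      fix l assume l: "l \<in> {..<n}"
      consider "l < k" | "l = k" | "l > k" by linarith
      then show "u $$ (k, l) * vec_index c l = (if l = k then vec_index c k else 0)"
        using uU c k l by cases (auto simp: U_grp_def upper_triangular_def)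
    qed
    also have "\<dots> = vec_index c k" using k by simp
    finally show ?thesis using c k conj_mat by simp
  qed
  have "(?N ^^ i) (y *\<^sub>v c) = 0\<^sub>v n"
    if "c \<in> carrier_vec n" "\<forall>k<n. i \<le> k \<longrightarrow> vec_index c k = 0" for c i
    using that
  proof (induction i arbitrary: c)
    case 0
    then have "y *\<^sub>v c \<in> colspan n y 0" by (simp add: colspan_mem)
    then show ?case by (simp add: colspan_0[OF GL_mat])
  next
    case (Suc i)
    have "?N (y *\<^sub>v c) = y *\<^sub>v (u *\<^sub>v c - c)" by (rule conj_act[OF Suc.prems(1)])
    moreover have "(?N ^^ i) (y *\<^sub>v (u *\<^sub>v c - c)) = 0\<^sub>v n"
      using step[OF Suc.prems] Suc.prems(1) conj_mat by (intro Suc.IH) auto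
    ultimately show ?case by (simp del: funpow.simps add: funpow_Suc_right)
  qed
  from this[of "inv\<^bsub>GL n\<^esub> y *\<^sub>v x" n] have "(?N ^^ n) (y *\<^sub>v (inv\<^bsub>GL n\<^esub> y *\<^sub>v x)) = 0\<^sub>v n"
    using GL_inv(1)[OF yG] assms(2) by simp
  then show ?thesis
    using assms(2) GL_inv(1,3)[OF yG] GL_mat by (simp add: assoc_mult_mat_vec[symmetric])
qed

end

end

lemma induced_char_not_unipotent:
  assumes g: "g \<in> carrier_mat n n" and x: "x \<in> carrier_vec n" "((\<lambda>x. g *\<^sub>v x - x) ^^ n) x \<noteq> 0\<^sub>v n"
  shows "induced_char (GL n) (U_grp n) \<chi> g = 0"
proof -
  have "{y \<in> carrier (GL n). inv\<^bsub>GL n\<^esub> y \<otimes>\<^bsub>GL n\<^esub> g \<otimes>\<^bsub>GL n\<^esub> y \<in> U_grp n} = {}"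
    using conj_U_nilpotent[OF _ g refl _ x(1)] x(2) by (auto simp: GL_mult)
  then have "(\<Sum>y | y \<in> carrier (GL n) \<and> inv\<^bsub>GL n\<^esub> y \<otimes>\<^bsub>GL n\<^esub> g \<otimes>\<^bsub>GL n\<^esub> y \<in> U_grp n.
      \<chi> (inv\<^bsub>GL n\<^esub> y \<otimes>\<^bsub>GL n\<^esub> g \<otimes>\<^bsub>GL n\<^esub> y)) = 0" by (simp only: sum.empty)
  then show ?thesis unfolding induced_char_def by simp
qed

text \<open>The sum over conjugating matrices is \<open>flag_total\<close>, and the kernel of g - 1
  consists of the fixed vectors. The order of U_n cancels the powers of q in
  \<open>flag_total_value\<close>.\<close>

lemma induced_char_unipotent:
  fixes g :: "'a::{field,finite} mat"
  assumes g: "g \<in> carrier_mat n n" and n: "n \<ge> 1" and psi: "nontrivial_additive_char \<psi>"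
    and qs: "\<And>i. 1 \<le> i \<Longrightarrow> i < n \<Longrightarrow> qs i \<noteq> 0"
    and nil: "\<And>x. x \<in> carrier_vec n \<Longrightarrow> \<exists>k. ((\<lambda>x. g *\<^sub>v x - x) ^^ k) x = 0\<^sub>v n"
    and fixed: "card {x \<in> carrier_vec n. g *\<^sub>v x = x} = CARD('a) ^ l" and l: "l \<ge> 1"
  shows "induced_char (GL n) (U_grp n) (lin_char \<psi> n qs) g = (-1) ^ n * (\<Prod>j=1..l. 1 - of_nat CARD('a) ^ j)"
proof -
  let ?N = "\<lambda>x. g *\<^sub>v x - x" and ?u = "\<lambda>y. inv\<^bsub>GL n\<^esub> y \<otimes>\<^bsub>GL n\<^esub> g \<otimes>\<^bsub>GL n\<^esub> y"
  interpret nilpotent_map n ?N \<psi> qs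
  proof
    fix x y :: "'a vec" and c assume x: "x \<in> carrier_vec n"
    show "?N x \<in> carrier_vec n" using g x by simp
    show "?N (c \<cdot>\<^sub>v x) = c \<cdot>\<^sub>v ?N x"
      using g x by (intro eq_vecI) (simp_all add: mult_mat_vec right_diff_distrib)
    assume y: "y \<in> carrier_vec n"
    show "?N (x + y) = ?N x + ?N y"
      using g x y by (intro eq_vecI) (simp_all add: mult_add_distrib_mat_vec)
  qed (use nil psi qs in auto)
  have fixed_iff: "?N x = 0\<^sub>v n \<longleftrightarrow> g *\<^sub>v x = x" if "x \<in> carrier_vec n" for x
  proof
    assume 0: "?N x = 0\<^sub>v n"
    show "g *\<^sub>v x = x"
    proof (rule eq_vecI)
      fix i assume "i < dim_vec x"
      then show "vec_index (g *\<^sub>v x) i = vec_index x i"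
        using arg_cong[OF 0, of "\<lambda>v. vec_index v i"] that by simp
    qed (use g that in simp)
  qed (use that in simp)
  have "pre {0\<^sub>v n} = {x \<in> carrier_vec n. g *\<^sub>v x = x}"
    using fixed_iff unfolding pre_def by auto
  then have cP: "card (pre {0\<^sub>v n}) = CARD('a) ^ Suc (l - 1)" using fixed l by simp
  have admissible_iff: "admissible y {..<n} \<longleftrightarrow> y \<in> carrier (GL n) \<and> ?u y \<in> U_grp n" if y: "y \<in> carrier_mat n n" for y
  proof
    assume a: "admissible y {..<n}"
    have "inj_on (\<lambda>c. y *\<^sub>v c) (carrier_vec n)"
      using a by (intro invertible_of_columns[OF y]) (auto simp: admissible_def)
    then have yG: "y \<in> carrier (GL n)" by (rule GL_of_inj[OF y])
    then show "y \<in> carrier (GL n) \<and> ?u y \<in> U_grp n"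
      using a conj_U_iff[OF yG g refl] by (auto simp: admissible_def pre_def GL_mult)
  next
    assume a: "y \<in> carrier (GL n) \<and> ?u y \<in> U_grp n"
    then show "admissible y {..<n}"
      using conj_U_iff[OF conjunct1[OF a] g refl] col_notin_colspan[OF conjunct1[OF a]] y
      by (auto simp: admissible_def pre_def GL_mult)
  qed
  have "flag_total = (\<Sum>y\<in>(carrier_mat n n :: 'a mat set). if admissible y {..<n}
     then \<Prod>j=1..<n. \<psi> (qs j * vcoef (colspan n y (j - 1)) (col y (j - 1)) (?N (col y j))) else 0)"
    by (rule flag_total_matrices[OF n])
  also have "\<dots> = (\<Sum>y | y \<in> carrier (GL n) \<and> ?u y \<in> U_grp n. lin_char \<psi> n qs (?u y))"
  proof (rule sum.mono_neutral_cong_right)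
    have "y \<in> mat_of_cols n ` {vs. set vs \<subseteq> carrier_vec n \<and> length vs = n}"
      if y: "y \<in> carrier_mat n n" for y :: "'a mat"
    proof (rule image_eqI[of _ _ "map (col y) [0..<n]"])
      show "y = mat_of_cols n (map (col y) [0..<n])"
        using y by (intro eq_matI) (auto simp: mat_of_cols_def)
    qed (use y in auto)
    then show "finite (carrier_mat n n :: 'a mat set)"
      using finite_imageI[OF finite_lists_length_eq[OF finite_carrier_vec, of n n], of "mat_of_cols n"]
      by (rule_tac finite_subset) auto
    show "{y \<in> carrier (GL n). ?u y \<in> U_grp n} \<subseteq> carrier_mat n n" by (auto simp: GL_carrier)
    show "\<forall>y\<in>carrier_mat n n - {y \<in> carrier (GL n). ?u y \<in> U_grp n}. (if admissible y {..<n}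
     then \<Prod>j=1..<n. \<psi> (qs j * vcoef (colspan n y (j - 1)) (col y (j - 1)) (?N (col y j))) else 0) = 0"
      using admissible_iff by auto
    fix y :: "'a mat" assume y: "y \<in> {y \<in> carrier (GL n). ?u y \<in> U_grp n}"
    then have yG: "y \<in> carrier (GL n)" and uU: "?u y \<in> U_grp n" by auto
    have "{1..n - 1} = {1..<n}" using n by auto
    moreover have "vcoef (colspan n y (j - 1)) (col y (j - 1)) (?N (col y j)) = ?u y $$ (j - 1, j)"
      if "j \<in> {1..<n}" for j
      using conj_coef[OF yG g refl, of j] uU that by (simp add: GL_mult)
    ultimately have "(\<Prod>j=1..<n. \<psi> (qs j * vcoef (colspan n y (j - 1)) (col y (j - 1)) (?N (col y j)))) = lin_char \<psi> n qs (?u y)"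
      unfolding lin_char_def by (intro prod.cong) auto
    moreover have "admissible y {..<n}" using admissible_iff[OF GL_mat[OF yG]] yG uU by simp
    ultimately show "(if admissible y {..<n}
     then \<Prod>j=1..<n. \<psi> (qs j * vcoef (colspan n y (j - 1)) (col y (j - 1)) (?N (col y j))) else 0) = lin_char \<psi> n qs (?u y)"
      by simp
  qed
  finally have "induced_char (GL n) (U_grp n) (lin_char \<psi> n qs) g = flag_total / (\<Prod>j<n. of_nat CARD('a) ^ j)"
    unfolding induced_char_def card_U_grp by simp
  also have "\<dots> = (-1) ^ (n - 1 + (l - 1)) * (\<Prod>j=1..l. of_nat CARD('a) ^ j - 1)"
    unfolding flag_total_value[OF n cP] using l by simp
  \<comment> \<open>Passing to the factors 1 - q^j costs (-1)^l, which leaves the sign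
    (-1)^n.\<close>
  also have "(\<Prod>j=1..l. of_nat CARD('a) ^ j - 1 :: complex) = (\<Prod>j=1..l. (-1) * (1 - of_nat CARD('a) ^ j))"
    by (intro prod.cong) auto
  also have "\<dots> = (-1) ^ l * (\<Prod>j=1..l. 1 - of_nat CARD('a) ^ j)"
    by (subst prod.distrib) simp
  also have "(-1) ^ (n - 1 + (l - 1)) * ((-1) ^ l * (\<Prod>j=1..l. 1 - of_nat CARD('a) ^ j)) =
      (-1) ^ (n - 1 + (l - 1) + l) * (\<Prod>j=1..l. 1 - of_nat CARD('a) ^ j :: complex)"
    by (simp add: power_add)
  also have "n - 1 + (l - 1) + l = n + 2 * (l - 1)" using n l by simp
  finally show ?thesis by (simp add: power_add)
qed


section \<open>Conjugacy classes\<close>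

lemma PhiD:
  assumes "f \<in> Phi"
  shows "degree f \<ge> 1" "f \<noteq> 0" "prime_elem f" "\<not> f dvd [:0, 1:]" "f \<noteq> [:-1, 1:] \<Longrightarrow> \<not> f dvd [:-1, 1:]"
proof -
  have irr: "irreducible f" and lc: "lead_coeff f = 1" and nx: "f \<noteq> [:0, 1:]" using assms by (auto simp: Phi_def)
  show f0: "f \<noteq> 0" using lc by auto
  show deg: "degree f \<ge> 1"
  proof (rule ccontr)
    assume "\<not> degree f \<ge> 1"
    then have "f dvd 1" using f0 by (simp add: is_unit_iff_degree)
    then show False using irr by (simp add: irreducible_def)
  qed
  show "prime_elem f" by (rule field_poly_irreducible_imp_prime[OF irr])
  \<comment> \<open>By degrees, a monic f of positive degree that divides a monic linear polynomial
    is equal to it.\<close>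
  have eq: "f = [:a, 1:]" if "f dvd [:a, 1:]" for a
  proof -
    obtain k where k: "[:a, 1:] = f * k" using \<open>f dvd [:a, 1:]\<close> by (rule dvdE)
    have k0: "k \<noteq> 0" using k by auto
    have "degree f + degree k = 1" using k f0 k0 degree_mult_eq[OF f0 k0] by (metis degree_pCons_eq_if one_pCons degree_1 One_nat_def pCons_eq_0_iff zero_neq_one)
    then have "degree k = 0" using deg by simp
    moreover have "lead_coeff k = 1" using arg_cong[OF k, of lead_coeff] lc by (simp add: lead_coeff_mult)
    ultimately have "k = 1" by (metis degree_0_id one_pCons coeff_0 degree_eq_zeroE coeff_pCons_0)
    then show ?thesis using k by simp
  qed
  show "\<not> f dvd [:0, 1:]" using eq[of 0] nx by blast
  show "f \<noteq> [:-1, 1:] \<Longrightarrow> \<not> f dvd [:-1, 1:]" using eq[of "-1"] by blast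
qed

lemma prime_power_dvd_mult:
  fixes f :: "'a::field poly"
  assumes "prime_elem f" "\<not> f dvd a" "f ^ k dvd a * b"
  shows "f ^ k dvd b"
proof -
  obtain x y where xy: "x + y = k" "f ^ x dvd a" "f ^ y dvd b"
    using prime_elem_power_dvd_prod[OF assms(3,1)] by blast
  have "x = 0"
  proof (rule ccontr)
    assume "x \<noteq> 0"
    then have "f dvd f ^ x" by (simp add: dvd_power)
    then show False using xy(2) assms(2) dvd_trans by blast
  qed
  then show ?thesis using xy by simp
qed

lemma mod_eq_self_iff:
  fixes m :: "'a::field poly"
  assumes "degree m \<ge> 1"
  shows "p mod m = p \<longleftrightarrow> (\<forall>j\<ge>degree m. coeff p j = 0)"
proof
  assume "p mod m = p"
  moreover have "p mod m = 0 \<or> degree (p mod m) < degree m" using assms by (intro degree_mod_less) auto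
  ultimately show "\<forall>j\<ge>degree m. coeff p j = 0" by (auto intro: coeff_eq_0)
next
  assume *: "\<forall>j\<ge>degree m. coeff p j = 0"
  have "p = 0 \<or> degree p < degree m"
    using * leading_coeff_0_iff[of p] by (meson not_le)
  then show "p mod m = p" using mod_poly_less by auto
qed

section \<open>Coordinates and multiplication by x on the module of type mu\<close>

context
  fixes \<mu> :: "'a::{field,finite} poly \<Rightarrow> nat list" and n :: nat
  assumes mu: "\<mu> \<in> P_Phi n"
begin

lemma mu_Phi: "i < length (\<mu> f) \<Longrightarrow> f \<in> Phi"
  using mu by (force simp: P_Phi_def)

lemma mu_pos: "i < length (\<mu> f) \<Longrightarrow> \<mu> f ! i \<ge> 1"
  using mu nth_mem[of i "\<mu> f"] unfolding P_Phi_def is_partition_def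
  by (metis (mono_tags, lifting) Suc_leI bot_nat_0.not_eq_extremum mem_Collect_eq One_nat_def)

lemma degree_modulus:
  assumes "i < length (\<mu> f)"
  shows "degree (f ^ (\<mu> f ! i)) = degree f * \<mu> f ! i" "degree (f ^ (\<mu> f ! i)) \<ge> 1"
proof -
  show d: "degree (f ^ (\<mu> f ! i)) = degree f * \<mu> f ! i"
    using PhiD(2)[OF mu_Phi[OF assms]] by (simp add: degree_power_eq)
  show "degree (f ^ (\<mu> f ! i)) \<ge> 1"
    unfolding d using PhiD(1)[OF mu_Phi[OF assms]] mu_pos[OF assms] by simp
qed

lemma prim_module_iff:
  "c \<in> prim_module \<mu> \<longleftrightarrow> (\<forall>f i j. (i < length (\<mu> f) \<longrightarrow> j \<ge> degree f * \<mu> f ! i \<longrightarrow> coeff (c (f, i)) j = 0)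
     \<and> (i \<ge> length (\<mu> f) \<longrightarrow> c (f, i) = 0))"
proof -
  have "c (f, i) mod f ^ (\<mu> f ! i) = c (f, i) \<longleftrightarrow> (\<forall>j\<ge>degree f * \<mu> f ! i. coeff (c (f, i)) j = 0)"
    if "i < length (\<mu> f)" for f i
    using mod_eq_self_iff[OF degree_modulus(2)[OF that]] degree_modulus(1)[OF that] by simp
  then show ?thesis unfolding prim_module_def by (auto simp: not_less)
qed

lemma x_mult_closed: "x_mult \<mu> c \<in> prim_module \<mu>"
  by (simp add: prim_module_def x_mult_def)

lemma x_mult_linear:
  "x_mult \<mu> (\<lambda>s. c s + d s) = (\<lambda>s. x_mult \<mu> c s + x_mult \<mu> d s)"
  "x_mult \<mu> (\<lambda>s. Polynomial.smult a (c s)) = (\<lambda>s. Polynomial.smult a (x_mult \<mu> c s))"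
  by (simp_all only: x_mult_def fun_eq_iff split: prod.split)
    (simp_all add: poly_mod_add_left mod_smult_left distrib_left del: mult_pCons_left)

text \<open>No f in Phi divides x, so x can be cancelled modulo powers of f. This makes the matrix
  built in \<open>K_class_nonempty\<close> invertible.\<close>

lemma x_mult_inj: "inj_on (x_mult \<mu>) (prim_module \<mu>)"
proof (rule inj_onI, rule ext)
  fix c d and s :: "'a poly \<times> nat" assume c: "c \<in> prim_module \<mu>" and d: "d \<in> prim_module \<mu>" and eq: "x_mult \<mu> c = x_mult \<mu> d"
  obtain f i where s: "s = (f, i)" by (cases s)
  show "c s = d s"
  proof (cases "i < length (\<mu> f)")
    case True
    let ?m = "f ^ (\<mu> f ! i)"
    have "([:0, 1:] * c s) mod ?m = ([:0, 1:] * d s) mod ?m"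
      using fun_cong[OF eq, of s] True by (simp add: x_mult_def s)
    then have "?m dvd [:0, 1:] * (c s - d s)" by (simp add: mod_eq_dvd_iff right_diff_distrib)
    then have "?m dvd c s - d s"
      using PhiD(3,4)[OF mu_Phi[OF True]] by (rule_tac prime_power_dvd_mult)
    then have "c s mod ?m = d s mod ?m" by (simp add: mod_eq_dvd_iff)
    then show ?thesis using c d True by (simp add: prim_module_def s)
  next
    case False
    then show ?thesis using c d by (simp add: prim_module_def s)
  qed
qed

text \<open>A residue modulo f^(mu(f)_i) has d(f) mu(f)_i coefficients, so all coefficients together
  are indexed by n triples (f, i, j); any numbering of these gives coordinates.\<close>

lemma ex_coordinates:
  "\<exists>L. bij_betw L (carrier_vec n) (prim_module \<mu>) \<and>
     (\<forall>v\<in>carrier_vec n. \<forall>w\<in>carrier_vec n. L (v + w) = (\<lambda>s. L v s + L w s)) \<and>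
     (\<forall>a. \<forall>v\<in>carrier_vec n. L (a \<cdot>\<^sub>v v) = (\<lambda>s. Polynomial.smult a (L v s)))"
proof -
  define I where "I = (SIGMA f:{f. \<mu> f \<noteq> []}. SIGMA i:{..<length (\<mu> f)}. {..<degree f * \<mu> f ! i})"
  have I: "(f, i, j) \<in> I \<longleftrightarrow> i < length (\<mu> f) \<and> j < degree f * \<mu> f ! i" for f i j
    by (auto simp: I_def)
  have fin: "finite {f. \<mu> f \<noteq> []}" and sum: "(\<Sum>f | \<mu> f \<noteq> []. degree f * sum_list (\<mu> f)) = n"
    using mu by (auto simp: P_Phi_def)
  have finI: "finite I" unfolding I_def using fin by (intro finite_SigmaI) auto
  have "card I = (\<Sum>f | \<mu> f \<noteq> []. \<Sum>i<length (\<mu> f). degree f * \<mu> f ! i)"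
    unfolding I_def using fin by (simp add: card_SigmaI)
  also have "\<dots> = n"
    unfolding sum[symmetric] by (simp add: sum_list_sum_nth sum_distrib_left atLeast0LessThan)
  finally have "card I = card {..<n}" by simp
  then obtain e where e: "bij_betw e I {..<n}" using finite_same_card_bij[OF finI] by blast
  define e' where "e' = inv_into I e"
  have e': "e' k \<in> I" "e (e' k) = k" if "k < n" for k
    using that e unfolding e'_def
    by (simp_all add: inv_into_into f_inv_into_f bij_betw_def)
  have ee: "e s < n" "e' (e s) = s" if "s \<in> I" for s
    using that e unfolding e'_def by (auto simp: bij_betw_def)
  define L where "L v = (\<lambda>(f, i). Abs_poly (\<lambda>j. if (f, i, j) \<in> I then vec_index v (e (f, i, j)) else 0))" for v :: "'a vec"
  have coeff_L: "coeff (L v (f, i)) j = (if (f, i, j) \<in> I then vec_index v (e (f, i, j)) else 0)" for v f i j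
  proof -
    have "(\<lambda>j. if (f, i, j) \<in> I then vec_index v (e (f, i, j)) else 0) \<in> {g. \<forall>\<^sub>\<infinity>k. g k = 0}"
      unfolding mem_Collect_eq MOST_nat by (rule exI[of _ "degree f * \<mu> f ! i"]) (simp add: I)
    then show ?thesis by (simp add: L_def Abs_poly_inverse)
  qed
  define L' where "L' c = vec n (\<lambda>k. case e' k of (f, i, j) \<Rightarrow> coeff (c (f, i)) j)" for c :: "'a poly \<times> nat \<Rightarrow> 'a poly"
  have "bij_betw L (carrier_vec n) (prim_module \<mu>)"
  proof (rule bij_betw_byWitness[where f' = L'])
    show "\<forall>v\<in>carrier_vec n. L' (L v) = v"
    proof (intro ballI eq_vecI)
      fix v :: "'a vec" and k assume v: "v \<in> carrier_vec n" and "k < dim_vec v"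
      then have k: "k < n" by simp
      obtain f i j where s: "e' k = (f, i, j)" by (cases "e' k") auto
      show "vec_index (L' (L v)) k = vec_index v k"
        using k e'[OF k] by (simp add: L'_def s coeff_L)
    qed (simp add: L'_def)
    show "\<forall>c\<in>prim_module \<mu>. L (L' c) = c"
    proof (intro ballI ext)
      fix c and s :: "'a poly \<times> nat" assume c: "c \<in> prim_module \<mu>"
      obtain f i where s: "s = (f, i)" by (cases s)
      show "L (L' c) s = c s"
      proof (rule poly_eqI)
        fix j
        show "coeff (L (L' c) s) j = coeff (c s) j"
        proof (cases "(f, i, j) \<in> I")
          case True
          then show ?thesis using ee[OF True] by (simp add: s coeff_L L'_def)
        next
          case False
          then have "i \<ge> length (\<mu> f) \<or> i < length (\<mu> f) \<and> j \<ge> degree f * \<mu> f ! i" by (auto simp: I)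
          then have "coeff (c s) j = 0" using c unfolding prim_module_iff s by fastforce
          then show ?thesis using False by (simp add: s coeff_L)
        qed
      qed
    qed
    show "L ` carrier_vec n \<subseteq> prim_module \<mu>"
      by (auto simp: prim_module_iff coeff_L I poly_eq_iff)
    show "L' ` prim_module \<mu> \<subseteq> carrier_vec n" by (auto simp: L'_def)
  qed
  moreover have "L (v + w) = (\<lambda>s. L v s + L w s)" if "v \<in> carrier_vec n" "w \<in> carrier_vec n" for v w
  proof (rule ext, rule poly_eqI)
    fix s :: "'a poly \<times> nat" and j
    obtain f i where "s = (f, i)" by (cases s)
    then show "coeff (L (v + w) s) j = coeff (L v s + L w s) j" using that ee(1) by (simp add: coeff_L)
  qed
  moreover have "L (a \<cdot>\<^sub>v v) = (\<lambda>s. Polynomial.smult a (L v s))" if "v \<in> carrier_vec n" for a v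
  proof (rule ext, rule poly_eqI)
    fix s :: "'a poly \<times> nat" and j
    obtain f i where "s = (f, i)" by (cases s)
    then show "coeff (L (a \<cdot>\<^sub>v v) s) j = coeff (Polynomial.smult a (L v s)) j" using that ee(1) by (simp add: coeff_L)
  qed
  ultimately show ?thesis by blast
qed

end

text \<open>The columns are the images of the unit vectors. Equality on v is by induction on the
  number k of leading coordinates that may be nonzero.\<close>

lemma matrix_of_linear:
  fixes h :: "'a::{field} vec \<Rightarrow> 'a vec"
  assumes closed: "\<And>v. v \<in> carrier_vec n \<Longrightarrow> h v \<in> carrier_vec n"
    and add: "\<And>v w. v \<in> carrier_vec n \<Longrightarrow> w \<in> carrier_vec n \<Longrightarrow> h (v + w) = h v + h w"
    and smult: "\<And>a v. v \<in> carrier_vec n \<Longrightarrow> h (a \<cdot>\<^sub>v v) = a \<cdot>\<^sub>v h v"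
  obtains A where "A \<in> carrier_mat n n" "\<And>v. v \<in> carrier_vec n \<Longrightarrow> A *\<^sub>v v = h v"
proof -
  define A where "A = mat n n (\<lambda>(i, j). vec_index (h (unit_vec n j)) i)"
  have A: "A \<in> carrier_mat n n" by (simp add: A_def)
  have unit: "A *\<^sub>v unit_vec n j = h (unit_vec n j)" if "j < n" for j
    using that closed[of "unit_vec n j"] unfolding mult_unit_vec[OF A that]
    by (intro eq_vecI) (auto simp: A_def)
  have h0: "h (0\<^sub>v n) = 0\<^sub>v n"
  proof -
    have "0\<^sub>v n = 0 \<cdot>\<^sub>v (0\<^sub>v n :: 'a vec)" by auto
    then have "h (0\<^sub>v n) = 0 \<cdot>\<^sub>v h (0\<^sub>v n)" using smult[of "0\<^sub>v n" 0] by simp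
    also have "\<dots> = 0\<^sub>v n" using closed[of "0\<^sub>v n"] by auto
    finally show ?thesis .
  qed
  have A0: "A *\<^sub>v 0\<^sub>v n = 0\<^sub>v n" using A by (intro eq_vecI) auto
  have "A *\<^sub>v v = h v" if "v \<in> carrier_vec n" "\<forall>i<n. k \<le> i \<longrightarrow> vec_index v i = 0" "k \<le> n" for v k
    using that
  proof (induction k arbitrary: v)
    case 0
    have "v = 0\<^sub>v n" using 0 by (intro eq_vecI) auto
    then show ?case using A0 h0 by simp
  next
    case (Suc k)
    let ?a = "vec_index v k"
    obtain w where w_def: "w = v - ?a \<cdot>\<^sub>v unit_vec n k" by blast
    have k: "k < n" using Suc.prems by simp
    have w: "w \<in> carrier_vec n" unfolding w_def using Suc.prems by (intro carrier_vecI) simp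
    have v: "v = w + ?a \<cdot>\<^sub>v unit_vec n k" unfolding w_def using Suc.prems(1) by (intro eq_vecI) auto
    have "vec_index w i = 0" if "i < n" "k \<le> i" for i
    proof (cases "i = k")
      case False
      then have "vec_index v i = 0" using Suc.prems(2) that by simp
      then show ?thesis unfolding w_def using that Suc.prems(1) k False by simp
    qed (use Suc.prems(1) k in \<open>simp add: w_def\<close>)
    then have "A *\<^sub>v w = h w" using Suc.IH[OF w] Suc.prems(3) by simp
    moreover obtain u where u: "u = ?a \<cdot>\<^sub>v unit_vec n k" "u \<in> carrier_vec n" by simp
    moreover have "A *\<^sub>v u = h u"
      unfolding u(1) mult_vec_lin(2)[OF A unit_vec_carrier unit_vec_carrier] smult[OF unit_vec_carrier] unit[OF k] ..
    moreover have "v = w + u" using v u(1) by (simp only:)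
    ultimately show ?case using mult_vec_lin(1)[OF A w u(2)] add[OF w u(2)] by (simp only:)
  qed
  from this[of _ n] show ?thesis using that[OF A] by auto
qed

text \<open>\<open>ch\<close> evaluates at a chosen element of the class, so the class must contain
  one: the matrix of multiplication by x in the coordinates of
  \<open>ex_coordinates\<close>.\<close>

lemma K_class_nonempty:
  assumes mu: "\<mu> \<in> P_Phi n"
  shows "K_class n \<mu> \<noteq> {}"
proof -
  obtain L where L: "bij_betw L (carrier_vec n) (prim_module \<mu>)"
    and L_add: "\<And>v w. v \<in> carrier_vec n \<Longrightarrow> w \<in> carrier_vec n \<Longrightarrow> L (v + w) = (\<lambda>s. L v s + L w s)"
    and L_smult: "\<And>a v. v \<in> carrier_vec n \<Longrightarrow> L (a \<cdot>\<^sub>v v) = (\<lambda>s. Polynomial.smult a (L v s))"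
    using ex_coordinates[OF mu] by metis
  define h where "h v = inv_into (carrier_vec n) L (x_mult \<mu> (L v))" for v
  have h: "h v \<in> carrier_vec n" "L (h v) = x_mult \<mu> (L v)" for v
    using x_mult_closed[OF mu, of "L v"] L unfolding h_def
    by (simp_all add: bij_betw_def inv_into_into f_inv_into_f)
  have inj: "v = w" if "L v = L w" "v \<in> carrier_vec n" "w \<in> carrier_vec n" for v w
    using that L by (auto simp: bij_betw_def inj_on_def)
  obtain g where g: "g \<in> carrier_mat n n" "\<And>v. v \<in> carrier_vec n \<Longrightarrow> g *\<^sub>v v = h v"
  proof (rule matrix_of_linear[of n h])
    show "h (v + w) = h v + h w" if "v \<in> carrier_vec n" "w \<in> carrier_vec n" for v w
      using that h(1) by (intro inj) (simp_all add: h(2) L_add x_mult_linear[OF mu])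
    show "h (a \<cdot>\<^sub>v v) = a \<cdot>\<^sub>v h v" if "v \<in> carrier_vec n" for a v
      using that h(1) by (intro inj) (simp_all add: h(2) L_smult x_mult_linear[OF mu])
  qed (use h in auto)
  have "inj_on (\<lambda>c. g *\<^sub>v c) (carrier_vec n)"
  proof (rule inj_onI)
    fix v w assume v: "v \<in> carrier_vec n" "w \<in> carrier_vec n" and "g *\<^sub>v v = g *\<^sub>v w"
    then have "x_mult \<mu> (L v) = x_mult \<mu> (L w)" using g(2) h(2) by metis
    moreover have "L v \<in> prim_module \<mu>" "L w \<in> prim_module \<mu>" using v L by (auto simp: bij_betw_def)
    ultimately have "L v = L w" using x_mult_inj[OF mu] by (auto simp: inj_on_def)
    then show "v = w" using inj v by simp
  qed
  then have "g \<in> carrier (GL n)" by (rule GL_of_inj[OF g(1)])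
  then have "g \<in> K_class n \<mu>"
    unfolding K_class_def using L L_add L_smult g(2) h(2)
    by (intro CollectI conjI exI[of _ L]) auto
  then show ?thesis by blast
qed

section \<open>The action of g - 1 as multiplication by x - 1\<close>

lemma prim_moduleD:
  assumes "c \<in> prim_module \<mu>"
  shows "i < length (\<mu> f) \<Longrightarrow> c (f, i) mod f ^ (\<mu> f ! i) = c (f, i)"
    and "\<not> i < length (\<mu> f) \<Longrightarrow> c (f, i) = 0"
  using assms by (auto simp: prim_module_def)

definition module_iso ::
    "nat \<Rightarrow> ('a::{field,finite} poly \<Rightarrow> nat list) \<Rightarrow> 'a mat \<Rightarrow> ('a vec \<Rightarrow> 'a poly \<times> nat \<Rightarrow> 'a poly) \<Rightarrow> bool" where
  "module_iso n \<mu> g L \<longleftrightarrow> bij_betw L (carrier_vec n) (prim_module \<mu>) \<and>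
     (\<forall>v\<in>carrier_vec n. \<forall>w\<in>carrier_vec n. L (v + w) = (\<lambda>s. L v s + L w s)) \<and>
     (\<forall>a. \<forall>v\<in>carrier_vec n. L (a \<cdot>\<^sub>v v) = (\<lambda>s. Polynomial.smult a (L v s))) \<and>
     (\<forall>v\<in>carrier_vec n. L (g *\<^sub>v v) = x_mult \<mu> (L v))"

lemma K_class_iff: "g \<in> K_class n \<mu> \<longleftrightarrow> g \<in> carrier (GL n) \<and> (\<exists>L. module_iso n \<mu> g L)"
  by (simp add: K_class_def module_iso_def)

context
  fixes \<mu> :: "'a::{field,finite} poly \<Rightarrow> nat list" and n :: nat and g :: "'a mat" and L
  assumes mu: "\<mu> \<in> P_Phi n" and g: "g \<in> carrier_mat n n" and iso: "module_iso n \<mu> g L"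
begin

lemma L: "bij_betw L (carrier_vec n) (prim_module \<mu>)"
  and L_add: "v \<in> carrier_vec n \<Longrightarrow> w \<in> carrier_vec n \<Longrightarrow> L (v + w) = (\<lambda>s. L v s + L w s)"
  and L_smult: "v \<in> carrier_vec n \<Longrightarrow> L (a \<cdot>\<^sub>v v) = (\<lambda>s. Polynomial.smult a (L v s))"
  and L_g: "v \<in> carrier_vec n \<Longrightarrow> L (g *\<^sub>v v) = x_mult \<mu> (L v)"
  using iso by (simp_all add: module_iso_def)

lemma L_mod: "v \<in> carrier_vec n \<Longrightarrow> i < length (\<mu> f) \<Longrightarrow> L v (f, i) mod f ^ (\<mu> f ! i) = L v (f, i)"
  and L_outside: "v \<in> carrier_vec n \<Longrightarrow> \<not> i < length (\<mu> f) \<Longrightarrow> L v (f, i) = 0"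
  using bij_betwE[OF L] by (auto simp: prim_module_def)

lemma L_inj: "v \<in> carrier_vec n \<Longrightarrow> w \<in> carrier_vec n \<Longrightarrow> L v = L w \<Longrightarrow> v = w"
  using L by (auto simp: bij_betw_def inj_on_def)

lemma L_0: "L (0\<^sub>v n) = (\<lambda>s. 0)"
proof -
  have "0\<^sub>v n = 0 \<cdot>\<^sub>v (0\<^sub>v n :: 'a vec)" by auto
  then show ?thesis using L_smult[of "0\<^sub>v n" 0] by simp
qed

lemma N_power_carrier: "v \<in> carrier_vec n \<Longrightarrow> ((\<lambda>x. g *\<^sub>v x - x) ^^ k) v \<in> carrier_vec n"
  by (induction k) (use g in simp_all)

lemma L_N_power:
  assumes v: "v \<in> carrier_vec n" and i: "i < length (\<mu> f)"
  shows "L (((\<lambda>x. g *\<^sub>v x - x) ^^ k) v) (f, i) = ([:-1, 1:] ^ k * L v (f, i)) mod f ^ (\<mu> f ! i)"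
proof (induction k)
  case 0
  then show ?case using L_mod[OF v i] by simp
next
  case (Suc k)
  let ?m = "f ^ (\<mu> f ! i)"
  obtain w where w: "w = ((\<lambda>x. g *\<^sub>v x - x) ^^ k) v" by blast
  have wc: "w \<in> carrier_vec n" unfolding w by (rule N_power_carrier[OF v])
  have gw: "g *\<^sub>v w \<in> carrier_vec n" using g wc by simp
  have "g *\<^sub>v w - w = g *\<^sub>v w + (-1) \<cdot>\<^sub>v w" using wc gw by (intro eq_vecI) auto
  then have "L (g *\<^sub>v w - w) = (\<lambda>s. x_mult \<mu> (L w) s - L w s)"
    using wc gw by (simp add: L_add L_smult L_g)
  then have "L (g *\<^sub>v w - w) (f, i) = ([:0, 1:] * L w (f, i)) mod ?m - L w (f, i) mod ?m"
    using i L_mod[OF wc i] by (simp add: x_mult_def)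
  also have "\<dots> = ([:0, 1:] * L w (f, i) - L w (f, i)) mod ?m"
    by (rule poly_mod_diff_left[symmetric])
  also have "[:0, 1:] * L w (f, i) - L w (f, i) = [:-1, 1:] * L w (f, i)"
  proof -
    have "[:-1, 1:] = [:0, 1:] - (1 :: 'a poly)" by (simp add: one_pCons)
    then show ?thesis by (simp only: left_diff_distrib mult_1_left)
  qed
  also have "([:-1, 1:] * L w (f, i)) mod ?m = ([:-1, 1:] * ([:-1, 1:] ^ k * L v (f, i))) mod ?m"
    unfolding w Suc.IH by (rule mod_mult_right_eq)
  finally show ?case by (simp only: w funpow.simps o_apply power_Suc mult.assoc)
qed

lemma L_surj: "c \<in> prim_module \<mu> \<Longrightarrow> \<exists>v\<in>carrier_vec n. L v = c"
  using bij_betw_imp_surj_on[OF L] by (metis imageE)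

text \<open>x - 1 is prime to f, so none of its powers annihilates the residue class of 1 in a
  summand belonging to f.\<close>

lemma not_nilpotent:
  assumes f: "\<mu> f \<noteq> []" "f \<noteq> [:-1, 1:]"
  shows "\<exists>x\<in>carrier_vec n. ((\<lambda>x. g *\<^sub>v x - x) ^^ n) x \<noteq> 0\<^sub>v n"
proof -
  have i: "0 < length (\<mu> f)" using f by simp
  let ?m = "f ^ (\<mu> f ! 0)"
  note deg = degree_modulus(2)[OF mu i]
  have "(\<lambda>s. if s = (f, 0) then 1 else 0) \<in> prim_module \<mu>"
    using i deg by (auto simp: prim_module_def mod_poly_less)
  then obtain v where v: "v \<in> carrier_vec n" "L v = (\<lambda>s. if s = (f, 0) then 1 else 0)" using L_surj by blast
  have "\<not> f dvd [:-1, 1:] ^ n"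
    using PhiD(3,5)[OF mu_Phi[OF mu i]] f(2) prime_elem_dvd_power by blast
  moreover have "f dvd ?m" using mu_pos[OF mu i] by (intro dvd_power) auto
  ultimately have "([:-1, 1:] ^ n) mod ?m \<noteq> 0" using dvd_trans by (auto simp: mod_eq_0_iff_dvd)
  then have "L (((\<lambda>x. g *\<^sub>v x - x) ^^ n) v) (f, 0) \<noteq> 0" using L_N_power[OF v(1) i, of n] v(2) by simp
  then show ?thesis using v(1) L_0 by (intro bexI[of _ v]) auto
qed

context
  fixes la
  assumes mu_eq: "\<mu> = (\<lambda>f. if f = [:-1, 1:] then la else [])"
begin

text \<open>The size of la bounds each of its parts, so this power of x - 1 is 0 in every
  summand.\<close>

lemma unipotent_nilpotent:
  assumes "x \<in> carrier_vec n"
  shows "((\<lambda>x. g *\<^sub>v x - x) ^^ sum_list la) x = 0\<^sub>v n"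
proof (rule L_inj[OF N_power_carrier[OF assms] zero_carrier_vec], rule ext)
  fix s :: "'a poly \<times> nat"
  obtain f i where s: "s = (f, i)" by (cases s)
  show "L (((\<lambda>x. g *\<^sub>v x - x) ^^ sum_list la) x) s = L (0\<^sub>v n) s"
  proof (cases "i < length (\<mu> f)")
    case True
    then have f: "f = [:-1, 1:]" "i < length la" by (auto simp: mu_eq split: if_splits)
    have "\<mu> f ! i \<le> sum_list la" using member_le_sum_list[OF nth_mem[OF f(2)]] f(1) by (simp add: mu_eq)
    then have "f ^ (\<mu> f ! i) dvd [:-1, 1:] ^ sum_list la * L x (f, i)"
      unfolding f(1) by (intro dvd_mult2 le_imp_power_dvd)
    then show ?thesis unfolding s L_N_power[OF assms True] L_0 by (simp only: mod_eq_0_iff_dvd)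
  next
    case False
    then show ?thesis by (simp add: s L_0 L_outside[OF N_power_carrier[OF assms]])
  qed
qed

text \<open>Fixed vectors are those killed by x - 1. In the summand modulo (x-1)^(la_i) they are the
  multiples of (x-1)^(la_i - 1), one dimension for each part.\<close>

lemma card_fixed_points: "card {v \<in> carrier_vec n. g *\<^sub>v v = v} = CARD('a) ^ length la"
proof -
  let ?X = "[:-1, 1:] :: 'a poly"
  let ?C = "{c \<in> prim_module \<mu>. x_mult \<mu> c = c}"
  let ?P = "PiE {..<length la} (\<lambda>_. UNIV :: 'a set)"
  let ?F = "\<lambda>h (f, i). if f = ?X \<and> i < length la then Polynomial.smult (h i) (?X ^ (la ! i - 1)) else 0"
  have pos: "la ! i \<ge> 1" if "i < length la" for i
    using mu_pos[OF mu, of i ?X] that by (simp add: mu_eq)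
  have degX: "degree (?X ^ k) = k" for k by (simp add: degree_power_eq)
  have gc: "g *\<^sub>v v \<in> carrier_vec n" if "v \<in> carrier_vec n" for v using g that by simp
  have "bij_betw L {v \<in> carrier_vec n. g *\<^sub>v v = v} ?C"
    unfolding bij_betw_def
  proof
    show "inj_on L {v \<in> carrier_vec n. g *\<^sub>v v = v}" using L by (auto simp: bij_betw_def inj_on_def)
    show "L ` {v \<in> carrier_vec n. g *\<^sub>v v = v} = ?C"
    proof (intro antisym subsetI)
      fix c assume "c \<in> L ` {v \<in> carrier_vec n. g *\<^sub>v v = v}"
      then obtain v where v: "v \<in> carrier_vec n" "g *\<^sub>v v = v" "c = L v" by auto
      then show "c \<in> ?C" using bij_betwE[OF L] L_g[OF v(1)] by simp
    next
      fix c assume c: "c \<in> ?C"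
      then obtain v where v: "v \<in> carrier_vec n" "L v = c" using L_surj by blast
      have "L (g *\<^sub>v v) = L v" using L_g[OF v(1)] v(2) c by simp
      then have "g *\<^sub>v v = v" using L_inj[OF gc[OF v(1)] v(1)] by simp
      then show "c \<in> L ` {v \<in> carrier_vec n. g *\<^sub>v v = v}" using v by auto
    qed
  qed
  then have "card {v \<in> carrier_vec n. g *\<^sub>v v = v} = card ?C" by (rule bij_betw_same_card)
  also have "?C = ?F ` ?P"
  proof (intro antisym subsetI)
    fix c assume "c \<in> ?C"
    then have c: "c \<in> prim_module \<mu>" "x_mult \<mu> c = c" by auto
    have "\<exists>a. c (?X, i) = Polynomial.smult a (?X ^ (la ! i - 1))" if i: "i < length la" for i
    proof -
      let ?m = "?X ^ (la ! i)" and ?p = "c (?X, i)"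
      have cm: "?p mod ?m = ?p" using prim_moduleD(1)[OF c(1), of i ?X] i by (simp add: mu_eq)
      have "([:0, 1:] * ?p) mod ?m = ?p mod ?m"
        using fun_cong[OF c(2), of "(?X, i)"] i cm by (simp add: x_mult_def mu_eq)
      then have "?m dvd [:0, 1:] * ?p - ?p" by (simp only: mod_eq_dvd_iff)
      moreover have "[:0, 1:] * ?p - ?p = ?X * ?p"
      proof -
        have "?X = [:0, 1:] - (1 :: 'a poly)" by (simp add: one_pCons)
        then show ?thesis by (simp only: left_diff_distrib mult_1_left)
      qed
      moreover have "?m = ?X * ?X ^ (la ! i - 1)" using pos[OF i] by (simp only: power_Suc[symmetric] Suc_diff_1)
      ultimately have "?X * ?X ^ (la ! i - 1) dvd ?X * ?p" by (simp only:)
      then have "?X ^ (la ! i - 1) dvd ?p" by (simp only: dvd_mult_cancel_left) simp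
      then obtain k where k: "?p = ?X ^ (la ! i - 1) * k" by (rule dvdE)
      \<comment> \<open>The residue has degree below la_i, which leaves only a constant cofactor of
        (x-1)^(la_i - 1).\<close>
      have "degree k = 0"
      proof (cases "k = 0")
        case False
        have "?p \<noteq> 0" using k False by simp
        have d: "degree ?p = la ! i - 1 + degree k"
          unfolding k using False by (subst degree_mult_eq) (simp_all add: degX)
        have "degree (?p mod ?m) < degree ?m" using \<open>?p \<noteq> 0\<close> cm by (intro degree_mod_less') simp_all
        then show ?thesis using d pos[OF i] by (simp only: cm degX)
      qed simp
      then obtain a where "k = [:a:]" by (rule degree_eq_zeroE)
      then show ?thesis using k by (intro exI[of _ a]) simp
    qed
    then obtain a where a: "\<And>i. i < length la \<Longrightarrow> c (?X, i) = Polynomial.smult (a i) (?X ^ (la ! i - 1))" by metis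
    have "c = ?F (restrict a {..<length la})"
    proof
      fix s :: "'a poly \<times> nat"
      obtain f i where s: "s = (f, i)" by (cases s)
      show "c s = ?F (restrict a {..<length la}) s"
      proof (cases "f = ?X \<and> i < length la")
        case True
        then show ?thesis using a[of i] by (simp add: s)
      next
        case False
        then show ?thesis using prim_moduleD(2)[OF c(1), of i f] by (auto simp: s mu_eq)
      qed
    qed
    moreover have "restrict a {..<length la} \<in> ?P" by auto
    ultimately show "c \<in> ?F ` ?P" by blast
  next
    fix c assume "c \<in> ?F ` ?P"
    then obtain h where h: "c = ?F h" by blast
    have "c \<in> prim_module \<mu> \<and> (\<forall>f i. i < length (\<mu> f) \<longrightarrow> ([:0, 1:] * c (f, i)) mod f ^ (\<mu> f ! i) = c (f, i))"
    proof -
      have *: "c (f, i) mod f ^ (\<mu> f ! i) = c (f, i) \<and> ([:0, 1:] * c (f, i)) mod f ^ (\<mu> f ! i) = c (f, i)"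
        if "i < length (\<mu> f)" for f i
      proof -
        have f: "f = ?X" and i: "i < length la" using that by (auto simp: mu_eq split: if_splits)
        let ?m = "?X ^ (la ! i)"
        have cs: "c (f, i) = Polynomial.smult (h i) (?X ^ (la ! i - 1))" using f i by (simp add: h)
        have "degree (c (f, i)) < degree ?m"
          unfolding cs degX using degree_smult_le[of "h i" "?X ^ (la ! i - 1)"] pos[OF i] by (simp add: degX)
        then have 1: "c (f, i) mod ?m = c (f, i)" by (rule mod_poly_less)
        have "?m = ?X * ?X ^ (la ! i - 1)" using pos[OF i] by (simp only: power_Suc[symmetric] Suc_diff_1)
        then have "?m dvd ?X * c (f, i)" unfolding cs by (simp add: dvd_smult)
        moreover have "?X * c (f, i) = [:0, 1:] * c (f, i) - c (f, i)"
        proof -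
          have "?X = [:0, 1:] - (1 :: 'a poly)" by (simp add: one_pCons)
          then show ?thesis by (simp only: left_diff_distrib mult_1_left)
        qed
        ultimately have "([:0, 1:] * c (f, i)) mod ?m = c (f, i) mod ?m" by (simp only: mod_eq_dvd_iff)
        then show ?thesis using 1 f by (simp add: mu_eq)
      qed
      have "c (f, i) = 0" if "\<not> i < length (\<mu> f)" for f i
        using that by (auto simp: h mu_eq split: if_splits)
      then show ?thesis using * by (auto simp: prim_module_def)
    qed
    then show "c \<in> ?C" using prim_moduleD(2) by (auto simp: x_mult_def fun_eq_iff)
  qed
  also have "card (?F ` ?P) = card ?P"
  proof (rule card_image, rule inj_onI)
    fix h k assume h: "h \<in> ?P" and k: "k \<in> ?P" and eq: "?F h = ?F k"
    have "h i = k i" if "i < length la" for i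
    proof -
      have "Polynomial.smult (h i) (?X ^ (la ! i - 1)) = Polynomial.smult (k i) (?X ^ (la ! i - 1))"
        using fun_cong[OF eq, of "(?X, i)"] that by simp
      then have "Polynomial.smult (h i - k i) (?X ^ (la ! i - 1)) = 0" by (simp add: smult_diff_left)
      then show ?thesis by (simp add: smult_eq_0_iff)
    qed
    then show "h = k" using h k by (intro PiE_ext) auto
  qed
  also have "card ?P = CARD('a) ^ length la" by (simp add: card_PiE)
  finally show ?thesis .
qed

end

end

lemma induced_char_K_class_other:
  assumes mu: "\<mu> \<in> P_Phi n" and gK: "g \<in> K_class n \<mu>" and f: "\<mu> f \<noteq> []" "f \<noteq> [:-1, 1:]"
  shows "induced_char (GL n) (U_grp n) \<chi> g = 0"
proof -
  have g: "g \<in> carrier_mat n n" using gK by (simp add: K_class_iff GL_carrier)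
  obtain L where "module_iso n \<mu> g L" using gK by (auto simp: K_class_iff)
  from not_nilpotent[OF mu g this f] obtain x
    where "x \<in> carrier_vec n" "((\<lambda>x. g *\<^sub>v x - x) ^^ n) x \<noteq> 0\<^sub>v n" by (rule bexE)
  then show ?thesis by (rule induced_char_not_unipotent[OF g])
qed

lemma induced_char_K_class_unipotent:
  fixes \<psi> :: "'a::{field,finite} \<Rightarrow> complex"
  assumes mu: "\<mu> \<in> P_Phi n" "\<mu> = (\<lambda>f. if f = [:-1, 1:] then la else [])" and gK: "g \<in> K_class n \<mu>"
    and n: "n \<ge> 1" and psi: "nontrivial_additive_char \<psi>"
    and qs: "\<And>i. 1 \<le> i \<Longrightarrow> i < n \<Longrightarrow> qs i \<noteq> 0"
  shows "induced_char (GL n) (U_grp n) (lin_char \<psi> n qs) g =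
    (-1) ^ n * (\<Prod>j=1..length la. 1 - of_nat CARD('a) ^ j)"
proof -
  have g: "g \<in> carrier_mat n n" using gK by (simp add: K_class_iff GL_carrier)
  obtain L where iso: "module_iso n \<mu> g L" using gK by (auto simp: K_class_iff)
  \<comment> \<open>The size of la is n and n is positive, so g has a nonzero fixed vector, as
    \<open>induced_char_unipotent\<close> demands.\<close>
  have "la \<noteq> []"
  proof
    assume "la = []"
    then have "{f. \<mu> f \<noteq> []} = {}" by (simp add: mu(2))
    then show False using mu(1) n by (simp add: P_Phi_def)
  qed
  then have la: "length la \<ge> 1" by (cases la) auto
  show ?thesis
  proof (rule induced_char_unipotent[OF g n psi])
    show "\<exists>k. ((\<lambda>x. g *\<^sub>v x - x) ^^ k) x = 0\<^sub>v n" if "x \<in> carrier_vec n" for x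
      using unipotent_nilpotent[OF mu(1) g iso mu(2) that] by (rule exI)
    show "card {x \<in> carrier_vec n. g *\<^sub>v x = x} = CARD('a) ^ length la"
      by (rule card_fixed_points[OF mu(1) g iso mu(2)])
  qed (use qs la in auto)
qed


section \<open>The characteristic of the induced character\<close>

lemma finite_poly_degree_le: "finite {f :: 'a::{field,finite} poly. degree f \<le> n}"
proof (rule finite_subset)
  show "{f :: 'a poly. degree f \<le> n} \<subseteq> Poly ` {xs. set xs \<subseteq> (UNIV :: 'a set) \<and> length xs \<le> Suc n}"
  proof
    fix f :: "'a poly" assume "f \<in> {f. degree f \<le> n}"
    then have "length (coeffs f) \<le> Suc n" by (cases "f = 0") (simp_all add: length_coeffs_degree)
    then show "f \<in> Poly ` {xs. set xs \<subseteq> (UNIV :: 'a set) \<and> length xs \<le> Suc n}"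
      by (intro image_eqI[of _ _ "coeffs f"]) simp_all
  qed
  show "finite (Poly ` {xs. set xs \<subseteq> (UNIV :: 'a set) \<and> length xs \<le> Suc n})"
    by (intro finite_imageI finite_lists_length_le) simp
qed

text \<open>A sum over an infinite set would be 0 by convention, so \<open>ch\<close> depends on
  this. The degrees and partition sizes in the support are at most n, and there are finitely many
  polynomials of bounded degree.\<close>

lemma finite_P_Phi: "finite (P_Phi n :: ('a::{field,finite} poly \<Rightarrow> nat list) set)"
proof (rule finite_subset)
  let ?A = "{f :: 'a poly. degree f \<le> n}" and ?B = "insert [] (\<Union>k\<le>n. Parts k)"
  show "P_Phi n \<subseteq> {\<mu>. \<forall>f. (f \<in> ?A \<longrightarrow> \<mu> f \<in> ?B) \<and> (f \<notin> ?A \<longrightarrow> \<mu> f = [])}"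
  proof (rule subsetI, rule CollectI, rule allI)
    fix \<mu> :: "'a poly \<Rightarrow> nat list" and f assume mu: "\<mu> \<in> P_Phi n"
    have "degree f \<le> n \<and> sum_list (\<mu> f) \<le> n" if ne: "\<mu> f \<noteq> []"
    proof -
      have i: "0 < length (\<mu> f)" using ne by simp
      have d: "degree f \<ge> 1" by (rule PhiD(1)[OF mu_Phi[OF mu i]])
      have s: "sum_list (\<mu> f) \<ge> 1"
        using mu_pos[OF mu i] member_le_sum_list[OF nth_mem[OF i]] by simp
      have "degree f * sum_list (\<mu> f) \<le> (\<Sum>f | \<mu> f \<noteq> []. degree f * sum_list (\<mu> f))"
        using mu ne by (intro member_le_sum) (auto simp: P_Phi_def)
      also have "\<dots> = n" using mu by (simp add: P_Phi_def)
      finally have le: "degree f * sum_list (\<mu> f) \<le> n" .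
      have "degree f * 1 \<le> degree f * sum_list (\<mu> f)" using s by (intro mult_le_mono2)
      moreover have "1 * sum_list (\<mu> f) \<le> degree f * sum_list (\<mu> f)" using d by (intro mult_le_mono1)
      ultimately show ?thesis using le by (simp only: mult_1 mult_1_right) linarith
    qed
    moreover have "is_partition (\<mu> f)" using mu by (simp add: P_Phi_def)
    ultimately show "(f \<in> ?A \<longrightarrow> \<mu> f \<in> ?B) \<and> (f \<notin> ?A \<longrightarrow> \<mu> f = [])"
      by (cases "\<mu> f = []") (auto simp: Parts_def)
  qed
  show "finite {\<mu>. \<forall>f. (f \<in> ?A \<longrightarrow> \<mu> f \<in> ?B) \<and> (f \<notin> ?A \<longrightarrow> \<mu> f = [])}"
    using finite_poly_degree_le[where 'a = 'a] finite_Parts by (intro finite_set_of_finite_funs) auto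
qed

definition unip :: "nat list \<Rightarrow> 'a::{field,finite} poly \<Rightarrow> nat list" where
  "unip la = (\<lambda>f. if f = [:-1, 1:] then la else [])"

lemma unip_P_Phi: "unip la \<in> P_Phi n \<longleftrightarrow> la \<in> Parts n"
proof (cases "la = []")
  case True
  then have "{f :: 'a poly. unip la f \<noteq> []} = {}" by (simp add: unip_def)
  then show ?thesis using True by (auto simp: P_Phi_def unip_def Parts_def is_partition_def)
next
  case False
  then have supp: "{f :: 'a poly. unip la f \<noteq> []} = {[:-1, 1:]}" by (auto simp: unip_def)
  have "is_partition []" by (simp add: is_partition_def)
  moreover have "unip la f = []" if "f \<notin> Phi" for f :: "'a poly"
    using that x_minus_1_Phi[where 'a = 'a] by (auto simp: unip_def)
  ultimately show ?thesis
    unfolding P_Phi_def Parts_def mem_Collect_eq supp by (auto simp: unip_def)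
qed

text \<open>As x - 1 has degree 1, the parameter q^d(f) is q itself.\<close>

lemma P_tilde_unip:
  assumes "la \<noteq> []"
  shows "P_tilde (unip la) = in_vars [:-1, 1 :: 'a::{field,finite}:] (hl_tilde la (of_nat CARD('a)))"
proof -
  have "{f :: 'a poly. unip la f \<noteq> []} = {[:-1, 1:]}" using assms by (auto simp: unip_def)
  then show ?thesis unfolding P_tilde_def by (simp add: unip_def)
qed

text \<open>For the positive real number 1/q all geometric sums are positive.\<close>

lemma hl_param_card: "hl_param (1 / of_nat CARD('a::{field,finite}))"
proof
  have q: "CARD('a) \<ge> 2" by (rule card_ge_2)
  then show "1 / of_nat CARD('a) \<noteq> (0 :: complex)" by simp
  show "1 / of_nat CARD('a) \<noteq> (1 :: complex)"
  proof
    assume "1 / of_nat CARD('a) = (1 :: complex)"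
    then have "of_nat CARD('a) = (of_nat 1 :: complex)" by (simp add: divide_eq_1_iff)
    then have "CARD('a) = 1" by (simp only: of_nat_eq_iff)
    then show False using q by simp
  qed
  fix n
  have "(\<Sum>j<Suc n. (1 / real CARD('a)) ^ j) > 0"
    using q by (intro sum_pos) auto
  moreover have "qint (1 / of_nat CARD('a)) (Suc n) = complex_of_real (\<Sum>j<Suc n. (1 / real CARD('a)) ^ j)"
    unfolding qint_def of_real_sum by simp
  ultimately show "qint (1 / of_nat CARD('a)) (Suc n) \<noteq> (0 :: complex)"
    by (simp only: of_real_eq_0_iff)
qed

text \<open>At t = 1/q the summand of la in \<open>Gser\<close> is the product of the 1 - q^j times
  \<open>hl_tilde\<close>, hence, up to (-1)^n, the character value times the image of the
  class.\<close>

lemma ch_induced: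
  fixes \<psi> :: "'a::{field,finite} \<Rightarrow> complex"
  assumes n: "n \<ge> 1" and psi: "nontrivial_additive_char \<psi>"
    and qs: "\<And>i. 1 \<le> i \<Longrightarrow> i < n \<Longrightarrow> qs i \<noteq> 0"
  shows "ch n (induced_char (GL n) (U_grp n) (lin_char \<psi> n qs)) =
    in_vars [:-1, 1:] (const_mps ((-1) ^ n) * hl_param.Gser (1 / of_nat CARD('a)) n)"
proof -
  let ?q = "of_nat CARD('a) :: complex"
  interpret hl: hl_param "1 / ?q" by (rule hl_param_card)
  let ?\<Gamma> = "induced_char (GL n) (U_grp n) (lin_char \<psi> n qs)"
  let ?F = "\<lambda>\<mu>. const_mps (?\<Gamma> (SOME g. g \<in> K_class n \<mu>)) * P_tilde \<mu>"
  have some: "(SOME g. g \<in> K_class n \<mu>) \<in> K_class n \<mu>" if "\<mu> \<in> P_Phi n" for \<mu> :: "'a poly \<Rightarrow> nat list"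
    using K_class_nonempty[OF that] by (simp add: some_in_eq)
  have inj: "inj_on (unip :: nat list \<Rightarrow> 'a poly \<Rightarrow> nat list) (Parts n)"
    by (rule inj_onI) (metis unip_def)
  have "ch n ?\<Gamma> = (\<Sum>\<mu>\<in>unip ` Parts n. ?F \<mu>)"
    unfolding ch_def
  proof (rule sum.mono_neutral_right[OF finite_P_Phi])
    show "unip ` Parts n \<subseteq> P_Phi n" using unip_P_Phi by blast
    show "\<forall>\<mu>\<in>P_Phi n - unip ` Parts n. ?F \<mu> = 0"
    proof
      fix \<mu> :: "'a poly \<Rightarrow> nat list" assume mu: "\<mu> \<in> P_Phi n - unip ` Parts n"
      have "\<exists>f. \<mu> f \<noteq> [] \<and> f \<noteq> [:-1, 1:]"
      proof (rule ccontr)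
        assume "\<not> ?thesis"
        then have eq: "\<mu> = unip (\<mu> [:-1, 1:])" by (intro ext) (auto simp: unip_def)
        have "\<mu> [:-1, 1:] \<in> Parts n" using mu eq unip_P_Phi[of "\<mu> [:-1, 1:]" n] by (metis DiffD1)
        then show False using mu eq by blast
      qed
      then obtain f where f: "\<mu> f \<noteq> []" "f \<noteq> [:-1, 1:]" by blast
      have "?\<Gamma> (SOME g. g \<in> K_class n \<mu>) = 0"
        using mu some f by (intro induced_char_K_class_other[of \<mu>]) auto
      then show "?F \<mu> = 0" by (simp add: const_mps_simps)
    qed
  qed
  also have "\<dots> = (\<Sum>la\<in>Parts n. ?F (unip la))"
    by (rule sum.reindex[OF inj, unfolded o_def])
  also have "\<dots> = (\<Sum>la\<in>Parts n. in_vars [:-1, 1:] (const_mps ((-1) ^ n) *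
      (const_mps ((\<Prod>j=1..length la. 1 - (1 / (1 / ?q)) ^ j) * (1 / ?q) ^ n_stat la) * hall_littlewood la (1 / ?q))))"
  proof (rule sum.cong[OF refl])
    fix la assume la: "la \<in> Parts n"
    then have mu: "(unip la :: 'a poly \<Rightarrow> nat list) \<in> P_Phi n" by (simp add: unip_P_Phi)
    have ne: "la \<noteq> []" using la n by (auto simp: Parts_def)
    have val: "?\<Gamma> (SOME g. g \<in> K_class n (unip la)) = (-1) ^ n * (\<Prod>j=1..length la. 1 - ?q ^ j)"
      by (rule induced_char_K_class_unipotent[OF mu _ some[OF mu] n psi qs]) (simp_all add: unip_def)
    show "?F (unip la) = in_vars [:-1, 1:] (const_mps ((-1) ^ n) *
      (const_mps ((\<Prod>j=1..length la. 1 - (1 / (1 / ?q)) ^ j) * (1 / ?q) ^ n_stat la) * hall_littlewood la (1 / ?q)))"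
      unfolding val P_tilde_unip[OF ne] hl_tilde_def in_vars_mult in_vars_const
      by (simp only: const_mps_simps(4) power_one_over mult.assoc div_by_1 divide_divide_eq_right mult_1)
  qed
  also have "\<dots> = in_vars [:-1, 1:] (const_mps ((-1) ^ n) * hl.Gser n)"
    unfolding hl.Gser_def in_vars_sum[symmetric] sum_distrib_left[symmetric] ..
  finally show ?thesis .
qed

theorem corollary3p6:
  fixes \<psi> :: "'a::{field,finite} \<Rightarrow> complex"
    and T :: "('a poly \<times> nat) mpseries \<Rightarrow> ('a lchar set \<times> nat) mpseries"
    and \<rho> :: "('a lchar set \<times> nat) mpseries \<Rightarrow> nat mpseries"
    and qs :: "nat \<Rightarrow> nat \<Rightarrow> 'a"
    and n :: nat
  assumes "nontrivial_additive_char \<psi>"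
    and "is_identification T"
    and "is_plethysm_map \<rho>"
    and "\<And>k i. 1 \<le> i \<Longrightarrow> i < k \<Longrightarrow> qs k i \<noteq> 0"
    and "n \<ge> 1"
  shows "rho_n T \<rho> \<psi> (qs n) n =
           (of_nat CARD('a) ^ n - 1) * hsym n
           - (\<Sum>i=1..n-1. rho_n T \<rho> \<psi> (qs (n - i)) (n - i) * hsym i)"
proof -
  let ?q = "of_nat CARD('a) :: complex" and ?X = "[:-1, 1 :: 'a:]"
  interpret hl: hl_param "1 / ?q" by (rule hl_param_card)
  \<comment> \<open>By \<open>ch_induced\<close> only the variables of x - 1 occur, so the composite
    of T and \<rho> matters on these alone.\<close>
  define \<phi> where "\<phi> f = \<rho> (T (in_vars ?X f))" for f
  have homT: "alg_hom Lambda_Phi Lambda_Theta T" using assms(2) by (simp add: is_identification_def)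
  have homR: "alg_hom Lambda_Theta Sym \<rho>" using assms(3) by (simp add: is_plethysm_map_def)
  have mem: "in_vars ?X f \<in> Lambda_Phi" "T (in_vars ?X f) \<in> Lambda_Theta" if "f \<in> Sym" for f
    using in_vars_tensor[OF x_minus_1_Phi that] alg_homD(1)[OF homT] by auto
  have add: "\<phi> (f + g) = \<phi> f + \<phi> g" and mult: "\<phi> (f * g) = \<phi> f * \<phi> g" if "f \<in> Sym" "g \<in> Sym" for f g
    using mem[OF that(1)] mem[OF that(2)] unfolding \<phi>_def in_vars_add in_vars_mult
    by (simp_all only: alg_homD(2,3)[OF homT] alg_homD(2,3)[OF homR])
  have const: "\<phi> (const_mps c) = const_mps c" for c
    by (simp only: \<phi>_def in_vars_const alg_homD(4)[OF homT] alg_homD(4)[OF homR])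
  have psum: "const_mps ((-1) ^ k * (1 - (1 / (1 / ?q)) ^ k)) * \<phi> (psum k) =
      const_mps ((1 / (1 / ?q)) ^ k - 1) * psum k" if "k \<ge> 1" for k
    using rho_T_psum[OF assms(2,3) that] by (simp add: \<phi>_def)
  have rho: "rho_n T \<rho> \<psi> (qs k) k = const_mps ((-1) ^ k) * \<phi> (hl.Gser k)" if "k \<ge> 1" for k
  proof -
    have G: "hl.Gser k \<in> Sym" using hl.Gser_SymN Sym_iff_SymN by blast
    have "rho_n T \<rho> \<psi> (qs k) k = \<phi> (const_mps ((-1) ^ k) * hl.Gser k)"
      unfolding rho_n_def \<phi>_def using ch_induced[OF that assms(1), of "qs k"] assms(4) by simp
    also have "\<dots> = const_mps ((-1) ^ k) * \<phi> (hl.Gser k)"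
      by (simp only: mult[OF Sym_closed(1) G] const)
    finally show ?thesis .
  qed
  have "rho_n T \<rho> \<psi> (qs n) n = (const_mps (1 / (1 / ?q)) ^ n - 1) * hsym n
      - (\<Sum>i=1..n-1. const_mps ((-1) ^ (n - i)) * \<phi> (hl.Gser (n - i)) * hsym i)"
    unfolding rho[OF assms(5)] by (rule hl.hom_Gser_recursion[OF add mult const psum assms(5)])
  also have "(\<Sum>i=1..n-1. const_mps ((-1) ^ (n - i)) * \<phi> (hl.Gser (n - i)) * hsym i) =
      (\<Sum>i=1..n-1. rho_n T \<rho> \<psi> (qs (n - i)) (n - i) * hsym i)"
  proof (rule sum.cong[OF refl])
    fix i assume "i \<in> {1..n - 1}"
    \<comment> \<open>Only \<rho>_k with k positive occur in the sum; the term of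
      \<open>Gser 0\<close> has gone into the coefficient of \<open>hsym n\<close>.\<close>
    then have "n - i \<ge> 1" by auto
    then show "const_mps ((-1) ^ (n - i)) * \<phi> (hl.Gser (n - i)) * hsym i =
        rho_n T \<rho> \<psi> (qs (n - i)) (n - i) * hsym i" by (simp only: rho)
  qed
  finally show ?thesis by (simp add: const_mps_of_nat)
qed

end
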